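(* Let $X$ be a Banach space, $A:D(A)\subset X\to X$ a Hille-Yosida operator, $X_0=\overline{D(A)}$, and let $F,V:\mathbb R\to\mathcal L(X_0,X)$ be almost periodic (in the operator norm), with the ordered-space conventions given in the context. Assume: (1) there is $\omega\in\mathbb R$ with $(\omega,+\infty)\subset\rho(A)$ and $(\lambda I-A)^{-1}$ is a positive operator for all $\lambda>\omega$; there exists $\lambda_1>\omega_A$ such that $\lambda_1\phi-V(t)\phi\in X_+$ for all $\phi\in X_0^+$, $t\in\mathbb R$; and $F(t)\phi\in X_+$ for all $t\in\mathbb R$, $\phi\in X_0^+$; (2) $\omega(\Gamma)<0$; (3) for any $\epsilon>0$ and $\nu>0$ there exist $\eta=\eta(\epsilon,\nu)>0$ and $\delta=\delta(\epsilon,\nu)<0$ such that $\|\Gamma(t+\tau,s+\tau)-\Gamma(t,s)\|\le\epsilon e^{\delta(t-s)}$ for all $t\ge s$ with $t-s\ge\nu$ and all $\tau\in\mathcal T(V,\eta)$. Let $R_0:=r(\mathscr L)$ be the spectral radius of the operator $\mathscr L$ on $AP(\mathbb R,X)$ given by $$\mathscr L(\phi)(t)=F(t)\lim_{\mu\to+\infty}\int_{-\infty}^t\Gamma(t,s)\mu(\mu I-A)^{-1}\phi(s)\,ds,\quad t\in\mathbb R,\ \phi\in AP(\mathbb R,X).$$ Then $R_0-1$ has the same sign as $\omega(\mathbb U)$, the exponential growth bound of the evolution semigroup $\{\mathbb U(t)\}_{t\ge0}$ (i.e. $R_0<1$, $R_0=1$, $R_0>1$ respectively correspond to $\omega(\mathbb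 U)<0$, $=0$, $>0$).
   Context: Almost periodicity: for a metric space $(Y,d)$, $f\in C(\mathbb R,Y)$ is almost periodic if for every $\epsilon>0$ the set $\mathcal T(f,\epsilon)=\{\tau\in\mathbb R:d(f(t+\tau),f(t))<\epsilon\ \forall t\in\mathbb R\}$ is relatively dense (there is $l>0$ with $[c,c+l]\cap\mathcal T(f,\epsilon)\ne\emptyset$ for all $c\in\mathbb R$). $AP(\mathbb R,Y)$ is the space of such functions; for $Y$ a Banach space it is a Banach space with the supremum norm. Hille-Yosida operator: a linear operator $A$ (possibly not densely defined) for which there are $\omega_A\in\mathbb R$, $M_A\ge1$ with $(\omega_A,+\infty)\subset\rho(A)$ and $\|(\lambda I-A)^{-n}\|\le M_A(\lambda-\omega_A)^{-n}$ for all $\lambda>\omega_A$, $n\ge1$. Order: $X$ and $X_0$ have normal and generating positive cones $X_+$ and $X_0^+=X_0\cap X_+$. Evolution families: $\{U(t,s)\}_{t\ge s}$ is the exponentially bounded evolution family on $X_0$ such that $u(t)=U(t,t_0)u_0$ is the unique mild (integrated) solution of $u'(t)=Au(t)+F(t)u(t)-V(t)u(t)$, $t>t_0$, $u(t_0)=u_0\in X_0$, i.e. $u\in C([t_0,\infty),X_0)$, $\int_{t_0}^tu(s)ds\in D(A)$ and $u(t)=u_0+A\int_{t_0}^tu(s)ds+\int_{t_0}^t(F(s)-V(s))u(s)ds$. $\{\Gamma(t,s)\}_{t\ge s}$ is the analogous evolution family for $v'(t)=Av(t)-V(t)v(t)$ (that is, with $F=0$). The exponential growth bound of an evolution family is $\omega(\Gamma)=\inf\{\hat\omega:\exists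 M\ge1,\ \forall s\in\mathbb R,\ t\ge s:\ \|\Gamma(t,s)\|\le Me^{\hat\omega(t-s)}\}$. Evolution semigroup: $[\mathbb U(t)\phi](s)=U(s,s-t)\phi(s-t)$ for $\phi\in AP(\mathbb R,X_0)$, $t\ge0$, $s\in\mathbb R$; this is a $C_0$-semigroup on $AP(\mathbb R,X_0)$, and $\omega(\mathbb U)=\inf\{\hat\omega\in\mathbb R:\exists M\ge1,\ \forall t\ge0:\ \|\mathbb U(t)\|\le Me^{\hat\omega t}\}$. The limit defining $\mathscr L$ exists uniformly in $t\in\mathbb R$, and $\mathscr L$ is a bounded operator on $AP(\mathbb R,X)$. *)

theory Defs
  imports "HOL-Analysis.Analysis"
begin

section \<open>Bounded operators on a subspace\<close>

text \<open>
  The closed subspaces that occur here (the closure of a domain, the almost periodic functions with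
  values in it) depend on data of the statement and so cannot be types. An operator defined on such a
  subspace \<open>S\<close> is a function on the ambient type of which only the values on \<open>S\<close> matter.
\<close>

definition linear_op_on :: "'a::real_vector set \<Rightarrow> ('a \<Rightarrow> 'b::real_vector) \<Rightarrow> bool" where
  "linear_op_on S T \<longleftrightarrow> subspace S \<and>
     (\<forall>x\<in>S. \<forall>y\<in>S. T (x + y) = T x + T y) \<and> (\<forall>c. \<forall>x\<in>S. T (c *\<^sub>R x) = c *\<^sub>R T x)"

definition bounded_op_on ::
  "'a::real_normed_vector set \<Rightarrow> ('a \<Rightarrow> 'b::real_normed_vector) \<Rightarrow> bool" where
  "bounded_op_on S T \<longleftrightarrow> linear_op_on S T \<and> (\<exists>K. \<forall>x\<in>S. norm (T x) \<le> K * norm x)"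

text \<open>The restriction of \<^const>\<open>onorm\<close> to a subspace; as there, \<open>0 / 0 = 0\<close>.\<close>

definition onorm_on ::
  "'a::real_normed_vector set \<Rightarrow> ('a \<Rightarrow> 'b::real_normed_vector) \<Rightarrow> real" where
  "onorm_on S T = (SUP x\<in>S. norm (T x) / norm x)"

definition op_dist_on ::
  "'a::real_normed_vector set \<Rightarrow> ('a \<Rightarrow> 'b::real_normed_vector) \<Rightarrow> ('a \<Rightarrow> 'b) \<Rightarrow> real" where
  "op_dist_on S T1 T2 = onorm_on S (\<lambda>x. T1 x - T2 x)"

subsection \<open>Spectral radius\<close>

text \<open>
  For an operator \<open>T\<close> on a real space \<open>S\<close> and a complex \<open>z\<close>, the operator \<open>z I - T\<close> on the
  complexification of \<open>S\<close>, where \<open>(x, y)\<close> stands for \<open>x + \<i> y\<close>. The norm of the product is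
  equivalent to any of the usual norms of the complexification.
\<close>

definition complex_shift ::
  "('a::real_vector \<Rightarrow> 'a) \<Rightarrow> complex \<Rightarrow> 'a \<times> 'a \<Rightarrow> 'a \<times> 'a" where
  "complex_shift T z = (\<lambda>(x, y).
     (Re z *\<^sub>R x - Im z *\<^sub>R y - T x, Im z *\<^sub>R x + Re z *\<^sub>R y - T y))"

definition spectrum_on :: "'a::real_normed_vector set \<Rightarrow> ('a \<Rightarrow> 'a) \<Rightarrow> complex set" where
  "spectrum_on S T = {z. \<not> (bij_betw (complex_shift T z) (S \<times> S) (S \<times> S) \<and>
     bounded_op_on (S \<times> S) (inv_into (S \<times> S) (complex_shift T z)))}"

text \<open>
  Extended real values avoid an unspecified supremum. For a bounded operator on a nonzero Banach space
  the spectrum is nonempty and bounded, and the value is the usual finite one.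
\<close>

definition spectral_radius_on :: "'a::real_normed_vector set \<Rightarrow> ('a \<Rightarrow> 'a) \<Rightarrow> ereal" where
  "spectral_radius_on S T = (SUP z\<in>spectrum_on S T. ereal (cmod z))"

section \<open>Almost periodic functions\<close>

definition relatively_dense :: "real set \<Rightarrow> bool" where
  "relatively_dense T \<longleftrightarrow> (\<exists>l>0. \<forall>c. {c..c + l} \<inter> T \<noteq> {})"

definition almost_periods ::
  "('y \<Rightarrow> 'y \<Rightarrow> real) \<Rightarrow> (real \<Rightarrow> 'y) \<Rightarrow> real \<Rightarrow> real set" where
  "almost_periods d f \<epsilon> = {\<tau>. \<forall>t. d (f (t + \<tau>)) (f t) < \<epsilon>}"

text \<open>
  The distance is a parameter since operators on a subspace do not form a metric space as a type; the
  first conjunct is continuity with respect to it.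
\<close>

definition almost_periodic :: "('y \<Rightarrow> 'y \<Rightarrow> real) \<Rightarrow> (real \<Rightarrow> 'y) \<Rightarrow> bool" where
  "almost_periodic d f \<longleftrightarrow>
     (\<forall>t. ((\<lambda>s. d (f s) (f t)) \<longlongrightarrow> 0) (at t)) \<and>
     (\<forall>\<epsilon>>0. relatively_dense (almost_periods d f \<epsilon>))"

text \<open>
  By the lemma, the almost periodic functions all lie in the Banach space of bounded continuous
  functions, whose norm is the supremum norm.
\<close>

lemma almost_periodic_bcontfun:
  fixes f :: "real \<Rightarrow> 'y::metric_space"
  assumes "almost_periodic dist f"
  shows "f \<in> bcontfun"
proof -
  have "isCont f t" for t
    using assms unfolding almost_periodic_def isCont_def by (subst tendsto_dist_iff) blast
  then have cont: "continuous_on A f" for A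
    by (simp add: continuous_at_imp_continuous_on)
  have "relatively_dense (almost_periods dist f 1)"
    using assms unfolding almost_periodic_def by simp
  then obtain l where l: "\<And>c. {c..c + l} \<inter> almost_periods dist f 1 \<noteq> {}"
    unfolding relatively_dense_def by blast
  have "bounded (f ` {0..l})"
    by (intro compact_imp_bounded compact_continuous_image cont compact_Icc)
  then obtain x e where e: "\<And>t. t \<in> {0..l} \<Longrightarrow> dist x (f t) \<le> e"
    unfolding bounded_def by blast
  have "dist x (f t) \<le> e + 1" for t
  proof -
    obtain \<tau> where \<tau>: "\<tau> \<in> {- t..- t + l}" "\<tau> \<in> almost_periods dist f 1"
      using l by blast
    then have "dist (f (t + \<tau>)) (f t) < 1" "t + \<tau> \<in> {0..l}"
      by (auto simp: almost_periods_def)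
    then show ?thesis
      using e dist_triangle[of x "f t" "f (t + \<tau>)"] by fastforce
  qed
  then have "bounded (range f)"
    unfolding bounded_def by blast
  then show ?thesis
    using cont by (simp add: bcontfun_def)
qed

definition AP :: "'a::real_normed_vector set \<Rightarrow> (real \<Rightarrow>\<^sub>C 'a) set" where
  "AP S = {\<phi>. almost_periodic dist (apply_bcontfun \<phi>) \<and> range (apply_bcontfun \<phi>) \<subseteq> S}"

section \<open>Hille-Yosida operators\<close>

definition resolvent :: "'a::real_normed_vector set \<Rightarrow> ('a \<Rightarrow> 'a) \<Rightarrow> real \<Rightarrow> 'a \<Rightarrow> 'a" where
  "resolvent D A \<mu> = inv_into D (\<lambda>x. \<mu> *\<^sub>R x - A x)"

text \<open>The real part of the resolvent set.\<close>

definition resolvent_set :: "'a::real_normed_vector set \<Rightarrow> ('a \<Rightarrow> 'a) \<Rightarrow> real set" where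
  "resolvent_set D A =
     {\<mu>. bij_betw (\<lambda>x. \<mu> *\<^sub>R x - A x) D UNIV \<and> bounded_linear (resolvent D A \<mu>)}"

definition hille_yosida ::
  "'a::real_normed_vector set \<Rightarrow> ('a \<Rightarrow> 'a) \<Rightarrow> real \<Rightarrow> real \<Rightarrow> bool" where
  "hille_yosida D A \<omega>\<^sub>A M\<^sub>A \<longleftrightarrow> linear_op_on D A \<and> M\<^sub>A \<ge> 1 \<and>
     {\<omega>\<^sub>A<..} \<subseteq> resolvent_set D A \<and>
     (\<forall>\<mu>>\<omega>\<^sub>A. \<forall>n\<ge>1. onorm (resolvent D A \<mu> ^^ n) \<le> M\<^sub>A / (\<mu> - \<omega>\<^sub>A) ^ n)"

section \<open>Positive cones\<close>

definition order_cone :: "'a::real_normed_vector set \<Rightarrow> bool" where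
  "order_cone P \<longleftrightarrow> closed P \<and> convex P \<and> cone P \<and> P \<inter> uminus ` P = {0}"

text \<open>In the order given by \<open>P\<close>, this says that \<open>0 \<le> x \<le> y\<close> implies \<open>norm x \<le> c * norm y\<close>.\<close>

definition normal_cone_of :: "'a::real_normed_vector set \<Rightarrow> bool" where
  "normal_cone_of P \<longleftrightarrow> (\<exists>c>0. \<forall>x\<in>P. \<forall>y. y - x \<in> P \<longrightarrow> norm x \<le> c * norm y)"

definition generating_cone :: "'a::real_normed_vector set \<Rightarrow> 'a set \<Rightarrow> bool" where
  "generating_cone S P \<longleftrightarrow> S = {x - y | x y. x \<in> P \<and> y \<in> P}"

section \<open>Evolution families\<close>

definition evolution_family ::
  "'a::real_normed_vector set \<Rightarrow> (real \<Rightarrow> real \<Rightarrow> 'a \<Rightarrow> 'a) \<Rightarrow> bool" where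
  "evolution_family S U \<longleftrightarrow>
     (\<forall>s t. s \<le> t \<longrightarrow> bounded_op_on S (U t s) \<and> U t s ` S \<subseteq> S) \<and>
     (\<forall>s. \<forall>x\<in>S. U s s x = x) \<and>
     (\<forall>s r t. s \<le> r \<longrightarrow> r \<le> t \<longrightarrow> (\<forall>x\<in>S. U t r (U r s x) = U t s x)) \<and>
     (\<forall>x\<in>S. continuous_on {(t, s). s \<le> t} (\<lambda>(t, s). U t s x))"

definition exp_rates ::
  "'a::real_normed_vector set \<Rightarrow> (real \<Rightarrow> real \<Rightarrow> 'a \<Rightarrow> 'a) \<Rightarrow> real set" where
  "exp_rates S U = {\<omega>. \<exists>M\<ge>1. \<forall>s t. s \<le> t \<longrightarrow> onorm_on S (U t s) \<le> M * exp (\<omega> * (t - s))}"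

definition exponentially_bounded ::
  "'a::real_normed_vector set \<Rightarrow> (real \<Rightarrow> real \<Rightarrow> 'a \<Rightarrow> 'a) \<Rightarrow> bool" where
  "exponentially_bounded S U \<longleftrightarrow> exp_rates S U \<noteq> {}"

text \<open>Growth bounds are extended reals since they may be \<open>-\<infinity>\<close>, e.g. for nilpotent semigroups.\<close>

definition growth_bound ::
  "'a::real_normed_vector set \<Rightarrow> (real \<Rightarrow> real \<Rightarrow> 'a \<Rightarrow> 'a) \<Rightarrow> ereal" where
  "growth_bound S U = (INF \<omega>\<in>exp_rates S U. ereal \<omega>)"

text \<open>Mild (integrated) solutions of \<open>u' = A u + B(t) u\<close>, \<open>u t\<^sub>0 = u\<^sub>0\<close>.\<close>

definition mild_solution ::
  "'a::banach set \<Rightarrow> ('a \<Rightarrow> 'a) \<Rightarrow> (real \<Rightarrow> 'a \<Rightarrow> 'a) \<Rightarrow> real \<Rightarrow> 'a \<Rightarrow> (real \<Rightarrow> 'a) \<Rightarrow> bool" where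
  "mild_solution D A B t\<^sub>0 u\<^sub>0 u \<longleftrightarrow>
     continuous_on {t\<^sub>0..} u \<and> u ` {t\<^sub>0..} \<subseteq> closure D \<and>
     (\<forall>t\<ge>t\<^sub>0. integral {t\<^sub>0..t} u \<in> D \<and>
        u t = u\<^sub>0 + A (integral {t\<^sub>0..t} u) + integral {t\<^sub>0..t} (\<lambda>s. B s (u s)))"

definition solution_family ::
  "'a::banach set \<Rightarrow> ('a \<Rightarrow> 'a) \<Rightarrow> (real \<Rightarrow> 'a \<Rightarrow> 'a) \<Rightarrow> (real \<Rightarrow> real \<Rightarrow> 'a \<Rightarrow> 'a) \<Rightarrow> bool" where
  "solution_family D A B U \<longleftrightarrow>
     evolution_family (closure D) U \<and> exponentially_bounded (closure D) U \<and>
     (\<forall>t\<^sub>0. \<forall>u\<^sub>0\<in>closure D.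
        mild_solution D A B t\<^sub>0 u\<^sub>0 (\<lambda>t. U t t\<^sub>0 u\<^sub>0) \<and>
        (\<forall>u. mild_solution D A B t\<^sub>0 u\<^sub>0 u \<longrightarrow> (\<forall>t\<ge>t\<^sub>0. u t = U t t\<^sub>0 u\<^sub>0)))"

section \<open>Evolution semigroup and next generation operator\<close>

definition evolution_semigroup ::
  "(real \<Rightarrow> real \<Rightarrow> 'a \<Rightarrow> 'a) \<Rightarrow> real \<Rightarrow> (real \<Rightarrow>\<^sub>C 'a::real_normed_vector) \<Rightarrow> (real \<Rightarrow>\<^sub>C 'a)" where
  "evolution_semigroup U t \<phi> = Bcontfun (\<lambda>s. U s (s - t) (apply_bcontfun \<phi> (s - t)))"

definition semigroup_growth_bound ::
  "'v::real_normed_vector set \<Rightarrow> (real \<Rightarrow> 'v \<Rightarrow> 'v) \<Rightarrow> ereal" where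
  "semigroup_growth_bound S T =
     (INF \<omega>\<in>{\<omega>. \<exists>M\<ge>1. \<forall>t\<ge>0. onorm_on S (T t) \<le> M * exp (\<omega> * t)}. ereal \<omega>)"

definition next_generation ::
  "'a::banach set \<Rightarrow> ('a \<Rightarrow> 'a) \<Rightarrow> (real \<Rightarrow> 'a \<Rightarrow> 'a) \<Rightarrow> (real \<Rightarrow> real \<Rightarrow> 'a \<Rightarrow> 'a) \<Rightarrow>
   (real \<Rightarrow>\<^sub>C 'a) \<Rightarrow> (real \<Rightarrow>\<^sub>C 'a)" where
  "next_generation D A F \<Gamma> \<phi> = Bcontfun (\<lambda>t. F t (Lim at_top (\<lambda>\<mu>.
     integral {..t} (\<lambda>s. \<Gamma> t s (\<mu> *\<^sub>R resolvent D A \<mu> (apply_bcontfun \<phi> s))))))"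

end

theory Submission imports Defs begin

text \<open>
  Let \<open>K \<sigma>\<close> map an almost periodic \<open>f\<close> to the unique bounded solution \<open>u\<close> on the whole line of
  \<open>u' = (A - V - \<sigma>) u + f\<close>, which exists when \<open>\<sigma>\<close> exceeds the growth bound of \<open>\<Gamma>\<close>. The next generation
  operator is \<open>LL 0\<close> with \<open>LL \<sigma> = F \<circ> K \<sigma>\<close>. All estimates for inhomogeneous solutions, and their
  positivity, come from one comparison of a mild solution with the implicit Euler scheme.

  The core is the equivalence of \<open>r (LL \<sigma>) < 1\<close> with \<open>U\<close> having a growth rate below \<open>\<sigma>\<close>. If \<open>U\<close> has
  such a rate, the solution operator \<open>K_U\<close> of \<open>u' = (A + F - V - \<sigma>) u + f\<close> gives the positive
  inverse \<open>1 + F K_U\<close> of \<open>1 - LL \<sigma>\<close>, which forces the spectral radius of the positive operator \<open>LL \<sigma>\<close>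
  below one. Conversely, if \<open>r (LL \<sigma>) < 1\<close>, the solution \<open>K \<sigma> ((1 - LL \<sigma>)\<^sup>-\<^sup>1 f)\<close> for a suitable
  periodic \<open>f\<close> of size \<open>x\<close> dominates the rescaled orbit of \<open>x\<close>.

  To obtain a rate strictly below \<open>\<sigma>\<close>, and to reach the case \<open>R\<^sub>0 \<le> 1\<close>, the spectral radii for different
  \<open>\<sigma>\<close> are compared: between two rescalings, the powers of \<open>LL \<sigma>\<close> are dominated by weighted sums of the
  powers at the two end points. On constant functions the evolution semigroup has the norm growth of
  \<open>U\<close>, so that its growth bound is the infimum of the rates of \<open>U\<close>.
\<close>

section \<open>Almost periodicity through translation-distance functions\<close>

text \<open>The domain of \<open>A\<close> need not be dense: inhomogeneities and the values of
  \<open>F\<close> lie in \<open>X\<close>, while the evolution families act only on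
  \<open>X0\<close>. The regularisations \<open>\<mu> (\<mu> - A)\<^sup>-\<^sup>1 f\<close> converge
  to \<open>f\<close> in general only after one more resolvent is applied. This is why solutions are
  described through a fixed resolvent \<open>R\<close>, why approximate inhomogeneities have to
  converge only behind \<open>R\<close>, and why a difference scheme stands in for the variation of
  constants formula.

  The order offers little structure as well: the cone is normal and generating, but no lattice
  operations or interior points are given. Elements are split into positive parts approximately, by
  a category argument, and the real points of the spectrum of a positive operator are controlled by
  continuing the positivity of the resolvent along the real axis from infinity.

  One a priori estimate carries most of the analysis: a bounded solution on the whole line is
  bounded by its inhomogeneity alone. Applied to differences of solutions it gives uniqueness and
  convergence of the regularisations, applied to translates it gives almost periodicity.\<close>

definition pseudo_dist :: "(real \<Rightarrow> real \<Rightarrow> real) \<Rightarrow> bool" where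
  "pseudo_dist \<rho> \<longleftrightarrow> (\<forall>t. \<rho> t t = 0) \<and> (\<forall>s t. \<rho> s t = \<rho> t s) \<and> (\<forall>r s t. \<rho> r t \<le> \<rho> r s + \<rho> s t)"

text \<open>Almost periodicity depends only on the distances between values. Expressing it by the
  two-point function \<open>\<rho>\<close> treats vector-valued and operator-valued functions alike
  and lets functions into different spaces be combined by adding their distances.\<close>

definition ap_dist :: "(real \<Rightarrow> real \<Rightarrow> real) \<Rightarrow> bool" where
  "ap_dist \<rho> \<longleftrightarrow> pseudo_dist \<rho> \<and> (\<forall>t. ((\<lambda>s. \<rho> s t) \<longlongrightarrow> 0) (at t)) \<and>
     (\<forall>\<epsilon>>0. relatively_dense {\<tau>. \<forall>t. \<rho> (t + \<tau>) t < \<epsilon>})"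

lemma pseudo_dist_nonneg: "pseudo_dist \<rho> \<Longrightarrow> 0 \<le> \<rho> s t"
  unfolding pseudo_dist_def by (smt (verit))

lemma pseudo_dist_dist: "pseudo_dist (\<lambda>s t. dist (f s) (f t))"
  unfolding pseudo_dist_def by (simp add: dist_commute dist_triangle)

lemma almost_periodic_ap_dist:
  assumes "pseudo_dist (\<lambda>s t. d (f s) (f t))"
  shows "almost_periodic d f \<longleftrightarrow> ap_dist (\<lambda>s t. d (f s) (f t))"
  using assms by (simp add: almost_periodic_def ap_dist_def almost_periods_def)

lemma relatively_dense_mono: "relatively_dense S \<Longrightarrow> S \<subseteq> T \<Longrightarrow> relatively_dense T"
  unfolding relatively_dense_def by (metis Int_mono subset_empty subset_refl)

lemma ap_dist_dense:
  "ap_dist \<rho> \<Longrightarrow> \<epsilon> > 0 \<Longrightarrow> relatively_dense {\<tau>. \<forall>t. \<rho> (t + \<tau>) t < \<epsilon>}"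
  by (simp add: ap_dist_def)

text \<open>An almost period moves any two nearby points into one fixed compact interval, where
  \<open>\<rho>\<close> is uniformly continuous. The two translations and the comparison there cost
  \<open>\<epsilon> / 3\<close> each.\<close>

lemma ap_dist_uniform:
  assumes "ap_dist \<rho>" "\<epsilon> > 0"
  obtains d where "d > 0" "\<And>s t. \<bar>s - t\<bar> < d \<Longrightarrow> \<rho> s t < \<epsilon>"
proof -
  have pd: "pseudo_dist \<rho>" and c: "\<And>t. ((\<lambda>s. \<rho> s t) \<longlongrightarrow> 0) (at t)"
    using assms by (auto simp: ap_dist_def)
  have rd: "relatively_dense {\<tau>. \<forall>t. \<rho> (t + \<tau>) t < \<epsilon> / 3}"
    by (intro ap_dist_dense assms) (use assms in simp)
  have z: "\<And>t. \<rho> t t = 0" and sy: "\<And>s t. \<rho> s t = \<rho> t s"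
    and tr: "\<And>r s t. \<rho> r t \<le> \<rho> r s + \<rho> s t"
    using pd by (auto simp: pseudo_dist_def)
  \<comment> \<open>For a pseudometric, continuity at the diagonal in one variable already yields
    joint continuity, through the quadrilateral inequality.\<close>
  have "isCont (\<lambda>p. \<rho> (fst p) (snd p)) (x, y)" for x y
  proof -
    have a: "isCont (\<lambda>s. \<rho> s t) t" for t
      using c z by (simp add: isCont_def)
    have "((\<lambda>p. \<rho> (fst p) x) \<longlongrightarrow> \<rho> x x) (at (x, y))"
      by (rule isCont_tendsto_compose[OF a]) (use tendsto_fst[OF tendsto_ident_at, of "(x, y)" UNIV] in simp)
    moreover have "((\<lambda>p. \<rho> (snd p) y) \<longlongrightarrow> \<rho> y y) (at (x, y))"
      by (rule isCont_tendsto_compose[OF a]) (use tendsto_snd[OF tendsto_ident_at, of "(x, y)" UNIV] in simp)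
    ultimately have l: "((\<lambda>p. \<rho> (fst p) x + \<rho> (snd p) y) \<longlongrightarrow> 0) (at (x, y))"
      using tendsto_add z by fastforce
    have "\<bar>\<rho> (fst p) (snd p) - \<rho> x y\<bar> \<le> \<rho> (fst p) x + \<rho> (snd p) y" for p
      using tr[of "fst p" "snd p" x] tr[of x "snd p" y] tr[of x y "fst p"] tr[of "fst p" y "snd p"]
        sy[of y "snd p"] sy[of x "fst p"] by linarith
    then have "((\<lambda>p. \<rho> (fst p) (snd p) - \<rho> x y) \<longlongrightarrow> 0) (at (x, y))"
      by (intro Lim_null_comparison[OF _ l]) auto
    then show ?thesis
      by (simp add: isCont_def LIM_zero_iff)
  qed
  then have cc: "continuous_on S (\<lambda>p. \<rho> (fst p) (snd p))" for S
    by (auto intro!: continuous_at_imp_continuous_on)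
  obtain l where l: "l > 0" "\<And>c. {c..c + l} \<inter> {\<tau>. \<forall>t. \<rho> (t + \<tau>) t < \<epsilon> / 3} \<noteq> {}"
    using rd by (auto simp: relatively_dense_def)
  have "uniformly_continuous_on ({-1..l+1} \<times> {-1..l+1}) (\<lambda>p. \<rho> (fst p) (snd p))"
    by (intro compact_uniformly_continuous cc compact_Times compact_Icc)
  then obtain d where d: "d > 0" "\<And>p q. p \<in> {-1..l+1} \<times> {-1..l+1} \<Longrightarrow> q \<in> {-1..l+1} \<times> {-1..l+1} \<Longrightarrow>
      dist q p < d \<Longrightarrow> dist (\<rho> (fst q) (snd q)) (\<rho> (fst p) (snd p)) < \<epsilon> / 3"
    unfolding uniformly_continuous_on_def using assms(2) by (metis zero_less_divide_iff zero_less_numeral)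
  show ?thesis
  proof
    show "min d 1 > 0" using d by simp
    fix s t :: real assume st: "\<bar>s - t\<bar> < min d 1"
    obtain \<tau> where \<tau>: "\<tau> \<in> {-t..-t+l}" "\<And>t. \<rho> (t + \<tau>) t < \<epsilon> / 3"
      using l(2)[of "-t"] by blast
    have "dist (\<rho> (s + \<tau>) (t + \<tau>)) (\<rho> (t + \<tau>) (t + \<tau>)) < \<epsilon> / 3"
    proof -
      have "(t+\<tau>, t+\<tau>) \<in> {-1..l+1} \<times> {-1..l+1}" "(s+\<tau>, t+\<tau>) \<in> {-1..l+1} \<times> {-1..l+1}"
        using st \<tau>(1) by auto
      then show ?thesis
        using d(2)[of "(t+\<tau>, t+\<tau>)" "(s+\<tau>, t+\<tau>)"] st by (simp add: dist_Pair_Pair dist_real_def)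
    qed
    then have "\<rho> (s + \<tau>) (t + \<tau>) < \<epsilon> / 3"
      by (auto simp: z dist_real_def)
    then show "\<rho> s t < \<epsilon>"
      using \<tau>(2)[of s] \<tau>(2)[of t] tr[of s t "s + \<tau>"] tr[of "s+\<tau>" t "t + \<tau>"] sy[of s "s + \<tau>"] by linarith
  qed
qed

text \<open>Bochner's criterion: the translates form a totally bounded set. An almost period brings
  the shift \<open>a\<close> into \<open>{0..l}\<close>, and uniform continuity replaces it there by
  a point of a finite net.\<close>

lemma ap_dist_net:
  assumes "ap_dist \<rho>" "\<epsilon> > 0"
  obtains N where "finite N" "N \<noteq> {}" "\<And>a. \<exists>c\<in>N. \<forall>t. \<rho> (t + a) (t + c) < \<epsilon>"
proof -
  have pd: "pseudo_dist \<rho>" using assms by (auto simp: ap_dist_def)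
  have sy: "\<And>s t. \<rho> s t = \<rho> t s" and tr: "\<And>r s t. \<rho> r t \<le> \<rho> r s + \<rho> s t"
    using pd by (auto simp: pseudo_dist_def)
  obtain d where d: "d > 0" "\<And>s t. \<bar>s - t\<bar> < d \<Longrightarrow> \<rho> s t < \<epsilon> / 2"
    using ap_dist_uniform[OF assms(1), of "\<epsilon> / 2"] assms(2) by auto
  have "relatively_dense {\<tau>. \<forall>t. \<rho> (t + \<tau>) t < \<epsilon> / 2}"
    by (intro ap_dist_dense assms) (use assms in simp)
  then obtain l where l: "l > 0" "\<And>c. {c..c + l} \<inter> {\<tau>. \<forall>t. \<rho> (t + \<tau>) t < \<epsilon> / 2} \<noteq> {}"
    by (auto simp: relatively_dense_def)
  obtain N where N: "finite N" "{0..l} \<subseteq> (\<Union>x\<in>N. ball x d)"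
    using compact_eq_totally_bounded[of "{0..l}"] d(1) by (metis compact_Icc)
  show ?thesis
  proof
    show "finite N" by fact
    show "N \<noteq> {}" using N(2) l(1) by force
    fix a
    obtain \<tau> where \<tau>: "\<tau> \<in> {-a..-a+l}" "\<And>t. \<rho> (t + \<tau>) t < \<epsilon> / 2"
      using l(2)[of "-a"] by blast
    have "a + \<tau> \<in> {0..l}" using \<tau>(1) by simp
    then have "a + \<tau> \<in> (\<Union>x\<in>N. ball x d)" using N(2) by (rule set_mp[rotated])
    then obtain c where c: "c \<in> N" "dist c (a + \<tau>) < d" by auto
    have "\<rho> (t + a) (t + c) < \<epsilon>" for t
    proof -
      have "\<rho> (t + a + \<tau>) (t + c) < \<epsilon> / 2" using c(2) by (intro d) (auto simp: dist_real_def)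
      then show ?thesis using \<tau>(2)[of "t+a"] tr[of "t+a" "t+c" "t+a+\<tau>"] sy[of "t+a" "t+a+\<tau>"] by linarith
    qed
    then show "\<exists>c\<in>N. \<forall>t. \<rho> (t + a) (t + c) < \<epsilon>" using c(1) by blast
  qed
qed

lemma ap_dist_bounded:
  assumes "ap_dist \<rho>"
  obtains B where "\<And>s t. \<rho> s t \<le> B"
proof -
  have tr: "\<And>r s t. \<rho> r t \<le> \<rho> r s + \<rho> s t" and sy: "\<And>s t. \<rho> s t = \<rho> t s"
    using assms by (auto simp: ap_dist_def pseudo_dist_def)
  obtain N where N: "finite N" "N \<noteq> {}" "\<And>a. \<exists>c\<in>N. \<forall>t. \<rho> (t + a) (t + c) < 1"
    using ap_dist_net[OF assms, of 1] by auto
  define B where "B = Max ((\<lambda>c. \<rho> c 0) ` N)"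
  have *: "\<rho> s 0 \<le> 1 + B" for s
  proof -
    obtain c where "c \<in> N" "\<rho> s c < 1" using N(3)[of s] by (metis add_0)
    moreover have "\<rho> c 0 \<le> B" unfolding B_def using N(1) \<open>c \<in> N\<close> by auto
    ultimately show ?thesis using tr[of s 0 c] by linarith
  qed
  have "\<rho> s t \<le> 2 + 2 * B" for s t
  proof -
    show ?thesis using *[of s] *[of t] tr[of s t 0] sy[of 0 t] by linarith
  qed
  then show ?thesis by (rule that)
qed

text \<open>Common almost periods come from pigeonholing translates with respect to both distances at once.\<close>

lemma ap_dist_add:
  assumes "ap_dist \<rho>1" "ap_dist \<rho>2"
  shows "ap_dist (\<lambda>s t. \<rho>1 s t + \<rho>2 s t)"
proof -
  have p: "pseudo_dist \<rho>1" "pseudo_dist \<rho>2" using assms by (auto simp: ap_dist_def)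
  have sy1: "\<And>s t. \<rho>1 s t = \<rho>1 t s" and tr1: "\<And>r s t. \<rho>1 r t \<le> \<rho>1 r s + \<rho>1 s t"
    and sy2: "\<And>s t. \<rho>2 s t = \<rho>2 t s" and tr2: "\<And>r s t. \<rho>2 r t \<le> \<rho>2 r s + \<rho>2 s t"
    using p by (auto simp: pseudo_dist_def)
  have "pseudo_dist (\<lambda>s t. \<rho>1 s t + \<rho>2 s t)"
    unfolding pseudo_dist_def
  proof (intro conjI allI)
    show "\<rho>1 r t + \<rho>2 r t \<le> \<rho>1 r s + \<rho>2 r s + (\<rho>1 s t + \<rho>2 s t)" for r s t
      using tr1[of r t s] tr2[of r t s] by linarith
    show "\<rho>1 s t + \<rho>2 s t = \<rho>1 t s + \<rho>2 t s" for s t by (metis sy1 sy2)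
  qed (use p in \<open>simp add: pseudo_dist_def\<close>)
  moreover have "((\<lambda>s. \<rho>1 s t + \<rho>2 s t) \<longlongrightarrow> 0) (at t)" for t
    using assms tendsto_add[of "\<lambda>s. \<rho>1 s t" 0 "at t" "\<lambda>s. \<rho>2 s t" 0] by (auto simp: ap_dist_def)
  moreover have "relatively_dense {\<tau>. \<forall>t. \<rho>1 (t + \<tau>) t + \<rho>2 (t + \<tau>) t < \<epsilon>}" if e: "\<epsilon> > 0" for \<epsilon>
  proof -
    obtain N1 where N1: "finite N1" "N1 \<noteq> {}" "\<And>a. \<exists>c\<in>N1. \<forall>t. \<rho>1 (t + a) (t + c) < \<epsilon> / 4"
      using ap_dist_net[OF assms(1), of "\<epsilon> / 4"] e by auto
    obtain N2 where N2: "finite N2" "N2 \<noteq> {}" "\<And>a. \<exists>c\<in>N2. \<forall>t. \<rho>2 (t + a) (t + c) < \<epsilon> / 4"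
      using ap_dist_net[OF assms(2), of "\<epsilon> / 4"] e by auto
    \<comment> \<open>Two shifts in the same class \<open>c\<close> differ by a common almost
      period, with error \<open>\<epsilon> / 2\<close> for each distance. \<open>b c\<close> is a
      fixed member of the class; for an empty class it is arbitrary and merely enlarges
      \<open>L\<close>.\<close>
    define G where "G a c \<longleftrightarrow> (\<forall>t. \<rho>1 (t + a) (t + fst c) < \<epsilon> / 4) \<and> (\<forall>t. \<rho>2 (t + a) (t + snd c) < \<epsilon> / 4)" for a c
    define b where "b c = (SOME a. G a c)" for c
    define L where "L = 1 + (\<Sum>c\<in>N1 \<times> N2. \<bar>b c\<bar>)"
    have L: "\<bar>b c\<bar> < L" if "c \<in> N1 \<times> N2" for c
      using member_le_sum[of c "N1 \<times> N2" "\<lambda>c. \<bar>b c\<bar>"] that N1 N2 by (auto simp: L_def)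
    have "L > 0" by (auto simp: L_def intro!: add_pos_nonneg sum_nonneg)
    moreover have "{c..c + 2 * L} \<inter> {\<tau>. \<forall>t. \<rho>1 (t + \<tau>) t + \<rho>2 (t + \<tau>) t < \<epsilon>} \<noteq> {}" for c
    proof -
      define a where "a = c + L"
      obtain k where k: "k \<in> N1 \<times> N2" "G a k"
        using N1(3)[of a] N2(3)[of a] unfolding G_def by (metis SigmaI fst_conv snd_conv)
      then have Gb: "G (b k) k" unfolding b_def by (metis someI)
      have "\<rho>1 (t + (a - b k)) t + \<rho>2 (t + (a - b k)) t < \<epsilon>" for t
      proof -
        have "\<rho>1 (t - b k + a) (t - b k + fst k) < \<epsilon> / 4" "\<rho>1 (t - b k + b k) (t - b k + fst k) < \<epsilon> / 4"
          "\<rho>2 (t - b k + a) (t - b k + snd k) < \<epsilon> / 4" "\<rho>2 (t - b k + b k) (t - b k + snd k) < \<epsilon> / 4"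
          using k(2) Gb by (auto simp only: G_def)
        moreover have "t - b k + a = t + (a - b k)" "t - b k + b k = t" by auto
        ultimately show ?thesis
          using tr1[of "t + (a - b k)" t "t - b k + fst k"] tr2[of "t + (a - b k)" t "t - b k + snd k"]
            sy1[of t "t - b k + fst k"] sy2[of t "t - b k + snd k"] by simp
      qed
      moreover have "a - b k \<in> {c..c + 2 * L}" using L[OF k(1)] by (auto simp: a_def)
      ultimately show ?thesis by blast
    qed
    ultimately show ?thesis unfolding relatively_dense_def
      by (intro exI[of _ "2 * L"]) auto
  qed
  ultimately show ?thesis by (simp add: ap_dist_def)
qed

text \<open>The tool behind the closure properties below: almost periodicity is inherited once the
  displacement under each translation is bounded by a fixed multiple of a known one. The premise
  involves the displacements at all times at once, because solution operators are not local in
  time.\<close>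

lemma ap_dist_transfer:
  assumes \<rho>: "ap_dist \<rho>" and pd: "pseudo_dist \<rho>'"
    and K: "\<And>\<tau> b t. (\<And>t. \<rho> (t + \<tau>) t \<le> b) \<Longrightarrow> \<rho>' (t + \<tau>) t \<le> K * b"
  shows "ap_dist \<rho>'"
proof -
  \<comment> \<open>Enlarging the constant makes it positive and the resulting bound strict, as
    almost periods require.\<close>
  define K' where "K' = \<bar>K\<bar> + 1"
  have K': "\<rho>' (t + \<tau>) t < K' * b" if "\<And>t. \<rho> (t + \<tau>) t < b" for \<tau> b t
  proof -
    have "0 \<le> \<rho> (0 + \<tau>) 0" using \<rho> pseudo_dist_nonneg by (auto simp: ap_dist_def)
    then have b: "b > 0" using that[of 0] by linarith
    have "\<rho>' (t + \<tau>) t \<le> K * b" using that by (intro K) (simp add: less_imp_le)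
    also have "\<dots> < K' * b" using b by (auto simp: K'_def intro!: mult_strict_right_mono)
    finally show ?thesis .
  qed
  have "K' > 0" by (simp add: K'_def add_nonneg_pos)
  have "((\<lambda>s. \<rho>' s t) \<longlongrightarrow> 0) (at t)" for t
  proof (rule LIM_I)
    fix r :: real assume r: "r > 0"
    obtain d where d: "d > 0" "\<And>s t. \<bar>s - t\<bar> < d \<Longrightarrow> \<rho> s t < r / K'"
      using ap_dist_uniform[OF \<rho>, of "r / K'"] r \<open>K' > 0\<close> by auto
    have "norm (\<rho>' s t - 0) < r" if "norm (s - t) < d" for s
    proof -
      \<comment> \<open>The shift \<open>s - t\<close> itself, under which \<open>\<rho>\<close> is
        uniformly small, turns the translation estimate into continuity.\<close>
      have "\<rho>' (t + (s - t)) t < K' * (r / K')" using that by (intro K' d) auto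
      then show ?thesis using pseudo_dist_nonneg[OF pd, of s t] \<open>K' > 0\<close> by simp
    qed
    then show "\<exists>s>0. \<forall>x. x \<noteq> t \<and> norm (x - t) < s \<longrightarrow> norm (\<rho>' x t - 0) < r"
      using d(1) by blast
  qed
  moreover have "relatively_dense {\<tau>. \<forall>t. \<rho>' (t + \<tau>) t < \<epsilon>}" if "\<epsilon> > 0" for \<epsilon>
  proof -
    have "relatively_dense {\<tau>. \<forall>t. \<rho> (t + \<tau>) t < \<epsilon> / K'}"
      by (intro ap_dist_dense \<rho>) (use that \<open>K' > 0\<close> in simp)
    moreover have "{\<tau>. \<forall>t. \<rho> (t + \<tau>) t < \<epsilon> / K'} \<subseteq> {\<tau>. \<forall>t. \<rho>' (t + \<tau>) t < \<epsilon>}"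
      using K'[of _ "\<epsilon> / K'"] \<open>K' > 0\<close> by auto
    ultimately show ?thesis by (rule relatively_dense_mono)
  qed
  ultimately show ?thesis using pd by (simp add: ap_dist_def)
qed

section \<open>Almost periodic functions with values in a metric or normed space\<close>

abbreviation ap :: "(real \<Rightarrow> 'a::metric_space) \<Rightarrow> bool" where
  "ap \<equiv> almost_periodic dist"

lemma ap_iff: "ap f \<longleftrightarrow> ap_dist (\<lambda>s t. dist (f s) (f t))"
  by (rule almost_periodic_ap_dist) (rule pseudo_dist_dist)

lemma ap_transfer:
  assumes "ap_dist \<rho>"
    and "\<And>\<tau> b t. (\<And>t. \<rho> (t + \<tau>) t \<le> b) \<Longrightarrow> dist (f (t + \<tau>)) (f t) \<le> K * b"
  shows "ap f"
  unfolding ap_iff by (rule ap_dist_transfer[OF assms(1) pseudo_dist_dist assms(2)])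

lemma ap_bounded:
  fixes f :: "real \<Rightarrow> 'a::real_normed_vector"
  assumes "ap f" obtains B where "\<And>t. norm (f t) \<le> B" "B \<ge> 0"
proof -
  have "bounded (range f)" using almost_periodic_bcontfun[OF assms] by (simp add: bcontfun_def)
  then obtain B where "\<And>t. norm (f t) \<le> B" unfolding bounded_iff by blast
  moreover from this[of 0] have "B \<ge> 0" using norm_ge_zero order_trans by blast
  ultimately show ?thesis by (rule that)
qed

lemma ap_const: "ap (\<lambda>t. c)"
proof -
  have "{c..c + 1} \<inter> UNIV \<noteq> {}" for c :: real by auto
  then have "relatively_dense UNIV" unfolding relatively_dense_def by (intro exI[of _ 1]) auto
  then show ?thesis by (auto simp: almost_periodic_def almost_periods_def)
qed

lemma ap_add:
  fixes f g :: "real \<Rightarrow> 'a::real_normed_vector"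
  assumes "ap f" "ap g" shows "ap (\<lambda>t. f t + g t)"
proof (rule ap_transfer)
  show "ap_dist (\<lambda>s t. dist (f s) (f t) + dist (g s) (g t))"
    using assms by (intro ap_dist_add) (auto simp: ap_iff)
  fix \<tau> b t assume "\<And>t. dist (f (t + \<tau>)) (f t) + dist (g (t + \<tau>)) (g t) \<le> b"
  then show "dist (f (t + \<tau>) + g (t + \<tau>)) (f t + g t) \<le> 1 * b"
    by (metis dist_triangle_add mult_1 order_trans)
qed

lemma ap_scaleR:
  fixes f :: "real \<Rightarrow> 'a::real_normed_vector"
  assumes "ap f" shows "ap (\<lambda>t. c *\<^sub>R f t)"
proof (rule ap_transfer)
  show "ap_dist (\<lambda>s t. dist (f s) (f t))" using assms by (simp add: ap_iff)
  fix \<tau> b t assume "\<And>t. dist (f (t + \<tau>)) (f t) \<le> b"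
  then have "dist (f (t + \<tau>)) (f t) \<le> b" by blast
  moreover have "c *\<^sub>R f (t + \<tau>) - c *\<^sub>R f t = c *\<^sub>R (f (t + \<tau>) - f t)" by (rule scaleR_diff_right[symmetric])
  ultimately show "dist (c *\<^sub>R f (t + \<tau>)) (c *\<^sub>R f t) \<le> \<bar>c\<bar> * b"
    by (simp add: dist_norm mult_left_mono)
qed

lemma ap_limit:
  fixes f :: "real \<Rightarrow> 'a::real_normed_vector"
  assumes "\<And>\<epsilon>. \<epsilon> > 0 \<Longrightarrow> \<exists>g. ap g \<and> (\<forall>t. dist (g t) (f t) \<le> \<epsilon>)"
  shows "ap f"
  unfolding ap_iff ap_dist_def
proof (intro conjI allI impI)
  show "pseudo_dist (\<lambda>s t. dist (f s) (f t))" by (rule pseudo_dist_dist)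
  have *: "dist (f s) (f t) \<le> dist (g s) (g t) + 2 * \<epsilon>" if "\<forall>t. dist (g t) (f t) \<le> \<epsilon>" for g \<epsilon> s t
    using that[rule_format, of s] that[rule_format, of t] dist_triangle[of "f s" "f t" "g s"]
      dist_triangle[of "g s" "f t" "g t"] dist_commute[of "f s" "g s"] by linarith
  fix t :: real
  show "((\<lambda>s. dist (f s) (f t)) \<longlongrightarrow> 0) (at t)"
  proof (rule LIM_I)
    fix r :: real assume r: "r > 0"
    have "r / 4 > 0" "r / 2 > 0" using r by auto
    obtain g where g: "ap g" "\<forall>t. dist (g t) (f t) \<le> r / 4" using assms[OF \<open>r / 4 > 0\<close>] by blast
    obtain d where "d > 0" "\<And>s t. \<bar>s - t\<bar> < d \<Longrightarrow> dist (g s) (g t) < r / 2"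
      using ap_dist_uniform[OF g(1)[unfolded ap_iff] \<open>r / 2 > 0\<close>] by metis
    then have "norm (dist (f x) (f t) - 0) < r" if "\<bar>x - t\<bar> < d" for x
      using *[OF g(2), of x t] that by fastforce
    then show "\<exists>s>0. \<forall>x. x \<noteq> t \<and> norm (x - t) < s \<longrightarrow> norm (dist (f x) (f t) - 0) < r"
      using \<open>d > 0\<close> by (auto intro!: exI[of _ d])
  qed
next
  fix \<epsilon> :: real assume e: "\<epsilon> > 0"
  obtain g where g: "ap g" "\<forall>t. dist (g t) (f t) \<le> \<epsilon> / 4" using assms[of "\<epsilon>/4"] e by (metis divide_pos_pos zero_less_numeral)
  have "relatively_dense {\<tau>. \<forall>t. dist (g (t + \<tau>)) (g t) < \<epsilon> / 2}"
    using ap_dist_dense[OF g(1)[unfolded ap_iff], of "\<epsilon> / 2"] e by simp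
  moreover have "dist (f (t + \<tau>)) (f t) < \<epsilon>" if "\<forall>t. dist (g (t + \<tau>)) (g t) < \<epsilon> / 2" for t \<tau>
  proof -
    have "dist (f (t+\<tau>)) (f t) \<le> dist (g (t+\<tau>)) (g t) + \<epsilon> / 2"
      using g(2)[rule_format, of "t+\<tau>"] g(2)[rule_format, of t]
      dist_triangle[of "f (t+\<tau>)" "f t" "g (t+\<tau>)"] dist_triangle[of "g (t+\<tau>)" "f t" "g t"]
      dist_commute[of "f (t+\<tau>)" "g (t+\<tau>)"] by linarith
    then show ?thesis using that[rule_format, of t] by linarith
  qed
  ultimately show "relatively_dense {\<tau>. \<forall>t. dist (f (t + \<tau>)) (f t) < \<epsilon>}"
    by (elim relatively_dense_mono) blast
qed

section \<open>Resolvents of Hille-Yosida operators\<close>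

lemma le_all_eps:
  fixes x a L :: real
  assumes "\<And>\<epsilon>. \<epsilon> > 0 \<Longrightarrow> x \<le> a + \<epsilon> * L"
  shows "x \<le> a"
proof (rule field_le_epsilon)
  fix e :: real assume e: "e > 0"
  have "e / (\<bar>L\<bar> + 1) > 0" using e by (simp add: add_nonneg_pos)
  from assms[OF this] have "x \<le> a + e / (\<bar>L\<bar> + 1) * L" .
  also have "e / (\<bar>L\<bar> + 1) * L \<le> e / (\<bar>L\<bar> + 1) * (\<bar>L\<bar> + 1)"
    using e by (intro mult_left_mono) auto
  also have "\<dots> = e" by (simp add: add_nonneg_pos)
  finally show "x \<le> a + e" by simp
qed

lemma closure_subspace:
  fixes S :: "'a::real_normed_vector set"
  assumes "subspace S" shows "subspace (closure S)"
proof (intro subspaceI)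
  show "0 \<in> closure S" using subspace_0[OF assms] closure_subset by blast
  show "x + y \<in> closure S" if xy: "x \<in> closure S" "y \<in> closure S" for x y
  proof -
    obtain f g where "\<forall>n. f n \<in> S" "f \<longlonglongrightarrow> x" "\<forall>n. g n \<in> S" "g \<longlonglongrightarrow> y"
      using xy by (auto simp: closure_sequential)
    then show ?thesis unfolding closure_sequential
      by (intro exI[of _ "\<lambda>n. f n + g n"]) (auto intro: subspace_add[OF assms] tendsto_add)
  qed
  show "c *\<^sub>R x \<in> closure S" if x: "x \<in> closure S" for c x
  proof -
    obtain f where "\<forall>n. f n \<in> S" "f \<longlonglongrightarrow> x" using x by (auto simp: closure_sequential)
    then show ?thesis unfolding closure_sequential
      by (intro exI[of _ "\<lambda>n. c *\<^sub>R f n"]) (auto intro: subspace_scale[OF assms] tendsto_scaleR)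
  qed
qed

text \<open>\<open>w\<close> belongs to the norm estimates of the resolvent and \<open>w'\<close> to
  its positivity; no relation between the two thresholds is assumed.\<close>

locale hille_yosida_cone =
  fixes D :: "'a::banach set" and A :: "'a \<Rightarrow> 'a" and P :: "'a set" and w M w' :: real
  assumes HY: "hille_yosida D A w M"
    and cone: "order_cone P"
    and res_pos: "\<And>\<mu> x. \<mu> > w' \<Longrightarrow> x \<in> P \<Longrightarrow> resolvent D A \<mu> x \<in> P"
begin

abbreviation res where "res \<mu> \<equiv> resolvent D A \<mu>"
abbreviation X0 where "X0 \<equiv> closure D"

text \<open>Takes all of \<open>X\<close> into \<open>D\<close> and is uniformly bounded for large
  \<open>\<mu>\<close>, but converges strongly to the identity only on \<open>X0\<close>.\<close>

definition J where "J \<mu> x = \<mu> *\<^sub>R res \<mu> x"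

text \<open>A fixed resolvent, taken at distance one from \<open>w\<close> so that its norm is at
  most \<open>M\<close>. It is the smoothing operator behind which \<open>J \<mu>\<close> converges
  on all of \<open>X\<close>.\<close>

definition R where "R = res (w + 1)"

lemma M1: "M \<ge> 1" and linA: "linear_op_on D A"
  using HY by (auto simp: hille_yosida_def)

lemma subD: "subspace D" using linA by (simp add: linear_op_on_def)

lemma subX0: "subspace X0" using subD by (rule closure_subspace)

lemma D_X0: "x \<in> D \<Longrightarrow> x \<in> X0" using closure_subset by auto

lemma P_closed: "closed P" and P0: "0 \<in> P"
  and P_scale: "\<And>c x. c \<ge> 0 \<Longrightarrow> x \<in> P \<Longrightarrow> c *\<^sub>R x \<in> P"
  using cone by (auto simp: order_cone_def cone_def)

lemma P_add: "x \<in> P \<Longrightarrow> y \<in> P \<Longrightarrow> x + y \<in> P"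
  using cone convex_cone[of P] by (auto simp: order_cone_def)

lemma res_set: "\<mu> > w \<Longrightarrow> bij_betw (\<lambda>x. \<mu> *\<^sub>R x - A x) D UNIV"
  and bounded_linear_res: "\<mu> > w \<Longrightarrow> bounded_linear (res \<mu>)"
  using HY by (auto simp: hille_yosida_def resolvent_set_def)

lemma res_in: "\<mu> > w \<Longrightarrow> res \<mu> x \<in> D"
  using res_set[of \<mu>] unfolding resolvent_def bij_betw_def by (metis UNIV_I inv_into_into)

lemma res_eq: "\<mu> > w \<Longrightarrow> \<mu> *\<^sub>R res \<mu> x - A (res \<mu> x) = x"
  using f_inv_into_f[of x "\<lambda>x. \<mu> *\<^sub>R x - A x" D] res_set[of \<mu>]
  unfolding resolvent_def bij_betw_def by simp

lemma A_res: "\<mu> > w \<Longrightarrow> A (res \<mu> x) = \<mu> *\<^sub>R res \<mu> x - x"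
  using res_eq[of \<mu> x] by (simp add: algebra_simps)

lemma res_inv: "\<mu> > w \<Longrightarrow> x \<in> D \<Longrightarrow> res \<mu> (\<mu> *\<^sub>R x - A x) = x"
  using res_set[of \<mu>] inv_into_f_f[of "\<lambda>x. \<mu> *\<^sub>R x - A x" D x]
  unfolding resolvent_def bij_betw_def by simp

lemma A_scale: "x \<in> D \<Longrightarrow> A (c *\<^sub>R x) = c *\<^sub>R A x"
  using linA by (simp add: linear_op_on_def)

lemma res_pow: "\<mu> > w \<Longrightarrow> norm ((res \<mu> ^^ n) x) \<le> M / (\<mu> - w) ^ n * norm x"
proof (cases "n = 0")
  case True
  then show ?thesis using M1 mult_right_mono[of 1 M "norm x"] by simp
next
  case False
  assume "\<mu> > w"
  have "bounded_linear (res \<mu> ^^ n)" for n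
  proof (induction n)
    case 0 then show ?case by (simp add: bounded_linear_ident id_def)
  next
    case (Suc n) then show ?case
      using bounded_linear_compose[OF bounded_linear_res[OF \<open>\<mu> > w\<close>] Suc] by (simp add: o_def)
  qed
  then have "norm ((res \<mu> ^^ n) x) \<le> onorm (res \<mu> ^^ n) * norm x" by (rule onorm)
  also have "onorm (res \<mu> ^^ n) \<le> M / (\<mu> - w) ^ n"
    using HY False \<open>\<mu> > w\<close> by (auto simp: hille_yosida_def)
  finally show ?thesis by (simp add: mult_right_mono)
qed

lemma res_bound: "\<mu> > w \<Longrightarrow> norm (res \<mu> x) \<le> M / (\<mu> - w) * norm x"
  using res_pow[of \<mu> 1 x] by simp

lemma res_identity:
  assumes "\<mu> > w" "\<nu> > w"
  shows "res \<nu> x = res \<mu> x + (\<mu> - \<nu>) *\<^sub>R res \<mu> (res \<nu> x)"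
proof -
  interpret r: bounded_linear "res \<mu>" using assms(1) by (rule bounded_linear_res)
  have "\<mu> *\<^sub>R res \<nu> x - A (res \<nu> x) = x + (\<mu> - \<nu>) *\<^sub>R res \<nu> x"
    using A_res[OF assms(2), of x] by (simp add: algebra_simps)
  then show ?thesis
    using res_inv[OF assms(1) res_in[OF assms(2), of x]] by (simp add: r.add r.scaleR)
qed

lemma res_commute:
  assumes "\<mu> > w" "\<nu> > w"
  shows "res \<nu> (res \<mu> x) = res \<mu> (res \<nu> x)"
proof (cases "\<mu> = \<nu>")
  case False
  have "(\<mu> - \<nu>) *\<^sub>R res \<mu> (res \<nu> x) = res \<nu> x - res \<mu> x"
    using res_identity[OF assms, of x] by (simp add: algebra_simps)
  moreover have "(\<mu> - \<nu>) *\<^sub>R res \<nu> (res \<mu> x) = res \<nu> x - res \<mu> x"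
    using res_identity[OF assms(2,1), of x] by (simp add: algebra_simps)
  ultimately show ?thesis using False by (metis eq_iff_diff_eq_0 scaleR_left_imp_eq)
qed simp

lemma bounded_linear_R: "bounded_linear R" unfolding R_def by (rule bounded_linear_res) simp

sublocale R: bounded_linear R by (rule bounded_linear_R)

lemma R_in: "R x \<in> X0" unfolding R_def by (intro D_X0 res_in) simp

lemma R_bound: "norm (R x) \<le> M * norm x"
  unfolding R_def using res_bound[of "w + 1" x] by simp

lemma bounded_linear_J: "\<mu> > w \<Longrightarrow> bounded_linear (J \<mu>)"
  unfolding J_def by (intro bounded_linear_const_scaleR bounded_linear_res)

lemma J_in: "\<mu> > w \<Longrightarrow> J \<mu> x \<in> D"
  unfolding J_def by (intro subspace_scale[OF subD] res_in)

text \<open>From here on \<open>\<mu>\<close> is positive and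
  \<open>\<mu> / (\<mu> - w) \<le> 2\<close>, which gives \<open>J \<mu>\<close> the uniform bound
  \<open>2 * M\<close>.\<close>

definition \<mu>0 where "\<mu>0 = 2 * \<bar>w\<bar> + 1"

lemma \<mu>0: "\<mu> \<ge> \<mu>0 \<Longrightarrow> \<mu> > w" "\<mu> \<ge> \<mu>0 \<Longrightarrow> \<mu> > 0" "\<mu> \<ge> \<mu>0 \<Longrightarrow> \<mu> \<ge> 2 * w"
  unfolding \<mu>0_def by auto

lemma J_bound: assumes "\<mu> \<ge> \<mu>0" shows "norm (J \<mu> x) \<le> 2 * M * norm x"
proof -
  have "norm (J \<mu> x) \<le> \<mu> * (M / (\<mu> - w) * norm x)"
    unfolding J_def using mult_left_mono[OF res_bound[of \<mu> x], of \<mu>] \<mu>0[OF assms] by simp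
  also have "\<dots> = (\<mu> / (\<mu> - w)) * (M * norm x)" by simp
  also have "\<dots> \<le> 2 * (M * norm x)"
    using \<mu>0[OF assms] M1 by (intro mult_right_mono) (auto simp: field_simps)
  finally show ?thesis by simp
qed

lemma J_diff: "\<mu> > w \<Longrightarrow> x \<in> D \<Longrightarrow> J \<mu> x - x = res \<mu> (A x)"
proof -
  assume "\<mu> > w" "x \<in> D"
  interpret r: bounded_linear "res \<mu>" by (rule bounded_linear_res) fact
  show ?thesis using res_inv[OF \<open>\<mu> > w\<close> \<open>x \<in> D\<close>] by (simp add: J_def r.diff r.scaleR algebra_simps)
qed

definition JR_const where "JR_const = M * (\<bar>w + 1\<bar> * M + 1)"

lemma J_R_commute: "\<mu> > w \<Longrightarrow> J \<mu> (R x) = R (J \<mu> x)"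
  using res_commute[of \<mu> "w + 1" x] unfolding J_def by (simp add: R.scaleR) (simp add: R_def)

text \<open>\<open>R J \<mu> - R\<close> equals \<open>res \<mu>\<close> applied to
  \<open>A R\<close>, and \<open>A R = (w + 1) R - 1\<close> is bounded. The convergence is
  therefore in operator norm, at rate \<open>1 / (\<mu> - w)\<close>, although
  \<open>J \<mu>\<close> itself need not converge.\<close>

lemma J_R: assumes "\<mu> > w" shows "norm (R (J \<mu> x) - R x) \<le> JR_const / (\<mu> - w) * norm x"
proof -
  have "R (J \<mu> x) - R x = res \<mu> (A (R x))"
    using J_diff[OF assms, of "R x"] res_in[of "w+1" x] by (simp add: J_R_commute[OF assms]) (simp add: R_def)
  also have "A (R x) = (w + 1) *\<^sub>R R x - x" unfolding R_def by (rule A_res) simp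
  finally have "norm (R (J \<mu> x) - R x) \<le> M / (\<mu> - w) * norm ((w + 1) *\<^sub>R R x - x)"
    using res_bound[OF assms] by simp
  moreover have "norm ((w + 1) *\<^sub>R R x - x) \<le> \<bar>w + 1\<bar> * (M * norm x) + norm x"
    by (rule order_trans[OF norm_triangle_ineq4]) (simp add: mult_left_mono R_bound)
  then have "M / (\<mu> - w) * norm ((w + 1) *\<^sub>R R x - x) \<le> M / (\<mu> - w) * (\<bar>w + 1\<bar> * (M * norm x) + norm x)"
    using M1 assms by (intro mult_left_mono) auto
  moreover have "M / (\<mu> - w) * (\<bar>w + 1\<bar> * (M * norm x) + norm x) = JR_const / (\<mu> - w) * norm x"
    by (simp add: JR_const_def field_simps)
  ultimately show ?thesis by linarith
qed

lemma JR_const: "JR_const \<ge> 0" using M1 by (simp add: JR_const_def)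

lemma JR_small:
  assumes "\<epsilon> > 0" shows "\<exists>\<mu>1\<ge>\<mu>0. \<forall>\<mu>\<ge>\<mu>1. \<forall>x. norm (R (J \<mu> x) - R x) \<le> \<epsilon> * norm x"
proof -
  define \<mu>1 where "\<mu>1 = max \<mu>0 (w + 1 + JR_const / \<epsilon>)"
  have "norm (R (J \<mu> x) - R x) \<le> \<epsilon> * norm x" if "\<mu> \<ge> \<mu>1" for \<mu> x
  proof -
    have *: "\<mu> - w > 0" "JR_const / \<epsilon> \<le> \<mu> - w" using that JR_const assms
      by (auto simp: \<mu>1_def intro: less_le_trans[OF _ that] dest: \<mu>0)
    then have "JR_const / (\<mu> - w) \<le> \<epsilon>" using assms by (simp add: field_simps)
    then have "JR_const / (\<mu> - w) * norm x \<le> \<epsilon> * norm x" by (rule mult_right_mono) simp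
    then show ?thesis using J_R[of \<mu> x] * by linarith
  qed
  then show ?thesis by (intro exI[of _ \<mu>1]) (auto simp: \<mu>1_def)
qed

lemma J_small_D:
  assumes "x \<in> D" "\<epsilon> > 0" shows "\<exists>\<mu>1\<ge>\<mu>0. \<forall>\<mu>\<ge>\<mu>1. norm (J \<mu> x - x) \<le> \<epsilon>"
proof -
  define \<mu>1 where "\<mu>1 = max \<mu>0 (w + 1 + M * norm (A x) / \<epsilon>)"
  have "norm (J \<mu> x - x) \<le> \<epsilon>" if "\<mu> \<ge> \<mu>1" for \<mu>
  proof -
    have n: "M * norm (A x) / \<epsilon> \<ge> 0" using M1 assms by simp
    then have *: "\<mu> - w > 0" "M * norm (A x) / \<epsilon> \<le> \<mu> - w" using that unfolding \<mu>1_def by linarith+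
    then have "norm (J \<mu> x - x) \<le> M / (\<mu> - w) * norm (A x)"
      using res_bound[of \<mu> "A x"] J_diff[of \<mu> x] assms by simp
    also have "\<dots> \<le> \<epsilon>" using * assms by (simp add: field_simps)
    finally show ?thesis .
  qed
  then show ?thesis by (intro exI[of _ \<mu>1]) (auto simp: \<mu>1_def)
qed

text \<open>Strong convergence of uniformly bounded operators is uniform on compact sets. The finite
  net is taken in \<open>D\<close>, where the convergence has an explicit rate; \<open>d\<close>
  makes the net error \<open>(2 * M + 1) * d\<close> equal to \<open>\<epsilon> / 2\<close>.\<close>

lemma J_uniform_compact:
  assumes K: "compact K" "K \<subseteq> X0" and e: "\<epsilon> > 0"
  shows "\<exists>\<mu>1\<ge>\<mu>0. \<forall>\<mu>\<ge>\<mu>1. \<forall>x\<in>K. norm (J \<mu> x - x) \<le> \<epsilon>"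
proof -
  define d where "d = \<epsilon> / (2 * (2 * M + 1))"
  have d: "d > 0" "(2 * M + 1) * d = \<epsilon> / 2" using e M1 by (auto simp: d_def field_simps)
  have "K \<subseteq> (\<Union>x\<in>D. ball x d)"
  proof
    fix x assume "x \<in> K"
    then obtain y where "y \<in> D" "dist y x < d" using K(2) d(1) closure_approachable by blast
    then show "x \<in> (\<Union>x\<in>D. ball x d)" by auto
  qed
  then obtain N where N: "N \<subseteq> D" "finite N" "K \<subseteq> (\<Union>x\<in>N. ball x d)"
    using compactE_image[OF K(1), of D "\<lambda>x. ball x d"] by auto
  have "\<forall>y\<in>N. \<exists>m\<ge>\<mu>0. \<forall>\<mu>\<ge>m. norm (J \<mu> y - y) \<le> \<epsilon> / 2"
    using J_small_D[of _ "\<epsilon> / 2"] N(1) e by auto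
  then obtain m where m: "\<And>y. y \<in> N \<Longrightarrow> m y \<ge> \<mu>0 \<and> (\<forall>\<mu>\<ge>m y. norm (J \<mu> y - y) \<le> \<epsilon> / 2)"
    by metis
  define \<mu>1 where "\<mu>1 = Max (insert \<mu>0 (m ` N))"
  have \<mu>1: "\<mu>1 \<ge> \<mu>0" "\<And>y. y \<in> N \<Longrightarrow> \<mu>1 \<ge> m y" using N(2) by (auto simp: \<mu>1_def)
  have "norm (J \<mu> x - x) \<le> \<epsilon>" if "\<mu> \<ge> \<mu>1" "x \<in> K" for \<mu> x
  proof -
    interpret J: bounded_linear "J \<mu>" using \<mu>0 \<mu>1 that by (intro bounded_linear_J) auto
    obtain y where y: "y \<in> N" "dist y x < d" using N(3) \<open>x \<in> K\<close> by auto
    have "J \<mu> x - x = J \<mu> (x - y) + (J \<mu> y - y) + (y - x)" by (simp add: J.diff)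
    also have "norm \<dots> \<le> norm (J \<mu> (x - y)) + norm (J \<mu> y - y) + norm (y - x)"
      by (intro order_trans[OF norm_triangle_ineq] add_mono norm_triangle_ineq order_refl)
    also have "\<dots> \<le> 2 * M * d + \<epsilon> / 2 + d"
    proof (intro add_mono)
      have "norm (J \<mu> (x - y)) \<le> 2 * M * norm (x - y)" by (rule J_bound) (use \<mu>1(1) that(1) in linarith)
      also have "\<dots> \<le> 2 * M * d" using y(2) M1 by (intro mult_left_mono) (auto simp: dist_norm norm_minus_commute)
      finally show "norm (J \<mu> (x - y)) \<le> 2 * M * d" .
      show "norm (J \<mu> y - y) \<le> \<epsilon> / 2" using m[OF y(1)] \<mu>1(2)[OF y(1)] that(1) by auto
      show "norm (y - x) \<le> d" using y(2) by (simp add: dist_norm)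
    qed
    also have "\<dots> = \<epsilon>" using d(2) by (simp add: algebra_simps)
    finally show ?thesis .
  qed
  then show ?thesis using \<mu>1(1) by blast
qed

lemma J_X0_small:
  "x \<in> X0 \<Longrightarrow> \<epsilon> > 0 \<Longrightarrow> \<exists>\<mu>1\<ge>\<mu>0. \<forall>\<mu>\<ge>\<mu>1. norm (J \<mu> x - x) \<le> \<epsilon>"
  using J_uniform_compact[of "{x}" \<epsilon>] by auto

section \<open>Mild solutions\<close>

text \<open>Applying the resolvent turns the integrated equation for \<open>u' = A u + G\<close> into a pointwise one.\<close>

definition mild :: "(real \<Rightarrow> 'a) \<Rightarrow> (real \<Rightarrow> 'a) \<Rightarrow> real \<Rightarrow> real \<Rightarrow> bool" where
  "mild u G s t \<longleftrightarrow> continuous_on {s..t} u \<and> continuous_on {s..t} G \<and> u ` {s..t} \<subseteq> X0 \<and>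
     (\<forall>r\<in>{s..t}. ((\<lambda>r. R (u r)) has_vector_derivative ((w + 1) *\<^sub>R R (u r) - u r + R (G r)))
        (at r within {s..t}))"

lemma mildD:
  assumes "mild u G s t"
  shows "continuous_on {s..t} u" "continuous_on {s..t} G" "\<And>r. r \<in> {s..t} \<Longrightarrow> u r \<in> X0"
    "\<And>r. r \<in> {s..t} \<Longrightarrow> ((\<lambda>r. R (u r)) has_vector_derivative ((w + 1) *\<^sub>R R (u r) - u r + R (G r)))
        (at r within {s..t})"
  using assms by (auto simp: mild_def)

lemma mild_add:
  assumes "mild u G s t" "mild v H s t"
  shows "mild (\<lambda>r. u r + v r) (\<lambda>r. G r + H r) s t"
  unfolding mild_def
proof (intro conjI ballI)
  show "(\<lambda>r. u r + v r) ` {s..t} \<subseteq> X0"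
    using mildD(3)[OF assms(1)] mildD(3)[OF assms(2)] subspace_add[OF subX0] by blast
  fix r assume "r \<in> {s..t}"
  from has_vector_derivative_add[OF mildD(4)[OF assms(1) this] mildD(4)[OF assms(2) this]]
  show "((\<lambda>r. R (u r + v r)) has_vector_derivative
      ((w + 1) *\<^sub>R R (u r + v r) - (u r + v r) + R (G r + H r))) (at r within {s..t})"
    by (simp add: R.add algebra_simps)
qed (auto intro!: continuous_intros mildD[OF assms(1)] mildD[OF assms(2)])

lemma mild_exp:
  assumes "mild u G s t"
  shows "mild (\<lambda>r. (k * exp (c * r)) *\<^sub>R u r) (\<lambda>r. (k * exp (c * r)) *\<^sub>R (G r + c *\<^sub>R u r)) s t"
  unfolding mild_def
proof (intro conjI ballI)
  show "(\<lambda>r. (k * exp (c * r)) *\<^sub>R u r) ` {s..t} \<subseteq> X0"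
    using mildD(3)[OF assms] subspace_scale[OF subX0] by blast
  fix r assume r: "r \<in> {s..t}"
  have "((\<lambda>r. k * exp (c * r)) has_real_derivative (k * exp (c * r)) * c) (at r within {s..t})"
    by (auto intro!: derivative_eq_intros)
  from has_vector_derivative_scaleR[OF this mildD(4)[OF assms r]]
  show "((\<lambda>r. R ((k * exp (c * r)) *\<^sub>R u r)) has_vector_derivative
      ((w + 1) *\<^sub>R R ((k * exp (c * r)) *\<^sub>R u r) - (k * exp (c * r)) *\<^sub>R u r +
        R ((k * exp (c * r)) *\<^sub>R (G r + c *\<^sub>R u r)))) (at r within {s..t})"
    by (simp add: R.add R.scaleR algebra_simps)
qed (auto intro!: continuous_intros mildD[OF assms])

lemma mild_scale: "mild u G s t \<Longrightarrow> mild (\<lambda>r. c *\<^sub>R u r) (\<lambda>r. c *\<^sub>R G r) s t"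
  using mild_exp[of u G s t c 0] by simp

lemma mild_diff:
  assumes "mild u G s t" "mild v H s t"
  shows "mild (\<lambda>r. u r - v r) (\<lambda>r. G r - H r) s t"
  using mild_add[OF assms(1) mild_scale[OF assms(2), of "-1"]] by simp

lemma mild_subset:
  assumes "mild u G s t" "s \<le> s'" "t' \<le> t" shows "mild u G s' t'"
proof -
  have sub: "{s'..t'} \<subseteq> {s..t}" using assms by auto
  show ?thesis unfolding mild_def
    using mildD[OF assms(1)] sub
    by (auto intro: continuous_on_subset has_vector_derivative_within_subset[OF _ sub])
qed

lemma mild_cong:
  assumes "mild u G s t" "\<And>r. r \<in> {s..t} \<Longrightarrow> u r = v r" "\<And>r. r \<in> {s..t} \<Longrightarrow> G r = H r"
  shows "mild v H s t"
  unfolding mild_def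
proof (intro conjI ballI)
  show "continuous_on {s..t} v" "continuous_on {s..t} H"
    using mildD(1,2)[OF assms(1)] assms(2,3) by (metis continuous_on_cong)+
  show "v ` {s..t} \<subseteq> X0" using mildD(3)[OF assms(1)] assms(2) by (metis image_subsetI)
  fix r assume r: "r \<in> {s..t}"
  show "((\<lambda>r. R (v r)) has_vector_derivative ((w + 1) *\<^sub>R R (v r) - v r + R (H r))) (at r within {s..t})"
    using mildD(4)[OF assms(1) r] assms(2,3)[OF r]
    by (intro has_vector_derivative_transform[OF r, of "\<lambda>r. R (v r)" "\<lambda>r. R (u r)"]) (simp_all add: assms(2))
qed

lemma mild_shift:
  assumes "mild u G (s + \<tau>) (t + \<tau>)"
  shows "mild (\<lambda>r. u (r + \<tau>)) (\<lambda>r. G (r + \<tau>)) s t"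
  unfolding mild_def
proof (intro conjI ballI)
  have im: "(\<lambda>r. r + \<tau>) ` {s..t} \<subseteq> {s + \<tau>..t + \<tau>}" by auto
  show "continuous_on {s..t} (\<lambda>r. u (r + \<tau>))" "continuous_on {s..t} (\<lambda>r. G (r + \<tau>))"
    by (intro continuous_on_compose2[OF mildD(1)[OF assms] _ im]
         continuous_on_compose2[OF mildD(2)[OF assms] _ im] continuous_intros)+
  show "(\<lambda>r. u (r + \<tau>)) ` {s..t} \<subseteq> X0" using mildD(3)[OF assms] by auto
  fix r assume r: "r \<in> {s..t}"
  then have "r + \<tau> \<in> {s + \<tau>..t + \<tau>}" by auto
  from mildD(4)[OF assms this]
  have "((\<lambda>r. R (u r)) has_vector_derivative ((w + 1) *\<^sub>R R (u (r + \<tau>)) - u (r + \<tau>) + R (G (r + \<tau>))))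
    (at (r + \<tau>) within (\<lambda>r. r + \<tau>) ` {s..t})"
    using im by (rule has_vector_derivative_within_subset)
  moreover have "((\<lambda>r. r + \<tau>) has_vector_derivative 1) (at r within {s..t})"
    by (auto intro!: derivative_eq_intros)
  ultimately show "((\<lambda>r. R (u (r + \<tau>))) has_vector_derivative
    ((w + 1) *\<^sub>R R (u (r + \<tau>)) - u (r + \<tau>) + R (G (r + \<tau>)))) (at r within {s..t})"
    using vector_diff_chain_within[of "\<lambda>r. r + \<tau>" 1 r "{s..t}" "\<lambda>r. R (u r)"] by (simp add: o_def)
qed

lemma mild_integral:
  assumes "mild u G s t" "r \<in> {s..t}"
  shows "((\<lambda>q. (w + 1) *\<^sub>R R (u q) - u q + R (G q)) has_integral (R (u r) - R (u s))) {s..r}"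
proof (rule fundamental_theorem_of_calculus)
  show "s \<le> r" using assms(2) by simp
  fix q assume "q \<in> {s..r}"
  then have "q \<in> {s..t}" "{s..r} \<subseteq> {s..t}" using assms(2) by auto
  then show "((\<lambda>q. R (u q)) has_vector_derivative ((w + 1) *\<^sub>R R (u q) - u q + R (G q))) (at q within {s..r})"
    by (intro has_vector_derivative_within_subset[OF mildD(4)[OF assms(1)]])
qed

lemma mildI_integral:
  assumes "continuous_on {s..t} u" "continuous_on {s..t} G" "\<And>r. r \<in> {s..t} \<Longrightarrow> u r \<in> X0"
    "\<And>r. r \<in> {s..t} \<Longrightarrow> R (u r) - R (u s) = integral {s..r} (\<lambda>q. (w + 1) *\<^sub>R R (u q) - u q + R (G q))"
  shows "mild u G s t"
  unfolding mild_def
proof (intro conjI ballI)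
  show "u ` {s..t} \<subseteq> X0" using assms(3) by auto
  fix r assume r: "r \<in> {s..t}"
  have "continuous_on {s..t} (\<lambda>q. (w + 1) *\<^sub>R R (u q) - u q + R (G q))"
    by (intro continuous_intros R.continuous_on assms)
  from integral_has_vector_derivative[OF this r]
  have "((\<lambda>r. R (u s) + integral {s..r} (\<lambda>q. (w + 1) *\<^sub>R R (u q) - u q + R (G q))) has_vector_derivative
     ((w + 1) *\<^sub>R R (u r) - u r + R (G r))) (at r within {s..t})"
    by (auto intro!: derivative_eq_intros)
  then show "((\<lambda>r. R (u r)) has_vector_derivative ((w + 1) *\<^sub>R R (u r) - u r + R (G r))) (at r within {s..t})"
    by (rule has_vector_derivative_transform[OF r, rotated]) (metis assms(4) add.commute diff_add_cancel)
qed (use assms in auto)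

text \<open>The resolvent identity expresses every resolvent through \<open>R\<close>, so the
  pointwise equation, imposed for \<open>R\<close> only, holds for all of them.\<close>

lemma mild_res:
  assumes "mild u G s t" "\<mu> > w" "r \<in> {s..t}"
  shows "((\<lambda>r. res \<mu> (u r)) has_vector_derivative (\<mu> *\<^sub>R res \<mu> (u r) - u r + res \<mu> (G r))) (at r within {s..t})"
proof -
  interpret r: bounded_linear "res \<mu>" using assms(2) by (rule bounded_linear_res)
  let ?d = "(w + 1) *\<^sub>R R (u r) - u r + R (G r)"
  have id: "res \<mu> x = R x + (w + 1 - \<mu>) *\<^sub>R res \<mu> (R x)" for x
    unfolding R_def using res_identity[of "w + 1" \<mu> x] res_commute[of "w+1" \<mu> x] assms(2) by simp
  have "((\<lambda>r. R (u r) + (w + 1 - \<mu>) *\<^sub>R res \<mu> (R (u r))) has_vector_derivative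
     ?d + (w + 1 - \<mu>) *\<^sub>R res \<mu> ?d) (at r within {s..t})"
    by (intro has_vector_derivative_add mildD(4)[OF assms(1,3)]
       bounded_linear.has_vector_derivative[OF bounded_linear_const_scaleR[OF r.bounded_linear_axioms]])
  moreover have "?d + (w + 1 - \<mu>) *\<^sub>R res \<mu> ?d = \<mu> *\<^sub>R res \<mu> (u r) - u r + res \<mu> (G r)"
  proof -
    have "?d + (w + 1 - \<mu>) *\<^sub>R res \<mu> ?d = (w + 1) *\<^sub>R (R (u r) + (w + 1 - \<mu>) *\<^sub>R res \<mu> (R (u r)))
       - (u r + (w + 1 - \<mu>) *\<^sub>R res \<mu> (u r)) + (R (G r) + (w + 1 - \<mu>) *\<^sub>R res \<mu> (R (G r)))"
      by (simp add: r.add r.diff r.scaleR algebra_simps)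
    also have "\<dots> = \<mu> *\<^sub>R res \<mu> (u r) - u r + res \<mu> (G r)"
      unfolding id[symmetric] by (simp add: algebra_simps)
    finally show ?thesis .
  qed
  ultimately show ?thesis by (simp flip: id)
qed

text \<open>\<open>J \<mu> u\<close> takes values in \<open>D\<close> and is a classical solution,
  which \<open>u\<close> need not be. The difference scheme is therefore compared with
  \<open>J \<mu> u\<close>.\<close>

lemma mild_J:
  assumes "mild u G s t" "\<mu> > w" "r \<in> {s..t}"
  shows "((\<lambda>r. J \<mu> (u r)) has_vector_derivative (A (J \<mu> (u r)) + J \<mu> (G r))) (at r within {s..t})"
proof -
  have "((\<lambda>r. \<mu> *\<^sub>R res \<mu> (u r)) has_vector_derivative \<mu> *\<^sub>R (\<mu> *\<^sub>R res \<mu> (u r) - u r + res \<mu> (G r))) (at r within {s..t})"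
    by (rule bounded_linear.has_vector_derivative[OF bounded_linear_scaleR_right mild_res[OF assms]])
  moreover have "A (J \<mu> (u r)) = \<mu> *\<^sub>R (\<mu> *\<^sub>R res \<mu> (u r) - u r)"
    unfolding J_def using A_scale[OF res_in[OF assms(2)]] A_res[OF assms(2)] by simp
  ultimately show ?thesis by (simp add: J_def scaleR_right_distrib)
qed

end

section \<open>The implicit Euler scheme\<close>

text \<open>The backward difference quotient at \<open>b\<close> is the mean of \<open>y'\<close>
  over \<open>{a..b}\<close>, so both errors are controlled by moduli of continuity, uniformly over
  the grid points.\<close>

lemma grid_errors:
  fixes y y' Q :: "real \<Rightarrow> 'a::banach"
  assumes st: "s < t"
    and y: "\<And>r. r \<in> {s..t} \<Longrightarrow> (y has_vector_derivative y' r) (at r within {s..t})"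
    and c: "continuous_on {s..t} y'" "continuous_on {s..t} Q" and e: "\<eta> > 0"
  shows "\<exists>N>0. \<forall>n\<ge>N. \<forall>j<n. let h = (t - s) / real n; a = s + real j * h; b = s + real (Suc j) * h in
    norm ((1 / h) *\<^sub>R (y b - y a) - y' b) \<le> \<eta> \<and> norm (Q b - Q a) \<le> \<eta>"
proof -
  obtain d1 where d1: "d1 > 0" "\<And>p q. p \<in> {s..t} \<Longrightarrow> q \<in> {s..t} \<Longrightarrow> dist q p < d1 \<Longrightarrow> dist (y' q) (y' p) < \<eta>"
    using compact_uniformly_continuous[OF c(1)] e unfolding uniformly_continuous_on_def by (metis compact_Icc)
  obtain d2 where d2: "d2 > 0" "\<And>p q. p \<in> {s..t} \<Longrightarrow> q \<in> {s..t} \<Longrightarrow> dist q p < d2 \<Longrightarrow> dist (Q q) (Q p) < \<eta>"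
    using compact_uniformly_continuous[OF c(2)] e unfolding uniformly_continuous_on_def by (metis compact_Icc)
  obtain N where N: "real N > (t - s) / min d1 d2" using reals_Archimedean2 by blast
  have md: "min d1 d2 > 0" using d1 d2 by auto
  have "N > 0" using N st md by (metis divide_pos_pos diff_gt_0_iff_gt of_nat_0_less_iff order_less_trans)
  show ?thesis
  proof (intro exI[of _ N] conjI allI impI \<open>N > 0\<close>)
    fix n j assume n: "N \<le> n" "j < n"
    define h where "h = (t - s) / real n"
    define a where "a = s + real j * h"
    define b where "b = s + real (Suc j) * h"
    have "n > 0" using n by auto
    have "real n > (t - s) / min d1 d2" using N n by linarith
    then have "t - s < real n * min d1 d2" using md by (simp add: pos_divide_less_eq)
    then have "h < min d1 d2" using \<open>n > 0\<close> by (simp add: h_def pos_divide_less_eq mult.commute del: min_less_iff_conj)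
    then have h: "h > 0" "h < d1" "h < d2" using st \<open>n > 0\<close> by (auto simp: h_def)
    have ba: "b = a + h" by (simp add: a_def b_def algebra_simps)
    have "real (Suc j) * h \<le> real n * h" using n h by (intro mult_right_mono) auto
    also have "\<dots> = t - s" using \<open>n > 0\<close> by (simp add: h_def)
    finally have bt: "b \<le> t" by (simp add: b_def)
    have as: "s \<le> a" using h by (simp add: a_def)
    have sub: "{a..b} \<subseteq> {s..t}" using bt as by auto
    have "(y' has_integral (y b - y a)) {a..b}"
    proof (rule fundamental_theorem_of_calculus)
      show "a \<le> b" using ba h by simp
      fix r assume "r \<in> {a..b}"
      with sub have "r \<in> {s..t}" by blast
      from has_vector_derivative_within_subset[OF y[OF this] sub]
      show "(y has_vector_derivative y' r) (at r within {a..b})" .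
    qed
    moreover have "((\<lambda>r. y' b) has_integral h *\<^sub>R y' b) {a..b}"
      using has_integral_const_real[of "y' b" a b] ba h by simp
    ultimately have i: "((\<lambda>r. y' r - y' b) has_integral (y b - y a - h *\<^sub>R y' b)) {a..b}"
      by (rule has_integral_diff)
    have "norm (y b - y a - h *\<^sub>R y' b) \<le> \<eta> * measure lborel (cbox a b)"
    proof (rule has_integral_bound[OF _ i[folded cbox_interval]])
      show "0 \<le> \<eta>" using e by auto
      show "norm (y' x - y' b) \<le> \<eta>" if "x \<in> cbox a b" for x
      proof -
        from that have "x \<in> {s..t}" "b \<in> {s..t}" "dist x b < d1" using sub ba h by (auto simp: dist_real_def)
        from d1(2)[OF this(2,1,3)] show "norm (y' x - y' b) \<le> \<eta>" by (simp add: dist_norm)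
      qed
    qed
    then have "norm (y b - y a - h *\<^sub>R y' b) \<le> \<eta> * h" using ba h by simp
    moreover have "(1 / h) *\<^sub>R (y b - y a) - y' b = (1 / h) *\<^sub>R (y b - y a - h *\<^sub>R y' b)"
      using h by (simp add: scaleR_diff_right)
    moreover have "norm ((1 / h) *\<^sub>R (y b - y a - h *\<^sub>R y' b)) = norm (y b - y a - h *\<^sub>R y' b) / h"
      using h by simp
    ultimately have "norm ((1 / h) *\<^sub>R (y b - y a) - y' b) \<le> \<eta>"
      using h by (simp only: pos_divide_le_eq)
    moreover have "norm (Q b - Q a) \<le> \<eta>"
      using d2(2)[of a b] as bt ba h by (auto simp: dist_norm)
    ultimately show "let h = (t - s) / real n; a = s + real j * h; b = s + real (Suc j) * h in
      norm ((1 / h) *\<^sub>R (y b - y a) - y' b) \<le> \<eta> \<and> norm (Q b - Q a) \<le> \<eta>"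
      by (simp add: Let_def h_def a_def b_def)
  qed
qed

text \<open>The powers of \<open>T\<close> are bounded by \<open>M\<close>, but \<open>T\<close>
  need not be a contraction, and estimating step by step would produce \<open>M ^ n\<close>. The
  recursion is therefore unrolled before norms are taken, so that each term contains one power of
  \<open>T\<close> and one factor \<open>M\<close>.\<close>

lemma discrete_gronwall:
  fixes d c :: "nat \<Rightarrow> 'a::real_normed_vector" and T :: "'a \<Rightarrow> 'a"
  assumes T: "linear T" "\<And>n x. norm ((T ^^ n) x) \<le> M * norm x" and M: "M \<ge> 0"
    and rec: "\<And>j. j < n \<Longrightarrow> d (Suc j) = T (d j + h *\<^sub>R c j)"
    and c: "\<And>j. j < n \<Longrightarrow> norm (c j) \<le> \<beta> * norm (d j) + \<eta>" and pos: "h \<ge> 0" "\<beta> \<ge> 0" "\<eta> \<ge> 0"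
  shows "norm (d n) \<le> M * (norm (d 0) + real n * h * \<eta>) * exp (real n * h * M * \<beta>)"
proof -
  have lin: "linear (T ^^ k)" for k
  proof (induction k)
    case (Suc k) then show ?case using linear_compose[OF Suc T(1)] by (simp add: o_def)
  qed (simp add: linear_iff)
  have formula: "d m = (T ^^ m) (d 0) + h *\<^sub>R (\<Sum>j<m. (T ^^ (m - j)) (c j))" if "m \<le> n" for m
    using that
  proof (induction m)
    case (Suc m)
    have "d (Suc m) = T ((T ^^ m) (d 0) + h *\<^sub>R (\<Sum>j<m. (T ^^ (m - j)) (c j)) + h *\<^sub>R c m)"
      using Suc rec by simp
    also have "\<dots> = (T ^^ Suc m) (d 0) + h *\<^sub>R (\<Sum>j<m. (T ^^ Suc (m - j)) (c j)) + h *\<^sub>R T (c m)"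
      using T(1) by (simp add: linear_add linear_scale linear_sum)
    also have "(\<Sum>j<m. (T ^^ Suc (m - j)) (c j)) = (\<Sum>j<m. (T ^^ (Suc m - j)) (c j))"
      by (intro sum.cong) (auto simp: Suc_diff_le)
    finally show ?case by (simp add: scaleR_add_right)
  qed simp
  define a where "a = M * (norm (d 0) + real n * h * \<eta>)"
  define q where "q = 1 + h * M * \<beta>"
  have q: "q \<ge> 1" and a: "a \<ge> 0" using pos M by (auto simp: q_def a_def)
  have main: "norm (d m) \<le> a * q ^ m" if "m \<le> n" for m
    using that
  proof (induction m rule: less_induct)
    case (less m)
    have "norm (d m) \<le> norm ((T ^^ m) (d 0)) + h * (\<Sum>j<m. norm ((T ^^ (m - j)) (c j)))"
      unfolding formula[OF less.prems] using pos
      by (intro order_trans[OF norm_triangle_ineq]) (simp add: mult_left_mono norm_sum)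
    also have "\<dots> \<le> M * norm (d 0) + h * (\<Sum>j<m. M * (\<beta> * (a * q ^ j) + \<eta>))"
    proof (intro add_mono mult_left_mono sum_mono)
      fix j assume j: "j \<in> {..<m}"
      have "norm ((T ^^ (m - j)) (c j)) \<le> M * norm (c j)" by (rule T)
      also have "\<dots> \<le> M * (\<beta> * norm (d j) + \<eta>)" using c less.prems j M by (intro mult_left_mono) auto
      also have "\<dots> \<le> M * (\<beta> * (a * q ^ j) + \<eta>)"
        using less j M pos by (intro mult_left_mono add_mono) auto
      finally show "norm ((T ^^ (m - j)) (c j)) \<le> M * (\<beta> * (a * q ^ j) + \<eta>)" .
    qed (use T pos in auto)
    \<comment> \<open>Since \<open>q - 1 = h * M * \<beta>\<close>, the geometric sum collapses to
      \<open>q ^ m - 1\<close>; the constant \<open>a\<close> absorbs the first term and the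
      induction closes.\<close>
    also have "\<dots> = M * (norm (d 0) + real m * h * \<eta>) + a * (\<Sum>j<m. (q - 1) * q ^ j)"
      by (simp add: q_def sum.distrib sum_distrib_left algebra_simps)
    also have "(\<Sum>j<m. (q - 1) * q ^ j) = q ^ m - 1"
      by (simp add: power_diff_1_eq sum_distrib_left)
    also have "M * (norm (d 0) + real m * h * \<eta>) + a * (q ^ m - 1) \<le> a + a * (q ^ m - 1)"
      unfolding a_def using less.prems pos M by (intro add_mono mult_left_mono order_refl mult_right_mono) auto
    finally show ?case by (simp add: algebra_simps)
  qed
  have "q ^ n \<le> exp (h * M * \<beta>) ^ n"
    unfolding q_def using pos M by (intro power_mono exp_ge_add_one_self) auto
  also have "\<dots> = exp (real n * h * M * \<beta>)" by (simp add: exp_of_nat_mult mult.assoc)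
  finally have "a * q ^ n \<le> a * exp (real n * h * M * \<beta>)" using a by (rule mult_left_mono)
  then show ?thesis using main[of n] by (simp add: a_def)
qed

context hille_yosida_cone
begin

text \<open>One step of the implicit Euler scheme for \<open>A - k\<close> with step size \<open>h\<close>.\<close>

definition euler where "euler k h x = (1 / h) *\<^sub>R res (k + 1 / h) x"

lemma add_inverse_gt: "x \<le> k \<Longrightarrow> h > 0 \<Longrightarrow> x < k + 1 / (h::real)"
  using divide_pos_pos[of 1 h] by linarith

lemma euler_linear: "k \<ge> w \<Longrightarrow> h > 0 \<Longrightarrow> linear (euler k h)"
  unfolding euler_def
  by (intro bounded_linear.linear bounded_linear_const_scaleR bounded_linear_res) (rule add_inverse_gt)

text \<open>The bounds on all powers of the resolvent become stability of the scheme: for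
  \<open>k \<ge> w\<close> the quotient of \<open>1 / h\<close> and \<open>k + 1 / h - w\<close> is
  at most one, so the constant \<open>M\<close> depends neither on \<open>n\<close> nor on
  \<open>h\<close>.\<close>

lemma euler_pow:
  assumes "k \<ge> w" "h > 0" shows "norm ((euler k h ^^ n) x) \<le> M * norm x"
proof -
  have kw: "k + 1 / h > w" using assms by (rule add_inverse_gt)
  interpret r: bounded_linear "res (k + 1 / h)" using kw by (rule bounded_linear_res)
  have "(euler k h ^^ n) x = (1 / h) ^ n *\<^sub>R (res (k + 1 / h) ^^ n) x"
    by (induction n) (auto simp: euler_def r.scaleR)
  then have "norm ((euler k h ^^ n) x) = (1 / h) ^ n * norm ((res (k + 1 / h) ^^ n) x)"
    using assms by simp
  also have "\<dots> \<le> (1 / h) ^ n * (M / (k + 1 / h - w) ^ n * norm x)"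
    using assms by (intro mult_left_mono res_pow kw) auto
  also have "\<dots> = ((1 / h) / (k + 1 / h - w)) ^ n * (M * norm x)"
    by (simp add: power_divide power_mult_distrib)
  also have "\<dots> \<le> 1 * (M * norm x)"
  proof (intro mult_right_mono power_le_one)
    have kp: "k + 1 / h - w > 0" using kw by simp
    show "1 / h / (k + 1 / h - w) \<le> 1" unfolding divide_le_eq_1_pos[OF kp] using assms by simp
    show "0 \<le> 1 / h / (k + 1 / h - w)" using kp assms by simp
  qed (use M1 in simp)
  finally show ?thesis by simp
qed

lemma euler_in: "k \<ge> w \<Longrightarrow> h > 0 \<Longrightarrow> euler k h x \<in> X0"
  unfolding euler_def by (intro D_X0 subspace_scale[OF subD] res_in) (rule add_inverse_gt)

lemma euler_pos: "k \<ge> w' \<Longrightarrow> h > 0 \<Longrightarrow> x \<in> P \<Longrightarrow> euler k h x \<in> P"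
  unfolding euler_def by (intro P_scale res_pos) (auto intro: add_inverse_gt)

text \<open>The generator is treated implicitly, which gives stability and positivity. The shift
  \<open>k\<close> and the term \<open>H\<close> are treated explicitly, so that they may later
  depend on the solution.\<close>

lemma euler_scheme:
  assumes st: "s < t" and k: "k \<ge> w"
    and yD: "\<And>r. r \<in> {s..t} \<Longrightarrow> y r \<in> D"
    and y: "\<And>r. r \<in> {s..t} \<Longrightarrow> (y has_vector_derivative (A (y r) + H r)) (at r within {s..t})"
    and c: "continuous_on {s..t} (\<lambda>r. A (y r) + H r)" "continuous_on {s..t} H" and e: "\<eta> > 0"
  shows "\<exists>N>0. \<forall>n\<ge>N. \<forall>j<n. \<exists>e. norm e \<le> \<eta> \<and>
    y (s + real (Suc j) * ((t - s) / real n)) = euler k ((t - s) / real n) (y (s + real j * ((t - s) / real n)) +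
      ((t - s) / real n) *\<^sub>R (H (s + real j * ((t - s) / real n)) + k *\<^sub>R y (s + real j * ((t - s) / real n)) + e))"
proof -
  have cy: "continuous_on {s..t} y"
    using y by (meson continuous_on_eq_continuous_within has_vector_derivative_continuous)
  obtain N where N: "N > 0" and *: "\<forall>n\<ge>N. \<forall>j<n. let h = (t - s) / real n; a = s + real j * h; b = s + real (Suc j) * h in
    norm ((1 / h) *\<^sub>R (y b - y a) - (A (y b) + H b)) \<le> \<eta> / 2 \<and> norm ((H b + k *\<^sub>R y b) - (H a + k *\<^sub>R y a)) \<le> \<eta> / 2"
  proof -
    have cQ: "continuous_on {s..t} (\<lambda>r. H r + k *\<^sub>R y r)" by (intro continuous_intros c(2) cy)
    have "\<eta> / 2 > 0" using e by simp
    from grid_errors[OF st y c(1) cQ this] show ?thesis using that by blast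
  qed
  show ?thesis
  proof (intro exI[of _ N] conjI allI impI N)
    fix n j assume n: "N \<le> n" "j < n"
    define h where "h = (t - s) / real n"
    define a where "a = s + real j * h"
    define b where "b = s + real (Suc j) * h"
    \<comment> \<open>The first bracket is the consistency error of the difference quotient; the
      second comes from evaluating \<open>H + k y\<close> at the left instead of the right end
      point.\<close>
    define e where "e = ((1 / h) *\<^sub>R (y b - y a) - (A (y b) + H b)) + ((H b + k *\<^sub>R y b) - (H a + k *\<^sub>R y a))"
    have "n > 0" using n by auto
    then have h: "h > 0" using st by (simp add: h_def)
    have "real (Suc j) * h \<le> real n * h" using n h by (intro mult_right_mono) auto
    also have "\<dots> = t - s" using \<open>n > 0\<close> by (simp add: h_def)
    finally have b: "b \<in> {s..t}" using h by (simp add: b_def)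
    have "norm e \<le> \<eta> / 2 + \<eta> / 2"
      unfolding e_def using *[rule_format, OF n] unfolding Let_def h_def a_def b_def
      by (intro order_trans[OF norm_triangle_ineq] add_mono) auto
    then have ee: "norm e \<le> \<eta>" by simp
    have "(k + 1 / h) *\<^sub>R y b - A (y b) = (1 / h) *\<^sub>R (y a + h *\<^sub>R (H a + k *\<^sub>R y a + e))"
      using h unfolding e_def by (simp add: algebra_simps)
    moreover have "k + 1 / h > w" using k h by (rule add_inverse_gt)
    ultimately have "y b = res (k + 1 / h) ((1 / h) *\<^sub>R (y a + h *\<^sub>R (H a + k *\<^sub>R y a + e)))"
      using res_inv[OF _ yD[OF b], of "k + 1 / h"] by simp
    also have "\<dots> = euler k h (y a + h *\<^sub>R (H a + k *\<^sub>R y a + e))"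
      using linear_scale[OF bounded_linear.linear[OF bounded_linear_res[OF \<open>k + 1 / h > w\<close>]]]
      by (simp add: euler_def)
    finally show "\<exists>e. norm e \<le> \<eta> \<and>
      y (s + real (Suc j) * ((t - s) / real n)) = euler k ((t - s) / real n) (y (s + real j * ((t - s) / real n)) +
        ((t - s) / real n) *\<^sub>R (H (s + real j * ((t - s) / real n)) + k *\<^sub>R y (s + real j * ((t - s) / real n)) + e))"
      using ee unfolding h_def a_def b_def by blast
  qed
qed

end

section \<open>Perturbed equations\<close>

text \<open>\<open>C\<close> is positive only after a multiple \<open>k\<close> of the identity is
  added; this is what the lower bound on \<open>- V\<close> provides.\<close>

locale perturbed = hille_yosida_cone D A P w M w'
  for D :: "'a::banach set" and A :: "'a \<Rightarrow> 'a" and P :: "'a set" and w M w' :: real +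
  fixes C :: "real \<Rightarrow> 'a \<Rightarrow> 'a" and c k :: real
  assumes C_lin: "\<And>t. linear_op_on X0 (C t)"
    and C_bound: "\<And>t x. x \<in> X0 \<Longrightarrow> norm (C t x) \<le> c * norm x"
    and C_cont: "\<And>\<epsilon>. \<epsilon> > 0 \<Longrightarrow> \<exists>d>0. \<forall>s t. \<bar>s - t\<bar> < d \<longrightarrow> (\<forall>x\<in>X0. norm (C s x - C t x) \<le> \<epsilon> * norm x)"
    and C_pos: "\<And>t x. x \<in> X0 \<Longrightarrow> x \<in> P \<Longrightarrow> C t x + k *\<^sub>R x \<in> P"
    and c0: "c \<ge> 0"
begin

lemma C_add: "x \<in> X0 \<Longrightarrow> y \<in> X0 \<Longrightarrow> C t (x + y) = C t x + C t y"
  and C_scale: "x \<in> X0 \<Longrightarrow> C t (a *\<^sub>R x) = a *\<^sub>R C t x"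
  using C_lin[of t] by (auto simp: linear_op_on_def)

lemma C_diff: "x \<in> X0 \<Longrightarrow> y \<in> X0 \<Longrightarrow> C t (x - y) = C t x - C t y"
  using C_add[of x "-y" t] C_scale[of y t "-1"] subspace_neg[OF subX0, of y] by simp

lemma C_continuous_on2:
  fixes u :: "'b::metric_space \<Rightarrow> 'a"
  assumes "continuous_on S u" "continuous_on S \<tau>" "u ` S \<subseteq> X0"
  shows "continuous_on S (\<lambda>r. C (\<tau> r) (u r))"
  unfolding continuous_on_iff
proof (intro ballI allI impI)
  fix r \<epsilon> assume r: "r \<in> S" and e: "(\<epsilon>::real) > 0"
  define e1 where "e1 = \<epsilon> / 2 / (norm (u r) + 1)"
  define e2 where "e2 = \<epsilon> / 2 / (c + 1)"
  have p: "norm (u r) + 1 > 0" "c + 1 > 0" using c0 by (auto simp: add_nonneg_pos)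
  then have e12: "e1 > 0" "e2 > 0" using e by (auto simp: e1_def e2_def)
  have half: "x * (\<epsilon> / 2 / x) = \<epsilon> / 2" "\<epsilon> / 2 / x * x = \<epsilon> / 2" if "x > 0" for x :: real
    using that by auto
  obtain d1 where d1: "d1 > 0" "\<And>s t x. \<bar>s - t\<bar> < d1 \<Longrightarrow> x \<in> X0 \<Longrightarrow> norm (C s x - C t x) \<le> e1 * norm x"
    using C_cont[OF e12(1)] by blast
  obtain d2 where d2: "d2 > 0" "\<And>q. q \<in> S \<Longrightarrow> dist q r < d2 \<Longrightarrow> dist (u q) (u r) < e2"
    using assms(1) r e12(2) unfolding continuous_on_iff by blast
  obtain d3 where d3: "d3 > 0" "\<And>q. q \<in> S \<Longrightarrow> dist q r < d3 \<Longrightarrow> dist (\<tau> q) (\<tau> r) < d1"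
    using assms(2) r d1(1) unfolding continuous_on_iff by blast
  have "dist (C (\<tau> q) (u q)) (C (\<tau> r) (u r)) < \<epsilon>" if q: "q \<in> S" "dist q r < min d3 d2" for q
  proof -
    have X: "u q \<in> X0" "u r \<in> X0" using assms(3) q r by auto
    have "norm (C (\<tau> q) (u q) - C (\<tau> q) (u r)) \<le> c * norm (u q - u r)"
      using C_bound[of "u q - u r" "\<tau> q"] C_diff[OF X, of "\<tau> q"] subspace_diff[OF subX0 X] by simp
    also have "\<dots> \<le> c * e2" using d2(2)[OF q(1)] q(2) c0 by (intro mult_left_mono) (auto simp: dist_norm)
    also have "\<dots> < (c + 1) * e2" using e12 by simp
    also have "\<dots> = \<epsilon> / 2" unfolding e2_def by (rule half(1)[OF p(2)])
    finally have 1: "norm (C (\<tau> q) (u q) - C (\<tau> q) (u r)) < \<epsilon> / 2" .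
    have "norm (C (\<tau> q) (u r) - C (\<tau> r) (u r)) \<le> e1 * norm (u r)" using d3(2)[OF q(1)] q(2) by (intro d1 X) (auto simp: dist_real_def)
    also have "\<dots> \<le> e1 * (norm (u r) + 1)" using e12 by simp
    also have "\<dots> = \<epsilon> / 2" unfolding e1_def by (rule half(2)[OF p(1)])
    finally have 2: "norm (C (\<tau> q) (u r) - C (\<tau> r) (u r)) \<le> \<epsilon> / 2" .
    show ?thesis using 1 2 norm_triangle_ineq[of "C (\<tau> q) (u q) - C (\<tau> q) (u r)" "C (\<tau> q) (u r) - C (\<tau> r) (u r)"]
      by (simp add: dist_norm)
  qed
  then show "\<exists>d>0. \<forall>q\<in>S. dist q r < d \<longrightarrow> dist (C (\<tau> q) (u q)) (C (\<tau> r) (u r)) < \<epsilon>"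
    using d3(1) d2(1) by (intro exI[of _ "min d3 d2"]) auto
qed

lemma C_continuous_on:
  fixes u :: "real \<Rightarrow> 'a"
  shows "continuous_on S u \<Longrightarrow> u ` S \<subseteq> X0 \<Longrightarrow> continuous_on S (\<lambda>r. C r (u r))"
  by (rule C_continuous_on2[OF _ continuous_on_id])

text \<open>The order of the choices matters: \<open>\<mu>\<close> is fixed first, close to the
  limit because \<open>u\<close> has compact range in \<open>X0\<close>, and the grid is then
  refined for the classical solution \<open>J \<mu> u\<close>.\<close>

lemma mild_J_setup:
  assumes u: "mild u (\<lambda>r. C r (u r) + g r) s t" and st: "s < t" and e: "\<epsilon> > 0" and kk: "kk \<ge> w"
  obtains \<mu> N where "\<mu> \<ge> \<mu>0" "\<mu> \<ge> w'+1" "\<And>r. r \<in> {s..t} \<Longrightarrow> norm (J \<mu> (u r) - u r) \<le> \<epsilon>" "N > 0"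
    "\<And>n. n \<ge> N \<Longrightarrow> \<exists>e. \<forall>j<n. norm (e j) \<le> \<epsilon> \<and>
      J \<mu> (u (s + real (Suc j) * ((t - s) / real n))) = euler kk ((t - s) / real n)
       (J \<mu> (u (s + real j * ((t - s) / real n))) +
      ((t - s) / real n) *\<^sub>R (J \<mu> (C (s + real j * ((t - s) / real n)) (u (s + real j * ((t - s) / real n)))
          + g (s + real j * ((t - s) / real n))) + kk *\<^sub>R J \<mu> (u (s + real j * ((t - s) / real n))) + e j))"
proof -
  have K: "compact (u ` {s..t})" "u ` {s..t} \<subseteq> X0"
    using mildD(1,3)[OF u] by (auto intro: compact_continuous_image)
  obtain \<mu>1 where \<mu>1: "\<mu>1 \<ge> \<mu>0" "\<And>\<mu> x. \<mu> \<ge> \<mu>1 \<Longrightarrow> x \<in> u ` {s..t} \<Longrightarrow> norm (J \<mu> x - x) \<le> \<epsilon>"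
    using J_uniform_compact[OF K e] by blast
  define \<mu> where "\<mu> = max \<mu>1 (w' + 1)"
  have \<mu>: "\<mu> \<ge> \<mu>0" "\<mu> \<ge> w' + 1" "\<mu> \<ge> \<mu>1" using \<mu>1 by (auto simp: \<mu>_def)
  have \<mu>w: "\<mu> > w" using \<mu>0(1) \<mu>(1) by blast
  interpret J: bounded_linear "J \<mu>" using \<mu>w by (rule bounded_linear_J)
  have cJu: "continuous_on {s..t} (\<lambda>r. J \<mu> (u r))" by (intro J.continuous_on mildD[OF u])
  have cJ: "continuous_on {s..t} (\<lambda>r. J \<mu> (C r (u r) + g r))" by (intro J.continuous_on mildD(2)[OF u])
  have "A (J \<mu> (u r)) = \<mu> *\<^sub>R (J \<mu> (u r) - u r)" for r
    unfolding J_def using A_scale[OF res_in[OF \<mu>w]] A_res[OF \<mu>w] by simp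
  then have cA: "continuous_on {s..t} (\<lambda>r. A (J \<mu> (u r)) + J \<mu> (C r (u r) + g r))"
    using cJu cJ mildD(1)[OF u] by (auto intro!: continuous_intros)
  define stp where "stp n j e \<longleftrightarrow> norm e \<le> \<epsilon> \<and>
      J \<mu> (u (s + real (Suc j) * ((t - s) / real n))) = euler kk ((t - s) / real n)
       (J \<mu> (u (s + real j * ((t - s) / real n))) +
      ((t - s) / real n) *\<^sub>R (J \<mu> (C (s + real j * ((t - s) / real n)) (u (s + real j * ((t - s) / real n)))
          + g (s + real j * ((t - s) / real n))) + kk *\<^sub>R J \<mu> (u (s + real j * ((t - s) / real n))) + e))" for n j e
  have "\<exists>N>0. \<forall>n\<ge>N. \<forall>j<n. \<exists>e. stp n j e"
    unfolding stp_def
    by (rule euler_scheme[OF st kk _ _ cA cJ e]) (auto intro: J_in[OF \<mu>w] mild_J[OF u \<mu>w])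
  then obtain N where N: "N > 0" "\<And>n. n \<ge> N \<Longrightarrow> \<forall>j<n. \<exists>e. stp n j e" by blast
  have "\<exists>e. \<forall>j<n. stp n j (e j)" if "n \<ge> N" for n
    using bchoice[of "{..<n}" "stp n"] N(2)[OF that] by (simp add: Ball_def)
  then show ?thesis
    using that[OF \<mu>(1,2) _ N(1)] \<mu>1(2)[OF \<mu>(3)] unfolding stp_def by simp
qed

text \<open>The constant of the discrete Gronwall estimate: \<open>2 * M\<close> bounds
  \<open>J \<mu>\<close>, \<open>c\<close> bounds the perturbation, and \<open>\<bar>w\<bar>\<close>
  is the shift that makes the Euler steps power bounded by \<open>M\<close>.\<close>

definition growth where "growth T = M * exp (T * M * (2 * M * c + \<bar>w\<bar>))"

text \<open>\<open>g\<close> may take values outside \<open>X0\<close>, where no evolution family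
  acts. The bound is proved for the scheme, and the error \<open>\<epsilon>\<close> tends to zero
  while the constants depend only on the length of the interval.\<close>

theorem mild_bound:
  assumes u: "mild u (\<lambda>r. C r (u r) + g r) s t" and st: "s \<le> t" and b: "\<And>r. r \<in> {s..t} \<Longrightarrow> norm (g r) \<le> b"
  shows "norm (u t) \<le> growth (t - s) * (norm (u s) + (t - s) * (2 * M * b))"
proof (cases "s = t")
  case True
  have "1 \<le> growth 0" using M1 by (simp add: growth_def)
  then show ?thesis using True mult_right_mono[of 1 "growth 0" "norm (u s)"] by simp
next
  case False
  then have st: "s < t" using st by simp
  define G where "G = growth (t - s)"
  have G: "G \<ge> 0" using M1 by (simp add: G_def growth_def)
  have b0: "b \<ge> 0" using order_trans[OF norm_ge_zero b[of s]] st by simp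
  have "norm (u t) \<le> G * (norm (u s) + (t - s) * (2 * M * b)) + \<epsilon> * (1 + G * (1 + (t - s) * (2 * M * c + 1)))"
    if e: "\<epsilon> > 0" for \<epsilon>
  proof -
    obtain \<mu> N where \<mu>: "\<mu> \<ge> \<mu>0" and close: "\<And>r. r \<in> {s..t} \<Longrightarrow> norm (J \<mu> (u r) - u r) \<le> \<epsilon>" and N: "N > 0"
    and scheme: "\<And>n. n \<ge> N \<Longrightarrow> \<exists>e. \<forall>j<n. norm (e j) \<le> \<epsilon> \<and>
      J \<mu> (u (s + real (Suc j) * ((t - s) / real n))) = euler \<bar>w\<bar> ((t - s) / real n)
       (J \<mu> (u (s + real j * ((t - s) / real n))) +
      ((t - s) / real n) *\<^sub>R (J \<mu> (C (s + real j * ((t - s) / real n)) (u (s + real j * ((t - s) / real n)))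
          + g (s + real j * ((t - s) / real n))) + \<bar>w\<bar> *\<^sub>R J \<mu> (u (s + real j * ((t - s) / real n))) + e j))"
      using mild_J_setup[OF u st e, of "\<bar>w\<bar>"] by (metis abs_ge_self)
    define h where "h = (t - s) / real N"
    have h: "h > 0" "real N * h = t - s" using N st by (auto simp: h_def)
    obtain e where ee: "\<And>j. j < N \<Longrightarrow> norm (e j) \<le> \<epsilon>" and step: "\<And>j. j < N \<Longrightarrow>
      J \<mu> (u (s + real (Suc j) * h)) = euler \<bar>w\<bar> h (J \<mu> (u (s + real j * h)) +
        h *\<^sub>R (J \<mu> (C (s + real j * h) (u (s + real j * h)) + g (s + real j * h))
          + \<bar>w\<bar> *\<^sub>R J \<mu> (u (s + real j * h)) + e j))"
      using scheme[of N] unfolding h_def[symmetric] by auto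
    define y where "y j = J \<mu> (u (s + real j * h))" for j
    define cc where "cc j = J \<mu> (C (s + real j * h) (u (s + real j * h)) + g (s + real j * h))
          + \<bar>w\<bar> *\<^sub>R y j + e j" for j
    have "norm (y N) \<le> M * (norm (y 0) + real N * h * (2 * M * c * \<epsilon> + 2 * M * b + \<epsilon>)) *
      exp (real N * h * M * (2 * M * c + \<bar>w\<bar>))"
    proof (rule discrete_gronwall[of "euler \<bar>w\<bar> h" M N y h cc])
      show "linear (euler \<bar>w\<bar> h)" using h by (intro euler_linear) auto
      show "norm ((euler \<bar>w\<bar> h ^^ n) x) \<le> M * norm x" for n x using h by (intro euler_pow) auto
      show "y (Suc j) = euler \<bar>w\<bar> h (y j + h *\<^sub>R cc j)" if "j < N" for j
        using step[OF that] by (simp add: y_def cc_def)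
      fix j assume j: "j < N"
      define r where "r = s + real j * h"
      have "real j * h \<le> real N * h" using j h by (intro mult_right_mono) auto
      then have r: "r \<in> {s..t}" using h by (simp add: r_def)
      have "norm (u r) \<le> norm (y j) + \<epsilon>"
        using close[OF r] norm_triangle_sub[of "u r" "y j"] by (simp add: y_def r_def norm_minus_commute)
      then have "c * norm (u r) \<le> c * (norm (y j) + \<epsilon>)" using c0 by (rule mult_left_mono)
      then have "norm (C r (u r) + g r) \<le> c * (norm (y j) + \<epsilon>) + b"
        using C_bound[OF mildD(3)[OF u r], of r] b[OF r] norm_triangle_ineq[of "C r (u r)" "g r"] by linarith
      then have "2 * M * norm (C r (u r) + g r) \<le> 2 * M * (c * (norm (y j) + \<epsilon>) + b)"
        using M1 by (intro mult_left_mono) auto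
      then have 1: "norm (J \<mu> (C r (u r) + g r)) \<le> 2 * M * (c * (norm (y j) + \<epsilon>) + b)"
        using J_bound[OF \<mu>, of "C r (u r) + g r"] by linarith
      have "norm (cc j) \<le> norm (J \<mu> (C r (u r) + g r)) + norm (\<bar>w\<bar> *\<^sub>R y j) + norm (e j)"
        unfolding cc_def r_def[symmetric]
        by (intro order_trans[OF norm_triangle_ineq] add_mono norm_triangle_ineq order_refl)
      also have "\<dots> \<le> 2 * M * (c * (norm (y j) + \<epsilon>) + b) + \<bar>w\<bar> * norm (y j) + \<epsilon>"
        using 1 ee[OF j] by simp
      finally show "norm (cc j) \<le> (2 * M * c + \<bar>w\<bar>) * norm (y j) + (2 * M * c * \<epsilon> + 2 * M * b + \<epsilon>)"
        by (simp add: algebra_simps)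
    qed (use M1 h c0 e b0 in auto)
    also have "\<dots> = G * (norm (y 0) + (t - s) * (2 * M * c * \<epsilon> + 2 * M * b + \<epsilon>))"
      by (simp add: h(2) G_def growth_def)
    also have "\<dots> \<le> G * ((norm (u s) + \<epsilon>) + (t - s) * (2 * M * c * \<epsilon> + 2 * M * b + \<epsilon>))"
      using close[of s] st norm_triangle_sub[of "y 0" "u s"] G
      by (intro mult_left_mono add_mono order_refl) (auto simp: y_def)
    finally have "norm (y N) \<le> \<dots>" .
    moreover have "norm (u t) \<le> norm (y N) + \<epsilon>"
      using close[of t] st norm_triangle_sub[of "u t" "y N"] by (simp add: y_def h(2) norm_minus_commute)
    ultimately show ?thesis by (simp add: algebra_simps)
  qed
  then show ?thesis unfolding G_def by (rule le_all_eps)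
qed

text \<open>A scheme without error terms, started at the positive vector
  \<open>J \<mu> (u s)\<close>, stays in the cone step by step. It ends within a multiple of
  \<open>\<epsilon>\<close> of \<open>u t\<close>, and the cone is closed.\<close>

theorem mild_pos:
  assumes u: "mild u (\<lambda>r. C r (u r) + g r) s t" and st: "s \<le> t"
    and us: "u s \<in> P" and g: "\<And>r. r \<in> {s..t} \<Longrightarrow> g r \<in> P"
  shows "u t \<in> P"
proof (cases "s = t")
  case True then show ?thesis using us by simp
next
  case False
  then have st: "s < t" using st by simp
  \<comment> \<open>Large enough for three purposes: stability of the Euler steps
    (\<open>w\<close>), their positivity (\<open>w'\<close>), and positivity of
    \<open>C + kk\<close> (\<open>k\<close>).\<close>
  define kk where "kk = \<bar>k\<bar> + \<bar>w\<bar> + \<bar>w'\<bar>"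
  have kk: "kk \<ge> w" "kk \<ge> w'" "kk \<ge> k" "kk \<ge> 0" by (auto simp: kk_def)
  define \<beta> where "\<beta> = 2 * M * (c + kk)"
  \<comment> \<open>Collects the factors of \<open>\<epsilon>\<close> in the final comparison; the
    leading \<open>1\<close> stands for the replacement of \<open>u t\<close> by
    \<open>J \<mu> (u t)\<close>.\<close>
  define L where "L = 1 + M * ((t - s) * (2 * M * (c + kk) + 1)) * exp ((t - s) * M * \<beta>)"
  have \<beta>: "\<beta> \<ge> 0" using M1 c0 kk by (simp add: \<beta>_def)
  have L: "L > 0" unfolding L_def using M1 st c0 kk
    by (intro add_pos_nonneg mult_nonneg_nonneg) auto
  have "\<exists>v\<in>P. dist v (u t) \<le> \<epsilon> * L" if e: "\<epsilon> > 0" for \<epsilon>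
  proof -
    obtain \<mu> N where \<mu>: "\<mu> \<ge> \<mu>0" "\<mu> \<ge> w' + 1" and close: "\<And>r. r \<in> {s..t} \<Longrightarrow> norm (J \<mu> (u r) - u r) \<le> \<epsilon>" and N: "N > 0"
    and scheme: "\<And>n. n \<ge> N \<Longrightarrow> \<exists>e. \<forall>j<n. norm (e j) \<le> \<epsilon> \<and>
      J \<mu> (u (s + real (Suc j) * ((t - s) / real n))) = euler kk ((t - s) / real n)
       (J \<mu> (u (s + real j * ((t - s) / real n))) +
      ((t - s) / real n) *\<^sub>R (J \<mu> (C (s + real j * ((t - s) / real n)) (u (s + real j * ((t - s) / real n)))
          + g (s + real j * ((t - s) / real n))) + kk *\<^sub>R J \<mu> (u (s + real j * ((t - s) / real n))) + e j))"
      using mild_J_setup[OF u st e kk(1)] by metis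
    have \<mu>w: "\<mu> > w" using \<mu>0(1) \<mu>(1) by blast
    interpret J: bounded_linear "J \<mu>" using \<mu>w by (rule bounded_linear_J)
    have J_pos: "J \<mu> x \<in> P" if "x \<in> P" for x
      unfolding J_def using that \<mu> \<mu>0(2)[OF \<mu>(1)] by (intro P_scale res_pos) auto
    define h where "h = (t - s) / real N"
    have h: "h > 0" "real N * h = t - s" using N st by (auto simp: h_def)
    obtain e where ee: "\<And>j. j < N \<Longrightarrow> norm (e j) \<le> \<epsilon>" and step: "\<And>j. j < N \<Longrightarrow>
      J \<mu> (u (s + real (Suc j) * h)) = euler kk h (J \<mu> (u (s + real j * h)) +
        h *\<^sub>R (J \<mu> (C (s + real j * h) (u (s + real j * h)) + g (s + real j * h))
          + kk *\<^sub>R J \<mu> (u (s + real j * h)) + e j))"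
      using scheme[of N] unfolding h_def[symmetric] by auto
    define B where "B r x = C r x + kk *\<^sub>R x" for r x
    have B_pos: "B r x \<in> P" if "x \<in> X0" "x \<in> P" for r x
    proof -
      have "C r x + k *\<^sub>R x + (kk - k) *\<^sub>R x \<in> P"
        using that kk by (intro P_add C_pos P_scale) auto
      then show ?thesis by (simp add: B_def algebra_simps)
    qed
    have B_diff: "B r (x - y) = B r x - B r y" if "x \<in> X0" "y \<in> X0" for r x y
      using that by (simp add: B_def C_diff algebra_simps)
    have B_bound: "norm (B r x) \<le> (c + kk) * norm x" if "x \<in> X0" for r x
      using C_bound[OF that, of r] norm_triangle_ineq[of "C r x" "kk *\<^sub>R x"] kk
      by (simp add: B_def algebra_simps)
    \<comment> \<open>The same recursion as for \<open>J \<mu> u\<close>, but fed with its own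
      values and without errors. Each right-hand side is a positive operator applied to positive
      data.\<close>
    define v where "v = rec_nat (J \<mu> (u s)) (\<lambda>j x. euler kk h (x + h *\<^sub>R J \<mu> (B (s + real j * h) x + g (s + real j * h))))"
    have v0: "v 0 = J \<mu> (u s)" and vS: "\<And>j. v (Suc j) = euler kk h (v j + h *\<^sub>R J \<mu> (B (s + real j * h) (v j) + g (s + real j * h)))"
      by (auto simp: v_def)
    have r: "s + real j * h \<in> {s..t}" if "j \<le> N" for j
    proof -
      have "real j * h \<le> real N * h" using that h by (intro mult_right_mono) auto
      then show ?thesis using h by simp
    qed
    have vP: "v j \<in> P \<and> v j \<in> X0" if "j \<le> N" for j
      using that
    proof (induction j)
      case 0 then show ?case using us J_pos J_in[OF \<mu>w] D_X0 by (simp add: v0)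
    next
      case (Suc j)
      then show ?case unfolding vS using h kk r[of j] g
        by (intro conjI euler_pos euler_in P_add P_scale J_pos B_pos) auto
    qed
    define d where "d j = J \<mu> (u (s + real j * h)) - v j" for j
    define cc where "cc j = J \<mu> (B (s + real j * h) (u (s + real j * h) - v j)) + e j" for j
    have "norm (d N) \<le> M * (norm (d 0) + real N * h * (\<beta> * \<epsilon> + \<epsilon>)) * exp (real N * h * M * \<beta>)"
    proof (rule discrete_gronwall[of "euler kk h" M N d h cc])
      show lin: "linear (euler kk h)" using h kk by (intro euler_linear) auto
      show "norm ((euler kk h ^^ n) x) \<le> M * norm x" for n x using h kk by (intro euler_pow) auto
      fix j assume j: "j < N"
      define q where "q = s + real j * h"
      have X: "u q \<in> X0" "v j \<in> X0" using mildD(3)[OF u r[of j]] vP[of j] j by (auto simp: q_def)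
      have "d (Suc j) = euler kk h (J \<mu> (u q) + h *\<^sub>R (J \<mu> (C q (u q) + g q) + kk *\<^sub>R J \<mu> (u q) + e j)
         - (v j + h *\<^sub>R J \<mu> (B q (v j) + g q)))"
        unfolding d_def vS step[OF j] q_def linear_diff[OF lin] ..
      also have "J \<mu> (u q) + h *\<^sub>R (J \<mu> (C q (u q) + g q) + kk *\<^sub>R J \<mu> (u q) + e j)
         - (v j + h *\<^sub>R J \<mu> (B q (v j) + g q)) = d j + h *\<^sub>R cc j"
        unfolding d_def cc_def q_def[symmetric] B_diff[OF X] by (simp add: B_def J.add J.diff J.scaleR algebra_simps)
      finally show "d (Suc j) = euler kk h (d j + h *\<^sub>R cc j)" .
      have "norm (u q - v j) \<le> norm (d j) + \<epsilon>"
        using close[OF r[of j]] j norm_triangle_ineq[of "u q - J \<mu> (u q)" "d j"]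
        by (simp add: d_def q_def norm_minus_commute)
      then have 1: "2 * M * ((c + kk) * norm (u q - v j)) \<le> 2 * M * ((c + kk) * (norm (d j) + \<epsilon>))"
        using M1 c0 kk by (intro mult_left_mono) auto
      have "2 * M * norm (B q (u q - v j)) \<le> 2 * M * ((c + kk) * norm (u q - v j))"
        using M1 by (intro mult_left_mono B_bound subspace_diff[OF subX0] X) auto
      then have "norm (J \<mu> (B q (u q - v j))) \<le> 2 * M * ((c + kk) * (norm (d j) + \<epsilon>))"
        using 1 J_bound[OF \<mu>(1), of "B q (u q - v j)"] by linarith
      then show "norm (cc j) \<le> \<beta> * norm (d j) + (\<beta> * \<epsilon> + \<epsilon>)"
        unfolding cc_def q_def[symmetric] using ee[OF j] norm_triangle_ineq[of "J \<mu> (B q (u q - v j))" "e j"]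
        by (simp add: \<beta>_def algebra_simps)
    qed (use M1 h \<beta> e in auto)
    then have "norm (J \<mu> (u t) - v N) \<le> M * ((t - s) * (\<beta> * \<epsilon> + \<epsilon>)) * exp ((t - s) * M * \<beta>)"
      using h(2) by (simp add: d_def v0)
    also have "\<dots> = \<epsilon> * (L - 1)" by (simp add: L_def \<beta>_def algebra_simps)
    finally have "norm (v N - u t) \<le> \<epsilon> * L"
      using close[of t] st norm_triangle_ineq[of "v N - J \<mu> (u t)" "J \<mu> (u t) - u t"]
      by (simp add: norm_minus_commute algebra_simps)
    then show ?thesis using vP[of N] by (auto simp: dist_norm)
  qed
  then have "\<exists>v\<in>P. dist v (u t) < \<epsilon>" if "\<epsilon> > 0" for \<epsilon>
  proof -
    have "\<epsilon> / (2 * L) > 0" using that L by simp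
    from \<open>\<And>\<epsilon>. \<epsilon> > 0 \<Longrightarrow> \<exists>v\<in>P. dist v (u t) \<le> \<epsilon> * L\<close>[OF this]
    obtain v where v: "v \<in> P" "dist v (u t) \<le> \<epsilon> / (2 * L) * L" by blast
    have "\<epsilon> / (2 * L) * L < \<epsilon>" using that L by simp
    then show ?thesis using v by (intro bexI[of _ v]) auto
  qed
  then have "u t \<in> closure P" by (simp add: closure_approachable)
  then show ?thesis using P_closed by (simp add: closure_closed)
qed

end

section \<open>Integrals of vector-valued functions\<close>

text \<open>The Riemann sums of fine tagged divisions lie in the subspace, and the subspace is
  closed.\<close>

lemma integral_in_closed_subspace:
  fixes f :: "real \<Rightarrow> 'a::banach"
  assumes S: "subspace S" "closed S" and f: "continuous_on {a..b} f" "f ` {a..b} \<subseteq> S"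
  shows "integral {a..b} f \<in> S"
proof -
  have i: "(f has_integral integral {a..b} f) (cbox a b)"
    using integrable_continuous_real[OF f(1)] by (simp add: integrable_integral)
  have "\<exists>y\<in>S. dist y (integral {a..b} f) < e" if "e > 0" for e
  proof -
    from i[unfolded has_integral, rule_format, OF that]
    obtain \<gamma> where \<gamma>: "gauge \<gamma>" "\<forall>\<D>. \<D> tagged_division_of (cbox a b) \<and> \<gamma> fine \<D> \<longrightarrow>
        norm ((\<Sum>(x, k)\<in>\<D>. measure lborel k *\<^sub>R f x) - integral {a..b} f) < e"
      by (elim exE conjE)
    obtain p where p: "p tagged_division_of (cbox a b)" "\<gamma> fine p" by (rule fine_division_exists[OF \<gamma>(1)])
    have "(\<Sum>(x, k)\<in>p. measure lborel k *\<^sub>R f x) \<in> S"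
    proof (rule subspace_sum[OF S(1)])
      fix xk assume xk: "xk \<in> p"
      obtain x k where [simp]: "xk = (x, k)" by (cases xk)
      have "x \<in> cbox a b" using tag_in_interval[OF p(1)] xk by auto
      then have "f x \<in> S" using f(2) by auto
      then show "(case xk of (x, k) \<Rightarrow> measure lborel k *\<^sub>R f x) \<in> S" using subspace_scale[OF S(1), of "f x"] by simp
    qed
    then show ?thesis using \<gamma>(2) p by (auto simp: dist_norm)
  qed
  then have "integral {a..b} f \<in> closure S" by (simp add: closure_approachable)
  then show ?thesis using S(2) by (simp add: closure_closed)
qed

text \<open>\<open>T\<close> is linear and bounded on \<open>S\<close> only, so the rule for bounded
  linear maps on a whole type does not apply. Instead \<open>T\<close> of the primitive is
  differentiated and the fundamental theorem is used.\<close>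

lemma integral_linear_op_on:
  fixes f :: "real \<Rightarrow> 'a::banach" and T :: "'a \<Rightarrow> 'b::banach"
  assumes T: "linear_op_on S T" "\<And>x. x \<in> S \<Longrightarrow> norm (T x) \<le> K * norm x" and S: "closed S"
    and f: "continuous_on {a..b} f" "f ` {a..b} \<subseteq> S" and ab: "a \<le> b"
  shows "T (integral {a..b} f) = integral {a..b} (\<lambda>r. T (f r))"
proof -
  have sub: "subspace S" using T by (simp add: linear_op_on_def)
  have Ts: "T (c *\<^sub>R x) = c *\<^sub>R T x" if "x \<in> S" for c x
    using T that by (simp add: linear_op_on_def)
  have Td: "T (x - y) = T x - T y" if "x \<in> S" "y \<in> S" for x y
    using T(1) Ts[of y "-1"] that subspace_neg[OF sub, of y]
    unfolding linear_op_on_def by (metis diff_conv_add_uminus scaleR_minus1_left)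
  have T0: "T 0 = 0" using Ts[OF subspace_0[OF sub], of 0] by simp
  define \<phi> where "\<phi> r = integral {a..r} f" for r
  have \<phi>S: "\<phi> r \<in> S" if "r \<in> {a..b}" for r
    unfolding \<phi>_def using f that
    by (intro integral_in_closed_subspace sub S) (auto intro: continuous_on_subset)
  have "((\<lambda>r. T (\<phi> r)) has_vector_derivative T (f r)) (at r within {a..b})" if r: "r \<in> {a..b}" for r
    unfolding has_vector_derivative_def has_derivative_within_alt
  proof (intro conjI allI impI)
    show "bounded_linear (\<lambda>x. x *\<^sub>R T (f r))" by (rule bounded_linear_scaleR_left)
    fix e :: real assume e: "e > 0"
    define K' where "K' = \<bar>K\<bar> + 1"
    have K': "K' > 0" by (simp add: K'_def add_nonneg_pos)
    have "(\<phi> has_derivative (\<lambda>x. x *\<^sub>R f r)) (at r within {a..b})"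
      using integral_has_vector_derivative[OF f(1) r] unfolding \<phi>_def[abs_def] has_vector_derivative_def .
    moreover have "e / K' > 0" using e K' by simp
    ultimately have "\<exists>d>0. \<forall>y\<in>{a..b}. norm (y - r) < d \<longrightarrow> norm (\<phi> y - \<phi> r - (y - r) *\<^sub>R f r) \<le> e / K' * norm (y - r)"
      by (simp only: has_derivative_within_alt)
    then obtain d where d: "d > 0" "\<And>y. y \<in> {a..b} \<Longrightarrow> norm (y - r) < d \<Longrightarrow>
        norm (\<phi> y - \<phi> r - (y - r) *\<^sub>R f r) \<le> e / K' * norm (y - r)"
      by blast
    have "norm (T (\<phi> y) - T (\<phi> r) - (y - r) *\<^sub>R T (f r)) \<le> e * norm (y - r)"
      if y: "y \<in> {a..b}" "norm (y - r) < d" for y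
    proof -
      have fS: "f r \<in> S" using f(2) r by auto
      have "T (\<phi> y) - T (\<phi> r) - (y - r) *\<^sub>R T (f r) = T (\<phi> y - \<phi> r - (y - r) *\<^sub>R f r)"
        using \<phi>S r y(1) fS by (simp add: Td Ts subspace_diff[OF sub] subspace_scale[OF sub])
      also have "norm \<dots> \<le> K * norm (\<phi> y - \<phi> r - (y - r) *\<^sub>R f r)"
        using \<phi>S r y(1) fS by (intro T subspace_diff[OF sub] subspace_scale[OF sub])
      also have "\<dots> \<le> K' * (e / K' * norm (y - r))"
        using d(2)[OF y] K' by (intro mult_mono) (auto simp: K'_def)
      also have "\<dots> = e * norm (y - r)" using K' by simp
      finally show ?thesis .
    qed
    then show "\<exists>d>0. \<forall>y\<in>{a..b}. norm (y - r) < d \<longrightarrow>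
        norm (T (\<phi> y) - T (\<phi> r) - (y - r) *\<^sub>R T (f r)) \<le> e * norm (y - r)"
      using d(1) by blast
  qed
  then have "((\<lambda>r. T (f r)) has_integral (T (\<phi> b) - T (\<phi> a))) {a..b}"
    by (intro fundamental_theorem_of_calculus ab)
  then show ?thesis using T0 by (simp add: \<phi>_def integral_unique)
qed

lemma has_integral_exp_decay:
  fixes \<delta> t :: real assumes "\<delta> \<noteq> 0" "a \<le> b"
  shows "((\<lambda>s. B * exp (- \<delta> * (t - s))) has_integral
    (B / \<delta> * exp (- \<delta> * (t - b)) - B / \<delta> * exp (- \<delta> * (t - a)))) {a..b}"
  using assms(1)
  by (intro fundamental_theorem_of_calculus assms(2))
     (auto intro!: derivative_eq_intros simp flip: has_real_derivative_iff_has_vector_derivative)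

text \<open>Integrability over the half line is part of the claim: the truncated integrals form a
  Cauchy sequence, and their limit \<open>L\<close> is verified to be the gauge integral. Otherwise
  the integral would be a default value.\<close>

lemma integral_decay:
  fixes f :: "real \<Rightarrow> 'a::banach"
  assumes f: "continuous_on {..t} f" "\<And>s. s \<le> t \<Longrightarrow> norm (f s) \<le> B * exp (- \<delta> * (t - s))" and \<delta>: "\<delta> > 0"
    and a: "a \<le> t"
  shows "norm (integral {..t} f - integral {a..t} f) \<le> B / \<delta> * exp (- \<delta> * (t - a))"
proof -
  have B: "B \<ge> 0" using order_trans[OF norm_ge_zero f(2)[of t]] by simp
  have int: "f integrable_on {x..y}" if "y \<le> t" for x y
    by (rule integrable_continuous_real, rule continuous_on_subset[OF f(1)]) (use that in auto)
  have bd: "norm (integral {x..y} f) \<le> B / \<delta> * exp (- \<delta> * (t - y))" if "x \<le> y" "y \<le> t" for x y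
  proof -
    have "norm (integral {x..y} f) \<le> integral {x..y} (\<lambda>s. B * exp (- \<delta> * (t - s)))"
      by (rule integral_norm_bound_integral[OF int])
         (use has_integral_exp_decay[of \<delta> x y B t] \<delta> that f(2) in \<open>auto intro: has_integral_integrable\<close>)
    also have "\<dots> = B / \<delta> * exp (- \<delta> * (t - y)) - B / \<delta> * exp (- \<delta> * (t - x))"
      using has_integral_exp_decay[of \<delta> x y B t] \<delta> that by (intro integral_unique) auto
    also have "\<dots> \<le> B / \<delta> * exp (- \<delta> * (t - y))" using B \<delta> by simp
    finally show ?thesis .
  qed
  have split: "integral {x..t} f - integral {y..t} f = integral {x..y} f" if "x \<le> y" "y \<le> t" for x y
    using Henstock_Kurzweil_Integration.integral_combine[OF that int[OF order_refl]] by (simp add: algebra_simps)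
  have ex: "((\<lambda>n. B / \<delta> * exp (- \<delta> * real n)) \<longlongrightarrow> 0) sequentially"
  proof -
    have "(\<lambda>n. exp (- \<delta>) ^ n) \<longlonglongrightarrow> 0" using \<delta> by (intro LIMSEQ_power_zero) auto
    then show ?thesis by (intro tendsto_mult_right_zero) (simp add: exp_of_nat_mult[symmetric] mult.commute)
  qed
  have "Cauchy (\<lambda>n. integral {t - real n..t} f)"
  proof (rule metric_CauchyI)
    fix e :: real assume e: "e > 0"
    obtain N where N: "\<And>n. n \<ge> N \<Longrightarrow> B / \<delta> * exp (- \<delta> * real n) < e"
      using order_tendstoD(2)[OF ex e] unfolding eventually_sequentially by blast
    have "dist (integral {t - real m..t} f) (integral {t - real n..t} f) < e" if "n \<ge> N" "m \<ge> n" for m n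
      using split[of "t - real m" "t - real n"] bd[of "t - real m" "t - real n"] N[OF that(1)] that(2)
      by (simp add: dist_norm)
    then show "\<exists>N. \<forall>m\<ge>N. \<forall>n\<ge>N. dist (integral {t - real m..t} f) (integral {t - real n..t} f) < e"
      by (metis dist_commute nat_le_linear)
  qed
  then obtain L where L: "(\<lambda>n. integral {t - real n..t} f) \<longlonglongrightarrow> L"
    by (auto simp: Cauchy_convergent_iff convergent_def)
  have tail: "norm (L - integral {x..t} f) \<le> B / \<delta> * exp (- \<delta> * (t - x))" if "x \<le> t" for x
  proof (rule LIMSEQ_le_const2)
    show "(\<lambda>n. norm (integral {t - real n..t} f - integral {x..t} f)) \<longlonglongrightarrow> norm (L - integral {x..t} f)"
      by (intro tendsto_intros L)
    obtain N where N: "real N \<ge> t - x" using real_arch_simple by blast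
    have "norm (integral {t - real n..t} f - integral {x..t} f) \<le> B / \<delta> * exp (- \<delta> * (t - x))" if "n \<ge> N" for n
    proof -
      have "t - real n \<le> x" using N that by simp
      then show ?thesis using split bd \<open>x \<le> t\<close> by metis
    qed
    then show "\<exists>N. \<forall>n\<ge>N. norm (integral {t - real n..t} f - integral {x..t} f) \<le> B / \<delta> * exp (- \<delta> * (t - x))"
      by blast
  qed
  have "(f has_integral L) {..t}"
    unfolding has_integral_alt'
  proof (intro conjI allI impI)
    have Int: "{..t} \<inter> cbox x y = {x..min t y}" for x y by auto
    show "(\<lambda>x. if x \<in> {..t} then f x else 0) integrable_on cbox x y" for x y
      unfolding integrable_restrict_Int Int by (rule int) simp
    fix e :: real assume e: "e > 0"
    obtain N where N: "B / \<delta> * exp (- \<delta> * real N) < e"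
      using order_tendstoD(2)[OF ex e] unfolding eventually_sequentially by blast
    \<comment> \<open>A ball of this radius contains \<open>t\<close> and \<open>t - real N\<close>,
      so any box around it cuts the half line at or below \<open>t - real N\<close>.\<close>
    define r where "r = \<bar>t\<bar> + real N + 1"
    have "norm (integral (cbox x y) (\<lambda>x. if x \<in> {..t} then f x else 0) - L) < e" if xy: "ball 0 r \<subseteq> cbox x y" for x y
    proof -
      have "t \<in> ball 0 r" "t - real N \<in> ball 0 r" by (auto simp: r_def dist_real_def)
      then have *: "t \<le> y" "x \<le> t - real N" using xy by auto
      then have "integral (cbox x y) (\<lambda>x. if x \<in> {..t} then f x else 0) = integral {x..t} f"
        unfolding Henstock_Kurzweil_Integration.integral_restrict_Int Int by (simp add: min_absorb1)
      moreover have "norm (L - integral {x..t} f) \<le> B / \<delta> * exp (- \<delta> * (t - x))" using * by (intro tail) auto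
      moreover have "B / \<delta> * exp (- \<delta> * (t - x)) \<le> B / \<delta> * exp (- \<delta> * real N)"
        using * B \<delta> by (intro mult_left_mono) (auto simp: mult_left_mono)
      ultimately show ?thesis using N by (simp add: norm_minus_commute)
    qed
    moreover have "r > 0" by (simp add: r_def)
    ultimately show "\<exists>B>0. \<forall>x y. ball 0 B \<subseteq> cbox x y \<longrightarrow>
        norm (integral (cbox x y) (\<lambda>x. if x \<in> {..t} then f x else 0) - L) < e"
      by blast
  qed
  then show ?thesis using tail[OF a] by (simp add: integral_unique)
qed

text \<open>The integrand is reduced to one vanishing on the diagonal, whose extension by zero is continuous.\<close>

lemma integral_triangle_swap:
  fixes g :: "real \<Rightarrow> real \<Rightarrow> 'a::banach"
  assumes g: "continuous_on {(q, s). a \<le> s \<and> s \<le> q \<and> q \<le> b} (\<lambda>(q, s). g q s)" and ab: "a \<le> b"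
  shows "integral {a..b} (\<lambda>s. integral {s..b} (\<lambda>q. g q s)) = integral {a..b} (\<lambda>q. integral {a..q} (\<lambda>s. g q s))"
proof -
  define d where "d s = g s s" for s
  define e where "e q s = g (max q s) s - d s" for q s
  have cd: "continuous_on {a..b} d"
  proof -
    have "continuous_on {a..b} (\<lambda>s. (\<lambda>(q, s). g q s) (s, s))"
      by (rule continuous_on_compose2[OF g]) (auto intro!: continuous_intros)
    then show ?thesis by (simp add: d_def)
  qed
  have ce: "continuous_on ({a..b} \<times> {a..b}) (\<lambda>(q, s). e q s)"
  proof -
    have "continuous_on ({a..b} \<times> {a..b}) (\<lambda>p. (case (max (fst p) (snd p), snd p) of (q, s) \<Rightarrow> g q s) - d (snd p))"
      by (intro continuous_on_diff continuous_on_compose2[OF g] continuous_on_compose2[OF cd])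
         (auto intro!: continuous_intros)
    then show ?thesis by (simp add: e_def case_prod_beta)
  qed
  have ce1: "continuous_on {x..y} (\<lambda>q. e q s)" if "s \<in> {a..b}" "a \<le> x" "y \<le> b" for x y s
  proof -
    have "continuous_on {x..y} (\<lambda>q. (\<lambda>(q, s). e q s) (q, s))"
      by (rule continuous_on_compose2[OF ce]) (use that in \<open>auto intro!: continuous_intros\<close>)
    then show ?thesis by simp
  qed
  have ce2: "continuous_on {x..y} (\<lambda>s. e q s)" if "q \<in> {a..b}" "a \<le> x" "y \<le> b" for x y q
  proof -
    have "continuous_on {x..y} (\<lambda>s. (\<lambda>(q, s). e q s) (q, s))"
      by (rule continuous_on_compose2[OF ce]) (use that in \<open>auto intro!: continuous_intros\<close>)
    then show ?thesis by simp
  qed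
  have z: "e q s = 0" if "q \<le> s" for q s using that by (simp add: e_def d_def max_absorb2)
  have l: "integral {s..b} (\<lambda>q. g q s) = integral {a..b} (\<lambda>q. e q s) + (b - s) *\<^sub>R d s" if s: "s \<in> {a..b}" for s
  proof -
    have "integral {a..b} (\<lambda>q. e q s) = integral {a..s} (\<lambda>q. e q s) + integral {s..b} (\<lambda>q. e q s)"
      using s Henstock_Kurzweil_Integration.integral_combine[of a s b "\<lambda>q. e q s"] integrable_continuous_real[OF ce1[OF s, of a b]] by auto
    also have "integral {a..s} (\<lambda>q. e q s) = integral {a..s} (\<lambda>q. 0)" by (rule integral_cong) (simp add: z)
    also have "integral {s..b} (\<lambda>q. g q s) = integral {s..b} (\<lambda>q. e q s + d s)"
      by (rule integral_cong) (simp add: e_def max_absorb1)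
    moreover have "\<dots> = integral {s..b} (\<lambda>q. e q s) + integral {s..b} (\<lambda>q. d s)"
      using s by (intro integral_add integrable_continuous_real ce1 continuous_intros) auto
    ultimately show ?thesis using s by simp
  qed
  have r: "integral {a..q} (\<lambda>s. g q s) = integral {a..b} (\<lambda>s. e q s) + integral {a..q} d" if q: "q \<in> {a..b}" for q
  proof -
    have "integral {a..b} (\<lambda>s. e q s) = integral {a..q} (\<lambda>s. e q s) + integral {q..b} (\<lambda>s. e q s)"
      using q Henstock_Kurzweil_Integration.integral_combine[of a q b "\<lambda>s. e q s"] integrable_continuous_real[OF ce2[OF q, of a b]] by auto
    also have "integral {q..b} (\<lambda>s. e q s) = integral {q..b} (\<lambda>s. 0)" by (rule integral_cong) (simp add: z)
    also have "integral {a..q} (\<lambda>s. g q s) = integral {a..q} (\<lambda>s. e q s + d s)"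
      by (rule integral_cong) (simp add: e_def max_absorb1)
    moreover have "\<dots> = integral {a..q} (\<lambda>s. e q s) + integral {a..q} d"
      using q by (intro integral_add integrable_continuous_real ce2 continuous_on_subset[OF cd]) auto
    ultimately show ?thesis by simp
  qed
  have cI1: "continuous_on {a..b} (\<lambda>s. integral {a..b} (\<lambda>q. e q s))"
  proof -
    have "continuous_on ({a..b} \<times> cbox a b) (\<lambda>(s, q). e q s)"
    proof -
      have "continuous_on ({a..b} \<times> cbox a b) (\<lambda>p. (\<lambda>(q, s). e q s) (snd p, fst p))"
        by (rule continuous_on_compose2[OF ce]) (auto intro!: continuous_intros)
      then show ?thesis by (simp add: case_prod_beta)
    qed
    from integral_continuous_on_param[OF this] show ?thesis by simp
  qed
  have cI2: "continuous_on {a..b} (\<lambda>q. integral {a..b} (\<lambda>s. e q s))"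
    using integral_continuous_on_param[of "{a..b}" a b e] ce by simp
  have id: "continuous_on {a..b} (\<lambda>q. integral {a..q} d)"
    by (rule indefinite_integral_continuous_1[OF integrable_continuous_real[OF cd]])
  have swap: "integral {a..b} (\<lambda>s. integral {a..b} (\<lambda>q. e q s)) = integral {a..b} (\<lambda>q. integral {a..b} (\<lambda>s. e q s))"
    using integral_swap_continuous[of a a b b e] ce by (simp add: cbox_Pair_eq)
  \<comment> \<open>Integration by parts with the primitive of \<open>d\<close>: the product with
    \<open>q - b\<close> vanishes at both end points.\<close>
  have diag: "integral {a..b} (\<lambda>s. (b - s) *\<^sub>R d s) = integral {a..b} (\<lambda>q. integral {a..q} d)"
  proof -
    have "((\<lambda>q. integral {a..q} d - (b - q) *\<^sub>R d q) has_integral ((q - b) *\<^sub>R integral {a..q} d - (a - b) *\<^sub>R integral {a..a} d)) {a..q}"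
      if "q = b" for q
    proof (rule fundamental_theorem_of_calculus)
      show "a \<le> q" using that ab by simp
      fix x assume x: "x \<in> {a..q}"
      have "((\<lambda>q. q - b) has_real_derivative 1) (at x within {a..q})" by (auto intro!: derivative_eq_intros)
      from has_vector_derivative_scaleR[OF this integral_has_vector_derivative[of a q d x]] x cd that
      show "((\<lambda>q. (q - b) *\<^sub>R integral {a..q} d) has_vector_derivative integral {a..x} d - (b - x) *\<^sub>R d x) (at x within {a..q})"
        by (simp add: algebra_simps)
    qed
    from integral_unique[OF this[OF refl]] have "integral {a..b} (\<lambda>q. integral {a..q} d - (b - q) *\<^sub>R d q) = 0"
      by simp
    moreover have "integral {a..b} (\<lambda>q. integral {a..q} d - (b - q) *\<^sub>R d q) =
        integral {a..b} (\<lambda>q. integral {a..q} d) - integral {a..b} (\<lambda>q. (b - q) *\<^sub>R d q)"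
      by (intro integral_diff integrable_continuous_real id continuous_intros cd)
    ultimately show ?thesis by simp
  qed
  have "integral {a..b} (\<lambda>s. integral {s..b} (\<lambda>q. g q s)) = integral {a..b} (\<lambda>s. integral {a..b} (\<lambda>q. e q s) + (b - s) *\<^sub>R d s)"
    by (rule integral_cong) (rule l)
  also have "\<dots> = integral {a..b} (\<lambda>s. integral {a..b} (\<lambda>q. e q s)) + integral {a..b} (\<lambda>s. (b - s) *\<^sub>R d s)"
    by (intro integral_add integrable_continuous_real cI1 continuous_intros cd)
  also have "\<dots> = integral {a..b} (\<lambda>q. integral {a..b} (\<lambda>s. e q s) + integral {a..q} d)"
    unfolding swap diag by (rule integral_add[symmetric]) (intro integrable_continuous_real cI2 id)+
  also have "\<dots> = integral {a..b} (\<lambda>q. integral {a..q} (\<lambda>s. g q s))"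
    by (rule integral_cong) (rule r[symmetric])
  finally show ?thesis .
qed

section \<open>Bounded solutions on the whole line\<close>

context hille_yosida_cone
begin

text \<open>The inhomogeneities have to converge only behind \<open>R\<close>. This is the mode of
  convergence available for \<open>J \<mu> f\<close> when \<open>f\<close> takes values outside
  \<open>X0\<close>.\<close>

lemma mild_limit:
  assumes m: "\<And>n. mild (u n) (G n) s t" and u: "uniform_limit {s..t} u v sequentially"
    and G: "uniform_limit {s..t} (\<lambda>n r. R (G n r)) (\<lambda>r. R (H r)) sequentially" and H: "continuous_on {s..t} H"
  shows "mild v H s t"
proof (rule mildI_integral)
  show cv: "continuous_on {s..t} v"
    by (rule uniform_limit_theorem[OF _ u]) (auto intro!: always_eventually mildD(1)[OF m])
  show "continuous_on {s..t} H" by fact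
  have pt: "(\<lambda>n. u n r) \<longlonglongrightarrow> v r" if "r \<in> {s..t}" for r
    using u that by (rule tendsto_uniform_limitI)
  show "v r \<in> X0" if "r \<in> {s..t}" for r
    using closed_sequentially[OF closed_closure _ pt[OF that]] mildD(3)[OF m that] by blast
  fix r assume r: "r \<in> {s..t}"
  have sub: "{s..r} \<subseteq> {s..t}" using r by auto
  let ?h = "\<lambda>n q. (w + 1) *\<^sub>R R (u n q) - u n q + R (G n q)"
  let ?k = "\<lambda>q. (w + 1) *\<^sub>R R (v q) - v q + R (H q)"
  have "uniform_limit {s..t} (\<lambda>n q. R (u n q)) (\<lambda>q. R (v q)) sequentially"
    using bounded_linear.uniform_limit[OF bounded_linear_R u] .
  then have "uniform_limit {s..t} ?h ?k sequentially"
    by (intro uniform_limit_intros u G)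
  then have ul: "uniform_limit {s..r} ?h ?k sequentially"
    using sub by (rule uniform_limit_on_subset)
  have ch: "continuous_on {s..r} (?h n)" for n
    using mildD(1,2)[OF m, of n] sub
    by (intro continuous_intros R.continuous_on) (auto intro: continuous_on_subset)
  obtain I K where I: "\<And>n. (?h n has_integral I n) {s..r}" and K: "(?k has_integral K) {s..r}" and IK: "I \<longlonglongrightarrow> K"
    using uniform_limit_integral[OF ul ch] by auto
  have "I = (\<lambda>n. R (u n r) - R (u n s))"
    using has_integral_unique[OF I mild_integral[OF m r]] by (rule ext)
  moreover have "(\<lambda>n. R (u n r) - R (u n s)) \<longlonglongrightarrow> R (v r) - R (v s)"
    using r by (intro tendsto_diff R.tendsto pt) auto
  ultimately have "K = R (v r) - R (v s)" using LIMSEQ_unique[OF IK] by simp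
  then show "R (v r) - R (v s) = integral {s..r} ?k" using K by (simp add: integral_unique)
qed

end

locale evolution = perturbed D A P w M w' C c k
  for D :: "'a::banach set" and A :: "'a \<Rightarrow> 'a" and P :: "'a set" and w M w' :: real
    and C :: "real \<Rightarrow> 'a \<Rightarrow> 'a" and c k :: real +
  fixes W :: "real \<Rightarrow> real \<Rightarrow> 'a \<Rightarrow> 'a" and N \<delta> :: real
  assumes W_ev: "evolution_family X0 W"
    and W_bound: "\<And>s t x. s \<le> t \<Longrightarrow> x \<in> X0 \<Longrightarrow> norm (W t s x) \<le> N * exp (- \<delta> * (t - s)) * norm x"
    and W_mild: "\<And>s t x. s \<le> t \<Longrightarrow> x \<in> X0 \<Longrightarrow> mild (\<lambda>r. W r s x) (\<lambda>r. C r (W r s x)) s t"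
    and N1: "N \<ge> 1" and delta: "\<delta> > 0"
begin

lemma W_op: "s \<le> t \<Longrightarrow> bounded_op_on X0 (W t s)"
  and W_in: "s \<le> t \<Longrightarrow> x \<in> X0 \<Longrightarrow> W t s x \<in> X0"
  and W_id: "x \<in> X0 \<Longrightarrow> W s s x = x"
  and W_cocycle: "s \<le> r \<Longrightarrow> r \<le> t \<Longrightarrow> x \<in> X0 \<Longrightarrow> W t r (W r s x) = W t s x"
  and W_cont: "x \<in> X0 \<Longrightarrow> continuous_on {(t, s). s \<le> t} (\<lambda>(t, s). W t s x)"
  using W_ev unfolding evolution_family_def by blast+

lemma W_lin: "s \<le> t \<Longrightarrow> linear_op_on X0 (W t s)"
  using W_op by (simp add: bounded_op_on_def)

lemma W_scale: "s \<le> t \<Longrightarrow> x \<in> X0 \<Longrightarrow> W t s (a *\<^sub>R x) = a *\<^sub>R W t s x"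
  and W_add: "s \<le> t \<Longrightarrow> x \<in> X0 \<Longrightarrow> y \<in> X0 \<Longrightarrow> W t s (x + y) = W t s x + W t s y"
  using W_lin[of s t] by (auto simp: linear_op_on_def)

lemma W_diff: "s \<le> t \<Longrightarrow> x \<in> X0 \<Longrightarrow> y \<in> X0 \<Longrightarrow> W t s (x - y) = W t s x - W t s y"
  using W_add[of s t x "-y"] W_scale[of s t y "-1"] subspace_neg[OF subX0, of y] by simp

lemma mild_minus_W:
  assumes u: "mild u (\<lambda>r. C r (u r) + g r) s t" and st: "s \<le> t"
  shows "mild (\<lambda>r. u r - W r s (u s)) (\<lambda>r. C r (u r - W r s (u s)) + g r) s t"
proof -
  have us: "u s \<in> X0" using mildD(3)[OF u] st by auto
  show ?thesis
    using mild_diff[OF u W_mild[OF st us]]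
    by (rule mild_cong) (use mildD(3)[OF u] us in \<open>auto simp: C_diff W_in\<close>)
qed

text \<open>What remains of the variation of constants formula for inhomogeneities outside
  \<open>X0\<close>: the deviation from the homogeneous orbit is itself a mild solution, starting at
  zero.\<close>

lemma duhamel_bound:
  assumes u: "mild u (\<lambda>r. C r (u r) + g r) s t" and st: "s \<le> t" and b: "\<And>r. r \<in> {s..t} \<Longrightarrow> norm (g r) \<le> b"
  shows "norm (u t - W t s (u s)) \<le> growth (t - s) * ((t - s) * (2 * M * b))"
proof -
  have "u s \<in> X0" using mildD(3)[OF u] st by auto
  then show ?thesis using mild_bound[OF mild_minus_W[OF u st] st b] by (simp add: W_id)
qed

lemma duhamel_pos:
  assumes u: "mild u (\<lambda>r. C r (u r) + g r) s t" and st: "s \<le> t" and g: "\<And>r. r \<in> {s..t} \<Longrightarrow> g r \<in> P"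
  shows "u t - W t s (u s) \<in> P"
proof -
  have "u s \<in> X0" using mildD(3)[OF u] st by auto
  then show ?thesis using mild_pos[OF mild_minus_W[OF u st] st _ g] P0 by (simp add: W_id)
qed

definition entire :: "(real \<Rightarrow> 'a) \<Rightarrow> (real \<Rightarrow> 'a) \<Rightarrow> bool" where
  "entire u f \<longleftrightarrow> (\<forall>s t. mild u (\<lambda>r. C r (u r) + f r) s t)"

lemma entireD: "entire u f \<Longrightarrow> mild u (\<lambda>r. C r (u r) + f r) s t"
  by (simp add: entire_def)

lemma entire_in: "entire u f \<Longrightarrow> u t \<in> X0"
  using mildD(3)[OF entireD, of u f t t t] by simp

lemma entire_diff:
  assumes "entire u f" "entire v g" shows "entire (\<lambda>t. u t - v t) (\<lambda>t. f t - g t)"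
  unfolding entire_def
proof (intro allI)
  fix s t
  show "mild (\<lambda>t. u t - v t) (\<lambda>r. C r (u r - v r) + (f r - g r)) s t"
    using mild_diff[OF entireD[OF assms(1)] entireD[OF assms(2)]]
    by (rule mild_cong) (simp_all add: C_diff entire_in[OF assms(1)] entire_in[OF assms(2)])
qed

lemma entire_add:
  assumes "entire u f" "entire v g" shows "entire (\<lambda>t. u t + v t) (\<lambda>t. f t + g t)"
  unfolding entire_def
proof (intro allI)
  fix s t
  show "mild (\<lambda>t. u t + v t) (\<lambda>r. C r (u r + v r) + (f r + g r)) s t"
    using mild_add[OF entireD[OF assms(1)] entireD[OF assms(2)]]
    by (rule mild_cong) (simp_all add: C_add entire_in[OF assms(1)] entire_in[OF assms(2)])
qed

lemma entire_scale:
  assumes "entire u f" shows "entire (\<lambda>t. a *\<^sub>R u t) (\<lambda>t. a *\<^sub>R f t)"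
  unfolding entire_def
proof (intro allI)
  fix s t
  show "mild (\<lambda>t. a *\<^sub>R u t) (\<lambda>r. C r (a *\<^sub>R u r) + a *\<^sub>R f r) s t"
    using mild_scale[OF entireD[OF assms]]
    by (rule mild_cong) (simp_all add: C_scale entire_in[OF assms] scaleR_add_right)
qed

text \<open>The Duhamel bound on an interval of length one, summed with the geometric series of the
  decay factors \<open>exp (- \<delta>)\<close>.\<close>

definition apriori where "apriori = N * (growth 1 * (2 * M)) / (1 - exp (- \<delta>))"

lemma growth_nonneg: "growth T \<ge> 0" using M1 by (simp add: growth_def)

lemma apriori_nonneg: "apriori \<ge> 0"
  unfolding apriori_def using N1 M1 growth_nonneg[of 1] delta by (intro divide_nonneg_pos) auto

text \<open>Going back \<open>n\<close> unit steps leaves the term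
  \<open>W t (t - n) (u (t - n))\<close>, which tends to zero because \<open>u\<close> is bounded.
  Hence \<open>B\<close> enters only qualitatively, and the final bound depends on the inhomogeneity
  alone.\<close>

theorem apriori_bound:
  assumes u: "entire u f" and B: "\<And>t. norm (u t) \<le> B" and b: "\<And>t. norm (f t) \<le> b"
  shows "norm (u t) \<le> apriori * b"
proof -
  define g where "g = growth 1 * (2 * M * b)"
  have b0: "b \<ge> 0" using order_trans[OF norm_ge_zero b] .
  have B0: "B \<ge> 0" using order_trans[OF norm_ge_zero B] .
  have g: "g \<ge> 0" using b0 M1 growth_nonneg[of 1] by (simp add: g_def)
  have step: "norm (u t - W t (t - 1) (u (t - 1))) \<le> g" for t
    using duhamel_bound[OF entireD[OF u], of "t - 1" t b] b by (simp add: g_def)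
  have sum: "norm (u t - W t (t - real n) (u (t - real n))) \<le> (\<Sum>j<n. N * exp (- \<delta>) ^ j * g)" for n
  proof (induction n)
    case 0 then show ?case using entire_in[OF u] by (simp add: W_id)
  next
    case (Suc n)
    define r where "r = t - real n"
    \<comment> \<open>The cocycle law moves the starting point back by one unit; the new
      contribution is a unit Duhamel term transported from \<open>r\<close> to
      \<open>t\<close>.\<close>
    have eq: "u t - W t (t - real (Suc n)) (u (t - real (Suc n))) =
       (u t - W t r (u r)) + W t r (u r - W r (r - 1) (u (r - 1)))"
    proof -
      have 1: "W t r (u r - W r (r - 1) (u (r - 1))) = W t r (u r) - W t (r - 1) (u (r - 1))"
        using entire_in[OF u] W_in[of "r - 1" r] by (simp add: W_diff W_cocycle r_def)
      have 2: "t - real (Suc n) = r - 1" by (simp add: r_def)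
      show ?thesis unfolding 1 2 by simp
    qed
    have b1: "norm (W t r (u r - W r (r - 1) (u (r - 1)))) \<le> N * exp (- \<delta>) ^ n * g"
    proof -
      have "norm (W t r (u r - W r (r - 1) (u (r - 1)))) \<le> N * exp (- \<delta> * (t - r)) * norm (u r - W r (r - 1) (u (r - 1)))"
        using entire_in[OF u] W_in[of "r - 1" r] by (intro W_bound subspace_diff[OF subX0]) (auto simp: r_def)
      also have "\<dots> \<le> N * exp (- \<delta> * (t - r)) * g" using step N1 by (intro mult_left_mono) auto
      also have "exp (- \<delta> * (t - r)) = exp (- \<delta>) ^ n" by (simp add: r_def exp_of_nat_mult[symmetric] mult.commute)
      finally show ?thesis .
    qed
    have b2: "norm (u t - W t r (u r)) \<le> (\<Sum>j<n. N * exp (- \<delta>) ^ j * g)" using Suc by (simp add: r_def)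
    show ?case
      unfolding eq sum.lessThan_Suc using b1 b2 norm_triangle_ineq[of "u t - W t r (u r)" "W t r (u r - W r (r - 1) (u (r - 1)))"] by linarith
  qed
  have q: "exp (- \<delta>) < 1" using delta by simp
  have bound: "norm (u t) \<le> apriori * b + N * B * exp (- \<delta>) ^ n" for n
  proof -
    have "(\<Sum>j<n. exp (- \<delta>) ^ j) \<le> 1 / (1 - exp (- \<delta>))"
      using sum_le_suminf[of "\<lambda>j. exp (- \<delta>) ^ j" "{..<n}"] q suminf_geometric[of "exp (- \<delta>)"] summable_geometric[of "exp (- \<delta>)"] by simp
    then have "N * g * (\<Sum>j<n. exp (- \<delta>) ^ j) \<le> N * g * (1 / (1 - exp (- \<delta>)))"
      using N1 g by (intro mult_left_mono) auto
    also have "\<dots> = apriori * b" by (simp add: apriori_def g_def)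
    finally have 1: "(\<Sum>j<n. N * exp (- \<delta>) ^ j * g) \<le> apriori * b"
      by (simp add: sum_distrib_left sum_distrib_right algebra_simps)
    have "norm (W t (t - real n) (u (t - real n))) \<le> N * exp (- \<delta> * real n) * norm (u (t - real n))"
      using W_bound[of "t - real n" t "u (t - real n)"] entire_in[OF u] by simp
    also have "\<dots> \<le> N * exp (- \<delta> * real n) * B" using B N1 by (intro mult_left_mono) auto
    also have "exp (- \<delta> * real n) = exp (- \<delta>) ^ n" by (simp add: exp_of_nat_mult[symmetric] mult.commute)
    finally have 2: "norm (W t (t - real n) (u (t - real n))) \<le> N * B * exp (- \<delta>) ^ n" by (simp add: mult_ac)
    show ?thesis
      using sum[of n] 1 2 norm_triangle_ineq[of "u t - W t (t - real n) (u (t - real n))" "W t (t - real n) (u (t - real n))"] by simp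
  qed
  have "(\<lambda>n. apriori * b + N * B * exp (- \<delta>) ^ n) \<longlonglongrightarrow> apriori * b + N * B * 0"
    using q by (intro tendsto_intros LIMSEQ_power_zero) auto
  then show ?thesis using bound by (intro LIMSEQ_le_const[of _ "apriori * b" "norm (u t)"]) auto
qed

lemma entire_unique:
  assumes "entire u f" "entire v f" "\<And>t. norm (u t) \<le> B" "\<And>t. norm (v t) \<le> B'"
  shows "u t = v t"
proof -
  have "norm (u t - v t) \<le> apriori * 0"
  proof (rule apriori_bound[OF entire_diff[OF assms(1,2)]])
    show "norm (u t - v t) \<le> B + B'" for t using norm_triangle_ineq4[of "u t" "v t"] assms(3,4)[of t] by linarith
  qed simp
  then show ?thesis by simp
qed

text \<open>\<open>u T\<close> is the limit of its deviations from the homogeneous orbits started at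
  \<open>T - n\<close>. Each deviation is positive whatever the sign of the initial value, and the
  transported initial values vanish because growth at rate \<open>\<epsilon>\<close> loses against
  decay at rate \<open>\<delta>\<close>.\<close>

theorem backward_pos:
  assumes u: "\<And>s. s \<le> T \<Longrightarrow> mild u (\<lambda>r. C r (u r) + f r) s T" and f: "\<And>r. r \<le> T \<Longrightarrow> f r \<in> P"
    and B: "\<And>s. s \<le> T \<Longrightarrow> norm (u s) \<le> B * exp (\<epsilon> * (T - s))" and \<epsilon>: "\<epsilon> < \<delta>"
  shows "u T \<in> P"
proof -
  define v where "v n = u T - W T (T - real n) (u (T - real n))" for n
  have "v n \<in> P" for n unfolding v_def by (rule duhamel_pos[OF u]) (auto intro: f)
  moreover have "(\<lambda>n. u T - v n) \<longlonglongrightarrow> 0"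
  proof (rule Lim_null_comparison)
    have "norm (u T - v n) \<le> N * B * exp (\<epsilon> - \<delta>) ^ n" for n
    proof -
      have "norm (u T - v n) \<le> N * exp (- \<delta> * real n) * norm (u (T - real n))"
        using W_bound[of "T - real n" T "u (T - real n)"] mildD(3)[OF u, of "T - real n" "T - real n"] by (simp add: v_def)
      also have "\<dots> \<le> N * exp (- \<delta> * real n) * (B * exp (\<epsilon> * (T - (T - real n))))"
        using N1 by (intro mult_left_mono B) auto
      also have "\<dots> = N * B * (exp (- \<delta> * real n) * exp (\<epsilon> * real n))" by simp
      also have "exp (- \<delta> * real n) * exp (\<epsilon> * real n) = exp (\<epsilon> - \<delta>) ^ n"
        by (simp add: exp_of_nat_mult[symmetric] exp_add[symmetric] algebra_simps)
      finally show ?thesis .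
    qed
    then show "\<forall>\<^sub>F n in sequentially. norm (u T - v n) \<le> N * B * exp (\<epsilon> - \<delta>) ^ n" by simp
    have "(\<lambda>n. N * B * exp (\<epsilon> - \<delta>) ^ n) \<longlonglongrightarrow> N * B * 0"
      using \<epsilon> by (intro tendsto_intros LIMSEQ_power_zero) auto
    then show "(\<lambda>n. N * B * exp (\<epsilon> - \<delta>) ^ n) \<longlonglongrightarrow> 0" by simp
  qed
  then have "v \<longlonglongrightarrow> u T" using tendsto_diff[OF tendsto_const[of "u T"]] by fastforce
  ultimately show ?thesis using closed_sequentially[OF P_closed] by blast
qed

lemma entire_pos:
  assumes "entire u f" "\<And>t. norm (u t) \<le> B" "\<And>t. f t \<in> P"
  shows "u t \<in> P"
  by (rule backward_pos[of t u f B 0]) (use assms entireD delta in auto)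

subsection \<open>Existence\<close>

definition conv :: "(real \<Rightarrow> 'a) \<Rightarrow> real \<Rightarrow> 'a" where
  "conv g t = integral {..t} (\<lambda>s. W t s (g s))"

context
  fixes g :: "real \<Rightarrow> 'a" and b :: real
  assumes g: "continuous_on UNIV g" "\<And>s. g s \<in> X0" "\<And>s. norm (g s) \<le> b"
begin

lemma W_g_cont: "continuous_on {(t, s). s \<le> t} (\<lambda>(t, s). W t s (g s))"
  unfolding continuous_on_iff
proof (intro ballI allI impI)
  fix p :: "real \<times> real" and e :: real assume p: "p \<in> {(t, s). s \<le> t}" and e: "e > 0"
  obtain t s where [simp]: "p = (t, s)" by (cases p)
  obtain d1 where d1: "d1 > 0" "\<And>q. q \<in> {(t, s). s \<le> t} \<Longrightarrow> dist q p < d1 \<Longrightarrow>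
      dist (case q of (t, s') \<Rightarrow> W t s' (g s)) (W t s (g s)) < e / 2"
  proof -
    have "\<exists>d>0. \<forall>q\<in>{(t, s). s \<le> t}. dist q p < d \<longrightarrow>
      dist (case q of (t, s') \<Rightarrow> W t s' (g s)) (case p of (t, s') \<Rightarrow> W t s' (g s)) < e / 2"
      using W_cont[OF g(2)[of s]] p half_gt_zero[OF e] unfolding continuous_on_iff by blast
    then show ?thesis using that by auto
  qed
  have "e / (2 * N) > 0" using e N1 by simp
  then obtain d2 where d2: "d2 > 0" "\<And>q. dist q s < d2 \<Longrightarrow> dist (g q) (g s) < e / (2 * N)"
    using g(1) unfolding continuous_on_iff by blast
  have "dist (case q of (t, s) \<Rightarrow> W t s (g s)) (case p of (t, s) \<Rightarrow> W t s (g s)) < e"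
    if q: "q \<in> {(t, s). s \<le> t}" "dist q p < min d1 d2" for q
  proof -
    obtain t' s' where [simp]: "q = (t', s')" by (cases q)
    have st: "s' \<le> t'" using q by simp
    have "dist s' s < d2" using q(2) dist_snd_le[of q p] by simp
    then have gd: "norm (g s' - g s) < e / (2 * N)" using d2(2) by (simp add: dist_norm)
    have "norm (W t' s' (g s') - W t' s' (g s)) \<le> N * exp (- \<delta> * (t' - s')) * norm (g s' - g s)"
      using W_bound[OF st, of "g s' - g s"] W_diff[OF st g(2) g(2)] subspace_diff[OF subX0 g(2) g(2)] by metis
    also have "\<dots> \<le> N * 1 * norm (g s' - g s)"
      using N1 delta st by (intro mult_right_mono mult_left_mono) auto
    also have "\<dots> < N * (e / (2 * N))" unfolding mult_1_right using gd N1 by (intro mult_strict_left_mono) auto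
    also have "\<dots> = e / 2" using N1 by simp
    finally have "dist (W t' s' (g s')) (W t' s' (g s)) < e / 2" by (simp add: dist_norm)
    moreover have "dist (W t' s' (g s)) (W t s (g s)) < e / 2" using d1(2)[OF q(1)] q(2) by simp
    ultimately show ?thesis using dist_triangle[of "W t' s' (g s')" "W t s (g s)" "W t' s' (g s)"] by simp
  qed
  then show "\<exists>d>0. \<forall>q\<in>{(t, s). s \<le> t}. dist q p < d \<longrightarrow>
      dist (case q of (t, s) \<Rightarrow> W t s (g s)) (case p of (t, s) \<Rightarrow> W t s (g s)) < e"
    using d1(1) d2(1) by (intro exI[of _ "min d1 d2"]) auto
qed

lemma W_g_cont2: "continuous_on {..t} (\<lambda>s. W t s (g s))"
proof -
  have "continuous_on {..t} (\<lambda>s. (\<lambda>(t, s). W t s (g s)) (t, s))"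
    by (rule continuous_on_compose2[OF W_g_cont]) (auto intro!: continuous_intros)
  then show ?thesis by simp
qed

lemma conv_tail:
  assumes "a \<le> t"
  shows "norm (conv g t - integral {a..t} (\<lambda>s. W t s (g s))) \<le> N * b / \<delta> * exp (- \<delta> * (t - a))"
  unfolding conv_def
proof (rule integral_decay[OF W_g_cont2 _ delta assms])
  fix s assume st: "s \<le> t"
  have "norm (W t s (g s)) \<le> N * exp (- \<delta> * (t - s)) * norm (g s)" by (rule W_bound[OF st g(2)])
  also have "\<dots> \<le> N * exp (- \<delta> * (t - s)) * b" using N1 g(3) by (intro mult_left_mono) auto
  finally show "norm (W t s (g s)) \<le> N * b * exp (- \<delta> * (t - s))" by (simp add: mult_ac)
qed

lemma conv_bound: "norm (conv g t) \<le> N * b / \<delta>"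
  using conv_tail[of t t] by simp

text \<open>For fixed \<open>s\<close> the orbit of \<open>g s\<close> satisfies the integrated
  equation. Integrating in \<open>s\<close> and exchanging the order over the triangle gives the
  equation for the integral; the initial values \<open>R (g s)\<close> turn into the
  inhomogeneity.\<close>

lemma finite_conv_mild:
  "mild (\<lambda>t. integral {a..t} (\<lambda>s. W t s (g s))) (\<lambda>t. C t (integral {a..t} (\<lambda>s. W t s (g s))) + g t) a T"
proof (cases "a \<le> T")
  case False then show ?thesis by (simp add: mild_def)
next
  case aT: True
  define v where "v t = integral {a..t} (\<lambda>s. W t s (g s))" for t
  have ci: "continuous_on {a..t} (\<lambda>s. W t s (g s))" for t
    by (rule continuous_on_subset[OF W_g_cont2]) auto
  have im: "(\<lambda>s. W t s (g s)) ` {a..t} \<subseteq> X0" for t by (auto intro: W_in g)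
  have vX: "v t \<in> X0" for t unfolding v_def
    by (rule integral_in_closed_subspace[OF subX0 closed_closure ci im])
  have vc: "continuous_on {a..T} v"
  proof -
    \<comment> \<open>Writing \<open>max t s\<close> for \<open>t\<close> makes the domain of
      integration independent of \<open>t\<close>. The surplus over \<open>{t..T}\<close> is the
      integral of \<open>g\<close> alone, since \<open>W s s\<close> is the identity on
      \<open>X0\<close>.\<close>
    have c1: "continuous_on ({a..T} \<times> cbox a T) (\<lambda>(t, s). W (max t s) s (g s))"
    proof -
      have "continuous_on ({a..T} \<times> cbox a T) (\<lambda>p. (\<lambda>(t, s). W t s (g s)) (max (fst p) (snd p), snd p))"
        by (rule continuous_on_compose2[OF W_g_cont]) (auto intro!: continuous_intros)
      then show ?thesis by (simp add: case_prod_beta)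
    qed
    have c2: "continuous_on {a..T} (\<lambda>t. integral (cbox a T) (\<lambda>s. W (max t s) s (g s)))"
      by (rule integral_continuous_on_param[OF c1])
    have c3: "continuous_on {a..T} (\<lambda>t. integral {a..T} g - integral {a..t} g)"
      by (intro continuous_intros indefinite_integral_continuous_1 integrable_continuous_real continuous_on_subset[OF g(1)]) auto
    have "v t = integral (cbox a T) (\<lambda>s. W (max t s) s (g s)) - (integral {a..T} g - integral {a..t} g)"
      if t: "t \<in> {a..T}" for t
    proof -
      have "continuous_on {a..T} (\<lambda>s. (\<lambda>(t, s). W (max t s) s (g s)) (t, s))"
        by (rule continuous_on_compose2[OF c1]) (use t in \<open>auto intro!: continuous_intros\<close>)
      then have "(\<lambda>s. W (max t s) s (g s)) integrable_on {a..T}" using integrable_continuous_real by simp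
      then have "integral {a..T} (\<lambda>s. W (max t s) s (g s)) =
         integral {a..t} (\<lambda>s. W (max t s) s (g s)) + integral {t..T} (\<lambda>s. W (max t s) s (g s))"
        using t by (intro Henstock_Kurzweil_Integration.integral_combine[symmetric]) auto
      moreover have "integral {a..t} (\<lambda>s. W (max t s) s (g s)) = v t" unfolding v_def
        by (rule integral_cong) (simp add: max_absorb1)
      moreover have "integral {t..T} (\<lambda>s. W (max t s) s (g s)) = integral {t..T} g"
        by (rule integral_cong) (simp add: max_absorb2 W_id g)
      moreover have "integral {a..T} g = integral {a..t} g + integral {t..T} g"
        using t Henstock_Kurzweil_Integration.integral_combine[of a t T g] integrable_continuous_real[OF continuous_on_subset[OF g(1)], of a T] by auto
      ultimately show ?thesis by simp
    qed
    then show ?thesis by (intro continuous_on_eq[OF continuous_on_diff[OF c2 c3]]) simp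
  qed
  have CC: "continuous_on {a..T} (\<lambda>r. C r (v r))" by (rule C_continuous_on[OF vc]) (use vX in auto)
  have gc: "continuous_on S g" for S using g(1) by (rule continuous_on_subset) auto
  have "mild v (\<lambda>t. C t (v t) + g t) a T"
  proof (rule mildI_integral)
    show "continuous_on {a..T} v" by fact
    show "continuous_on {a..T} (\<lambda>t. C t (v t) + g t)" by (intro continuous_intros CC gc)
    show "v r \<in> X0" for r by (rule vX)
    fix r assume r: "r \<in> {a..T}"
    \<comment> \<open>The derivative in \<open>q\<close> of \<open>R (W q s (g s))\<close>, that is,
      the right-hand side of the homogeneous mild equation. It depends on \<open>W q s (g s)\<close>
      through an operator bounded on \<open>X0\<close>, which can be taken out of the inner
      integral.\<close>
    define h where "h q s = (w + 1) *\<^sub>R R (W q s (g s)) - W q s (g s) + R (C q (W q s (g s)))" for q s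
    have ch: "continuous_on {(q, s). a \<le> s \<and> s \<le> q \<and> q \<le> r} (\<lambda>(q, s). h q s)"
    proof -
      let ?S = "{(q, s). a \<le> s \<and> s \<le> q \<and> q \<le> r}"
      have 1: "continuous_on ?S (\<lambda>p. W (fst p) (snd p) (g (snd p)))"
        using continuous_on_subset[OF W_g_cont, of ?S] by (auto simp: case_prod_beta)
      have 2: "continuous_on ?S (\<lambda>p. C (fst p) (W (fst p) (snd p) (g (snd p))))"
        by (rule C_continuous_on2[OF 1 continuous_on_fst[OF continuous_on_id]]) (auto intro: W_in g)
      have "continuous_on ?S (\<lambda>p. h (fst p) (snd p))"
        unfolding h_def by (intro continuous_intros R.continuous_on 1 2)
      then show ?thesis by (simp add: case_prod_beta)
    qed
    have 1: "R (W r s (g s)) = R (g s) + integral {s..r} (\<lambda>q. h q s)" if "s \<in> {a..r}" for s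
      using mild_integral[OF W_mild[OF _ g(2)[of s]], of s r r] that
      by (auto simp: h_def[abs_def] W_id g dest!: integral_unique)
    have op: "linear_op_on X0 (\<lambda>x. (w + 1) *\<^sub>R R x - x + R (C q x))" for q
      unfolding linear_op_on_def using subX0
      by (auto simp: C_add C_scale R.add R.scaleR algebra_simps)
    have opb: "norm ((w + 1) *\<^sub>R R x - x + R (C q x)) \<le> (\<bar>w + 1\<bar> * M + 1 + M * c) * norm x" if "x \<in> X0" for x q
    proof -
      have "M * norm (C q x) \<le> M * (c * norm x)" using M1 C_bound[OF that] by (intro mult_left_mono) auto
      then have "norm (R (C q x)) \<le> M * (c * norm x)" using R_bound[of "C q x"] by linarith
      moreover have "norm ((w + 1) *\<^sub>R R x) \<le> \<bar>w + 1\<bar> * (M * norm x)" by (simp add: R_bound mult_left_mono)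
      ultimately show ?thesis
        using norm_triangle_ineq[of "(w + 1) *\<^sub>R R x - x" "R (C q x)"] norm_triangle_ineq4[of "(w + 1) *\<^sub>R R x" x]
        by (simp add: algebra_simps)
    qed
    have 2: "integral {a..q} (\<lambda>s. h q s) = (w + 1) *\<^sub>R R (v q) - v q + R (C q (v q))" if "q \<in> {a..r}" for q
      unfolding h_def v_def using that
      by (intro integral_linear_op_on[OF op opb closed_closure ci im, symmetric]) auto
    have sub: "continuous_on {a..r} f" if "continuous_on {a..T} f" for f :: "real \<Rightarrow> 'a"
      using that by (rule continuous_on_subset) (use r in auto)
    have int2: "(\<lambda>q. integral {a..q} (\<lambda>s. h q s)) integrable_on {a..r}"
    proof -
      have "(\<lambda>q. (w + 1) *\<^sub>R R (v q) - v q + R (C q (v q))) integrable_on {a..r}"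
        by (intro integrable_continuous_real sub continuous_intros R.continuous_on vc CC)
      then show ?thesis by (rule integrable_eq) (simp add: 2)
    qed
    have cR: "continuous_on {a..r} (\<lambda>s. R (W r s (g s)))" by (intro R.continuous_on ci)
    have cRg: "continuous_on {a..r} (\<lambda>s. R (g s))" by (intro R.continuous_on gc)
    have int1: "(\<lambda>s. integral {s..r} (\<lambda>q. h q s)) integrable_on {a..r}"
    proof -
      have "(\<lambda>s. R (W r s (g s)) - R (g s)) integrable_on {a..r}"
        by (intro integrable_continuous_real continuous_intros cR cRg)
      then show ?thesis by (rule integrable_eq) (simp add: 1)
    qed
    have "R (v r) = integral {a..r} (\<lambda>s. R (W r s (g s)))"
      unfolding v_def using integral_linear[OF integrable_continuous_real[OF ci] bounded_linear_R]
      by (simp add: o_def)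
    also have "\<dots> = integral {a..r} (\<lambda>s. R (g s) + integral {s..r} (\<lambda>q. h q s))"
      by (rule integral_cong) (rule 1)
    also have "\<dots> = integral {a..r} (\<lambda>s. R (g s)) + integral {a..r} (\<lambda>s. integral {s..r} (\<lambda>q. h q s))"
      by (intro integral_add integrable_continuous_real cRg int1)
    also have "integral {a..r} (\<lambda>s. integral {s..r} (\<lambda>q. h q s)) = integral {a..r} (\<lambda>q. integral {a..q} (\<lambda>s. h q s))"
      by (rule integral_triangle_swap[OF ch]) (use r in simp)
    also have "integral {a..r} (\<lambda>s. R (g s)) + integral {a..r} (\<lambda>q. integral {a..q} (\<lambda>s. h q s)) =
      integral {a..r} (\<lambda>q. R (g q) + integral {a..q} (\<lambda>s. h q s))"
      by (intro integral_add[symmetric] integrable_continuous_real cRg int2)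
    also have "\<dots> = integral {a..r} (\<lambda>q. (w + 1) *\<^sub>R R (v q) - v q + R (C q (v q) + g q))"
      by (rule integral_cong) (simp add: 2 R.add)
    finally show "R (v r) - R (v a) = integral {a..r} (\<lambda>q. (w + 1) *\<^sub>R R (v q) - v q + R (C q (v q) + g q))"
      by (simp add: v_def R.zero)
  qed
  then show ?thesis unfolding v_def[abs_def] .
qed

text \<open>The truncated integrals started at \<open>s - n\<close> solve the equation on
  \<open>{s..t}\<close> and converge there uniformly, at the rate
  \<open>exp (- \<delta>) ^ n\<close>.\<close>

theorem conv_entire: "entire (conv g) g"
  unfolding entire_def
proof (intro allI)
  fix s t
  define u where "u n r = integral {s - real n..r} (\<lambda>q. W r q (g q))" for n r
  have m: "mild (u n) (\<lambda>r. C r (u n r) + g r) s t" for n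
    unfolding u_def by (rule mild_subset[OF finite_conv_mild[of "s - real n" t]]) auto
  have b0: "b \<ge> 0" using order_trans[OF norm_ge_zero g(3)] .
  have close: "norm (conv g r - u n r) \<le> N * b / \<delta> * exp (- \<delta>) ^ n" if "r \<in> {s..t}" for n r
  proof -
    have "norm (conv g r - u n r) \<le> N * b / \<delta> * exp (- \<delta> * (r - (s - real n)))"
      unfolding u_def using that by (intro conv_tail) auto
    also have "\<dots> \<le> N * b / \<delta> * exp (- \<delta> * real n)"
      using that N1 b0 delta by (intro mult_left_mono) auto
    also have "exp (- \<delta> * real n) = exp (- \<delta>) ^ n" by (simp add: exp_of_nat_mult[symmetric] mult.commute)
    finally show ?thesis .
  qed
  have "(\<lambda>n. N * b / \<delta> * exp (- \<delta>) ^ n) \<longlonglongrightarrow> N * b / \<delta> * 0"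
    using delta by (intro tendsto_intros LIMSEQ_power_zero) auto
  then have z: "(\<lambda>n. N * b / \<delta> * exp (- \<delta>) ^ n) \<longlonglongrightarrow> 0" by simp
  have ul: "uniform_limit {s..t} u (conv g) sequentially"
  proof (rule uniform_limitI)
    fix e :: real assume "e > 0"
    from order_tendstoD(2)[OF z this]
    show "\<forall>\<^sub>F n in sequentially. \<forall>r\<in>{s..t}. dist (u n r) (conv g r) < e"
    proof (rule eventually_mono, intro ballI)
      fix n r assume "N * b / \<delta> * exp (- \<delta>) ^ n < e" "r \<in> {s..t}"
      then show "dist (u n r) (conv g r) < e" using close[of r n] by (simp add: dist_norm norm_minus_commute)
    qed
  qed
  have uX: "u n r \<in> X0" if "r \<in> {s..t}" for n r using mildD(3)[OF m that] .
  have cX: "conv g r \<in> X0" if "r \<in> {s..t}" for r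
    using closed_sequentially[OF closed_closure _ tendsto_uniform_limitI[OF ul that]] uX[OF that] by blast
  have cc: "continuous_on {s..t} (conv g)"
    by (rule uniform_limit_theorem[OF _ ul]) (auto intro!: always_eventually mildD(1)[OF m])
  show "mild (conv g) (\<lambda>r. C r (conv g r) + g r) s t"
  proof (rule mild_limit[OF m ul])
    show "continuous_on {s..t} (\<lambda>r. C r (conv g r) + g r)"
      by (intro continuous_intros C_continuous_on cc continuous_on_subset[OF g(1)]) (use cX in auto)
    show "uniform_limit {s..t} (\<lambda>n r. R (C r (u n r) + g r)) (\<lambda>r. R (C r (conv g r) + g r)) sequentially"
    proof (rule uniform_limitI)
      fix e :: real assume e: "e > 0"
      have "(\<lambda>n. M * (c * (N * b / \<delta> * exp (- \<delta>) ^ n))) \<longlonglongrightarrow> M * (c * 0)"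
        by (intro tendsto_intros z)
      then have "\<forall>\<^sub>F n in sequentially. M * (c * (N * b / \<delta> * exp (- \<delta>) ^ n)) < e"
        using e by (intro order_tendstoD(2)) auto
      then show "\<forall>\<^sub>F n in sequentially. \<forall>r\<in>{s..t}. dist (R (C r (u n r) + g r)) (R (C r (conv g r) + g r)) < e"
      proof (rule eventually_mono, intro ballI)
        fix n r assume n: "M * (c * (N * b / \<delta> * exp (- \<delta>) ^ n)) < e" and r: "r \<in> {s..t}"
        have "norm (C r (u n r - conv g r)) \<le> c * norm (u n r - conv g r)"
          by (intro C_bound subspace_diff[OF subX0] uX cX r)
        also have "\<dots> \<le> c * (N * b / \<delta> * exp (- \<delta>) ^ n)"
          using close[OF r, of n] c0 by (intro mult_left_mono) (auto simp: norm_minus_commute)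
        finally have "M * norm (C r (u n r - conv g r)) \<le> M * (c * (N * b / \<delta> * exp (- \<delta>) ^ n))"
          using M1 by (intro mult_left_mono) auto
        moreover have "R (C r (u n r) + g r) - R (C r (conv g r) + g r) = R (C r (u n r - conv g r))"
          using C_diff[OF uX[OF r] cX[OF r]] by (simp add: R.add R.diff)
        ultimately show "dist (R (C r (u n r) + g r)) (R (C r (conv g r) + g r)) < e"
          using R_bound[of "C r (u n r - conv g r)"] n by (simp add: dist_norm)
      qed
    qed
  qed
qed

end
end

section \<open>Solutions for inhomogeneities with values outside \<open>X0\<close>\<close>

context evolution
begin

text \<open>The limit that stands inside the next generation operator, without \<open>F\<close>: the
  factor \<open>\<mu> *\<^sub>R res \<mu>\<close> brings \<open>f s\<close> into \<open>X0\<close>,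
  where \<open>W\<close> is defined.\<close>

definition sol :: "(real \<Rightarrow> 'a) \<Rightarrow> real \<Rightarrow> 'a" where
  "sol f t = Lim at_top (\<lambda>\<mu>. integral {..t} (\<lambda>s. W t s (\<mu> *\<^sub>R res \<mu> (f s))))"

text \<open>
  The functions \<open>J \<mu> (f s)\<close> need not converge uniformly. For continuously differentiable \<open>f\<close> the
  difference of two approximate solutions is nevertheless small, since up to the small corrector
  \<open>R (J \<mu> (f s))\<close> it solves an equation whose inhomogeneity contains \<open>J \<mu>\<close> only behind \<open>R\<close>.
\<close>

lemma corrector_mild:
  assumes fe: "continuous_on UNIV fe" "continuous_on UNIV fe'"
    "\<And>r. r \<in> {s..t} \<Longrightarrow> (fe has_vector_derivative fe' r) (at r within {s..t})" and \<mu>: "\<mu> \<ge> \<mu>0"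
  shows "mild (\<lambda>r. R (J \<mu> (fe r))) (\<lambda>r. R (J \<mu> (fe' r - (w + 1) *\<^sub>R fe r)) + J \<mu> (fe r)) s t"
proof -
  have blJ: "bounded_linear (J \<mu>)" using \<mu>0(1)[OF \<mu>] by (rule bounded_linear_J)
  interpret J: bounded_linear "J \<mu>" by (rule blJ)
  have c: "continuous_on S fe" "continuous_on S fe'" for S
    using fe by (auto intro: continuous_on_subset)
  show ?thesis
    unfolding mild_def
  proof (intro conjI ballI)
    show "continuous_on {s..t} (\<lambda>r. R (J \<mu> (fe r)))" by (intro R.continuous_on J.continuous_on c)
    show "continuous_on {s..t} (\<lambda>r. R (J \<mu> (fe' r - (w + 1) *\<^sub>R fe r)) + J \<mu> (fe r))"
      by (intro continuous_intros R.continuous_on J.continuous_on c)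
    show "(\<lambda>r. R (J \<mu> (fe r))) ` {s..t} \<subseteq> X0" using R_in by auto
    fix r assume r: "r \<in> {s..t}"
    have "((\<lambda>r. R (R (J \<mu> (fe r)))) has_vector_derivative R (R (J \<mu> (fe' r)))) (at r within {s..t})"
      by (intro R.has_vector_derivative J.has_vector_derivative fe r)
    moreover have "R (R (J \<mu> (fe' r))) = (w + 1) *\<^sub>R R (R (J \<mu> (fe r))) - R (J \<mu> (fe r)) +
        R (R (J \<mu> (fe' r - (w + 1) *\<^sub>R fe r)) + J \<mu> (fe r))"
      by (simp add: R.add R.diff R.scaleR J.diff J.scaleR)
    ultimately show "((\<lambda>r. R (R (J \<mu> (fe r)))) has_vector_derivative (w + 1) *\<^sub>R R (R (J \<mu> (fe r))) - R (J \<mu> (fe r)) +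
        R (R (J \<mu> (fe' r - (w + 1) *\<^sub>R fe r)) + J \<mu> (fe r))) (at r within {s..t})" by simp
  qed
qed

end

lemma moving_integral_derivative:
  fixes f :: "real \<Rightarrow> 'a::banach"
  assumes f: "continuous_on UNIV f" and h: "h > 0" and r: "r \<in> {s..t}"
  shows "((\<lambda>r. integral {r..r + h} f) has_vector_derivative (f (r + h) - f r)) (at r within {s..t})"
proof -
  have c: "continuous_on S f" for S using f by (rule continuous_on_subset) auto
  have d1: "((\<lambda>u. integral {s..u} f) has_vector_derivative f r) (at r within {s..t})"
    by (rule integral_has_vector_derivative[OF c r])
  have "((\<lambda>u. integral {s..u} f) has_vector_derivative f (r + h)) (at (r + h) within {s..t + h})"
    by (rule integral_has_vector_derivative[OF c]) (use r h in auto)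
  then have "((\<lambda>u. integral {s..u} f) has_vector_derivative f (r + h)) (at (r + h) within (\<lambda>r. r + h) ` {s..t})"
    by (rule has_vector_derivative_within_subset) (use h in auto)
  moreover have "((\<lambda>r. r + h) has_vector_derivative 1) (at r within {s..t})"
    by (auto intro!: derivative_eq_intros)
  ultimately have d2: "((\<lambda>u. integral {s..u + h} f) has_vector_derivative f (r + h)) (at r within {s..t})"
    using vector_diff_chain_within[of "\<lambda>r. r + h" 1 r "{s..t}" "\<lambda>u. integral {s..u} f"] by (simp add: o_def)
  have "integral {u..u + h} f = integral {s..u + h} f - integral {s..u} f" if "u \<in> {s..t}" for u
    using Henstock_Kurzweil_Integration.integral_combine[of s u "u + h" f] integrable_continuous_real[OF c, of s "u + h"] that h
    by (auto simp: algebra_simps)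
  then show ?thesis
    by (intro has_vector_derivative_transform[OF r _ has_vector_derivative_diff[OF d2 d1]])
qed

lemma moving_average_close:
  fixes f :: "real \<Rightarrow> 'a::banach"
  assumes f: "continuous_on UNIV f" and h: "h > 0" and e: "\<And>q. q \<in> {r..r + h} \<Longrightarrow> norm (f q - x) \<le> e"
  shows "norm ((1 / h) *\<^sub>R integral {r..r + h} f - x) \<le> e"
proof -
  have c: "continuous_on S f" for S using f by (rule continuous_on_subset) auto
  have "((\<lambda>q. f q - x) has_integral (integral {r..r + h} f - h *\<^sub>R x)) (cbox r (r + h))"
    using has_integral_diff[OF integrable_integral[OF integrable_continuous_real[OF c, of r "r + h"]] has_integral_const_real[of x r "r + h"]] h
    by simp
  moreover have e0: "0 \<le> e" using order_trans[OF norm_ge_zero e[of r]] h by simp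
  ultimately have "norm (integral {r..r + h} f - h *\<^sub>R x) \<le> e * measure lborel (cbox r (r + h))"
    by (intro has_integral_bound[OF e0]) (use e in auto)
  then have "norm (integral {r..r + h} f - h *\<^sub>R x) / h \<le> e" using h by (simp add: pos_divide_le_eq)
  moreover have "(1 / h) *\<^sub>R integral {r..r + h} f - x = (1 / h) *\<^sub>R (integral {r..r + h} f - h *\<^sub>R x)"
    using h by (simp add: scaleR_diff_right)
  ultimately show ?thesis using h by simp
qed

context evolution
begin

context
  fixes f :: "real \<Rightarrow> 'a" and b :: real
  assumes fb: "\<And>t. norm (f t) \<le> b"
    and fu: "\<And>e. e > 0 \<Longrightarrow> \<exists>d>0. \<forall>s t. \<bar>s - t\<bar> < d \<longrightarrow> norm (f s - f t) \<le> e"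
begin

lemma f_continuous: "continuous_on S f"
  unfolding continuous_on_iff
proof (intro ballI allI impI)
  fix x and e :: real assume "e > 0"
  then obtain d where "d > 0" "\<forall>s t. \<bar>s - t\<bar> < d \<longrightarrow> norm (f s - f t) \<le> e / 2" using fu[of "e / 2"] by auto
  then show "\<exists>d>0. \<forall>y\<in>S. dist y x < d \<longrightarrow> dist (f y) (f x) < e"
    using \<open>e > 0\<close> by (intro exI[of _ d]) (force simp: dist_norm)
qed

lemma b_nonneg: "b \<ge> 0" using order_trans[OF norm_ge_zero fb] .

lemma conv_J:
  assumes \<mu>: "\<mu> \<ge> \<mu>0" and g: "continuous_on UNIV g" "\<And>t. norm (g t) \<le> b'"
  shows "entire (conv (\<lambda>s. J \<mu> (g s))) (\<lambda>s. J \<mu> (g s))" "norm (conv (\<lambda>s. J \<mu> (g s)) t) \<le> N * (2 * M * b') / \<delta>"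
proof -
  interpret J: bounded_linear "J \<mu>" using \<mu>0(1)[OF \<mu>] by (rule bounded_linear_J)
  have 1: "continuous_on UNIV (\<lambda>s. J \<mu> (g s))" by (intro J.continuous_on g)
  have 2: "J \<mu> (g s) \<in> X0" for s using J_in[OF \<mu>0(1)[OF \<mu>]] D_X0 by blast
  have 3: "norm (J \<mu> (g s)) \<le> 2 * M * b'" for s
    using J_bound[OF \<mu>, of "g s"] mult_left_mono[OF g(2)[of s], of "2 * M"] M1 by linarith
  show "entire (conv (\<lambda>s. J \<mu> (g s))) (\<lambda>s. J \<mu> (g s))" using 1 2 3 by (rule conv_entire)
  show "norm (conv (\<lambda>s. J \<mu> (g s)) t) \<le> N * (2 * M * b') / \<delta>" using 1 2 3 by (rule conv_bound)
qed

text \<open>\<open>f\<close> is only uniformly continuous, so the corrector is formed with a moving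
  average, at a cost that is small uniformly in \<open>\<mu>\<close>. The explicit factor matters
  only in that it does not depend on \<open>\<epsilon>\<close>, \<open>\<mu>\<close>,
  \<open>\<nu>\<close> and \<open>t\<close>.\<close>

lemma conv_J_cauchy:
  assumes \<epsilon>: "\<epsilon> > 0"
  shows "\<exists>\<mu>1\<ge>\<mu>0. \<forall>\<mu>\<ge>\<mu>1. \<forall>\<nu>\<ge>\<mu>1. \<forall>t.
    norm (conv (\<lambda>s. J \<mu> (f s)) t - conv (\<lambda>s. J \<nu> (f s)) t) \<le>
      \<epsilon> * (2 * (apriori * (2 * M)) + (apriori * (c * (2 * b) + 2 * (2 * b + \<bar>w + 1\<bar> * b)) + 2 * b))"
proof -
  obtain d where d: "d > 0" "\<And>s t. \<bar>s - t\<bar> < d \<Longrightarrow> norm (f s - f t) \<le> \<epsilon>" using fu[OF \<epsilon>] by blast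
  define h where "h = d / 2"
  have h: "h > 0" "h < d" using d by (auto simp: h_def)
  define fe where "fe r = (1 / h) *\<^sub>R integral {r..r + h} f" for r
  define fe' where "fe' r = (1 / h) *\<^sub>R (f (r + h) - f r)" for r
  have der: "(fe has_vector_derivative fe' r) (at r within {s..t})" if "r \<in> {s..t}" for r s t
    unfolding fe_def fe'_def
    using bounded_linear.has_vector_derivative[OF bounded_linear_scaleR_right moving_integral_derivative[OF f_continuous h(1) that]] .
  have cfe: "continuous_on UNIV fe"
  proof -
    have "isCont fe x" for x
    proof -
      have "continuous_on {x - 1..x + 1} fe"
        using der[of _ "x - 1" "x + 1"] by (meson continuous_on_eq_continuous_within has_vector_derivative_continuous)
      then show ?thesis by (rule continuous_on_interior) (simp add: interior_atLeastAtMost_real)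
    qed
    then show ?thesis by (auto intro!: continuous_at_imp_continuous_on)
  qed
  have cfe': "continuous_on UNIV fe'" unfolding fe'_def
    by (intro continuous_intros continuous_on_compose2[OF f_continuous] f_continuous) auto
  have close: "norm (fe r - f r) \<le> \<epsilon>" for r
    unfolding fe_def by (rule moving_average_close[OF f_continuous h(1)]) (use d(2) h in auto)
  have feb: "norm (fe r) \<le> b" for r
    using moving_average_close[OF f_continuous h(1), of r 0 b] fb by (simp add: fe_def)
  have feb': "norm (fe' r) \<le> 2 * b / h" for r
    using norm_triangle_ineq4[of "f (r + h)" "f r"] fb[of "r + h"] fb[of r] h
    by (simp add: fe'_def divide_right_mono)
  \<comment> \<open>The derivative of the average is bounded only by \<open>2 * b / h\<close>. The
    precision behind \<open>R\<close> must therefore also beat \<open>1 / h\<close>, which is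
    possible because \<open>h\<close> is fixed before \<open>\<mu>1\<close>.\<close>
  define \<kappa> where "\<kappa> = \<epsilon> * min 1 h"
  have \<kappa>: "\<kappa> > 0" "\<kappa> \<le> \<epsilon>" "\<kappa> / h \<le> \<epsilon>" using \<epsilon> h by (auto simp: \<kappa>_def pos_divide_le_eq mult_left_le)
  obtain \<mu>1 where \<mu>1: "\<mu>1 \<ge> \<mu>0" "\<And>\<mu> x. \<mu> \<ge> \<mu>1 \<Longrightarrow> norm (R (J \<mu> x) - R x) \<le> \<kappa> * norm x"
    using JR_small[OF \<kappa>(1)] by blast
  have JJ: "norm (R (J \<mu> x) - R (J \<nu> x)) \<le> 2 * \<kappa> * norm x" if "\<mu> \<ge> \<mu>1" "\<nu> \<ge> \<mu>1" for \<mu> \<nu> x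
    using \<mu>1(2)[OF that(1), of x] \<mu>1(2)[OF that(2), of x] norm_triangle_ineq4[of "R (J \<mu> x) - R x" "R (J \<nu> x) - R x"] by simp
  show ?thesis
  proof (intro exI[of _ \<mu>1] conjI allI impI \<mu>1(1))
    fix \<mu> \<nu> t assume \<mu>\<nu>: "\<mu> \<ge> \<mu>1" "\<nu> \<ge> \<mu>1"
    then have \<mu>\<nu>0: "\<mu> \<ge> \<mu>0" "\<nu> \<ge> \<mu>0" using \<mu>1(1) by auto
    define ww where "ww \<mu> = conv (\<lambda>s. J \<mu> (fe s))" for \<mu>
    have replace: "norm (conv (\<lambda>s. J \<mu> (f s)) t - ww \<mu> t) \<le> apriori * (2 * M * \<epsilon>)" if m: "\<mu> \<ge> \<mu>0" for \<mu> t
    proof (rule apriori_bound)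
      interpret J: bounded_linear "J \<mu>" using \<mu>0(1)[OF m] by (rule bounded_linear_J)
      show "entire (\<lambda>t. conv (\<lambda>s. J \<mu> (f s)) t - ww \<mu> t) (\<lambda>s. J \<mu> (f s) - J \<mu> (fe s))"
        unfolding ww_def by (rule entire_diff[OF conv_J(1)[OF m f_continuous fb] conv_J(1)[OF m cfe feb]])
      show "norm (conv (\<lambda>s. J \<mu> (f s)) t - ww \<mu> t) \<le> N * (2 * M * b) / \<delta> + N * (2 * M * b) / \<delta>" for t
        using norm_triangle_ineq4[of "conv (\<lambda>s. J \<mu> (f s)) t" "ww \<mu> t"] conv_J(2)[OF m f_continuous fb, of t] conv_J(2)[OF m cfe feb, of t]
        unfolding ww_def by linarith
      show "norm (J \<mu> (f t) - J \<mu> (fe t)) \<le> 2 * M * \<epsilon>" for t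
      proof -
        have "norm (J \<mu> (f t - fe t)) \<le> 2 * M * norm (f t - fe t)" by (rule J_bound[OF m])
        also have "\<dots> \<le> 2 * M * \<epsilon>" using close[of t] M1 by (intro mult_left_mono) (auto simp: norm_minus_commute)
        finally show ?thesis by (simp add: J.diff)
      qed
    qed
    define H where "H \<mu> r = R (J \<mu> (fe r))" for \<mu> r
    define G where "G \<mu> r = R (J \<mu> (fe' r - (w + 1) *\<^sub>R fe r)) + J \<mu> (fe r)" for \<mu> r
    have mH: "mild (H \<mu>) (G \<mu>) s t" if "\<mu> \<ge> \<mu>0" for \<mu> s t
      unfolding H_def G_def by (rule corrector_mild[OF cfe cfe' der that])
    have HX: "H \<mu> r \<in> X0" for \<mu> r unfolding H_def by (rule R_in)
    \<comment> \<open>The inhomogeneity of the corrected difference \<open>D\<close>. The terms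
      \<open>J \<mu> (fe r)\<close> and \<open>J \<nu> (fe r)\<close> have cancelled against those
      produced by the correctors, so every remaining \<open>J\<close> is preceded by
      \<open>R\<close>.\<close>
    define q where "q r = C r (H \<mu> r - H \<nu> r) - (R (J \<mu> (fe' r - (w + 1) *\<^sub>R fe r)) - R (J \<nu> (fe' r - (w + 1) *\<^sub>R fe r)))" for r
    define D where "D r = (ww \<mu> r - H \<mu> r) - (ww \<nu> r - H \<nu> r)" for r
    have eW: "entire (ww \<mu>) (\<lambda>s. J \<mu> (fe s))" if "\<mu> \<ge> \<mu>0" for \<mu> unfolding ww_def by (rule conv_J(1)[OF that cfe feb])
    have wX: "ww \<mu> r \<in> X0" if "\<mu> \<ge> \<mu>0" for \<mu> r using entire_in[OF eW[OF that]] .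
    have eD: "entire D q"
      unfolding entire_def
    proof (intro allI)
      fix s t
      have "mild D (\<lambda>r. (C r (ww \<mu> r) + J \<mu> (fe r) - G \<mu> r) - (C r (ww \<nu> r) + J \<nu> (fe r) - G \<nu> r)) s t"
        unfolding D_def by (intro mild_diff entireD[OF eW] mH \<mu>\<nu>0)
      then show "mild D (\<lambda>r. C r (D r) + q r) s t"
      proof (rule mild_cong)
        fix r
        have "C r (D r) = C r (ww \<mu> r) - C r (H \<mu> r) - (C r (ww \<nu> r) - C r (H \<nu> r))"
          unfolding D_def using wX[OF \<mu>\<nu>0(1)] wX[OF \<mu>\<nu>0(2)] HX by (simp add: C_diff subspace_diff[OF subX0])
        then show "(C r (ww \<mu> r) + J \<mu> (fe r) - G \<mu> r) - (C r (ww \<nu> r) + J \<nu> (fe r) - G \<nu> r) = C r (D r) + q r"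
          unfolding q_def G_def by (simp add: C_diff HX)
      qed simp
    qed
    have Hd: "norm (H \<mu> r - H \<nu> r) \<le> \<epsilon> * (2 * b)" for r
    proof -
      have "norm (H \<mu> r - H \<nu> r) \<le> 2 * \<kappa> * norm (fe r)" unfolding H_def by (rule JJ[OF \<mu>\<nu>])
      also have "\<dots> \<le> 2 * \<epsilon> * b" using \<kappa> \<epsilon> feb by (intro mult_mono) auto
      finally show ?thesis by simp
    qed
    have qb: "norm (q r) \<le> \<epsilon> * (c * (2 * b) + 2 * (2 * b + \<bar>w + 1\<bar> * b))" for r
    proof -
      have 1: "norm (C r (H \<mu> r - H \<nu> r)) \<le> c * (\<epsilon> * (2 * b))"
        using C_bound[OF subspace_diff[OF subX0 HX HX], of r \<mu> r \<nu> r] mult_left_mono[OF Hd[of r] c0] by linarith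
      have "norm (R (J \<mu> (fe' r - (w + 1) *\<^sub>R fe r)) - R (J \<nu> (fe' r - (w + 1) *\<^sub>R fe r))) \<le>
        2 * \<kappa> * norm (fe' r - (w + 1) *\<^sub>R fe r)" by (rule JJ[OF \<mu>\<nu>])
      also have "\<dots> \<le> 2 * \<kappa> * (2 * b / h + \<bar>w + 1\<bar> * b)"
        using \<kappa> feb' feb by (intro mult_left_mono order_trans[OF norm_triangle_ineq4] add_mono) (auto intro: mult_left_mono)
      also have "\<dots> = 2 * ((\<kappa> / h) * (2 * b) + \<kappa> * (\<bar>w + 1\<bar> * b))" by (simp add: algebra_simps)
      also have "\<dots> \<le> 2 * (\<epsilon> * (2 * b) + \<epsilon> * (\<bar>w + 1\<bar> * b))"
        using \<kappa> b_nonneg by (intro mult_left_mono add_mono mult_right_mono) auto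
      finally have 2: "norm (R (J \<mu> (fe' r - (w + 1) *\<^sub>R fe r)) - R (J \<nu> (fe' r - (w + 1) *\<^sub>R fe r))) \<le>
        2 * (\<epsilon> * (2 * b) + \<epsilon> * (\<bar>w + 1\<bar> * b))" .
      show ?thesis unfolding q_def using 1 2
        by (intro order_trans[OF norm_triangle_ineq4]) (simp add: algebra_simps)
    qed
    have Db: "norm (D r) \<le> 2 * (N * (2 * M * b) / \<delta>) + \<epsilon> * (2 * b)" for r
    proof -
      have e: "D r = (ww \<mu> r - ww \<nu> r) - (H \<mu> r - H \<nu> r)" by (simp add: D_def)
      define Z where "Z = N * (2 * M * b) / \<delta>"
      show ?thesis
        using norm_triangle_ineq4[of "ww \<mu> r - ww \<nu> r" "H \<mu> r - H \<nu> r"] norm_triangle_ineq4[of "ww \<mu> r" "ww \<nu> r"]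
          conv_J(2)[OF \<mu>\<nu>0(1) cfe feb, of r] conv_J(2)[OF \<mu>\<nu>0(2) cfe feb, of r] Hd[of r]
        unfolding e ww_def Z_def[symmetric] by linarith
    qed
    have Dt: "norm (D t) \<le> apriori * (\<epsilon> * (c * (2 * b) + 2 * (2 * b + \<bar>w + 1\<bar> * b)))"
      by (rule apriori_bound[OF eD Db qb])
    have "conv (\<lambda>s. J \<mu> (f s)) t - conv (\<lambda>s. J \<nu> (f s)) t =
       (conv (\<lambda>s. J \<mu> (f s)) t - ww \<mu> t) - (conv (\<lambda>s. J \<nu> (f s)) t - ww \<nu> t) + (D t + (H \<mu> t - H \<nu> t))"
      by (simp add: D_def)
    also have "norm \<dots> \<le> (apriori * (2 * M * \<epsilon>) + apriori * (2 * M * \<epsilon>)) +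
       (apriori * (\<epsilon> * (c * (2 * b) + 2 * (2 * b + \<bar>w + 1\<bar> * b))) + \<epsilon> * (2 * b))"
      by (intro order_trans[OF norm_triangle_ineq] add_mono order_trans[OF norm_triangle_ineq4] replace \<mu>\<nu>0 Dt Hd)
    finally show "norm (conv (\<lambda>s. J \<mu> (f s)) t - conv (\<lambda>s. J \<nu> (f s)) t) \<le>
      \<epsilon> * (2 * (apriori * (2 * M)) + (apriori * (c * (2 * b) + 2 * (2 * b + \<bar>w + 1\<bar> * b)) + 2 * b))"
      by (simp add: algebra_simps)
  qed
qed

lemma conv_J_cauchy':
  assumes "\<epsilon> > 0"
  shows "\<exists>\<mu>1\<ge>\<mu>0. \<forall>\<mu>\<ge>\<mu>1. \<forall>\<nu>\<ge>\<mu>1. \<forall>t. norm (conv (\<lambda>s. J \<mu> (f s)) t - conv (\<lambda>s. J \<nu> (f s)) t) \<le> \<epsilon>"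
proof -
  define L where "L = 2 * (apriori * (2 * M)) + (apriori * (c * (2 * b) + 2 * (2 * b + \<bar>w + 1\<bar> * b)) + 2 * b)"
  have "L \<ge> 0" unfolding L_def using apriori_nonneg M1 b_nonneg c0 by (intro add_nonneg_nonneg mult_nonneg_nonneg) auto
  then have "\<epsilon> / (L + 1) > 0" "\<epsilon> / (L + 1) * L \<le> \<epsilon>" using assms by (auto simp: field_simps)
  with conv_J_cauchy[of "\<epsilon> / (L + 1)"] show ?thesis unfolding L_def[symmetric] by (meson order_trans)
qed

text \<open>The Cauchy estimate is uniform in \<open>t\<close>. Completeness is used along the
  integers; the same estimate extends the limit to real \<open>\<mu>\<close>, and letting
  \<open>\<nu>\<close> tend to infinity makes the convergence uniform.\<close>

lemma sol_uniform:
  assumes "\<epsilon> > 0"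
  shows "\<exists>\<mu>1\<ge>\<mu>0. \<forall>\<mu>\<ge>\<mu>1. \<forall>t. norm (conv (\<lambda>s. J \<mu> (f s)) t - sol f t) \<le> \<epsilon>"
proof -
  define ww where "ww \<mu> t = conv (\<lambda>s. J \<mu> (f s)) t" for \<mu> t
  have cau: "\<exists>\<mu>1\<ge>\<mu>0. \<forall>\<mu>\<ge>\<mu>1. \<forall>\<nu>\<ge>\<mu>1. \<forall>t. norm (ww \<mu> t - ww \<nu> t) \<le> \<epsilon>" if "\<epsilon> > 0" for \<epsilon>
    using conv_J_cauchy'[OF that] by (simp add: ww_def)
  have "\<exists>y. ((\<lambda>\<mu>. ww \<mu> t) \<longlongrightarrow> y) at_top" for t
  proof -
    have "Cauchy (\<lambda>n. ww (real n) t)"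
    proof (rule metric_CauchyI)
      fix e :: real assume e: "e > 0"
      obtain \<mu>1 where \<mu>1: "\<And>\<mu> \<nu>. \<mu> \<ge> \<mu>1 \<Longrightarrow> \<nu> \<ge> \<mu>1 \<Longrightarrow> norm (ww \<mu> t - ww \<nu> t) \<le> e / 2" using cau[of "e / 2"] e by auto
      obtain n0 where "real n0 \<ge> \<mu>1" using real_arch_simple by blast
      then have "dist (ww (real m) t) (ww (real n) t) < e" if "m \<ge> n0" "n \<ge> n0" for m n
        using \<mu>1[of "real m" "real n"] that e by (simp add: dist_norm)
      then show "\<exists>n0. \<forall>m\<ge>n0. \<forall>n\<ge>n0. dist (ww (real m) t) (ww (real n) t) < e" by blast
    qed
    then obtain y where y: "(\<lambda>n. ww (real n) t) \<longlonglongrightarrow> y" by (auto simp: Cauchy_convergent_iff convergent_def)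
    have "((\<lambda>\<mu>. ww \<mu> t) \<longlongrightarrow> y) at_top"
    proof (rule tendstoI)
      fix e :: real assume e: "e > 0"
      obtain \<mu>1 where \<mu>1: "\<And>\<mu> \<nu>. \<mu> \<ge> \<mu>1 \<Longrightarrow> \<nu> \<ge> \<mu>1 \<Longrightarrow> norm (ww \<mu> t - ww \<nu> t) \<le> e / 2" using cau[of "e / 2"] e by auto
      have "eventually (\<lambda>n. dist (ww (real n) t) y < e / 2) sequentially" using tendstoD[OF y half_gt_zero[OF e]] .
      moreover have "eventually (\<lambda>n. real n \<ge> \<mu>1) sequentially"
        using filterlim_real_sequentially by (simp add: filterlim_at_top)
      ultimately have "eventually (\<lambda>n. dist (ww (real n) t) y < e / 2 \<and> real n \<ge> \<mu>1) sequentially"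
        by (rule eventually_conj)
      then obtain n where n: "dist (ww (real n) t) y < e / 2" "real n \<ge> \<mu>1"
        by (auto simp: eventually_sequentially)
      show "\<forall>\<^sub>F \<mu> in at_top. dist (ww \<mu> t) y < e"
        using eventually_ge_at_top[of \<mu>1]
      proof (rule eventually_mono)
        fix \<mu> assume "\<mu>1 \<le> \<mu>"
        then have "dist (ww \<mu> t) (ww (real n) t) \<le> e / 2" using \<mu>1[of \<mu> "real n"] n(2) by (simp add: dist_norm)
        then show "dist (ww \<mu> t) y < e" using n(1) dist_triangle[of "ww \<mu> t" y "ww (real n) t"] by linarith
      qed
    qed
    then show ?thesis ..
  qed
  then obtain y where y: "\<And>t. ((\<lambda>\<mu>. ww \<mu> t) \<longlongrightarrow> y t) at_top" by metis
  have "sol f t = y t" for t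
    using tendsto_Lim[OF _ y[of t]] by (simp add: sol_def ww_def conv_def J_def)
  then have lim: "((\<lambda>\<mu>. ww \<mu> t) \<longlongrightarrow> sol f t) at_top" for t using y by simp
  obtain \<mu>1 where \<mu>1: "\<mu>1 \<ge> \<mu>0" "\<And>\<mu> \<nu> t. \<mu> \<ge> \<mu>1 \<Longrightarrow> \<nu> \<ge> \<mu>1 \<Longrightarrow> norm (ww \<mu> t - ww \<nu> t) \<le> \<epsilon>" using cau[OF assms] by blast
  have "norm (ww \<mu> t - sol f t) \<le> \<epsilon>" if "\<mu> \<ge> \<mu>1" for \<mu> t
  proof (rule tendsto_upperbound)
    show "((\<lambda>\<nu>. norm (ww \<mu> t - ww \<nu> t)) \<longlongrightarrow> norm (ww \<mu> t - sol f t)) at_top" by (intro tendsto_intros lim)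
    show "\<forall>\<^sub>F \<nu> in at_top. norm (ww \<mu> t - ww \<nu> t) \<le> \<epsilon>"
      using eventually_ge_at_top[of \<mu>1] by (rule eventually_mono) (rule \<mu>1(2)[OF that])
  qed simp
  then show ?thesis using \<mu>1(1) unfolding ww_def by blast
qed

text \<open>\<open>J \<mu> (f r)\<close> need not converge to \<open>f r\<close>, but its image
  under \<open>R\<close> converges uniformly because \<open>f\<close> is bounded. Passing to the
  limit in the mild equation asks for no more.\<close>

theorem sol_entire: "entire (sol f) f"
  unfolding entire_def
proof (intro allI)
  fix s t
  define m where "m n = \<mu>0 + real n" for n
  have m0: "m n \<ge> \<mu>0" for n by (simp add: m_def)
  define u where "u n = conv (\<lambda>s. J (m n) (f s))" for n
  have eu: "entire (u n) (\<lambda>s. J (m n) (f s))" for n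
    unfolding u_def by (rule conv_J(1)[OF m0 f_continuous fb])
  have ev: "\<exists>n0. \<forall>n\<ge>n0. m n \<ge> x" for x
  proof -
    obtain n0 where "real n0 \<ge> x - \<mu>0" using real_arch_simple by blast
    then show ?thesis by (intro exI[of _ n0]) (auto simp: m_def)
  qed
  have ul: "uniform_limit S u (sol f) sequentially" for S
  proof (rule uniform_limitI)
    fix e :: real assume e: "e > 0"
    obtain \<mu>1 where "\<And>\<mu> t. \<mu> \<ge> \<mu>1 \<Longrightarrow> norm (conv (\<lambda>s. J \<mu> (f s)) t - sol f t) \<le> e / 2"
      using sol_uniform[of "e / 2"] e by auto
    moreover obtain n0 where "\<forall>n\<ge>n0. m n \<ge> \<mu>1" using ev by blast
    ultimately have half: "dist (u n x) (sol f x) \<le> e / 2" if "n \<ge> n0" for n x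
      using that unfolding u_def dist_norm by blast
    have "dist (u n x) (sol f x) < e" if "n \<ge> n0" for n x
    proof -
      have "dist (u n x) (sol f x) \<le> e / 2" using half that by blast
      then show ?thesis using e by simp
    qed
    then show "\<forall>\<^sub>F n in sequentially. \<forall>x\<in>S. dist (u n x) (sol f x) < e"
      unfolding eventually_sequentially by blast
  qed
  have sX: "sol f r \<in> X0" for r
    using closed_sequentially[OF closed_closure _ tendsto_uniform_limitI[OF ul[of UNIV] UNIV_I]] entire_in[OF eu] by blast
  have sc: "continuous_on {s..t} (sol f)"
    by (rule uniform_limit_theorem[OF _ ul]) (auto intro!: always_eventually mildD(1)[OF entireD[OF eu]])
  show "mild (sol f) (\<lambda>r. C r (sol f r) + f r) s t"
  proof (rule mild_limit[OF entireD[OF eu] ul])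
    show "continuous_on {s..t} (\<lambda>r. C r (sol f r) + f r)"
      by (intro continuous_intros C_continuous_on sc f_continuous) (use sX in auto)
    have l1: "uniform_limit {s..t} (\<lambda>n r. R (C r (u n r))) (\<lambda>r. R (C r (sol f r))) sequentially"
    proof (rule uniform_limitI)
      fix e :: real assume e: "e > 0"
      have Mc: "M * (c + 1) > 0" using M1 c0 by simp
      have "\<forall>\<^sub>F n in sequentially. \<forall>r\<in>{s..t}. dist (u n r) (sol f r) < e / (M * (c + 1))"
        using uniform_limitD[OF ul] e Mc by simp
      then show "\<forall>\<^sub>F n in sequentially. \<forall>r\<in>{s..t}. dist (R (C r (u n r))) (R (C r (sol f r))) < e"
      proof (rule eventually_mono, intro ballI)
        fix n r assume "\<forall>r\<in>{s..t}. dist (u n r) (sol f r) < e / (M * (c + 1))" "r \<in> {s..t}"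
        then have "norm (u n r - sol f r) * (M * (c + 1)) < e"
          using Mc by (simp add: dist_norm pos_less_divide_eq)
        moreover have "norm (R (C r (u n r - sol f r))) \<le> norm (u n r - sol f r) * (M * (c + 1))"
        proof -
          have "norm (C r (u n r - sol f r)) \<le> c * norm (u n r - sol f r)"
            by (intro C_bound subspace_diff[OF subX0] entire_in[OF eu] sX)
          also have "\<dots> \<le> (c + 1) * norm (u n r - sol f r)" by (intro mult_right_mono) auto
          finally have "M * norm (C r (u n r - sol f r)) \<le> M * ((c + 1) * norm (u n r - sol f r))"
            using M1 by (intro mult_left_mono) auto
          then show ?thesis using R_bound[of "C r (u n r - sol f r)"] by (simp add: mult_ac)
        qed
        ultimately show "dist (R (C r (u n r))) (R (C r (sol f r))) < e"
          using C_diff[OF entire_in[OF eu] sX, of r n r] by (simp add: dist_norm R.diff)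
      qed
    qed
    have l2: "uniform_limit {s..t} (\<lambda>n r. R (J (m n) (f r))) (\<lambda>r. R (f r)) sequentially"
    proof (rule uniform_limitI)
      fix e :: real assume e: "e > 0"
      define \<kappa> where "\<kappa> = e / (2 * (b + 1))"
      have \<kappa>: "\<kappa> > 0" "\<kappa> * b < e" using e b_nonneg by (auto simp: \<kappa>_def field_simps add_nonneg_pos)
      obtain \<mu>1 where \<mu>1: "\<And>\<mu> x. \<mu> \<ge> \<mu>1 \<Longrightarrow> norm (R (J \<mu> x) - R x) \<le> \<kappa> * norm x"
        using JR_small[OF \<kappa>(1)] by blast
      obtain n0 where n0: "\<forall>n\<ge>n0. m n \<ge> \<mu>1" using ev by blast
      have "dist (R (J (m n) (f r))) (R (f r)) < e" if "n \<ge> n0" for n r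
      proof -
        have "\<kappa> * norm (f r) \<le> \<kappa> * b" using \<kappa> by (intro mult_left_mono fb) auto
        moreover have "norm (R (J (m n) (f r)) - R (f r)) \<le> \<kappa> * norm (f r)" using \<mu>1 n0 that by blast
        ultimately show ?thesis using \<kappa>(2) by (simp only: dist_norm)
      qed
      then show "\<forall>\<^sub>F n in sequentially. \<forall>r\<in>{s..t}. dist (R (J (m n) (f r))) (R (f r)) < e"
        unfolding eventually_sequentially by blast
    qed
    show "uniform_limit {s..t} (\<lambda>n r. R (C r (u n r) + J (m n) (f r))) (\<lambda>r. R (C r (sol f r) + f r)) sequentially"
      unfolding R.add by (rule uniform_limit_add[OF l1 l2])
  qed
qed

theorem sol_bound: "norm (sol f t) \<le> apriori * b"
proof (rule apriori_bound[OF sol_entire _ fb])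
  obtain \<mu>1 where \<mu>1: "\<mu>1 \<ge> \<mu>0" "\<And>\<mu> t. \<mu> \<ge> \<mu>1 \<Longrightarrow> norm (conv (\<lambda>s. J \<mu> (f s)) t - sol f t) \<le> 1"
    using sol_uniform[of 1] by auto
  show "norm (sol f t) \<le> N * (2 * M * b) / \<delta> + 1" for t
    using \<mu>1(2)[OF order_refl, of t] conv_J(2)[OF \<mu>1(1) f_continuous fb, of t]
      norm_triangle_ineq4[of "conv (\<lambda>s. J \<mu>1 (f s)) t" "conv (\<lambda>s. J \<mu>1 (f s)) t - sol f t"] by simp
qed

end

section \<open>The solution operator on almost periodic inhomogeneities\<close>

lemma sol_ap_facts:
  assumes "ap f"
  obtains b where "\<And>t. norm (f t) \<le> b" "b \<ge> 0"
    "\<And>e. e > 0 \<Longrightarrow> \<exists>d>0. \<forall>s t. \<bar>s - t\<bar> < d \<longrightarrow> norm (f s - f t) \<le> e"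
proof -
  obtain b where b: "\<And>t. norm (f t) \<le> b" "b \<ge> 0" using ap_bounded[OF assms] by metis
  have "\<exists>d>0. \<forall>s t. \<bar>s - t\<bar> < d \<longrightarrow> norm (f s - f t) \<le> e" if "e > 0" for e
  proof -
    obtain d where "d > 0" "\<And>s t. \<bar>s - t\<bar> < d \<Longrightarrow> dist (f s) (f t) < e"
      using ap_dist_uniform[OF assms[unfolded ap_iff] \<open>e > 0\<close>] by metis
    then show ?thesis by (intro exI[of _ d]) (auto simp: dist_norm intro: less_imp_le)
  qed
  with b show ?thesis by (rule that)
qed

lemma ap_sol_entire: "ap f \<Longrightarrow> entire (sol f) f"
  by (erule sol_ap_facts) (rule sol_entire)

lemma ap_sol_bound: "ap f \<Longrightarrow> (\<And>t. norm (f t) \<le> b) \<Longrightarrow> norm (sol f t) \<le> apriori * b"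
  by (erule sol_ap_facts) (rule sol_bound)

lemma ap_sol_bounded: assumes "ap f" obtains B where "\<And>t. norm (sol f t) \<le> B" "B \<ge> 0"
proof -
  obtain b where "\<And>t. norm (f t) \<le> b" "b \<ge> 0" using ap_bounded[OF assms] by metis
  then show ?thesis using that[of "apriori * b"] ap_sol_bound[OF assms] apriori_nonneg by simp
qed

lemma sol_unique:
  assumes "ap f" "entire u f" "\<And>t. norm (u t) \<le> B" shows "u t = sol f t"
  using ap_sol_bounded[OF assms(1)] entire_unique[OF assms(2) ap_sol_entire[OF assms(1)] assms(3)] by metis

lemma sol_add: assumes "ap f" "ap g" shows "sol (\<lambda>t. f t + g t) t = sol f t + sol g t"
proof -
  obtain B1 B2 where B: "\<And>t. norm (sol f t) \<le> B1" "\<And>t. norm (sol g t) \<le> B2"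
    using ap_sol_bounded assms by metis
  have "norm (sol f t + sol g t) \<le> B1 + B2" for t using B[of t] norm_triangle_ineq[of "sol f t" "sol g t"] by linarith
  then show ?thesis using sol_unique[OF ap_add[OF assms] entire_add[OF ap_sol_entire[OF assms(1)] ap_sol_entire[OF assms(2)]]] by metis
qed

lemma sol_scale: assumes "ap f" shows "sol (\<lambda>t. a *\<^sub>R f t) t = a *\<^sub>R sol f t"
proof -
  obtain B where B: "\<And>t. norm (sol f t) \<le> B" using ap_sol_bounded assms by metis
  have "norm (a *\<^sub>R sol f t) \<le> \<bar>a\<bar> * B" for t using B[of t] by (simp add: mult_left_mono)
  then show ?thesis using sol_unique[OF ap_scaleR[OF assms] entire_scale[OF ap_sol_entire[OF assms]]] by metis
qed

lemma sol_pos: assumes "ap f" "\<And>t. f t \<in> P" shows "sol f t \<in> P"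
  using ap_sol_bounded[OF assms(1)] entire_pos[OF ap_sol_entire[OF assms(1)] _ assms(2)] by metis

text \<open>The translate of a solution solves an equation whose coefficient and inhomogeneity are translated.\<close>

theorem sol_ap:
  assumes \<rho>: "ap_dist \<rho>" "\<And>s t x. x \<in> X0 \<Longrightarrow> norm (C s x - C t x) \<le> \<rho> s t * norm x" and f: "ap f"
  obtains K where "\<And>\<tau> b t. (\<And>t. \<rho> (t + \<tau>) t + dist (f (t + \<tau>)) (f t) \<le> b) \<Longrightarrow> dist (sol f (t + \<tau>)) (sol f t) \<le> K * b"
proof -
  obtain B where B: "\<And>t. norm (sol f t) \<le> B" "B \<ge> 0" using ap_sol_bounded[OF f] by metis
  have e: "entire (sol f) f" by (rule ap_sol_entire[OF f])
  have "dist (sol f (t + \<tau>)) (sol f t) \<le> apriori * (B + 1) * b"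
    if b: "\<And>t. \<rho> (t + \<tau>) t + dist (f (t + \<tau>)) (f t) \<le> b" for \<tau> b t
  proof -
    define q where "q r = (C (r + \<tau>) (sol f (r + \<tau>)) - C r (sol f (r + \<tau>))) + (f (r + \<tau>) - f r)" for r
    have "entire (\<lambda>r. sol f (r + \<tau>) - sol f r) q"
      unfolding entire_def
    proof (intro allI)
      fix s t
      have "mild (\<lambda>r. sol f (r + \<tau>) - sol f r) (\<lambda>r. (C (r + \<tau>) (sol f (r + \<tau>)) + f (r + \<tau>)) - (C r (sol f r) + f r)) s t"
        by (intro mild_diff mild_shift entireD[OF e])
      then show "mild (\<lambda>r. sol f (r + \<tau>) - sol f r) (\<lambda>r. C r (sol f (r + \<tau>) - sol f r) + q r) s t"
        by (rule mild_cong) (simp_all add: q_def C_diff entire_in[OF e])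
    qed
    moreover have "norm (sol f (r + \<tau>) - sol f r) \<le> B + B" for r
      using norm_triangle_ineq4[of "sol f (r + \<tau>)" "sol f r"] B(1)[of r] B(1)[of "r + \<tau>"] by linarith
    moreover have "norm (q r) \<le> (B + 1) * b" for r
    proof -
      have \<rho>0: "\<rho> (r + \<tau>) r \<ge> 0" using \<rho>(1) pseudo_dist_nonneg by (auto simp: ap_dist_def)
      have \<rho>b: "\<rho> (r + \<tau>) r \<le> b" "dist (f (r + \<tau>)) (f r) \<le> b"
        using b[of r] \<rho>0 zero_le_dist[of "f (r + \<tau>)" "f r"] by linarith+
      have "norm (C (r + \<tau>) (sol f (r + \<tau>)) - C r (sol f (r + \<tau>))) \<le> \<rho> (r + \<tau>) r * norm (sol f (r + \<tau>))"
        by (rule \<rho>(2)[OF entire_in[OF e]])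
      also have "\<dots> \<le> b * B" using \<rho>b \<rho>0 B by (intro mult_mono) auto
      finally show ?thesis unfolding q_def using \<rho>b(2)
        by (intro order_trans[OF norm_triangle_ineq]) (simp add: dist_norm algebra_simps)
    qed
    ultimately have "norm (sol f (t + \<tau>) - sol f t) \<le> apriori * ((B + 1) * b)" by (rule apriori_bound)
    then show ?thesis by (simp add: dist_norm mult.assoc)
  qed
  then show ?thesis by (rule that)
qed

end

section \<open>Decomposition into positive elements\<close>

text \<open>The category part of the open mapping argument: the closure of some \<open>E n\<close>
  has interior points, and convexity and symmetry centre a ball at the origin. The decomposition
  holds up to an arbitrarily small error with a constant \<open>d\<close> independent of that error;
  this suffices wherever a bounded operator is applied afterwards.\<close>

lemma generating_cone_approx:
  fixes P :: "'a::banach set"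
  assumes P: "convex P" "cone P" and gen: "generating_cone UNIV P"
  obtains d where "d \<ge> 0" "\<And>x \<epsilon>. \<epsilon> > 0 \<Longrightarrow> \<exists>y\<in>P. \<exists>z\<in>P. norm y \<le> d * norm x \<and> norm z \<le> d * norm x \<and> norm (x - (y - z)) \<le> \<epsilon>"
proof -
  define E where "E n = {y - z | y z. y \<in> P \<and> z \<in> P \<and> norm y \<le> real n \<and> norm z \<le> real n}" for n :: nat
  have cov: "(\<Union>n. closure (E n)) = UNIV"
  proof (intro set_eqI iffI UNIV_I)
    fix x :: 'a
    have "x \<in> {x - y | x y. x \<in> P \<and> y \<in> P}" using gen by (simp add: generating_cone_def)
    then obtain y z where yz: "x = y - z" "y \<in> P" "z \<in> P" by blast
    obtain n where "max (norm y) (norm z) \<le> real n" using real_arch_simple by blast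
    then have "x \<in> E n" using yz by (auto simp: E_def)
    then show "x \<in> (\<Union>n. closure (E n))" using closure_subset by blast
  qed
  \<comment> \<open>Baire's theorem: countably many closed sets with empty interior cannot cover the
    Banach space.\<close>
  have "\<exists>n. interior (closure (E n)) \<noteq> {}"
  proof (rule ccontr)
    assume neg: "\<not> ?thesis"
    have "Met_TC.mtopology interior_of \<Union>(range (\<lambda>n. closure (E n))) = {}"
    proof (rule Met_TC.metric_Baire_category_alt)
      show "Met_TC.mcomplete TYPE('a)" by (simp add: complete_UNIV)
      show "countable (range (\<lambda>n. closure (E n)))" by simp
      show "closedin Met_TC.mtopology T \<and> Met_TC.mtopology interior_of T = {}" if "T \<in> range (\<lambda>n. closure (E n))" for T
        using that neg by (auto simp: interior_of_def interior_def)
    qed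
    then show False using cov by (simp add: interior_of_def) (metis open_UNIV UNIV_I empty_iff)
  qed
  then obtain n x0 where "x0 \<in> interior (closure (E n))" by blast
  then obtain r where r: "r > 0" "ball x0 r \<subseteq> closure (E n)" by (auto simp: mem_interior)
  have cE: "convex (E n)"
    unfolding convex_def
  proof (intro ballI allI impI)
    fix x y and u v :: real assume xy: "x \<in> E n" "y \<in> E n" and uv: "0 \<le> u" "0 \<le> v" "u + v = 1"
    obtain x1 x2 where x: "x = x1 - x2" "x1 \<in> P" "x2 \<in> P" "norm x1 \<le> real n" "norm x2 \<le> real n" using xy by (auto simp: E_def)
    obtain y1 y2 where y: "y = y1 - y2" "y1 \<in> P" "y2 \<in> P" "norm y1 \<le> real n" "norm y2 \<le> real n" using xy by (auto simp: E_def)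
    have P': "u *\<^sub>R p + v *\<^sub>R q \<in> P" if "p \<in> P" "q \<in> P" for p q using P(1) that uv by (simp add: convex_def)
    have n': "norm (u *\<^sub>R p + v *\<^sub>R q) \<le> real n" if "norm p \<le> real n" "norm q \<le> real n" for p q :: 'a
    proof -
      have "norm (u *\<^sub>R p + v *\<^sub>R q) \<le> u * norm p + v * norm q" using norm_triangle_ineq[of "u *\<^sub>R p" "v *\<^sub>R q"] uv by simp
      also have "\<dots> \<le> u * real n + v * real n" using that uv by (intro add_mono mult_left_mono)
      also have "\<dots> = real n" using uv(3) by (simp flip: distrib_right)
      finally show ?thesis .
    qed
    have "u *\<^sub>R x + v *\<^sub>R y = (u *\<^sub>R x1 + v *\<^sub>R y1) - (u *\<^sub>R x2 + v *\<^sub>R y2)" by (simp add: x y algebra_simps)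
    then show "u *\<^sub>R x + v *\<^sub>R y \<in> E n" unfolding E_def using P' n' x y by blast
  qed
  have sym: "- x \<in> closure (E n)" if "x \<in> closure (E n)" for x
  proof -
    have "uminus ` E n \<subseteq> E n" unfolding E_def by force
    have "- x \<in> uminus ` closure (E n)" using that by blast
    also have "\<dots> \<subseteq> closure (uminus ` E n)"
      by (rule closure_bounded_linear_image_subset[OF bounded_linear_minus[OF bounded_linear_ident]])
    also have "\<dots> \<subseteq> closure (E n)" by (rule closure_mono) fact
    finally show ?thesis .
  qed
  \<comment> \<open>\<open>v\<close> is the midpoint of \<open>x0 + v\<close> and the reflection of
    \<open>x0 - v\<close>.\<close>
  have ball: "v \<in> closure (E n)" if v: "norm v < r" for v
  proof -
    have a: "x0 + v \<in> closure (E n)" and b: "x0 - v \<in> closure (E n)" using r(2) v by (auto simp: dist_norm)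
    have "(1 / 2) *\<^sub>R (x0 + v) + (1 / 2) *\<^sub>R (- (x0 - v)) \<in> closure (E n)"
      by (rule convexD[OF convex_closure[OF cE] a sym[OF b]]) simp_all
    moreover have "(1 / 2) *\<^sub>R (x0 + v) + (1 / 2) *\<^sub>R (- (x0 - v)) = v"
      by (simp add: algebra_simps flip: scaleR_left_distrib)
    ultimately show ?thesis by simp
  qed
  show ?thesis
  proof (rule that)
    show "0 \<le> 2 * real n / r" using r by simp
    fix x :: 'a and \<epsilon> :: real assume \<epsilon>: "\<epsilon> > 0"
    show "\<exists>y\<in>P. \<exists>z\<in>P. norm y \<le> 2 * real n / r * norm x \<and> norm z \<le> 2 * real n / r * norm x \<and> norm (x - (y - z)) \<le> \<epsilon>"
    proof (cases "x = 0")
      case True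
      have "0 \<in> P" using cone_contains_0[OF P(2)] gen by (auto simp: generating_cone_def)
      then show ?thesis using True \<epsilon> by (intro bexI[of _ 0]) auto
    next
      case False
      \<comment> \<open>Scales \<open>x\<close> to norm \<open>r / 2\<close>, inside the ball;
        scaling back produces the factor \<open>2 * n / r\<close>.\<close>
      define s where "s = 2 * norm x / r"
      have s: "s > 0" using False r by (simp add: s_def)
      have "norm ((1 / s) *\<^sub>R x) < r" using False r by (simp add: s_def)
      then have "(1 / s) *\<^sub>R x \<in> closure (E n)" by (rule ball)
      then obtain e where e: "e \<in> E n" "dist e ((1 / s) *\<^sub>R x) < \<epsilon> / s"
        using s \<epsilon> unfolding closure_approachable by (meson divide_pos_pos)
      then obtain y z where yz: "e = y - z" "y \<in> P" "z \<in> P" "norm y \<le> real n" "norm z \<le> real n" by (auto simp: E_def)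
      have "x - (s *\<^sub>R y - s *\<^sub>R z) = s *\<^sub>R ((1 / s) *\<^sub>R x - e)" using s by (simp add: yz algebra_simps)
      then have "norm (x - (s *\<^sub>R y - s *\<^sub>R z)) = s * norm ((1 / s) *\<^sub>R x - e)" using s by simp
      also have "\<dots> \<le> s * (\<epsilon> / s)" using e(2) s by (intro mult_left_mono) (auto simp: dist_norm norm_minus_commute)
      finally have "norm (x - (s *\<^sub>R y - s *\<^sub>R z)) \<le> \<epsilon>" using s by simp
      moreover have "norm (s *\<^sub>R p) \<le> 2 * real n / r * norm x" if "norm p \<le> real n" for p :: 'a
      proof -
        have "norm (s *\<^sub>R p) = s * norm p" using s by simp
        also have "\<dots> \<le> s * real n" using that s by (intro mult_left_mono) auto
        also have "\<dots> = 2 * real n / r * norm x" by (simp add: s_def)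
        finally show ?thesis .
      qed
      moreover have "s *\<^sub>R y \<in> P" "s *\<^sub>R z \<in> P" using yz s P(2) by (auto simp: cone_def)
      ultimately show ?thesis using yz by blast
    qed
  qed
qed

text \<open>A partition of unity on the (totally bounded) range transports the decomposition to functions.\<close>

lemma ap_cone_approx:
  fixes P :: "'a::banach set" and f :: "real \<Rightarrow> 'a"
  assumes P: "convex P" "cone P" "0 \<in> P"
    and dec: "\<And>x \<epsilon>. \<epsilon> > 0 \<Longrightarrow> \<exists>y\<in>P. \<exists>z\<in>P. norm y \<le> d * norm x \<and> norm z \<le> d * norm x \<and> norm (x - (y - z)) \<le> \<epsilon>"
    and d: "d \<ge> 0" and f: "ap f" "\<And>t. norm (f t) \<le> b" and \<epsilon>: "\<epsilon> > 0"
  shows "\<exists>y z. ap y \<and> ap z \<and> (\<forall>t. y t \<in> P \<and> z t \<in> P \<and> norm (y t) \<le> d * b \<and> norm (z t) \<le> d * b \<and>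
    norm (f t - (y t - z t)) \<le> \<epsilon>)"
proof -
  define e where "e = \<epsilon> / 4"
  have e: "e > 0" using \<epsilon> by (simp add: e_def)
  obtain N where N: "finite N" "N \<noteq> {}" "\<And>a. \<exists>c\<in>N. \<forall>t. dist (f (t + a)) (f (t + c)) < e"
    using ap_dist_net[OF f(1)[unfolded ap_iff] e] by metis
  \<comment> \<open>Tent functions of the value \<open>f t\<close>. They vanish beyond distance
    \<open>2 * e\<close>, while net points lie within \<open>e\<close>, so the sum
    \<open>S t\<close> stays above \<open>e\<close> and can be used as a denominator.\<close>
  define \<rho> where "\<rho> c t = max 0 (2 * e - dist (f t) (f c))" for c t
  define S where "S t = (\<Sum>c\<in>N. \<rho> c t)" for t
  define l where "l c t = \<rho> c t / S t" for c t
  have \<rho>0: "\<rho> c t \<ge> 0" for c t by (simp add: \<rho>_def)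
  have Se: "S t \<ge> e" for t
  proof -
    obtain c where c: "c \<in> N" "\<forall>s. dist (f (s + t)) (f (s + c)) < e" using N(3) by blast
    from c(2) have "dist (f t) (f c) < e" by (metis add_0)
    then have "e \<le> \<rho> c t" by (simp add: \<rho>_def)
    also have "\<dots> \<le> S t" unfolding S_def by (rule member_le_sum) (use c \<rho>0 N in auto)
    finally show ?thesis .
  qed
  have S0: "S t > 0" for t using Se[of t] e by linarith
  have l0: "l c t \<ge> 0" for c t using \<rho>0[of c t] S0[of t] by (simp add: l_def)
  have l1: "(\<Sum>c\<in>N. l c t) = 1" for t using S0[of t] by (simp add: l_def S_def flip: sum_divide_distrib)
  have \<rho>L: "\<bar>\<rho> c s - \<rho> c t\<bar> \<le> dist (f s) (f t)" for c s t
    using dist_triangle[of "f s" "f c" "f t"] dist_triangle[of "f t" "f c" "f s"]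
    by (auto simp: \<rho>_def max_def dist_commute)
  define n where "n = real (card N)"
  have SL: "\<bar>S s - S t\<bar> \<le> n * dist (f s) (f t)" for s t
  proof -
    have "\<bar>S s - S t\<bar> \<le> (\<Sum>c\<in>N. \<bar>\<rho> c s - \<rho> c t\<bar>)" unfolding S_def by (simp flip: sum_subtractf)
    also have "\<dots> \<le> (\<Sum>c\<in>N. dist (f s) (f t))" by (intro sum_mono \<rho>L)
    finally show ?thesis by (simp add: n_def)
  qed
  \<comment> \<open>The weights are Lipschitz functions of the value of \<open>f\<close>, hence
    inherit its almost periods.\<close>
  have lL: "\<bar>l c s - l c t\<bar> \<le> (1 + n) / e * dist (f s) (f t)" if c: "c \<in> N" for c s t
  proof -
    have "l c s - l c t = (\<rho> c s - \<rho> c t) / S s + l c t * (S t - S s) / S s"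
      using S0[of s] S0[of t] by (simp add: l_def field_simps)
    then have "\<bar>l c s - l c t\<bar> \<le> \<bar>\<rho> c s - \<rho> c t\<bar> / S s + l c t * \<bar>S t - S s\<bar> / S s"
      using S0[of s] l0[of c t] by (metis abs_divide abs_mult abs_of_nonneg abs_of_pos abs_triangle_ineq)
    also have "\<dots> \<le> dist (f s) (f t) / e + 1 * (n * dist (f s) (f t)) / e"
    proof (intro add_mono frac_le mult_mono)
      show "l c t \<le> 1" using member_le_sum[of c N "\<lambda>c. l c t"] c N(1) l0 l1[of t] by simp
      show "\<bar>S t - S s\<bar> \<le> n * dist (f s) (f t)" using SL[of t s] by (simp add: dist_commute)
    qed (use \<rho>L Se e l0 n_def in auto)
    finally show ?thesis by (simp add: add_divide_distrib distrib_right distrib_left)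
  qed
  obtain y z where yz: "\<And>c. y c \<in> P" "\<And>c. z c \<in> P" "\<And>c. norm (y c) \<le> d * norm (f c)"
      "\<And>c. norm (z c) \<le> d * norm (f c)" "\<And>c. norm (f c - (y c - z c)) \<le> e"
  proof -
    have "\<forall>c. \<exists>y z. y \<in> P \<and> z \<in> P \<and> norm y \<le> d * norm (f c) \<and> norm z \<le> d * norm (f c) \<and> norm (f c - (y - z)) \<le> e"
      using dec[OF e] by blast
    then have "\<exists>y z. \<forall>c. y c \<in> P \<and> z c \<in> P \<and> norm (y c) \<le> d * norm (f c) \<and> norm (z c) \<le> d * norm (f c)
        \<and> norm (f c - (y c - z c)) \<le> e"
      by (simp only: choice_iff)
    then show ?thesis using that by blast
  qed
  have comb: "ap (\<lambda>t. \<Sum>c\<in>N. l c t *\<^sub>R v c) \<and> (\<forall>t. (\<Sum>c\<in>N. l c t *\<^sub>R v c) \<in> P \<and> norm (\<Sum>c\<in>N. l c t *\<^sub>R v c) \<le> d * b)"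
    if v: "\<And>c. v c \<in> P" "\<And>c. norm (v c) \<le> d * norm (f c)" for v
  proof (intro conjI allI)
    show "ap (\<lambda>t. \<Sum>c\<in>N. l c t *\<^sub>R v c)"
    proof (rule ap_transfer[OF f(1)[unfolded ap_iff]])
      fix \<tau> b' t assume b': "\<And>t. dist (f (t + \<tau>)) (f t) \<le> b'"
      have "dist (\<Sum>c\<in>N. l c (t + \<tau>) *\<^sub>R v c) (\<Sum>c\<in>N. l c t *\<^sub>R v c) = norm (\<Sum>c\<in>N. (l c (t + \<tau>) - l c t) *\<^sub>R v c)"
        by (simp add: dist_norm scaleR_diff_left sum_subtractf)
      also have "\<dots> \<le> (\<Sum>c\<in>N. \<bar>l c (t + \<tau>) - l c t\<bar> * norm (v c))"
        by (rule order_trans[OF norm_sum]) simp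
      also have "\<dots> \<le> (\<Sum>c\<in>N. ((1 + n) / e * b') * norm (v c))"
        using e n_def b'
        by (intro sum_mono mult_right_mono order_trans[OF lL] mult_left_mono) auto
      also have "\<dots> = (\<Sum>c\<in>N. (1 + n) / e * norm (v c)) * b'"
        unfolding sum_distrib_right by (rule sum.cong) (simp_all add: mult_ac)
      finally show "dist (\<Sum>c\<in>N. l c (t + \<tau>) *\<^sub>R v c) (\<Sum>c\<in>N. l c t *\<^sub>R v c) \<le> (\<Sum>c\<in>N. (1 + n) / e * norm (v c)) * b'" .
    qed
    fix t
    show "(\<Sum>c\<in>N. l c t *\<^sub>R v c) \<in> P" by (rule convex_sum[OF N(1) P(1) l1]) (use l0 v in auto)
    have "norm (\<Sum>c\<in>N. l c t *\<^sub>R v c) \<le> (\<Sum>c\<in>N. l c t * (d * b))"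
    proof (rule order_trans[OF norm_sum], rule sum_mono)
      fix c
      have "norm (v c) \<le> d * b" using v(2)[of c] mult_left_mono[OF f(2)[of c] d] by linarith
      then show "norm (l c t *\<^sub>R v c) \<le> l c t * (d * b)" using l0 by (simp add: mult_left_mono)
    qed
    also have "\<dots> = d * b" using l1[of t] by (simp flip: sum_distrib_right)
    finally show "norm (\<Sum>c\<in>N. l c t *\<^sub>R v c) \<le> d * b" .
  qed
  have err: "norm (f t - ((\<Sum>c\<in>N. l c t *\<^sub>R y c) - (\<Sum>c\<in>N. l c t *\<^sub>R z c))) \<le> \<epsilon>" for t
  proof -
    have "f t = (\<Sum>c\<in>N. l c t *\<^sub>R f t)" using l1[of t] by (simp flip: scaleR_left.sum)
    then have "f t - ((\<Sum>c\<in>N. l c t *\<^sub>R y c) - (\<Sum>c\<in>N. l c t *\<^sub>R z c)) = (\<Sum>c\<in>N. l c t *\<^sub>R (f t - (y c - z c)))"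
      by (simp add: scaleR_diff_right sum_subtractf)
    also have "norm \<dots> \<le> (\<Sum>c\<in>N. l c t * \<epsilon>)"
    proof (rule order_trans[OF norm_sum], rule sum_mono)
      fix c assume "c \<in> N"
      show "norm (l c t *\<^sub>R (f t - (y c - z c))) \<le> l c t * \<epsilon>"
      proof (cases "dist (f t) (f c) < 2 * e")
        \<comment> \<open>A nonzero weight forces \<open>f t\<close> within \<open>2 * e\<close> of
          \<open>f c\<close>; with the decomposition error \<open>e\<close> this is below
          \<open>\<epsilon> = 4 * e\<close>.\<close>
        case True
        have "f t - (y c - z c) = (f t - f c) + (f c - (y c - z c))" by simp
        then have "norm (f t - (y c - z c)) \<le> norm (f t - f c) + norm (f c - (y c - z c))"
          by (metis norm_triangle_ineq)
        also have "\<dots> \<le> \<epsilon>" using True yz(5)[of c] e by (simp add: dist_norm e_def)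
        finally show ?thesis using l0 by (simp add: mult_left_mono)
      next
        case False then show ?thesis by (simp add: l_def \<rho>_def)
      qed
    qed
    also have "\<dots> = \<epsilon>" using l1[of t] by (simp flip: sum_distrib_right)
    finally show ?thesis .
  qed
  show ?thesis
    using comb[OF yz(1,3)] comb[OF yz(2,4)] err
    by (intro exI[of _ "\<lambda>t. \<Sum>c\<in>N. l c t *\<^sub>R y c"] exI[of _ "\<lambda>t. \<Sum>c\<in>N. l c t *\<^sub>R z c"]) auto
qed

section \<open>Positive operators on a closed subspace\<close>

text \<open>A working form of the bound \<open>r(T) \<le> a\<close>. It is stronger in that the
  powers are of order \<open>a ^ n\<close> with the base \<open>a\<close> itself.\<close>

definition power_bounded_by :: "'b::real_normed_vector set \<Rightarrow> ('b \<Rightarrow> 'b) \<Rightarrow> real \<Rightarrow> bool" where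
  "power_bounded_by S T a \<longleftrightarrow> (\<exists>K. \<forall>n. \<forall>x\<in>S. norm ((T ^^ n) x) \<le> K * a ^ n * norm x)"

text \<open>Multiplication by \<open>z\<close> on the complexification. The product norm is only
  equivalent to a complex norm, which is where constants such as the \<open>4\<close> below come
  from.\<close>

definition cscale :: "complex \<Rightarrow> 'b::real_vector \<times> 'b \<Rightarrow> 'b \<times> 'b" where
  "cscale z p = (Re z *\<^sub>R fst p - Im z *\<^sub>R snd p, Im z *\<^sub>R fst p + Re z *\<^sub>R snd p)"

lemma cscale_mult: "cscale (y * z) p = cscale y (cscale z p)"
  by (simp add: cscale_def algebra_simps)

lemma cscale_one: "cscale 1 p = p" by (simp add: cscale_def)

lemma cscale_diff: "cscale z (p - q) = cscale z p - cscale z q"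
  and cscale_add: "cscale z (p + q) = cscale z p + cscale z q"
  and cscale_scaleR: "cscale z (r *\<^sub>R p) = r *\<^sub>R cscale z p"
  by (auto simp: cscale_def algebra_simps)

lemma norm_components_le: "norm (fst p) \<le> norm p" "norm (snd p) \<le> norm p"
  by (metis norm_fst_le norm_snd_le prod.collapse)+

lemma norm_pair_le: "norm p \<le> norm (fst p) + norm (snd p)"
  by (metis norm_Pair_le prod.collapse)

lemma norm_cscale: "norm (cscale z p) \<le> 4 * cmod z * norm p"
proof -
  have *: "norm (a *\<^sub>R x) \<le> cmod z * norm p" if "\<bar>a\<bar> \<le> cmod z" "norm x \<le> norm p" for a x
    using that by (auto intro: mult_mono)
  note n = norm_components_le[of p]
  have "norm (Re z *\<^sub>R fst p - Im z *\<^sub>R snd p) \<le> cmod z * norm p + cmod z * norm p"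
    by (intro order_trans[OF norm_triangle_ineq4] add_mono * n abs_Re_le_cmod abs_Im_le_cmod)
  moreover have "norm (Im z *\<^sub>R fst p + Re z *\<^sub>R snd p) \<le> cmod z * norm p + cmod z * norm p"
    by (intro order_trans[OF norm_triangle_ineq] add_mono * n abs_Re_le_cmod abs_Im_le_cmod)
  ultimately show ?thesis using norm_pair_le[of "cscale z p"] by (simp add: cscale_def)
qed

section \<open>Operators on a closed subspace and their complexified spectrum\<close>

locale closed_op =
  fixes S :: "'b::banach set" and T :: "'b \<Rightarrow> 'b" and B :: real
  assumes S: "subspace S" "closed S" and T_lin: "linear_op_on S T" and T_in: "\<And>x. x \<in> S \<Longrightarrow> T x \<in> S"
    and T_bound: "\<And>x. x \<in> S \<Longrightarrow> norm (T x) \<le> B * norm x" and B0: "B \<ge> 0"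
begin

lemma T_add: "x \<in> S \<Longrightarrow> y \<in> S \<Longrightarrow> T (x + y) = T x + T y"
  and T_scale: "x \<in> S \<Longrightarrow> T (c *\<^sub>R x) = c *\<^sub>R T x"
  using T_lin by (auto simp: linear_op_on_def)

lemma T_diff: "x \<in> S \<Longrightarrow> y \<in> S \<Longrightarrow> T (x - y) = T x - T y"
  using T_add[of x "-y"] T_scale[of y "-1"] subspace_neg[OF S(1), of y] by simp

lemma T_zero: "T 0 = 0" using T_scale[OF subspace_0[OF S(1)], of 0] by simp

lemma Tn_in: "x \<in> S \<Longrightarrow> (T ^^ n) x \<in> S" by (induction n) (auto intro: T_in)

lemma Tn_add: "x \<in> S \<Longrightarrow> y \<in> S \<Longrightarrow> (T ^^ n) (x + y) = (T ^^ n) x + (T ^^ n) y"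
  by (induction n) (auto simp: T_add Tn_in)

lemma Tn_scale: "x \<in> S \<Longrightarrow> (T ^^ n) (c *\<^sub>R x) = c *\<^sub>R (T ^^ n) x"
  by (induction n) (auto simp: T_scale Tn_in)

lemma Tn_diff: "x \<in> S \<Longrightarrow> y \<in> S \<Longrightarrow> (T ^^ n) (x - y) = (T ^^ n) x - (T ^^ n) y"
  by (induction n) (auto simp: T_diff Tn_in)

lemma Tn_bound: "x \<in> S \<Longrightarrow> norm ((T ^^ n) x) \<le> B ^ n * norm x"
proof (induction n)
  case (Suc n)
  have "norm (T ((T ^^ n) x)) \<le> B * norm ((T ^^ n) x)" by (rule T_bound[OF Tn_in[OF Suc.prems]])
  also have "\<dots> \<le> B * (B ^ n * norm x)" using Suc B0 by (intro mult_left_mono) auto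
  finally show ?case by simp
qed simp

definition TT where "TT p = (T (fst p), T (snd p))"

lemma TT_pow: "(TT ^^ n) p = ((T ^^ n) (fst p), (T ^^ n) (snd p))"
  by (induction n) (auto simp: TT_def)

lemma complex_shift_eq: "complex_shift T z p = cscale z p - TT p"
  by (cases p) (simp add: complex_shift_def cscale_def TT_def)

lemma SS: "subspace (S \<times> S)" "closed (S \<times> S)"
  using S by (auto intro: subspace_Times closed_Times)

lemma cscale_in: "p \<in> S \<times> S \<Longrightarrow> cscale z p \<in> S \<times> S"
  unfolding cscale_def by (auto intro!: subspace_diff[OF S(1)] subspace_add[OF S(1)] subspace_scale[OF S(1)])

lemma TT_in: "p \<in> S \<times> S \<Longrightarrow> TT p \<in> S \<times> S" unfolding TT_def by (auto intro: T_in)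

lemma TTn_in: "p \<in> S \<times> S \<Longrightarrow> (TT ^^ n) p \<in> S \<times> S" by (induction n) (auto simp del: mem_Times_iff intro: TT_in)

lemma TT_cscale: "p \<in> S \<times> S \<Longrightarrow> TT (cscale z p) = cscale z (TT p)"
  by (auto simp: TT_def cscale_def T_add T_diff T_scale subspace_scale[OF S(1)])

lemma TT_diff: "p \<in> S \<times> S \<Longrightarrow> q \<in> S \<times> S \<Longrightarrow> TT (p - q) = TT p - TT q"
  and TT_add: "p \<in> S \<times> S \<Longrightarrow> q \<in> S \<times> S \<Longrightarrow> TT (p + q) = TT p + TT q"
  and TT_scaleR: "p \<in> S \<times> S \<Longrightarrow> TT (r *\<^sub>R p) = r *\<^sub>R TT p"
  by (auto simp: TT_def T_add T_diff T_scale)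

lemma shift_diff: "p \<in> S \<times> S \<Longrightarrow> q \<in> S \<times> S \<Longrightarrow> complex_shift T z (p - q) = complex_shift T z p - complex_shift T z q"
  and shift_add: "p \<in> S \<times> S \<Longrightarrow> q \<in> S \<times> S \<Longrightarrow> complex_shift T z (p + q) = complex_shift T z p + complex_shift T z q"
  and shift_scaleR: "p \<in> S \<times> S \<Longrightarrow> complex_shift T z (r *\<^sub>R p) = r *\<^sub>R complex_shift T z p"
  by (simp_all add: complex_shift_eq cscale_diff cscale_add cscale_scaleR TT_diff TT_add TT_scaleR scaleR_diff_right)

lemma shift_in: "p \<in> S \<times> S \<Longrightarrow> complex_shift T z p \<in> S \<times> S"
  unfolding complex_shift_eq by (intro subspace_diff[OF SS(1)] cscale_in TT_in)

lemma shift_bound: "p \<in> S \<times> S \<Longrightarrow> norm (complex_shift T z p) \<le> (4 * cmod z + 2 * B) * norm p"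
proof -
  assume p: "p \<in> S \<times> S"
  have "norm (TT p) \<le> B * norm (fst p) + B * norm (snd p)"
    using p norm_pair_le[of "TT p"] T_bound[of "fst p"] T_bound[of "snd p"] by (auto simp: TT_def)
  also have "\<dots> \<le> B * norm p + B * norm p"
    using B0 by (intro add_mono mult_left_mono norm_components_le)
  finally show ?thesis
    unfolding complex_shift_eq using norm_triangle_ineq4[of "cscale z p" "TT p"] norm_cscale[of z p]
    by (simp add: algebra_simps)
qed

text \<open>The Neumann series \<open>G\<close>, carried out on pairs. The series gives surjectivity
  and the bound on the inverse; injectivity has its own argument, and linearity of the inverse is
  then read off from injectivity.\<close>

theorem power_bounded_not_spectrum:
  assumes pb: "power_bounded_by S T a" and a: "a > 0" and z: "cmod z > a"
  shows "z \<notin> spectrum_on S T"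
proof -
  obtain K0 where K0: "\<And>n x. x \<in> S \<Longrightarrow> norm ((T ^^ n) x) \<le> K0 * a ^ n * norm x"
    using pb by (auto simp: power_bounded_by_def)
  define K where "K = \<bar>K0\<bar>"
  have K: "norm ((T ^^ n) x) \<le> K * a ^ n * norm x" if "x \<in> S" for n x
  proof -
    have "K0 * (a ^ n * norm x) \<le> K * (a ^ n * norm x)" using a by (intro mult_right_mono) (auto simp: K_def)
    then show ?thesis using K0[OF that, of n] by (simp only: mult.assoc)
  qed
  have z0: "z \<noteq> 0" using z a by auto
  have TTn: "norm ((TT ^^ n) p) \<le> 2 * K * a ^ n * norm p" if "p \<in> S \<times> S" for n p
  proof -
    have "norm ((TT ^^ n) p) \<le> K * a ^ n * norm (fst p) + K * a ^ n * norm (snd p)"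
      using that norm_pair_le[of "(TT ^^ n) p"] K[of "fst p" n] K[of "snd p" n] by (auto simp: TT_pow)
    also have "\<dots> \<le> K * a ^ n * norm p + K * a ^ n * norm p"
      using a by (intro add_mono mult_left_mono) (auto simp: K_def norm_components_le)
    finally show ?thesis by (simp add: mult_ac)
  qed
  define q where "q = a / cmod z"
  have q: "q \<ge> 0" "q < 1" using a z by (auto simp: q_def divide_less_eq_1)
  define g where "g p n = cscale (inverse z ^ Suc n) ((TT ^^ n) p)" for p n
  define c where "c = 8 * K / cmod z"
  have c0: "c \<ge> 0" by (simp add: c_def K_def)
  have pw: "norm (cscale (inverse z ^ n) ((TT ^^ n) p)) \<le> 8 * K * q ^ n * norm p" if "p \<in> S \<times> S" for p n
  proof -
    have "norm (cscale (inverse z ^ n) ((TT ^^ n) p)) \<le> 4 * cmod (inverse z ^ n) * norm ((TT ^^ n) p)"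
      by (rule norm_cscale)
    also have "\<dots> \<le> 4 * cmod (inverse z ^ n) * (2 * K * a ^ n * norm p)" by (intro mult_left_mono TTn that) auto
    also have "\<dots> = 8 * K * q ^ n * norm p" by (simp add: q_def power_divide norm_power norm_inverse norm_divide power_inverse field_simps)
    finally show ?thesis .
  qed
  have gb: "norm (g p n) \<le> c * q ^ n * norm p" if "p \<in> S \<times> S" for p n
  proof -
    have "norm (g p n) \<le> 4 * cmod (inverse z ^ Suc n) * norm ((TT ^^ n) p)" unfolding g_def by (rule norm_cscale)
    also have "\<dots> \<le> 4 * cmod (inverse z ^ Suc n) * (2 * K * a ^ n * norm p)" by (intro mult_left_mono TTn that) auto
    also have "\<dots> = c * q ^ n * norm p" by (simp add: c_def q_def power_divide norm_mult norm_power norm_inverse norm_divide power_inverse field_simps)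
    finally show ?thesis .
  qed
  have gS: "g p n \<in> S \<times> S" if "p \<in> S \<times> S" for p n unfolding g_def by (intro cscale_in TTn_in that)
  have sg: "summable (\<lambda>n. c * q ^ n * norm p)" for p :: "'b \<times> 'b"
    using q by (intro summable_mult2 summable_mult summable_geometric) auto
  have sn: "summable (\<lambda>n. norm (g p n))" if "p \<in> S \<times> S" for p
    by (rule summable_comparison_test[OF _ sg]) (use gb[OF that] in auto)
  define G where "G p = (\<Sum>n. g p n)" for p
  have part: "(\<Sum>k<n. g p k) \<in> S \<times> S" if "p \<in> S \<times> S" for p n by (rule subspace_sum[OF SS(1)]) (rule gS[OF that])
  have Glim: "(\<lambda>n. \<Sum>k<n. g p k) \<longlonglongrightarrow> G p" if "p \<in> S \<times> S" for p
    unfolding G_def by (rule summable_LIMSEQ[OF summable_norm_cancel[OF sn[OF that]]])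
  have GS: "G p \<in> S \<times> S" if "p \<in> S \<times> S" for p
    using closed_sequentially[OF SS(2) _ Glim[OF that]] part[OF that] by blast
  have Gb: "norm (G p) \<le> c / (1 - q) * norm p" if "p \<in> S \<times> S" for p
  proof -
    have "norm (G p) \<le> (\<Sum>n. norm (g p n))" unfolding G_def by (rule summable_norm[OF sn[OF that]])
    also have "\<dots> \<le> (\<Sum>n. c * q ^ n * norm p)" by (rule suminf_le[OF gb[OF that] sn[OF that] sg])
    also have "\<dots> = c * (\<Sum>n. q ^ n) * norm p"
      using q by (simp add: suminf_mult suminf_mult2[symmetric] summable_geometric summable_mult)
    also have "\<dots> = c / (1 - q) * norm p" using q by (simp add: suminf_geometric)
    finally show ?thesis .
  qed
  have zz: "z * inverse z ^ Suc n = inverse z ^ n" for n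
  proof -
    have "z * inverse z ^ Suc n = (z * inverse z) * inverse z ^ n" by (simp only: power_Suc mult.assoc)
    then show ?thesis using z0 by simp
  qed
  have telescope: "complex_shift T z (\<Sum>k<n. g p k) = p - cscale (inverse z ^ n) ((TT ^^ n) p)" if p: "p \<in> S \<times> S" for p n
  proof (induction n)
    case 0 show ?case by (simp add: cscale_one complex_shift_eq TT_def cscale_def T_zero zero_prod_def)
  next
    case (Suc n)
    have "complex_shift T z (g p n) = cscale (inverse z ^ n) ((TT ^^ n) p) - cscale (inverse z ^ Suc n) ((TT ^^ Suc n) p)"
    proof -
      have "cscale z (g p n) = cscale (inverse z ^ n) ((TT ^^ n) p)"
        unfolding g_def cscale_mult[symmetric] zz ..
      then show ?thesis unfolding complex_shift_eq using TT_cscale[OF TTn_in[OF p]] by (simp add: g_def)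
    qed
    then show ?case using Suc shift_add[OF part[OF p] gS[OF p]] by simp
  qed
  have pw0: "(\<lambda>n. cscale (inverse z ^ n) ((TT ^^ n) p)) \<longlonglongrightarrow> 0" if "p \<in> S \<times> S" for p
  proof (rule Lim_null_comparison)
    show "\<forall>\<^sub>F n in sequentially. norm (cscale (inverse z ^ n) ((TT ^^ n) p)) \<le> 8 * K * q ^ n * norm p"
      using pw[OF that] by simp
    have "(\<lambda>n. 8 * K * q ^ n * norm p) \<longlonglongrightarrow> 8 * K * 0 * norm p"
      using q by (intro tendsto_intros LIMSEQ_power_zero) auto
    then show "(\<lambda>n. 8 * K * q ^ n * norm p) \<longlonglongrightarrow> 0" by simp
  qed
  have right: "complex_shift T z (G p) = p" if p: "p \<in> S \<times> S" for p
  proof -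
    have "(\<lambda>n. complex_shift T z (\<Sum>k<n. g p k) - complex_shift T z (G p)) \<longlonglongrightarrow> 0"
    proof (rule Lim_null_comparison)
      show "\<forall>\<^sub>F n in sequentially. norm (complex_shift T z (\<Sum>k<n. g p k) - complex_shift T z (G p)) \<le>
          (4 * cmod z + 2 * B) * norm ((\<Sum>k<n. g p k) - G p)"
        using shift_diff[OF part[OF p] GS[OF p]] shift_bound[OF subspace_diff[OF SS(1) part[OF p] GS[OF p]]] by simp
      have "(\<lambda>n. (4 * cmod z + 2 * B) * norm ((\<Sum>k<n. g p k) - G p)) \<longlonglongrightarrow> (4 * cmod z + 2 * B) * norm (G p - G p)"
        by (intro tendsto_intros Glim p)
      then show "(\<lambda>n. (4 * cmod z + 2 * B) * norm ((\<Sum>k<n. g p k) - G p)) \<longlonglongrightarrow> 0" by simp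
    qed
    moreover have "(\<lambda>n. complex_shift T z (\<Sum>k<n. g p k) - complex_shift T z (G p)) \<longlonglongrightarrow> p - 0 - complex_shift T z (G p)"
      unfolding telescope[OF p] by (intro tendsto_intros pw0 p)
    ultimately show ?thesis using LIMSEQ_unique by fastforce
  qed
  \<comment> \<open>On the kernel, \<open>p\<close> equals the \<open>n\<close>-th power of
    \<open>TT\<close> applied to \<open>p\<close> and divided by \<open>z ^ n\<close>, for every
    \<open>n\<close>; these vectors tend to zero.\<close>
  have zero: "p = 0" if p: "p \<in> S \<times> S" and e: "complex_shift T z p = 0" for p
  proof -
    have "cscale (inverse z ^ n) ((TT ^^ n) p) = p" for n
    proof (induction n)
      case (Suc n)
      have "TT p = cscale z p" using e by (simp add: complex_shift_eq)
      have "(TT ^^ Suc n) p = (TT ^^ n) (cscale z p)" using \<open>TT p = cscale z p\<close> by (simp add: funpow_swap1)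
      also have "\<dots> = cscale z ((TT ^^ n) p)"
        by (induction n) (use p TTn_in in \<open>auto simp: TT_cscale simp del: mem_Times_iff\<close>)
      finally have "cscale (inverse z ^ Suc n) ((TT ^^ Suc n) p) = cscale (inverse z ^ n) ((TT ^^ n) p)"
        using zz[of n] by (simp only: cscale_mult[symmetric] mult.commute)
      then show ?case using Suc by simp
    qed (simp add: cscale_one)
    then have "(\<lambda>n. p) \<longlonglongrightarrow> 0" using pw0[OF p] by simp
    then show ?thesis by (simp add: LIMSEQ_const_iff)
  qed
  have inj: "inj_on (complex_shift T z) (S \<times> S)"
  proof (rule inj_onI)
    fix p q assume pq: "p \<in> S \<times> S" "q \<in> S \<times> S" "complex_shift T z p = complex_shift T z q"
    have "p - q = 0"
    proof (rule zero)
      show "p - q \<in> S \<times> S" by (rule subspace_diff[OF SS(1) pq(1,2)])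
      show "complex_shift T z (p - q) = 0" unfolding shift_diff[OF pq(1,2)] pq(3) by simp
    qed
    then show "p = q" by simp
  qed
  have bij: "bij_betw (complex_shift T z) (S \<times> S) (S \<times> S)"
    unfolding bij_betw_def
  proof (intro conjI inj equalityI subsetI)
    fix p assume "p \<in> complex_shift T z ` (S \<times> S)"
    then show "p \<in> S \<times> S" using shift_in by blast
  next
    fix p assume p: "p \<in> S \<times> S"
    show "p \<in> complex_shift T z ` (S \<times> S)" using imageI[OF GS[OF p], of "complex_shift T z"] unfolding right[OF p] .
  qed
  have invG: "inv_into (S \<times> S) (complex_shift T z) p = G p" if "p \<in> S \<times> S" for p
    using inv_into_f_f[OF inj GS[OF that]] right[OF that] by simp
  have Gadd: "G (p + p') = G p + G p'" if "p \<in> S \<times> S" "p' \<in> S \<times> S" for p p'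
  proof (rule inj_onD[OF inj])
    note pp = subspace_add[OF SS(1) that]
    show "complex_shift T z (G (p + p')) = complex_shift T z (G p + G p')"
      by (simp only: right[OF pp] shift_add[OF GS[OF that(1)] GS[OF that(2)]] right[OF that(1)] right[OF that(2)])
    show "G (p + p') \<in> S \<times> S" by (rule GS[OF pp])
    show "G p + G p' \<in> S \<times> S" by (rule subspace_add[OF SS(1) GS[OF that(1)] GS[OF that(2)]])
  qed
  have Gscale: "G (r *\<^sub>R p) = r *\<^sub>R G p" if "p \<in> S \<times> S" for r p
  proof (rule inj_onD[OF inj])
    note pp = subspace_scale[OF SS(1) that]
    show "complex_shift T z (G (r *\<^sub>R p)) = complex_shift T z (r *\<^sub>R G p)"
      by (simp only: right[OF pp] shift_scaleR[OF GS[OF that]] right[OF that])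
    show "G (r *\<^sub>R p) \<in> S \<times> S" by (rule GS[OF pp])
    show "r *\<^sub>R G p \<in> S \<times> S" by (rule subspace_scale[OF SS(1) GS[OF that]])
  qed
  have "linear_op_on (S \<times> S) (inv_into (S \<times> S) (complex_shift T z))"
    unfolding linear_op_on_def
  proof (intro conjI ballI allI SS(1))
    fix p q assume pq: "p \<in> S \<times> S" "q \<in> S \<times> S"
    show "inv_into (S \<times> S) (complex_shift T z) (p + q) =
        inv_into (S \<times> S) (complex_shift T z) p + inv_into (S \<times> S) (complex_shift T z) q"
      by (simp only: invG[OF pq(1)] invG[OF pq(2)] invG[OF subspace_add[OF SS(1) pq]] Gadd[OF pq])
  next
    fix r p assume p: "p \<in> S \<times> S"
    show "inv_into (S \<times> S) (complex_shift T z) (r *\<^sub>R p) = r *\<^sub>R inv_into (S \<times> S) (complex_shift T z) p"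
      by (simp only: invG[OF p] invG[OF subspace_scale[OF SS(1) p]] Gscale[OF p])
  qed
  moreover have "\<exists>K. \<forall>p\<in>S \<times> S. norm (inv_into (S \<times> S) (complex_shift T z) p) \<le> K * norm p"
    using invG Gb by (intro exI[of _ "c / (1 - q)"]) simp
  ultimately show ?thesis using bij by (simp add: spectrum_on_def bounded_op_on_def)
qed

text \<open>What remains of the complex resolvent at a real point: unique solvability in
  \<open>S\<close> itself, with \<open>N\<close> bounding the inverse.\<close>

definition resolvable :: "real \<Rightarrow> real \<Rightarrow> bool" where
  "resolvable \<xi> N \<longleftrightarrow> (\<forall>f\<in>S. \<exists>!g. g \<in> S \<and> \<xi> *\<^sub>R g - T g = f) \<and> (\<forall>g\<in>S. norm g \<le> N * norm (\<xi> *\<^sub>R g - T g))"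

text \<open>At a real point the shift acts on both components separately, so the pairs with second
  component zero carry the real statement.\<close>

lemma not_spectrum_resolvable:
  assumes "complex_of_real \<xi> \<notin> spectrum_on S T" obtains N where "resolvable \<xi> N" "N \<ge> 0"
proof -
  let ?C = "complex_shift T (complex_of_real \<xi>)"
  have sh: "?C (x, y) = (\<xi> *\<^sub>R x - T x, \<xi> *\<^sub>R y - T y)" for x y by (simp add: complex_shift_def)
  have bij: "bij_betw ?C (S \<times> S) (S \<times> S)" and "bounded_op_on (S \<times> S) (inv_into (S \<times> S) ?C)"
    using assms by (auto simp: spectrum_on_def)
  then obtain K where K: "\<And>p. p \<in> S \<times> S \<Longrightarrow> norm (inv_into (S \<times> S) ?C p) \<le> K * norm p"
    by (auto simp: bounded_op_on_def)
  have inj: "inj_on ?C (S \<times> S)" using bij by (simp add: bij_betw_def)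
  have 0: "0 \<in> S" by (rule subspace_0[OF S(1)])
  have "resolvable \<xi> \<bar>K\<bar>"
    unfolding resolvable_def
  proof (intro conjI ballI)
    fix f assume f: "f \<in> S"
    have "(f, 0) \<in> ?C ` (S \<times> S)" using bij f 0 by (auto simp: bij_betw_def)
    then obtain x y where xy: "x \<in> S" "y \<in> S" "?C (x, y) = (f, 0)" by auto
    show "\<exists>!g. g \<in> S \<and> \<xi> *\<^sub>R g - T g = f"
    proof (rule ex1I[of _ x])
      show "x \<in> S \<and> \<xi> *\<^sub>R x - T x = f" using xy by (simp add: sh)
      fix g assume g: "g \<in> S \<and> \<xi> *\<^sub>R g - T g = f"
      have "(g, y) = (x, y)" by (rule inj_onD[OF inj]) (use g xy in \<open>auto simp: sh\<close>)
      then show "g = x" by simp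
    qed
  next
    fix g assume g: "g \<in> S"
    have "inv_into (S \<times> S) ?C (?C (g, 0)) = (g, 0)" by (rule inv_into_f_f[OF inj]) (use g 0 in auto)
    moreover have "?C (g, 0) \<in> S \<times> S" using shift_in[of "(g, 0)"] g 0 by blast
    ultimately have "norm (g, 0::'b) \<le> K * norm (?C (g, 0))" using K[of "?C (g, 0)"] by simp
    then have "norm g \<le> K * norm (\<xi> *\<^sub>R g - T g)" by (simp add: sh T_zero norm_Pair)
    also have "\<dots> \<le> \<bar>K\<bar> * norm (\<xi> *\<^sub>R g - T g)" by (simp add: mult_right_mono)
    finally show "norm g \<le> \<bar>K\<bar> * norm (\<xi> *\<^sub>R g - T g)" .
  qed
  then show ?thesis by (rule that) simp
qed

end

section \<open>Positivity of the resolvent at real points\<close>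

locale positive_op = closed_op S T B for S :: "'b::banach set" and T B +
  fixes Q :: "'b set" and cn cd :: real
  assumes Q_sub: "Q \<subseteq> S" and Q_closed: "closed Q" and Q_0: "0 \<in> Q"
    and Q_add: "\<And>x y. x \<in> Q \<Longrightarrow> y \<in> Q \<Longrightarrow> x + y \<in> Q"
    and Q_scale: "\<And>c x. c \<ge> 0 \<Longrightarrow> x \<in> Q \<Longrightarrow> c *\<^sub>R x \<in> Q"
    and T_pos: "\<And>x. x \<in> Q \<Longrightarrow> T x \<in> Q"
    and normal: "\<And>x y. x \<in> Q \<Longrightarrow> y - x \<in> Q \<Longrightarrow> norm x \<le> cn * norm y" and cn0: "cn \<ge> 0"
    and decomp: "\<And>x \<epsilon>. x \<in> S \<Longrightarrow> \<epsilon> > 0 \<Longrightarrow> \<exists>y\<in>Q. \<exists>z\<in>Q. norm y \<le> cd * norm x \<and> norm z \<le> cd * norm x \<and> norm (x - (y - z)) \<le> \<epsilon>"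
    and cd0: "cd \<ge> 0"
begin

lemma Q_in: "x \<in> Q \<Longrightarrow> x \<in> S" using Q_sub by blast

lemma Tn_pos: "x \<in> Q \<Longrightarrow> (T ^^ n) x \<in> Q" by (induction n) (auto intro: T_pos)

lemma Q_sum: "(\<And>i. i \<in> I \<Longrightarrow> f i \<in> Q) \<Longrightarrow> sum f I \<in> Q"
  by (induction I rule: infinite_finite_induct) (auto intro: Q_add Q_0)

text \<open>The error of the decomposition is magnified by \<open>B ^ n\<close>, which is harmless
  because \<open>n\<close> stays fixed while \<open>\<epsilon>\<close> tends to zero.\<close>

lemma bound_from_positive:
  assumes K: "\<And>x. x \<in> Q \<Longrightarrow> norm ((T ^^ n) x) \<le> K * norm x" and K0: "K \<ge> 0" and x: "x \<in> S"
  shows "norm ((T ^^ n) x) \<le> 2 * cd * K * norm x"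
proof (rule le_all_eps)
  fix \<epsilon> :: real assume e: "\<epsilon> > 0"
  obtain y z where yz: "y \<in> Q" "z \<in> Q" "norm y \<le> cd * norm x" "norm z \<le> cd * norm x" "norm (x - (y - z)) \<le> \<epsilon>"
    using decomp[OF x e] by blast
  have *: "norm ((T ^^ n) y) \<le> K * (cd * norm x)" if "y \<in> Q" "norm y \<le> cd * norm x" for y
    using K[OF that(1)] mult_left_mono[OF that(2) K0] by linarith
  have S': "y \<in> S" "z \<in> S" "y - z \<in> S" "x - (y - z) \<in> S" using yz x Q_in subspace_diff[OF S(1)] by auto
  have "x = (x - (y - z)) + (y - z)" by simp
  then have "(T ^^ n) x = (T ^^ n) (x - (y - z)) + ((T ^^ n) y - (T ^^ n) z)"
    using Tn_add[OF S'(4,3), of n] Tn_diff[OF S'(1,2), of n] by simp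
  also have "norm \<dots> \<le> norm ((T ^^ n) (x - (y - z))) + (norm ((T ^^ n) y) + norm ((T ^^ n) z))"
    by (intro order_trans[OF norm_triangle_ineq] add_mono order_refl norm_triangle_ineq4)
  also have "\<dots> \<le> B ^ n * \<epsilon> + (K * (cd * norm x) + K * (cd * norm x))"
  proof (intro add_mono * yz)
    have "norm ((T ^^ n) (x - (y - z))) \<le> B ^ n * norm (x - (y - z))" by (rule Tn_bound[OF S'(4)])
    also have "\<dots> \<le> B ^ n * \<epsilon>" using yz(5) B0 by (intro mult_left_mono) auto
    finally show "norm ((T ^^ n) (x - (y - z))) \<le> B ^ n * \<epsilon>" .
  qed
  finally show "norm ((T ^^ n) x) \<le> 2 * cd * K * norm x + \<epsilon> * B ^ n" by (simp add: algebra_simps)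
qed

lemma power_bounded_from_positive:
  assumes "\<And>n x. x \<in> Q \<Longrightarrow> norm ((T ^^ n) x) \<le> K * a ^ n * norm x" "K \<ge> 0" "a \<ge> 0"
  shows "power_bounded_by S T a"
  unfolding power_bounded_by_def
proof (intro exI[of _ "2 * cd * K"] allI ballI)
  fix n x assume "x \<in> S"
  then show "norm ((T ^^ n) x) \<le> 2 * cd * K * a ^ n * norm x"
    using bound_from_positive[of n "K * a ^ n" x] assms by (simp add: mult.assoc)
qed

text \<open>Positivity of the inverse of \<open>\<xi> - T\<close>, in a form that makes sense
  independently of invertibility.\<close>

definition pos_at :: "real \<Rightarrow> bool" where
  "pos_at \<xi> \<longleftrightarrow> (\<forall>g\<in>S. \<xi> *\<^sub>R g - T g \<in> Q \<longrightarrow> g \<in> Q)"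

lemma closed_limitI:
  assumes "\<And>n. v n \<in> Q" "\<And>n. norm (v n - g) \<le> c * q ^ n" "0 \<le> q" "q < 1" shows "g \<in> Q"
proof -
  have "(\<lambda>n. v n - g) \<longlonglongrightarrow> 0"
  proof (rule Lim_null_comparison)
    show "\<forall>\<^sub>F n in sequentially. norm (v n - g) \<le> c * q ^ n" using assms(2) by simp
    have "(\<lambda>n. c * q ^ n) \<longlonglongrightarrow> c * 0" using assms(3,4) by (intro tendsto_intros LIMSEQ_power_zero) auto
    then show "(\<lambda>n. c * q ^ n) \<longlonglongrightarrow> 0" by simp
  qed
  then have "v \<longlonglongrightarrow> g" by (simp add: LIM_zero_iff)
  then show ?thesis using closed_sequentially[OF Q_closed] assms(1) by blast
qed

lemma pos_at_large:
  assumes "\<xi> > B" shows "pos_at \<xi>"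
  unfolding pos_at_def
proof (intro ballI impI)
  fix g assume g: "g \<in> S" and f: "\<xi> *\<^sub>R g - T g \<in> Q"
  have \<xi>: "\<xi> > 0" using assms B0 by linarith
  define v where "v = rec_nat 0 (\<lambda>n x. (1 / \<xi>) *\<^sub>R ((\<xi> *\<^sub>R g - T g) + T x))"
  have v0: "v 0 = 0" and vS: "v (Suc n) = (1 / \<xi>) *\<^sub>R ((\<xi> *\<^sub>R g - T g) + T (v n))" for n by (auto simp: v_def)
  have vQ: "v n \<in> Q" for n
    by (induction n) (use \<xi> f in \<open>auto simp: v0 vS Q_0 intro!: Q_scale Q_add T_pos\<close>)
  have "norm (v n - g) \<le> norm g * (B / \<xi>) ^ n" for n
  proof (induction n)
    case (Suc n)
    have "v (Suc n) - g = (1 / \<xi>) *\<^sub>R T (v n - g)"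
      using \<xi> by (simp add: vS T_diff[OF Q_in[OF vQ] g] algebra_simps)
    then have "norm (v (Suc n) - g) \<le> (1 / \<xi>) * (B * norm (v n - g))"
      using T_bound[OF subspace_diff[OF S(1) Q_in[OF vQ] g], of n] \<xi> by (simp add: divide_right_mono)
    also have "\<dots> \<le> (1 / \<xi>) * (B * (norm g * (B / \<xi>) ^ n))" using Suc \<xi> B0 by (intro mult_left_mono) auto
    finally show ?case by (simp add: mult_ac)
  qed (simp add: v0)
  then show "g \<in> Q" using closed_limitI[of v g "norm g" "B / \<xi>"] vQ assms \<xi> B0 by auto
qed

text \<open>The expansion of the resolvent about \<open>\<xi>\<close>, run as a fixed point
  iteration. To the left of \<open>\<xi>\<close> its coefficients are the positive numbers
  \<open>\<eta> ^ n\<close>, so positivity is passed on in this direction.\<close>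

lemma pos_at_down:
  assumes p: "pos_at \<xi>" and r: "resolvable \<xi> N" and \<eta>: "\<eta> \<ge> 0" "N * \<eta> < 1" and N: "N \<ge> 0"
  shows "pos_at (\<xi> - \<eta>)"
  unfolding pos_at_def
proof (intro ballI impI)
  fix g assume g: "g \<in> S" and f: "(\<xi> - \<eta>) *\<^sub>R g - T g \<in> Q"
  define f where "f = (\<xi> - \<eta>) *\<^sub>R g - T g"
  have fQ: "f \<in> Q" using f by (simp add: f_def)
  have "\<forall>x\<in>S. \<exists>y\<in>S. \<xi> *\<^sub>R y - T y = f + \<eta> *\<^sub>R x"
    using r Q_in[OF fQ] subspace_add[OF S(1)] subspace_scale[OF S(1)] unfolding resolvable_def by (metis (no_types))
  then obtain Y where Y: "\<And>x. x \<in> S \<Longrightarrow> Y x \<in> S" "\<And>x. x \<in> S \<Longrightarrow> \<xi> *\<^sub>R Y x - T (Y x) = f + \<eta> *\<^sub>R x" by metis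
  define v where "v n = (Y ^^ n) 0" for n
  have v0: "v 0 = 0" and vS: "v (Suc n) = Y (v n)" for n by (auto simp: v_def)
  have vQ: "v n \<in> Q" for n
  proof (induction n)
    case (Suc n)
    have "\<xi> *\<^sub>R v (Suc n) - T (v (Suc n)) \<in> Q"
      unfolding vS Y(2)[OF Q_in[OF Suc]] using \<eta> Suc fQ by (intro Q_add Q_scale)
    then show ?case using p Y(1)[OF Q_in[OF Suc]] by (simp add: pos_at_def vS)
  qed (simp add: v0 Q_0)
  have "norm (v n - g) \<le> norm g * (N * \<eta>) ^ n" for n
  proof (induction n)
    case (Suc n)
    have i: "v (Suc n) \<in> S" "v n \<in> S" using Q_in[OF vQ] by auto
    have "norm (v (Suc n) - g) \<le> N * norm (\<xi> *\<^sub>R (v (Suc n) - g) - T (v (Suc n) - g))"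
      using r subspace_diff[OF S(1) i(1) g] by (simp add: resolvable_def)
    also have "\<xi> *\<^sub>R (v (Suc n) - g) - T (v (Suc n) - g) = \<eta> *\<^sub>R (v n - g)"
      unfolding T_diff[OF i(1) g] using Y(2)[OF i(2)] by (simp add: vS f_def algebra_simps)
    also have "N * norm (\<eta> *\<^sub>R (v n - g)) = N * \<eta> * norm (v n - g)" using \<eta> by simp
    also have "\<dots> \<le> N * \<eta> * (norm g * (N * \<eta>) ^ n)" using Suc N \<eta> by (intro mult_left_mono) auto
    finally show ?case by (simp add: mult_ac)
  qed (simp add: v0)
  then show "g \<in> Q" using closed_limitI[of v g "norm g" "N * \<eta>"] vQ \<eta> N by auto
qed

text \<open>The solution depends continuously on \<open>\<xi>\<close>, and the cone is
  closed.\<close>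

lemma pos_at_closed:
  assumes r: "resolvable \<xi> N" and N: "N \<ge> 0"
    and seq: "\<And>d. d > 0 \<Longrightarrow> \<exists>\<xi>'. \<bar>\<xi>' - \<xi>\<bar> < d \<and> pos_at \<xi>' \<and> (\<exists>N'. resolvable \<xi>' N')"
  shows "pos_at \<xi>"
  unfolding pos_at_def
proof (intro ballI impI)
  fix g assume g: "g \<in> S" and f: "\<xi> *\<^sub>R g - T g \<in> Q"
  have "\<exists>y\<in>Q. dist y g < e" if e: "e > 0" for e
  proof -
    \<comment> \<open>The first bound makes \<open>N * x \<le> 1 / 2\<close>, so that the unknown
      distance is absorbed; the second makes the remainder smaller than \<open>e\<close>.\<close>
    define d where "d = min (1 / (2 * N + 1)) (e / (2 * N * norm g + 1))"
    have p: "2 * N + 1 > 0" "2 * N * norm g + 1 > 0" using N by (auto intro: add_nonneg_pos)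
    have d: "d > 0" using e p by (simp add: d_def)
    obtain \<xi>' N' where \<xi>': "\<bar>\<xi>' - \<xi>\<bar> < d" "pos_at \<xi>'" "resolvable \<xi>' N'" using seq[OF d] by blast
    define x where "x = \<bar>\<xi>' - \<xi>\<bar>"
    have x: "x * (2 * N + 1) < 1" "x * (2 * N * norm g + 1) < e"
      using \<xi>'(1) p by (auto simp: d_def x_def pos_less_divide_eq)
    obtain y where y: "y \<in> S" "\<xi>' *\<^sub>R y - T y = \<xi> *\<^sub>R g - T g" using \<xi>'(3) Q_in[OF f] unfolding resolvable_def by blast
    have yQ: "y \<in> Q" using \<xi>'(2) y f by (simp add: pos_at_def)
    have "norm (y - g) \<le> N * norm (\<xi> *\<^sub>R (y - g) - T (y - g))"
      using r subspace_diff[OF S(1) y(1) g] by (simp add: resolvable_def)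
    also have "\<xi> *\<^sub>R (y - g) - T (y - g) = (\<xi> - \<xi>') *\<^sub>R y"
      using y(2) by (simp add: T_diff[OF y(1) g] algebra_simps)
    also have "N * norm ((\<xi> - \<xi>') *\<^sub>R y) = N * x * norm y" by (simp add: x_def abs_minus_commute)
    also have "\<dots> \<le> N * x * (norm (y - g) + norm g)"
      using N norm_triangle_ineq[of "y - g" g] by (intro mult_left_mono) (auto simp: x_def)
    finally have "norm (y - g) \<le> N * x * norm (y - g) + N * x * norm g" by (simp add: algebra_simps)
    moreover have "N * x \<le> 1 / 2" using x(1) N by (simp add: x_def algebra_simps)
    then have "N * x * norm (y - g) \<le> 1 / 2 * norm (y - g)" by (rule mult_right_mono) simp
    ultimately have "norm (y - g) \<le> 2 * (N * x * norm g)" by linarith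
    also have "\<dots> < e" using x(2) by (simp add: x_def algebra_simps)
    finally show ?thesis using yQ by (auto simp: dist_norm)
  qed
  then have "g \<in> closure Q" by (simp add: closure_approachable)
  then show "g \<in> Q" using Q_closed by (simp add: closure_closed)
qed

text \<open>Continuation from infinity: the half lines on which all inverses are positive can be
  extended to their end point and then further left, until \<open>\<xi>0\<close> is reached. Only
  real resolvent points are visited, which is how the rest of the spectrum is avoided.\<close>

lemma pos_at_all:
  assumes r: "\<And>\<xi>. \<xi> \<ge> \<xi>0 \<Longrightarrow> \<exists>N\<ge>0. resolvable \<xi> N" and "\<xi> \<ge> \<xi>0"
  shows "pos_at \<xi>"
proof -
  define I where "I = {x. x \<ge> \<xi>0 \<and> (\<forall>y\<ge>x. pos_at y)}"
  have ne: "max \<xi>0 (B + 1) \<in> I" using pos_at_large by (auto simp: I_def)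
  have bdd: "bdd_below I" by (rule bdd_belowI[of _ \<xi>0]) (auto simp: I_def)
  define m where "m = Inf I"
  have m: "m \<ge> \<xi>0" unfolding m_def by (rule cInf_greatest) (use ne in blast, simp add: I_def)
  have above: "pos_at y" if "y > m" for y
  proof -
    have "I \<noteq> {}" "Inf I < y" using ne that by (auto simp: m_def)
    then obtain x where "x \<in> I" "x < y" using cInf_less_iff[OF _ bdd, of y] by blast
    then show ?thesis unfolding I_def using less_imp_le by blast
  qed
  obtain N where N: "N \<ge> 0" "resolvable m N" using r[OF m] by blast
  have pm: "pos_at m"
  proof (rule pos_at_closed[OF N(2,1)])
    fix d :: real assume "d > 0"
    then show "\<exists>\<xi>'. \<bar>\<xi>' - m\<bar> < d \<and> pos_at \<xi>' \<and> (\<exists>N'. resolvable \<xi>' N')"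
      using above[of "m + d / 2"] r[of "m + d / 2"] m by (intro exI[of _ "m + d / 2"]) auto
  qed
  have "m = \<xi>0"
  proof (rule ccontr)
    assume "m \<noteq> \<xi>0"
    then have lt: "\<xi>0 < m" using m by simp
    \<comment> \<open>The step to the left must stay in the region above \<open>\<xi>0\<close> and
      satisfy \<open>N * \<eta> < 1\<close> for the expansion.\<close>
    define \<eta> where "\<eta> = min (m - \<xi>0) (1 / (N + 1))"
    have \<eta>: "\<eta> > 0" "\<eta> \<le> m - \<xi>0" using lt N by (auto simp: \<eta>_def)
    have "\<eta> * (N + 1) \<le> 1" using N by (simp add: \<eta>_def min_le_iff_disj pos_le_divide_eq flip: pos_le_divide_eq)
    then have N\<eta>: "N * \<eta> < 1" using \<eta> by (simp add: algebra_simps)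
    have "m - \<eta> \<in> I"
      unfolding I_def
    proof (intro CollectI conjI allI impI)
      show "\<xi>0 \<le> m - \<eta>" using \<eta> by simp
      fix y assume y: "m - \<eta> \<le> y"
      show "pos_at y"
      proof (cases "y > m")
        case False
        have "N * (m - y) \<le> N * \<eta>" using y N by (intro mult_left_mono) auto
        then have "pos_at (m - (m - y))" using False N\<eta> N by (intro pos_at_down[OF pm N(2)]) auto
        then show ?thesis by simp
      qed (rule above)
    qed
    then have "m \<le> m - \<eta>" unfolding m_def using bdd by (rule cInf_lower)
    then show False using \<eta> by simp
  qed
  then show ?thesis using above[of \<xi>] pm assms(2) by (cases "\<xi> = m") auto
qed

text \<open>A single term of the Neumann series lies below its sum. Convergence of the series is not
  presupposed: \<open>T g \<le> \<xi> g\<close> is iterated directly.\<close>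

lemma neumann_lower:
  assumes g: "g \<in> Q" "\<xi> *\<^sub>R g - T g = f" and f: "f \<in> Q" and \<xi>: "\<xi> > 0"
  shows "\<xi> ^ Suc n *\<^sub>R g - (T ^^ n) f \<in> Q"
proof -
  have main: "\<xi> ^ n *\<^sub>R g - (T ^^ n) g \<in> Q" for n
  proof (induction n)
    case (Suc n)
    have "(T ^^ n) (\<xi> *\<^sub>R g - T g) = \<xi> *\<^sub>R (T ^^ n) g - (T ^^ Suc n) g"
      using Tn_diff[of "\<xi> *\<^sub>R g" "T g" n] Tn_scale[OF Q_in[OF g(1)]] T_in[OF Q_in[OF g(1)]] subspace_scale[OF S(1) Q_in[OF g(1)]]
      by (simp add: funpow_swap1)
    then have "\<xi> ^ Suc n *\<^sub>R g - (T ^^ Suc n) g = \<xi> *\<^sub>R (\<xi> ^ n *\<^sub>R g - (T ^^ n) g) + (T ^^ n) f"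
      by (simp add: g(2)[symmetric] algebra_simps)
    then show ?case using Suc \<xi> Tn_pos[OF f] by (simp add: Q_add Q_scale)
  qed (simp add: Q_0)
  have "(T ^^ n) f = \<xi> *\<^sub>R (T ^^ n) g - (T ^^ Suc n) g"
    using Tn_diff[of "\<xi> *\<^sub>R g" "T g" n] Tn_scale[OF Q_in[OF g(1)]] T_in[OF Q_in[OF g(1)]] subspace_scale[OF S(1) Q_in[OF g(1)]]
    by (simp add: funpow_swap1 flip: g(2))
  then have "\<xi> ^ Suc n *\<^sub>R g - (T ^^ n) f = \<xi> *\<^sub>R (\<xi> ^ n *\<^sub>R g - (T ^^ n) g) + (T ^^ Suc n) g"
    by (simp add: algebra_simps)
  then show ?thesis using main[of n] \<xi> Tn_pos[OF g(1)] by (simp add: Q_add Q_scale del: funpow.simps)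
qed

text \<open>Normality turns the order bound of each Neumann term by the resolvent into a norm bound,
  valid with the base \<open>\<xi>\<close> itself.\<close>

theorem resolvable_power_bounded:
  assumes p: "pos_at \<xi>" and r: "resolvable \<xi> N" and N: "N \<ge> 0" and \<xi>: "\<xi> > 0"
  shows "power_bounded_by S T \<xi>"
proof (rule power_bounded_from_positive)
  show "0 \<le> cn * N * \<xi>" using cn0 N \<xi> by simp
  show "0 \<le> \<xi>" using \<xi> by simp
  fix n f assume f: "f \<in> Q"
  obtain g where g: "g \<in> S" "\<xi> *\<^sub>R g - T g = f" using r Q_in[OF f] unfolding resolvable_def by blast
  have gQ: "g \<in> Q" using p g f by (simp add: pos_at_def)
  have "norm ((T ^^ n) f) \<le> cn * norm (\<xi> ^ Suc n *\<^sub>R g)"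
    by (rule normal[OF Tn_pos[OF f] neumann_lower[OF gQ g(2) f \<xi>]])
  also have "\<dots> = cn * \<xi> ^ Suc n * norm g" using \<xi> by simp
  also have "\<dots> \<le> cn * \<xi> ^ Suc n * (N * norm f)"
    using r g cn0 \<xi> by (intro mult_left_mono) (auto simp: resolvable_def)
  finally show "norm ((T ^^ n) f) \<le> cn * N * \<xi> * \<xi> ^ n * norm f" by (simp add: mult_ac)
qed

text \<open>With \<open>Q = (1 - T)\<^sup>-\<^sup>1\<close> one has \<open>n T\<^sup>n \<le> Q\<^sup>2\<close>, so some power of \<open>T\<close> has norm less than one.\<close>

theorem resolvable_one_power_bounded:
  assumes p: "pos_at 1" and r: "resolvable 1 N" and N: "N \<ge> 0"
  obtains a where "0 < a" "a < 1" "power_bounded_by S T a"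
proof -
  obtain K0 where K0: "\<And>n x. x \<in> S \<Longrightarrow> norm ((T ^^ n) x) \<le> K0 * 1 ^ n * norm x"
    using resolvable_power_bounded[OF p r N] by (auto simp: power_bounded_by_def)
  define K where "K = \<bar>K0\<bar> + 1"
  have K: "norm ((T ^^ n) x) \<le> K * norm x" if "x \<in> S" for n x
  proof -
    have "K0 * norm x \<le> K * norm x" by (intro mult_right_mono) (auto simp: K_def)
    then show ?thesis using K0[OF that, of n] by simp
  qed
  have decay: "real n * norm ((T ^^ n) f) \<le> cn * N\<^sup>2 * norm f" if f: "f \<in> Q" for n f
  proof -
    obtain g where g: "g \<in> S" "1 *\<^sub>R g - T g = f" using r Q_in[OF f] unfolding resolvable_def by blast
    have gQ: "g \<in> Q" using p g f unfolding pos_at_def by metis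
    obtain h where h: "h \<in> S" "1 *\<^sub>R h - T h = g" using r Q_in[OF gQ] unfolding resolvable_def by blast
    have hQ: "h \<in> Q" using p h gQ unfolding pos_at_def by metis
    have low: "g - (T ^^ j) f \<in> Q" for j using neumann_lower[OF gQ g(2) f, of j] by simp
    \<comment> \<open>\<open>g\<close> dominates every iterate of \<open>f\<close>; applying
      \<open>T ^^ k\<close> to this for the exponent \<open>n - k\<close> gives the same lower bound
      \<open>(T ^^ n) f\<close> for all \<open>k \<le> n\<close>.\<close>
    have gk: "(T ^^ k) g - (T ^^ n) f \<in> Q" if "k \<le> n" for k
    proof -
      have "(T ^^ k) (g - (T ^^ (n - k)) f) \<in> Q" by (rule Tn_pos[OF low])
      moreover have "(T ^^ k) ((T ^^ (n - k)) f) = (T ^^ n) f" using that by (simp flip: funpow_add comp_apply[of "T ^^ k" "T ^^ (n - k)"])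
      ultimately show ?thesis using Tn_diff[OF g(1) Tn_in[OF Q_in[OF f]], of k "n - k"] by simp
    qed
    have hsum: "h = (\<Sum>k<m. (T ^^ k) g) + (T ^^ m) h" for m
    proof (induction m)
      case (Suc m)
      have "(T ^^ m) g = (T ^^ m) h - (T ^^ Suc m) h"
        using Tn_diff[OF h(1) T_in[OF h(1)], of m] h(2) by (simp add: funpow_swap1)
      then show ?case using Suc by simp
    qed simp
    have "h - real n *\<^sub>R (T ^^ n) f = (\<Sum>k<n. ((T ^^ k) g - (T ^^ n) f)) + (T ^^ n) h"
      by (subst hsum[of n]) (simp add: sum_subtractf scaleR_conv_of_real sum_constant_scaleR)
    then have "h - real n *\<^sub>R (T ^^ n) f \<in> Q" using gk Tn_pos[OF hQ] by (auto intro!: Q_add Q_sum)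
    then have "norm (real n *\<^sub>R (T ^^ n) f) \<le> cn * norm h"
      by (intro normal Q_scale Tn_pos f) auto
    also have "\<dots> \<le> cn * (N * (N * norm f))"
    proof -
      have "norm h \<le> N * norm g" "norm g \<le> N * norm f" using r g h unfolding resolvable_def by metis+
      then have "norm h \<le> N * (N * norm f)" using mult_left_mono[of "norm g" "N * norm f" N] N by linarith
      then show ?thesis using cn0 by (rule mult_left_mono)
    qed
    finally show ?thesis by (simp add: power2_eq_square mult_ac)
  qed
  \<comment> \<open>Makes \<open>2 * cd * cn * N\<^sup>2 / m\<close> at most one half; the factor
    \<open>2 * cd\<close> passes from the cone to all of \<open>S\<close>.\<close>
  obtain m where m: "real m > 4 * cd * (cn * N\<^sup>2) + 1" using reals_Archimedean2 by blast
  have m0: "m > 0" using m cd0 cn0 by (metis add_nonneg_pos mult_nonneg_nonneg of_nat_0_less_iff order.strict_trans zero_le_numeral zero_le_power2 zero_less_one)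
  have half: "norm ((T ^^ m) x) \<le> 1 / 2 * norm x" if x: "x \<in> S" for x
  proof -
    have "norm ((T ^^ m) f) \<le> (cn * N\<^sup>2 / real m) * norm f" if "f \<in> Q" for f
      using decay[OF that, of m] m0 by (simp add: field_simps)
    then have "norm ((T ^^ m) x) \<le> 2 * cd * (cn * N\<^sup>2 / real m) * norm x"
      by (rule bound_from_positive) (use cn0 x in auto)
    also have "\<dots> \<le> 1 / 2 * norm x"
      using m m0 by (intro mult_right_mono) (auto simp: field_simps)
    finally show ?thesis .
  qed
  \<comment> \<open>The base for which halving every \<open>m\<close> steps is the decay
    \<open>a ^ n\<close>. The remainder \<open>n mod m\<close> costs a factor of at most two, since
    \<open>a ^ (n mod m) \<ge> 1 / 2\<close>.\<close>
  define a where "a = root m (1 / 2)"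
  have a: "0 < a" "a < 1" "a ^ m = 1 / 2" using m0 by (auto simp: a_def)
  have pw: "norm ((T ^^ (m * j)) x) \<le> (1 / 2) ^ j * norm x" if "x \<in> S" for j x
  proof (induction j)
    case (Suc j)
    have "(T ^^ (m * Suc j)) x = (T ^^ m) ((T ^^ (m * j)) x)" by (simp add: funpow_add)
    then have "norm ((T ^^ (m * Suc j)) x) \<le> 1 / 2 * norm ((T ^^ (m * j)) x)" using half[OF Tn_in[OF that]] by simp
    then show ?case using Suc by simp
  qed simp
  have "power_bounded_by S T a"
    unfolding power_bounded_by_def
  proof (intro exI[of _ "2 * K"] allI ballI)
    fix n x assume x: "x \<in> S"
    have "(T ^^ n) x = (T ^^ (n mod m)) ((T ^^ (m * (n div m))) x)"
      by (metis add.commute comp_apply funpow_add mult_div_mod_eq)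
    then have "norm ((T ^^ n) x) \<le> K * norm ((T ^^ (m * (n div m))) x)" using K[OF Tn_in[OF x]] by simp
    also have "\<dots> \<le> K * ((1 / 2) ^ (n div m) * norm x)" using pw[OF x] by (intro mult_left_mono) (auto simp: K_def)
    moreover have "(1 / 2) ^ (n div m) \<le> 2 * a ^ n"
    proof -
      have e: "(1 / 2) ^ (n div m) = a ^ (m * (n div m))" by (simp add: a(3)[symmetric] power_mult)
      have "1 / 2 \<le> a ^ (n mod m)"
        unfolding a(3)[symmetric] using m0 a by (intro power_decreasing) (auto intro: less_imp_le)
      then have "1 \<le> 2 * a ^ (n mod m)" by simp
      then have "a ^ (m * (n div m)) * 1 \<le> a ^ (m * (n div m)) * (2 * a ^ (n mod m))" using a by (intro mult_left_mono) auto
      also have "\<dots> = 2 * a ^ n" by (simp flip: power_add)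
      finally show ?thesis unfolding e by simp
    qed
    then have "K * ((1 / 2) ^ (n div m) * norm x) \<le> K * (2 * a ^ n * norm x)"
      by (intro mult_left_mono mult_right_mono) (auto simp: K_def)
    ultimately show "norm ((T ^^ n) x) \<le> 2 * K * a ^ n * norm x" by (simp add: mult_ac)
  qed
  then show ?thesis using that a by blast
qed

lemma power_bounded_resolvable:
  assumes pb: "power_bounded_by S T a" and a: "0 < a" "a < 1"
  obtains N where "resolvable 1 N" "N \<ge> 0" "pos_at 1"
proof -
  have "complex_of_real 1 \<notin> spectrum_on S T"
    by (rule power_bounded_not_spectrum[OF pb a(1)]) (use a in simp)
  then obtain N where N: "resolvable 1 N" "N \<ge> 0" by (rule not_spectrum_resolvable)
  obtain K0 where K0: "\<And>n x. x \<in> S \<Longrightarrow> norm ((T ^^ n) x) \<le> K0 * a ^ n * norm x"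
    using pb by (auto simp: power_bounded_by_def)
  have "pos_at 1"
    unfolding pos_at_def
  proof (intro ballI impI)
    fix g assume g: "g \<in> S" and f: "1 *\<^sub>R g - T g \<in> Q"
    define v where "v n = (\<Sum>k<n. (T ^^ k) (1 *\<^sub>R g - T g))" for n
    have "v n = g - (T ^^ n) g" for n
      unfolding v_def
    proof (induction n)
      case (Suc n)
      then show ?case using Tn_diff[OF g T_in[OF g], of n] by (simp add: funpow_swap1)
    qed simp
    then have "norm (v n - g) \<le> (K0 * norm g) * a ^ n" for n using K0[OF g, of n] by (simp add: mult_ac)
    moreover have "v n \<in> Q" for n unfolding v_def by (intro Q_sum Tn_pos f)
    ultimately show "g \<in> Q" using closed_limitI[of v g "K0 * norm g" a] a by auto
  qed
  with N show ?thesis using that by blast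
qed

text \<open>For positive operators the real points of the spectrum determine the spectral radius.\<close>

theorem spectral_radius_less_one:
  "spectral_radius_on S T < 1 \<longleftrightarrow> (\<exists>a. 0 < a \<and> a < 1 \<and> power_bounded_by S T a)"
proof
  assume "spectral_radius_on S T < 1"
  then obtain a where a: "spectral_radius_on S T < ereal a" "ereal a < 1" using ereal_dense2 by blast
  \<comment> \<open>\<open>a\<close> need not be positive: an empty spectrum, as on a trivial space,
    has spectral radius \<open>- \<infinity>\<close>.\<close>
  define \<xi>0 where "\<xi>0 = max a (1 / 2)"
  have \<xi>0: "0 < \<xi>0" "\<xi>0 < 1" "a \<le> \<xi>0" using a(2) by (auto simp: \<xi>0_def)
  have r: "\<exists>N\<ge>0. resolvable \<xi> N" if "\<xi> \<ge> \<xi>0" for \<xi>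
  proof -
    have "complex_of_real \<xi> \<notin> spectrum_on S T"
    proof
      assume "complex_of_real \<xi> \<in> spectrum_on S T"
      then have "ereal (cmod (complex_of_real \<xi>)) \<le> spectral_radius_on S T" unfolding spectral_radius_on_def by (rule SUP_upper)
      also have "\<dots> < ereal a" by fact
      finally show False using that \<xi>0 by simp
    qed
    then show ?thesis using not_spectrum_resolvable by metis
  qed
  obtain N where N: "N \<ge> 0" "resolvable \<xi>0 N" using r by blast
  have "power_bounded_by S T \<xi>0"
    by (rule resolvable_power_bounded[OF pos_at_all[OF r order_refl] N(2,1) \<xi>0(1)])
  then show "\<exists>a. 0 < a \<and> a < 1 \<and> power_bounded_by S T a" using \<xi>0 by blast
next
  assume "\<exists>a. 0 < a \<and> a < 1 \<and> power_bounded_by S T a"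
  then obtain a where a: "0 < a" "a < 1" "power_bounded_by S T a" by blast
  have "spectral_radius_on S T \<le> ereal a"
    unfolding spectral_radius_on_def using power_bounded_not_spectrum[OF a(3,1)] by (force intro!: SUP_least)
  also have "\<dots> < 1" using a by simp
  finally show "spectral_radius_on S T < 1" .
qed

theorem spectral_radius_le_one:
  "spectral_radius_on S T \<le> 1 \<longleftrightarrow> (\<forall>a>1. power_bounded_by S T a)"
proof (intro iffI allI impI)
  fix a :: real assume sr: "spectral_radius_on S T \<le> 1" and a: "a > 1"
  have r: "\<exists>N\<ge>0. resolvable \<xi> N" if "\<xi> \<ge> a" for \<xi>
  proof -
    have "complex_of_real \<xi> \<notin> spectrum_on S T"
    proof
      assume "complex_of_real \<xi> \<in> spectrum_on S T"
      then have "ereal (cmod (complex_of_real \<xi>)) \<le> spectral_radius_on S T" unfolding spectral_radius_on_def by (rule SUP_upper)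
      also have "\<dots> \<le> 1" by fact
      finally show False using that a by simp
    qed
    then show ?thesis using not_spectrum_resolvable by metis
  qed
  obtain N where N: "N \<ge> 0" "resolvable a N" using r by blast
  show "power_bounded_by S T a"
    by (rule resolvable_power_bounded[OF pos_at_all[OF r order_refl] N(2,1)]) (use a in auto)
next
  assume pb: "\<forall>a>1. power_bounded_by S T a"
  show "spectral_radius_on S T \<le> 1"
    unfolding spectral_radius_on_def
  proof (rule SUP_least)
    fix z assume z: "z \<in> spectrum_on S T"
    have "cmod z \<le> a" if "a > 1" for a
      using power_bounded_not_spectrum[of a z] pb that z by force
    then have "cmod z \<le> 1" by (rule dense_ge)
    then show "ereal (cmod z) \<le> 1" by simp
  qed
qed

end

section \<open>Spaces of almost periodic functions and operator norms\<close>

lemma ap_periodic: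
  fixes f :: "real \<Rightarrow> 'a::metric_space"
  assumes c: "continuous_on UNIV f" and p: "\<And>t. f (t + T) = f t" and T: "T > 0"
  shows "ap f"
proof -
  have nat: "f (t + real n * T) = f t" for t n
  proof (induction n)
    case (Suc n)
    have "f (t + real (Suc n) * T) = f ((t + real n * T) + T)" by (simp add: algebra_simps)
    then show ?case using p Suc by simp
  qed simp
  have int: "f (t + of_int n * T) = f t" for t n
  proof (cases "n \<ge> 0")
    case True
    then show ?thesis using nat[of t "nat n"] by simp
  next
    case False
    have e: "(t + of_int n * T) + real (nat (- n)) * T = t" using False by (simp add: algebra_simps)
    show ?thesis using nat[of "t + of_int n * T" "nat (- n)"] unfolding e by simp
  qed
  have "((\<lambda>s. dist (f s) (f t)) \<longlongrightarrow> 0) (at t)" for t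
  proof -
    have "isCont f t" using c by (simp add: continuous_on_eq_continuous_at)
    then show ?thesis unfolding isCont_def by (subst (asm) tendsto_dist_iff)
  qed
  moreover have "relatively_dense (almost_periods dist f \<epsilon>)" if "\<epsilon> > 0" for \<epsilon>
    unfolding relatively_dense_def
  proof (intro exI[of _ T] conjI allI T)
    fix a
    define n where "n = \<lceil>a / T\<rceil>"
    have "a / T \<le> of_int n" "of_int n < a / T + 1" by (auto simp: n_def) linarith
    then have "a \<le> of_int n * T" "of_int n * T \<le> a + T" using T by (auto simp: field_simps)
    moreover have "of_int n * T \<in> almost_periods dist f \<epsilon>" using int that by (simp add: almost_periods_def)
    ultimately show "{a..a + T} \<inter> almost_periods dist f \<epsilon> \<noteq> {}" by auto
  qed
  ultimately show ?thesis by (simp add: almost_periodic_def)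
qed

lemma AP_iff: "\<phi> \<in> AP S \<longleftrightarrow> ap (apply_bcontfun \<phi>) \<and> (\<forall>t. apply_bcontfun \<phi> t \<in> S)"
  by (auto simp: AP_def)

lemma apply_Bcontfun_ap: "ap f \<Longrightarrow> apply_bcontfun (Bcontfun f) = f"
  by (rule Bcontfun_inverse[OF almost_periodic_bcontfun])

lemma subspace_AP: "subspace (AP (UNIV :: 'a::real_normed_vector set))"
  by (auto simp: subspace_def AP_iff intro: ap_const ap_add ap_scaleR)

lemma closed_AP: "closed (AP (UNIV :: 'a::real_normed_vector set))"
proof -
  have "\<phi> \<in> AP UNIV" if cl: "\<phi> \<in> closure (AP UNIV)" for \<phi> :: "real \<Rightarrow>\<^sub>C 'a"
  proof -
    have "ap (apply_bcontfun \<phi>)"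
    proof (rule ap_limit)
      fix \<epsilon> :: real assume "\<epsilon> > 0"
      then obtain \<psi> where "\<psi> \<in> AP UNIV" "dist \<psi> \<phi> < \<epsilon>" using cl unfolding closure_approachable by blast
      then show "\<exists>g. ap g \<and> (\<forall>t. dist (g t) (apply_bcontfun \<phi> t) \<le> \<epsilon>)"
        using dist_bounded[of \<psi> _ \<phi>] by (intro exI[of _ "apply_bcontfun \<psi>"]) (auto simp: AP_iff intro: order_trans less_imp_le)
    qed
    then show ?thesis by (simp add: AP_iff)
  qed
  then have "closure (AP (UNIV :: 'a set)) \<subseteq> AP UNIV" by blast
  then show ?thesis by (simp add: closure_subset_eq)
qed

lemma closed_AP_cone:
  assumes "closed (P :: 'a::real_normed_vector set)" shows "closed {\<phi> \<in> AP UNIV. \<forall>t. apply_bcontfun \<phi> t \<in> P}"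
proof -
  let ?Q = "{\<phi> \<in> AP UNIV. \<forall>t. apply_bcontfun \<phi> t \<in> P}"
  have "\<phi> \<in> ?Q" if \<phi>: "\<phi> \<in> closure ?Q" for \<phi>
  proof -
    have "\<phi> \<in> closure (AP UNIV)" using \<phi> closure_mono[of ?Q "AP UNIV"] by blast
    then have "\<phi> \<in> AP UNIV" by (simp add: closure_closed[OF closed_AP])
    moreover have "apply_bcontfun \<phi> t \<in> closure P" for t
      unfolding closure_approachable
    proof (intro allI impI)
      fix e :: real assume "e > 0"
      then obtain \<psi> where "\<psi> \<in> ?Q" "dist \<psi> \<phi> < e" using \<phi> unfolding closure_approachable by blast
      then show "\<exists>y\<in>P. dist y (apply_bcontfun \<phi> t) < e"
        using dist_bounded[of \<psi> t \<phi>] by (intro bexI[of _ "apply_bcontfun \<psi> t"]) auto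
    qed
    ultimately show ?thesis using assms by (simp add: closure_closed)
  qed
  then have "closure ?Q \<subseteq> ?Q" by blast
  then show ?thesis by (simp add: closure_subset_eq)
qed

section \<open>Operator norms on a subspace\<close>

lemma onorm_on_bdd:
  assumes "\<And>x. x \<in> S \<Longrightarrow> norm (T x) \<le> K * norm x"
  shows "bdd_above ((\<lambda>x. norm (T x) / norm x) ` S)"
proof (rule bdd_aboveI2)
  fix x assume x: "x \<in> S"
  have "K * norm x \<le> \<bar>K\<bar> * norm x" by (intro mult_right_mono) auto
  then have "norm (T x) \<le> \<bar>K\<bar> * norm x" using assms[OF x] by linarith
  then show "norm (T x) / norm x \<le> \<bar>K\<bar>" by (cases "x = 0") (auto simp: pos_divide_le_eq)
qed

text \<open>Some bound has to be known beforehand, as the real supremum of an unbounded set is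
  unspecified.\<close>

lemma onorm_on_bound:
  assumes "\<And>x. x \<in> S \<Longrightarrow> norm (T x) \<le> K * norm x" and x: "x \<in> S"
  shows "norm (T x) \<le> onorm_on S T * norm x"
proof (cases "x = 0")
  case True then show ?thesis using assms(1)[OF x] by simp
next
  case False
  have "norm (T x) / norm x \<le> onorm_on S T"
    unfolding onorm_on_def by (rule cSUP_upper[OF x onorm_on_bdd[OF assms(1)]])
  then show ?thesis using False by (simp add: pos_divide_le_eq)
qed

lemma onorm_on_le:
  assumes "\<And>x. x \<in> S \<Longrightarrow> norm (T x) \<le> K * norm x" and "K \<ge> 0" "S \<noteq> {}"
  shows "onorm_on S T \<le> K"
  unfolding onorm_on_def
proof (rule cSUP_least[OF assms(3)])
  fix x assume "x \<in> S"
  then show "norm (T x) / norm x \<le> K" using assms(1)[of x] assms(2) by (cases "x = 0") (auto simp: pos_divide_le_eq)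
qed

lemma bounded_op_onD:
  assumes "bounded_op_on S T"
  obtains K where "K \<ge> 0" "\<And>x. x \<in> S \<Longrightarrow> norm (T x) \<le> K * norm x"
proof -
  obtain K where "\<And>x. x \<in> S \<Longrightarrow> norm (T x) \<le> K * norm x" using assms by (auto simp: bounded_op_on_def)
  then have "norm (T x) \<le> \<bar>K\<bar> * norm x" if "x \<in> S" for x
  proof -
    have "K * norm x \<le> \<bar>K\<bar> * norm x" by (intro mult_right_mono) auto
    then show ?thesis using \<open>\<And>x. x \<in> S \<Longrightarrow> norm (T x) \<le> K * norm x\<close>[OF that] by linarith
  qed
  then show ?thesis by (intro that[of "\<bar>K\<bar>"]) auto
qed

lemma op_dist_on_bound:
  assumes "bounded_op_on S T1" "bounded_op_on S T2" "x \<in> S"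
  shows "norm (T1 x - T2 x) \<le> op_dist_on S T1 T2 * norm x"
proof -
  obtain K1 where K1: "\<And>x. x \<in> S \<Longrightarrow> norm (T1 x) \<le> K1 * norm x" using bounded_op_onD[OF assms(1)] by metis
  obtain K2 where K2: "\<And>x. x \<in> S \<Longrightarrow> norm (T2 x) \<le> K2 * norm x" using bounded_op_onD[OF assms(2)] by metis
  have "norm (T1 x - T2 x) \<le> (K1 + K2) * norm x" if "x \<in> S" for x
    using norm_triangle_ineq4[of "T1 x" "T2 x"] K1[OF that] K2[OF that] by (simp add: algebra_simps)
  then show ?thesis unfolding op_dist_on_def by (rule onorm_on_bound[OF _ assms(3)])
qed

lemma op_dist_on_nonneg:
  assumes "bounded_op_on S T1" "bounded_op_on S T2" shows "op_dist_on S T1 T2 \<ge> 0"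
proof -
  have 0: "0 \<in> S" using assms by (auto simp: bounded_op_on_def linear_op_on_def subspace_0)
  obtain K1 where K1: "\<And>x. x \<in> S \<Longrightarrow> norm (T1 x) \<le> K1 * norm x" using bounded_op_onD[OF assms(1)] by metis
  obtain K2 where K2: "\<And>x. x \<in> S \<Longrightarrow> norm (T2 x) \<le> K2 * norm x" using bounded_op_onD[OF assms(2)] by metis
  have "norm (T1 x - T2 x) \<le> (K1 + K2) * norm x" if "x \<in> S" for x
    using norm_triangle_ineq4[of "T1 x" "T2 x"] K1[OF that] K2[OF that] by (simp add: algebra_simps)
  from cSUP_upper[OF 0 onorm_on_bdd[OF this]] show ?thesis by (simp add: op_dist_on_def onorm_on_def)
qed

lemma pseudo_dist_op_dist:
  assumes "\<And>t. bounded_op_on S (F t)" shows "pseudo_dist (\<lambda>s t. op_dist_on S (F s) (F t))"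
proof -
  have ne: "S \<noteq> {}" using assms[of 0] subspace_0 by (auto simp: bounded_op_on_def linear_op_on_def)
  have le: "op_dist_on S T1 T2 \<le> K" if "\<And>x. x \<in> S \<Longrightarrow> norm (T1 x - T2 x) \<le> K * norm x" "K \<ge> 0" for T1 T2 K
    unfolding op_dist_on_def using that ne by (intro onorm_on_le)
  show ?thesis
    unfolding pseudo_dist_def
  proof (intro conjI allI)
    fix r s t
    show "op_dist_on S (F t) (F t) = 0" using ne by (simp add: op_dist_on_def onorm_on_def)
    show "op_dist_on S (F s) (F t) = op_dist_on S (F t) (F s)" by (simp add: op_dist_on_def onorm_on_def norm_minus_commute)
    show "op_dist_on S (F r) (F t) \<le> op_dist_on S (F r) (F s) + op_dist_on S (F s) (F t)"
    proof (rule le)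
      fix x assume x: "x \<in> S"
      show "norm (F r x - F t x) \<le> (op_dist_on S (F r) (F s) + op_dist_on S (F s) (F t)) * norm x"
        using op_dist_on_bound[OF assms assms x, of r s] op_dist_on_bound[OF assms assms x, of s t]
          norm_triangle_ineq[of "F r x - F s x" "F s x - F t x"] by (simp add: algebra_simps)
    qed (intro add_nonneg_nonneg op_dist_on_nonneg assms)
  qed
qed

text \<open>The uniform bound is the norm at time \<open>0\<close> plus the oscillation of the
  family, finite because an almost periodic distance is bounded.\<close>

lemma ap_operator:
  assumes F: "\<And>t. bounded_op_on S (F t)" "almost_periodic (op_dist_on S) F"
  obtains \<rho> c where "ap_dist \<rho>" "\<And>s t x. x \<in> S \<Longrightarrow> norm (F s x - F t x) \<le> \<rho> s t * norm x"
    "c \<ge> 0" "\<And>t x. x \<in> S \<Longrightarrow> norm (F t x) \<le> c * norm x"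
proof -
  define \<rho> where "\<rho> s t = op_dist_on S (F s) (F t)" for s t
  have \<rho>: "ap_dist \<rho>"
  proof -
    have "pseudo_dist (\<lambda>s t. op_dist_on S (F s) (F t))" by (rule pseudo_dist_op_dist[OF F(1)])
    from almost_periodic_ap_dist[of "op_dist_on S" F, OF this] show ?thesis
      using F(2) unfolding \<rho>_def[abs_def] by simp
  qed
  obtain b where b: "\<And>s t. \<rho> s t \<le> b" using ap_dist_bounded[OF \<rho>] by metis
  have d: "norm (F s x - F t x) \<le> \<rho> s t * norm x" if "x \<in> S" for s t x
    unfolding \<rho>_def by (rule op_dist_on_bound[OF F(1) F(1) that])
  obtain K where K: "K \<ge> 0" "\<And>x. x \<in> S \<Longrightarrow> norm (F 0 x) \<le> K * norm x" using bounded_op_onD[OF F(1)] by metis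
  have b0: "b \<ge> 0" using b[of 0 0] pseudo_dist_nonneg[of \<rho> 0 0] \<rho> by (auto simp: ap_dist_def)
  have "norm (F t x) \<le> (K + b) * norm x" if "x \<in> S" for t x
  proof -
    have "\<rho> t 0 * norm x \<le> b * norm x" using b by (rule mult_right_mono) simp
    then show ?thesis using d[OF that, of t 0] K(2)[OF that] norm_triangle_ineq[of "F t x - F 0 x" "F 0 x"]
      by (simp add: algebra_simps)
  qed
  then show ?thesis using that[OF \<rho> d, of "K + b"] K b0 by simp
qed

section \<open>Families of solution operators and their rescalings\<close>

context hille_yosida_cone
begin

text \<open>Needed for the weight \<open>r - s\<close>: it turns an orbit into a solution that
  starts at zero and has that orbit as inhomogeneity.\<close>

lemma mild_multiply:
  assumes "mild u G s t" "\<And>r. (f has_real_derivative f' r) (at r)" "continuous_on UNIV f'"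
  shows "mild (\<lambda>r. f r *\<^sub>R u r) (\<lambda>r. f r *\<^sub>R G r + f' r *\<^sub>R u r) s t"
  unfolding mild_def
proof (intro conjI ballI)
  have cf: "continuous_on {s..t} f" using assms(2) by (meson DERIV_continuous_on has_field_derivative_at_within)
  have cf': "continuous_on {s..t} f'" using assms(3) by (rule continuous_on_subset) auto
  show "continuous_on {s..t} (\<lambda>r. f r *\<^sub>R u r)" "continuous_on {s..t} (\<lambda>r. f r *\<^sub>R G r + f' r *\<^sub>R u r)"
    by (intro continuous_intros mildD[OF assms(1)] cf cf')+
  show "(\<lambda>r. f r *\<^sub>R u r) ` {s..t} \<subseteq> X0"
    using mildD(3)[OF assms(1)] subspace_scale[OF subX0] by blast
  fix r assume r: "r \<in> {s..t}"
  from has_vector_derivative_scaleR[OF has_field_derivative_at_within[OF assms(2)] mildD(4)[OF assms(1) r]]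
  show "((\<lambda>r. R (f r *\<^sub>R u r)) has_vector_derivative
      ((w + 1) *\<^sub>R R (f r *\<^sub>R u r) - f r *\<^sub>R u r + R (f r *\<^sub>R G r + f' r *\<^sub>R u r))) (at r within {s..t})"
    by (simp add: R.add R.scaleR algebra_simps)
qed

text \<open>On \<open>D\<close> the product of \<open>R\<close> and \<open>A\<close> is
  \<open>(w + 1) R - 1\<close>. Applying \<open>R\<close> to the integrated equation therefore
  removes the unbounded operator.\<close>

lemma mild_from_solution:
  assumes u: "mild_solution D A C s u0 u" and G: "continuous_on {s..t} (\<lambda>r. C r (u r))"
  shows "mild u (\<lambda>r. C r (u r)) s t"
proof -
  have cu: "continuous_on {s..} u" and uX: "u ` {s..} \<subseteq> X0"
    and I: "\<And>r. r \<ge> s \<Longrightarrow> integral {s..r} u \<in> D"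
    and eq: "\<And>r. r \<ge> s \<Longrightarrow> u r = u0 + A (integral {s..r} u) + integral {s..r} (\<lambda>q. C q (u q))"
    using u by (auto simp: mild_solution_def)
  show ?thesis
  proof (rule mildI_integral)
    show c: "continuous_on {s..t} u" using cu by (rule continuous_on_subset) auto
    show "u r \<in> X0" if "r \<in> {s..t}" for r using uX that by auto
    show "continuous_on {s..t} (\<lambda>r. C r (u r))" by (rule G)
    fix r assume r: "r \<in> {s..t}"
    have sub: "{s..r} \<subseteq> {s..t}" using r by auto
    have iu: "u integrable_on {s..r}" and iG: "(\<lambda>q. C q (u q)) integrable_on {s..r}"
      by (rule integrable_continuous_real[OF continuous_on_subset[OF c sub]]
          integrable_continuous_real[OF continuous_on_subset[OF G sub]])+
    have A0: "A 0 = 0" using A_scale[OF subspace_0[OF subD], of 0] by simp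
    have us: "u s = u0" using eq[of s] A0 by simp
    have RA: "R (A (integral {s..r} u)) = (w + 1) *\<^sub>R R (integral {s..r} u) - integral {s..r} u"
    proof -
      have "R ((w + 1) *\<^sub>R integral {s..r} u - A (integral {s..r} u)) = integral {s..r} u"
        unfolding R_def by (rule res_inv) (use I r in auto)
      then have "(w + 1) *\<^sub>R R (integral {s..r} u) - R (A (integral {s..r} u)) = integral {s..r} u"
        by (simp only: R.diff R.scaleR)
      then show ?thesis by (simp only: diff_eq_eq eq_diff_eq add.commute)
    qed
    have RI: "R (integral {s..r} h) = integral {s..r} (\<lambda>q. R (h q))" if "h integrable_on {s..r}" for h
      using integral_linear[OF that bounded_linear_R] by (simp add: o_def)
    have iR: "(\<lambda>q. R (h q)) integrable_on {s..r}" if "h integrable_on {s..r}" for h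
      using integrable_linear[OF that bounded_linear_R] by (simp add: o_def)
    have "R (u r) - R (u s) = (w + 1) *\<^sub>R R (integral {s..r} u) - integral {s..r} u + R (integral {s..r} (\<lambda>q. C q (u q)))"
      using eq[of r] r us RA by (simp add: R.add)
    also have "\<dots> = integral {s..r} (\<lambda>q. (w + 1) *\<^sub>R R (u q) - u q + R (C q (u q)))"
      by (simp add: RI iu iG iR integral_add integral_diff integrable_diff integrable_cmul flip: integral_cmul)
    finally show "R (u r) - R (u s) = integral {s..r} (\<lambda>q. (w + 1) *\<^sub>R R (u q) - u q + R (C q (u q)))" .
  qed
qed

end

locale ap_coefficient = hille_yosida_cone D A P w M w'
  for D :: "'a::banach set" and A :: "'a \<Rightarrow> 'a" and P :: "'a set" and w M w' :: real +
  fixes C :: "real \<Rightarrow> 'a \<Rightarrow> 'a" and c k :: real and \<rho> :: "real \<Rightarrow> real \<Rightarrow> real"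
  assumes C_lin': "\<And>t. linear_op_on X0 (C t)"
    and C_bound': "\<And>t x. x \<in> X0 \<Longrightarrow> norm (C t x) \<le> c * norm x"
    and C_pos': "\<And>t x. x \<in> X0 \<Longrightarrow> x \<in> P \<Longrightarrow> C t x + k *\<^sub>R x \<in> P"
    and c0': "c \<ge> 0"
    and ap_\<rho>: "ap_dist \<rho>" and C_\<rho>: "\<And>s t x. x \<in> X0 \<Longrightarrow> norm (C s x - C t x) \<le> \<rho> s t * norm x"
begin

lemma perturbed_shift: "perturbed D A P w M w' (\<lambda>t x. C t x - \<sigma> *\<^sub>R x) (c + \<bar>\<sigma>\<bar>) (k + \<sigma>)"
proof unfold_locales
  fix t x
  show "linear_op_on X0 (\<lambda>x. C t x - \<sigma> *\<^sub>R x)"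
    using C_lin'[of t] by (auto simp: linear_op_on_def algebra_simps)
  show "norm (C t x - \<sigma> *\<^sub>R x) \<le> (c + \<bar>\<sigma>\<bar>) * norm x" if "x \<in> X0"
    using C_bound'[OF that, of t] norm_triangle_ineq4[of "C t x" "\<sigma> *\<^sub>R x"] by (simp add: algebra_simps)
  show "C t x - \<sigma> *\<^sub>R x + (k + \<sigma>) *\<^sub>R x \<in> P" if "x \<in> X0" "x \<in> P"
    using C_pos'[OF that, of t] by (simp add: algebra_simps)
  show "0 \<le> c + \<bar>\<sigma>\<bar>" using c0' by simp
  fix \<epsilon> :: real assume "\<epsilon> > 0"
  then obtain d where d: "d > 0" "\<And>s t. \<bar>s - t\<bar> < d \<Longrightarrow> \<rho> s t < \<epsilon>" using ap_dist_uniform[OF ap_\<rho>] by metis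
  have "norm (C s x - \<sigma> *\<^sub>R x - (C t x - \<sigma> *\<^sub>R x)) \<le> \<epsilon> * norm x" if "\<bar>s - t\<bar> < d" "x \<in> X0" for s t x
    using C_\<rho>[OF that(2), of s t] mult_right_mono[of "\<rho> s t" \<epsilon> "norm x"] d(2)[OF that(1)] by simp
  then show "\<exists>d>0. \<forall>s t. \<bar>s - t\<bar> < d \<longrightarrow> (\<forall>x\<in>X0. norm (C s x - \<sigma> *\<^sub>R x - (C t x - \<sigma> *\<^sub>R x)) \<le> \<epsilon> * norm x)"
    using d(1) by blast
qed

end

locale ap_family = ap_coefficient D A P w M w' C c k \<rho>
  for D :: "'a::banach set" and A :: "'a \<Rightarrow> 'a" and P :: "'a set" and w M w' :: real
    and C :: "real \<Rightarrow> 'a \<Rightarrow> 'a" and c k :: real and \<rho> :: "real \<Rightarrow> real \<Rightarrow> real" +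
  fixes W :: "real \<Rightarrow> real \<Rightarrow> 'a \<Rightarrow> 'a"
  assumes W_ev: "evolution_family X0 W"
    and W_sol: "\<And>s t x. s \<le> t \<Longrightarrow> x \<in> X0 \<Longrightarrow> mild (\<lambda>r. W r s x) (\<lambda>r. C r (W r s x)) s t"
begin

definition rate :: "real \<Rightarrow> bool" where
  "rate r \<longleftrightarrow> (\<exists>N\<ge>1. \<forall>s t. \<forall>x\<in>X0. s \<le> t \<longrightarrow> norm (W t s x) \<le> N * exp (r * (t - s)) * norm x)"

definition sh where "sh \<sigma> t s x = exp (- \<sigma> * (t - s)) *\<^sub>R W t s x"

lemma W_in: "s \<le> t \<Longrightarrow> x \<in> X0 \<Longrightarrow> W t s x \<in> X0"
  and W_id: "x \<in> X0 \<Longrightarrow> W s s x = x"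
  and W_cocycle: "s \<le> r \<Longrightarrow> r \<le> t \<Longrightarrow> x \<in> X0 \<Longrightarrow> W t r (W r s x) = W t s x"
  and W_cont: "x \<in> X0 \<Longrightarrow> continuous_on {(t, s). s \<le> t} (\<lambda>(t, s). W t s x)"
  and W_op: "s \<le> t \<Longrightarrow> bounded_op_on X0 (W t s)"
  using W_ev unfolding evolution_family_def by blast+

lemma sh_evolution: "evolution_family X0 (sh \<sigma>)"
  unfolding evolution_family_def
proof (intro conjI allI ballI impI)
  fix s t :: real assume st: "s \<le> t"
  obtain K where K: "K \<ge> 0" "\<And>x. x \<in> X0 \<Longrightarrow> norm (W t s x) \<le> K * norm x" using bounded_op_onD[OF W_op[OF st]] by metis
  have "norm (sh \<sigma> t s x) \<le> (exp (- \<sigma> * (t - s)) * K) * norm x" if "x \<in> X0" for x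
    using mult_left_mono[OF K(2)[OF that], of "exp (- \<sigma> * (t - s))"] by (simp add: sh_def mult.assoc)
  moreover have "linear_op_on X0 (sh \<sigma> t s)"
    using W_op[OF st] by (auto simp: bounded_op_on_def linear_op_on_def sh_def algebra_simps)
  ultimately show "bounded_op_on X0 (sh \<sigma> t s)" unfolding bounded_op_on_def by blast
  show "sh \<sigma> t s ` X0 \<subseteq> X0" using W_in[OF st] by (auto simp: sh_def intro: subspace_scale[OF subX0])
next
  fix s x assume "x \<in> X0" then show "sh \<sigma> s s x = x" by (simp add: sh_def W_id)
next
  fix s r t :: real and x assume *: "s \<le> r" "r \<le> t" "x \<in> X0"
  have "W t r (exp (- \<sigma> * (r - s)) *\<^sub>R W r s x) = exp (- \<sigma> * (r - s)) *\<^sub>R W t r (W r s x)"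
    using W_op[OF *(2)] W_in[OF *(1,3)] by (simp add: bounded_op_on_def linear_op_on_def)
  then show "sh \<sigma> t r (sh \<sigma> r s x) = sh \<sigma> t s x"
    using W_cocycle[OF *] by (simp add: sh_def algebra_simps flip: exp_add)
next
  fix x assume "x \<in> X0"
  from W_cont[OF this] have "continuous_on {(t, s). s \<le> t} (\<lambda>p. exp (- \<sigma> * (fst p - snd p)) *\<^sub>R (\<lambda>(t, s). W t s x) p)"
    by (intro continuous_intros)
  then show "continuous_on {(t, s). s \<le> t} (\<lambda>(t, s). sh \<sigma> t s x)" by (simp add: sh_def case_prod_beta)
qed

lemma sh_mild:
  assumes "s \<le> t" "x \<in> X0"
  shows "mild (\<lambda>r. sh \<sigma> r s x) (\<lambda>r. C r (sh \<sigma> r s x) - \<sigma> *\<^sub>R sh \<sigma> r s x) s t"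
proof -
  have "mild (\<lambda>r. (exp (\<sigma> * s) * exp (- \<sigma> * r)) *\<^sub>R W r s x)
     (\<lambda>r. (exp (\<sigma> * s) * exp (- \<sigma> * r)) *\<^sub>R (C r (W r s x) + (- \<sigma>) *\<^sub>R W r s x)) s t"
    by (rule mild_exp[OF W_sol[OF assms]])
  then show ?thesis
  proof (rule mild_cong)
    fix r assume r: "r \<in> {s..t}"
    have e: "exp (\<sigma> * s) * exp (- \<sigma> * r) = exp (- \<sigma> * (r - s))" by (simp add: algebra_simps flip: exp_add)
    show "(exp (\<sigma> * s) * exp (- \<sigma> * r)) *\<^sub>R W r s x = sh \<sigma> r s x" unfolding e sh_def ..
    have "C r (exp (- \<sigma> * (r - s)) *\<^sub>R W r s x) = exp (- \<sigma> * (r - s)) *\<^sub>R C r (W r s x)"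
      using C_lin'[of r] W_in[of s r x] r assms by (simp add: linear_op_on_def)
    then show "(exp (\<sigma> * s) * exp (- \<sigma> * r)) *\<^sub>R (C r (W r s x) + (- \<sigma>) *\<^sub>R W r s x) = C r (sh \<sigma> r s x) - \<sigma> *\<^sub>R sh \<sigma> r s x"
      unfolding e sh_def by (simp add: algebra_simps)
  qed
qed

lemma evolution_shift:
  assumes "rate r" "r < \<sigma>"
  obtains N where "evolution D A P w M w' (\<lambda>t x. C t x - \<sigma> *\<^sub>R x) (c + \<bar>\<sigma>\<bar>) (k + \<sigma>) (sh \<sigma>) N (\<sigma> - r)"
proof -
  obtain N where N: "N \<ge> 1" "\<And>s t x. x \<in> X0 \<Longrightarrow> s \<le> t \<Longrightarrow> norm (W t s x) \<le> N * exp (r * (t - s)) * norm x"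
    using assms(1) by (auto simp: rate_def)
  interpret perturbed D A P w M w' "\<lambda>t x. C t x - \<sigma> *\<^sub>R x" "c + \<bar>\<sigma>\<bar>" "k + \<sigma>" by (rule perturbed_shift)
  have "evolution D A P w M w' (\<lambda>t x. C t x - \<sigma> *\<^sub>R x) (c + \<bar>\<sigma>\<bar>) (k + \<sigma>) (sh \<sigma>) N (\<sigma> - r)"
  proof unfold_locales
    show "evolution_family X0 (sh \<sigma>)" by (rule sh_evolution)
    show "norm (sh \<sigma> t s x) \<le> N * exp (- (\<sigma> - r) * (t - s)) * norm x" if "s \<le> t" "x \<in> X0" for s t x
    proof -
      have "norm (sh \<sigma> t s x) \<le> exp (- \<sigma> * (t - s)) * (N * exp (r * (t - s)) * norm x)"
        using mult_left_mono[OF N(2)[OF that(2,1)], of "exp (- \<sigma> * (t - s))"] by (simp add: sh_def)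
      also have "\<dots> = N * (exp (- \<sigma> * (t - s)) * exp (r * (t - s))) * norm x" by simp
      also have "exp (- \<sigma> * (t - s)) * exp (r * (t - s)) = exp (- (\<sigma> - r) * (t - s))"
        by (simp add: algebra_simps flip: exp_add)
      finally show ?thesis .
    qed
    show "mild (\<lambda>r. sh \<sigma> r s x) (\<lambda>r. C r (sh \<sigma> r s x) - \<sigma> *\<^sub>R sh \<sigma> r s x) s t" if "s \<le> t" "x \<in> X0" for s t x
      by (rule sh_mild[OF that])
  qed (use N assms in auto)
  then show ?thesis by (rule that)
qed

definition solves :: "real \<Rightarrow> (real \<Rightarrow> 'a) \<Rightarrow> (real \<Rightarrow> 'a) \<Rightarrow> bool" where
  "solves \<sigma> u f \<longleftrightarrow> (\<forall>s t. mild u (\<lambda>r. C r (u r) - \<sigma> *\<^sub>R u r + f r) s t)"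

text \<open>The limit from \<open>sol\<close> for the rescaled family. It is written out so that it
  makes sense without a decay rate, and so that \<open>\<sigma> = 0\<close> reproduces the limit of
  the statement.\<close>

definition K :: "real \<Rightarrow> (real \<Rightarrow> 'a) \<Rightarrow> real \<Rightarrow> 'a" where
  "K \<sigma> f t = Lim at_top (\<lambda>\<mu>. integral {..t} (\<lambda>s. sh \<sigma> t s (\<mu> *\<^sub>R res \<mu> (f s))))"

context
  fixes r \<sigma> :: real
  assumes r: "rate r" "r < \<sigma>"
begin

lemma K_solves: assumes "ap f" shows "solves \<sigma> (K \<sigma> f) f"
proof -
  obtain N where "evolution D A P w M w' (\<lambda>t x. C t x - \<sigma> *\<^sub>R x) (c + \<bar>\<sigma>\<bar>) (k + \<sigma>) (sh \<sigma>) N (\<sigma> - r)"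
    by (rule evolution_shift[OF r])
  then interpret e: evolution D A P w M w' "\<lambda>t x. C t x - \<sigma> *\<^sub>R x" "c + \<bar>\<sigma>\<bar>" "k + \<sigma>" "sh \<sigma>" N "\<sigma> - r" .
  have "e.sol f = K \<sigma> f" by (simp add: fun_eq_iff e.sol_def K_def)
  then show ?thesis using e.ap_sol_entire[OF assms] by (simp add: e.entire_def solves_def)
qed

lemma K_bound: obtains b where "b \<ge> 0" "\<And>f B t. ap f \<Longrightarrow> (\<And>t. norm (f t) \<le> B) \<Longrightarrow> norm (K \<sigma> f t) \<le> b * B"
proof -
  obtain N where "evolution D A P w M w' (\<lambda>t x. C t x - \<sigma> *\<^sub>R x) (c + \<bar>\<sigma>\<bar>) (k + \<sigma>) (sh \<sigma>) N (\<sigma> - r)"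
    by (rule evolution_shift[OF r])
  then interpret e: evolution D A P w M w' "\<lambda>t x. C t x - \<sigma> *\<^sub>R x" "c + \<bar>\<sigma>\<bar>" "k + \<sigma>" "sh \<sigma>" N "\<sigma> - r" .
  have 1: "e.sol f = K \<sigma> f" for f by (simp add: fun_eq_iff e.sol_def K_def)
  show ?thesis by (rule that[OF e.apriori_nonneg], unfold 1[symmetric]) (rule e.ap_sol_bound)
qed

lemma K_unique:
  assumes f: "ap f" and u: "solves \<sigma> u f" "\<And>t. norm (u t) \<le> B" shows "u t = K \<sigma> f t"
proof -
  obtain N where "evolution D A P w M w' (\<lambda>t x. C t x - \<sigma> *\<^sub>R x) (c + \<bar>\<sigma>\<bar>) (k + \<sigma>) (sh \<sigma>) N (\<sigma> - r)"
    by (rule evolution_shift[OF r])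
  then interpret e: evolution D A P w M w' "\<lambda>t x. C t x - \<sigma> *\<^sub>R x" "c + \<bar>\<sigma>\<bar>" "k + \<sigma>" "sh \<sigma>" N "\<sigma> - r" .
  have 1: "e.sol f = K \<sigma> f" by (simp add: fun_eq_iff e.sol_def K_def)
  have 2: "e.entire u f" using u(1) by (simp add: e.entire_def solves_def)
  show ?thesis using e.sol_unique[OF f 2 u(2), of t] unfolding 1 .
qed

lemma K_add: assumes "ap f" "ap g" shows "K \<sigma> (\<lambda>t. f t + g t) t = K \<sigma> f t + K \<sigma> g t"
proof -
  obtain N where "evolution D A P w M w' (\<lambda>t x. C t x - \<sigma> *\<^sub>R x) (c + \<bar>\<sigma>\<bar>) (k + \<sigma>) (sh \<sigma>) N (\<sigma> - r)"
    by (rule evolution_shift[OF r])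
  then interpret e: evolution D A P w M w' "\<lambda>t x. C t x - \<sigma> *\<^sub>R x" "c + \<bar>\<sigma>\<bar>" "k + \<sigma>" "sh \<sigma>" N "\<sigma> - r" .
  have "e.sol f = K \<sigma> f" for f by (simp add: fun_eq_iff e.sol_def K_def)
  then show ?thesis using e.sol_add[OF assms] by simp
qed

lemma K_scale: assumes "ap f" shows "K \<sigma> (\<lambda>t. a *\<^sub>R f t) t = a *\<^sub>R K \<sigma> f t"
proof -
  obtain N where "evolution D A P w M w' (\<lambda>t x. C t x - \<sigma> *\<^sub>R x) (c + \<bar>\<sigma>\<bar>) (k + \<sigma>) (sh \<sigma>) N (\<sigma> - r)"
    by (rule evolution_shift[OF r])
  then interpret e: evolution D A P w M w' "\<lambda>t x. C t x - \<sigma> *\<^sub>R x" "c + \<bar>\<sigma>\<bar>" "k + \<sigma>" "sh \<sigma>" N "\<sigma> - r" .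
  have "e.sol f = K \<sigma> f" for f by (simp add: fun_eq_iff e.sol_def K_def)
  then show ?thesis using e.sol_scale[OF assms] by simp
qed

lemma K_pos: assumes "ap f" "\<And>t. f t \<in> P" shows "K \<sigma> f t \<in> P"
proof -
  obtain N where "evolution D A P w M w' (\<lambda>t x. C t x - \<sigma> *\<^sub>R x) (c + \<bar>\<sigma>\<bar>) (k + \<sigma>) (sh \<sigma>) N (\<sigma> - r)"
    by (rule evolution_shift[OF r])
  then interpret e: evolution D A P w M w' "\<lambda>t x. C t x - \<sigma> *\<^sub>R x" "c + \<bar>\<sigma>\<bar>" "k + \<sigma>" "sh \<sigma>" N "\<sigma> - r" .
  have "e.sol f = K \<sigma> f" by (simp add: fun_eq_iff e.sol_def K_def)
  then show ?thesis using e.sol_pos[OF assms] by simp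
qed

lemma K_in: "ap f \<Longrightarrow> K \<sigma> f t \<in> X0"
  using K_solves[of f] mildD(3)[of "K \<sigma> f" _ t t t] by (auto simp: solves_def)

lemma K_almost_periods:
  assumes f: "ap f"
  obtains b where "\<And>\<tau> B t. (\<And>t. \<rho> (t + \<tau>) t + dist (f (t + \<tau>)) (f t) \<le> B) \<Longrightarrow> dist (K \<sigma> f (t + \<tau>)) (K \<sigma> f t) \<le> b * B"
proof -
  obtain N where "evolution D A P w M w' (\<lambda>t x. C t x - \<sigma> *\<^sub>R x) (c + \<bar>\<sigma>\<bar>) (k + \<sigma>) (sh \<sigma>) N (\<sigma> - r)"
    by (rule evolution_shift[OF r])
  then interpret e: evolution D A P w M w' "\<lambda>t x. C t x - \<sigma> *\<^sub>R x" "c + \<bar>\<sigma>\<bar>" "k + \<sigma>" "sh \<sigma>" N "\<sigma> - r" .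
  have 1: "e.sol f = K \<sigma> f" by (simp add: fun_eq_iff e.sol_def K_def)
  have 2: "norm (C s x - \<sigma> *\<^sub>R x - (C t x - \<sigma> *\<^sub>R x)) \<le> \<rho> s t * norm x" if "x \<in> X0" for s t x
    using C_\<rho>[OF that] by simp
  show ?thesis
  proof (rule e.sol_ap[OF ap_\<rho> 2 f])
    fix b assume "\<And>\<tau> B t. (\<And>t. \<rho> (t + \<tau>) t + dist (f (t + \<tau>)) (f t) \<le> B) \<Longrightarrow> dist (e.sol f (t + \<tau>)) (e.sol f t) \<le> b * B"
    then show ?thesis unfolding 1 by (rule that)
  qed
qed

lemma K_ap: assumes "ap f" shows "ap (K \<sigma> f)"
proof -
  obtain b where b: "\<And>\<tau> B t. (\<And>t. \<rho> (t + \<tau>) t + dist (f (t + \<tau>)) (f t) \<le> B) \<Longrightarrow> dist (K \<sigma> f (t + \<tau>)) (K \<sigma> f t) \<le> b * B"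
    using K_almost_periods[OF assms] by metis
  have "ap_dist (\<lambda>s t. \<rho> s t + dist (f s) (f t))" using assms by (intro ap_dist_add ap_\<rho>) (simp add: ap_iff)
  then show ?thesis by (rule ap_transfer) (rule b)
qed

end

text \<open>Growth of \<open>u\<close> at minus infinity is harmless as long as the decay of \<open>W\<close> compensates it.\<close>

lemma backward_positivity:
  assumes r: "rate r" "r < 0"
    and u: "\<And>s. s \<le> T \<Longrightarrow> mild u (\<lambda>q. C q (u q) + f q) s T" and f: "\<And>q. q \<le> T \<Longrightarrow> f q \<in> P"
    and B: "\<And>s. s \<le> T \<Longrightarrow> norm (u s) \<le> B * exp (\<epsilon> * (T - s))" and \<epsilon>: "\<epsilon> < - r"
  shows "u T \<in> P"
proof -
  obtain N where "evolution D A P w M w' (\<lambda>t x. C t x - 0 *\<^sub>R x) (c + \<bar>0\<bar>) (k + 0) (sh 0) N (0 - r)"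
    by (rule evolution_shift[OF r])
  then interpret e: evolution D A P w M w' "\<lambda>t x. C t x - 0 *\<^sub>R x" "c + \<bar>0\<bar>" "k + 0" "sh 0" N "0 - r" .
  show ?thesis by (rule e.backward_pos[of T u f B \<epsilon>]) (use u f B \<epsilon> in auto)
qed

end

section \<open>The next generation operators of the rescaled problems\<close>

instance bcontfun :: (metric_space, banach) banach ..

text \<open>Two families over the same generator: \<open>\<Gamma>\<close> with the coefficient
  \<open>CG\<close> and decay, \<open>U\<close> with \<open>CG + F\<close> and some exponential rate
  \<open>rE\<close> of either sign.\<close>

locale reproduction_model = hille_yosida_cone D A P w M w' +
  G: ap_family D A P w M w' CG cG kG \<rho>G \<Gamma> + E: ap_family D A P w M w' CE cE kE \<rho>E U
  for D :: "'a::banach set" and A :: "'a \<Rightarrow> 'a" and P :: "'a set" and w M w' :: real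
    and CG :: "real \<Rightarrow> 'a \<Rightarrow> 'a" and cG kG :: real and \<rho>G :: "real \<Rightarrow> real \<Rightarrow> real" and \<Gamma> :: "real \<Rightarrow> real \<Rightarrow> 'a \<Rightarrow> 'a"
    and CE :: "real \<Rightarrow> 'a \<Rightarrow> 'a" and cE kE :: real and \<rho>E :: "real \<Rightarrow> real \<Rightarrow> real" and U :: "real \<Rightarrow> real \<Rightarrow> 'a \<Rightarrow> 'a" +
  fixes F :: "real \<Rightarrow> 'a \<Rightarrow> 'a" and cF cn cd rG rE :: real and \<rho>F :: "real \<Rightarrow> real \<Rightarrow> real"
  assumes F_lin: "\<And>t. linear_op_on X0 (F t)"
    and F_bound: "\<And>t x. x \<in> X0 \<Longrightarrow> norm (F t x) \<le> cF * norm x" and cF0: "cF \<ge> 0"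
    and F_pos: "\<And>t x. x \<in> X0 \<Longrightarrow> x \<in> P \<Longrightarrow> F t x \<in> P"
    and ap_\<rho>F: "ap_dist \<rho>F" and F_\<rho>: "\<And>s t x. x \<in> X0 \<Longrightarrow> norm (F s x - F t x) \<le> \<rho>F s t * norm x"
    and CE_eq: "\<And>t x. x \<in> X0 \<Longrightarrow> CE t x = CG t x + F t x"
    and normal_P: "\<And>x y. x \<in> P \<Longrightarrow> y - x \<in> P \<Longrightarrow> norm x \<le> cn * norm y" and cn0: "cn \<ge> 0"
    and decomp_P: "\<And>x \<epsilon>. \<epsilon> > 0 \<Longrightarrow> \<exists>y\<in>P. \<exists>z\<in>P. norm y \<le> cd * norm x \<and> norm z \<le> cd * norm x \<and> norm (x - (y - z)) \<le> \<epsilon>"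
    and cd0: "cd \<ge> 0"
    and rG: "G.rate rG" "rG < 0" and rE: "E.rate rE"
begin

abbreviation S where "S \<equiv> AP (UNIV :: 'a set)"

definition Q where "Q = {\<phi> \<in> S. \<forall>t. apply_bcontfun \<phi> t \<in> P}"

text \<open>The next generation operator of the problem with the additional death rate
  \<open>\<sigma>\<close>.\<close>

definition LL where "LL \<sigma> \<phi> = Bcontfun (\<lambda>t. F t (G.K \<sigma> (apply_bcontfun \<phi>) t))"

lemma F_add: "x \<in> X0 \<Longrightarrow> y \<in> X0 \<Longrightarrow> F t (x + y) = F t x + F t y"
  and F_scale: "x \<in> X0 \<Longrightarrow> F t (a *\<^sub>R x) = a *\<^sub>R F t x"
  using F_lin[of t] by (auto simp: linear_op_on_def)

lemma F_diff: "x \<in> X0 \<Longrightarrow> y \<in> X0 \<Longrightarrow> F t (x - y) = F t x - F t y"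
  using F_add[of x "-y" t] F_scale[of y t "-1"] subspace_neg[OF subX0, of y] by simp

lemma F_ap:
  assumes u: "\<And>t. u t \<in> X0" "ap u" shows "ap (\<lambda>t. F t (u t))"
proof -
  obtain B where B: "\<And>t. norm (u t) \<le> B" "B \<ge> 0" using ap_bounded[OF u(2)] by metis
  have "ap_dist (\<lambda>s t. \<rho>F s t + dist (u s) (u t))" using u(2) by (intro ap_dist_add ap_\<rho>F) (simp add: ap_iff)
  then show ?thesis
  proof (rule ap_transfer)
    fix \<tau> b t assume b: "\<And>t. \<rho>F (t + \<tau>) t + dist (u (t + \<tau>)) (u t) \<le> b"
    have \<rho>0: "\<rho>F (t + \<tau>) t \<ge> 0" using ap_\<rho>F pseudo_dist_nonneg by (auto simp: ap_dist_def)
    then have \<rho>b: "\<rho>F (t + \<tau>) t \<le> b" "dist (u (t + \<tau>)) (u t) \<le> b"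
      using b[of t] zero_le_dist[of "u (t + \<tau>)" "u t"] by linarith+
    have "norm (F (t + \<tau>) (u (t + \<tau>)) - F t (u (t + \<tau>))) \<le> \<rho>F (t + \<tau>) t * norm (u (t + \<tau>))" by (rule F_\<rho>[OF u(1)])
    also have "\<dots> \<le> b * B" using \<rho>b \<rho>0 B by (intro mult_mono) auto
    finally have 1: "norm (F (t + \<tau>) (u (t + \<tau>)) - F t (u (t + \<tau>))) \<le> b * B" .
    have "norm (F t (u (t + \<tau>)) - F t (u t)) \<le> cF * norm (u (t + \<tau>) - u t)"
      using F_bound[OF subspace_diff[OF subX0 u(1) u(1)], of t "t + \<tau>" t] F_diff[OF u(1) u(1)] by simp
    also have "\<dots> \<le> cF * b" using \<rho>b(2) cF0 by (intro mult_left_mono) (auto simp: dist_norm)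
    finally have 2: "norm (F t (u (t + \<tau>)) - F t (u t)) \<le> cF * b" .
    show "dist (F (t + \<tau>) (u (t + \<tau>))) (F t (u t)) \<le> (B + cF) * b"
      using 1 2 norm_triangle_ineq[of "F (t + \<tau>) (u (t + \<tau>)) - F t (u (t + \<tau>))" "F t (u (t + \<tau>)) - F t (u t)"]
      by (simp add: dist_norm algebra_simps)
  qed
qed

context
  fixes \<sigma> :: real assumes \<sigma>: "rG < \<sigma>"
begin

lemma FK_ap: "ap f \<Longrightarrow> ap (\<lambda>t. F t (G.K \<sigma> f t))"
  by (intro F_ap G.K_in[OF rG(1) \<sigma>] G.K_ap[OF rG(1) \<sigma>])

lemma LL_apply: "\<phi> \<in> S \<Longrightarrow> apply_bcontfun (LL \<sigma> \<phi>) = (\<lambda>t. F t (G.K \<sigma> (apply_bcontfun \<phi>) t))"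
  unfolding LL_def by (intro apply_Bcontfun_ap FK_ap) (simp add: AP_iff)

lemma LL_in: "\<phi> \<in> S \<Longrightarrow> LL \<sigma> \<phi> \<in> S"
  using LL_apply[of \<phi>] FK_ap[of "apply_bcontfun \<phi>"] by (simp add: AP_iff)

text \<open>Closedness and normality of the cone pass to functions pointwise; the decomposition does
  not, and uses the almost periodic splitting.\<close>

lemma LL_positive_op: obtains B where "positive_op S (LL \<sigma>) B Q cn cd"
proof -
  obtain b where b: "b \<ge> 0" "\<And>f B t. ap f \<Longrightarrow> (\<And>t. norm (f t) \<le> B) \<Longrightarrow> norm (G.K \<sigma> f t) \<le> b * B"
    using G.K_bound[OF rG(1) \<sigma>] by metis
  have "positive_op S (LL \<sigma>) (cF * b) Q cn cd"
  proof unfold_locales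
    show "subspace S" by (rule subspace_AP)
    show "closed S" by (rule closed_AP)
    show "linear_op_on S (LL \<sigma>)"
      unfolding linear_op_on_def
    proof (intro conjI ballI allI subspace_AP)
      fix \<phi> \<psi> assume *: "\<phi> \<in> S" "\<psi> \<in> S"
      have a: "ap (apply_bcontfun \<phi>)" "ap (apply_bcontfun \<psi>)" using * by (auto simp: AP_iff)
      have "\<phi> + \<psi> \<in> S" by (rule subspace_add[OF subspace_AP *])
      then show "LL \<sigma> (\<phi> + \<psi>) = LL \<sigma> \<phi> + LL \<sigma> \<psi>"
        by (intro bcontfun_eqI) (simp add: LL_apply * G.K_add[OF rG(1) \<sigma> a] F_add G.K_in[OF rG(1) \<sigma> a(1)] G.K_in[OF rG(1) \<sigma> a(2)])
    next
      fix a \<phi> assume *: "\<phi> \<in> S"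
      have ap: "ap (apply_bcontfun \<phi>)" using * by (auto simp: AP_iff)
      have "a *\<^sub>R \<phi> \<in> S" by (rule subspace_scale[OF subspace_AP *])
      then show "LL \<sigma> (a *\<^sub>R \<phi>) = a *\<^sub>R LL \<sigma> \<phi>"
        by (intro bcontfun_eqI) (simp add: LL_apply * G.K_scale[OF rG(1) \<sigma> ap] F_scale G.K_in[OF rG(1) \<sigma> ap])
    qed
    show "LL \<sigma> \<phi> \<in> S" if "\<phi> \<in> S" for \<phi> by (rule LL_in[OF that])
    show "norm (LL \<sigma> \<phi>) \<le> cF * b * norm \<phi>" if \<phi>: "\<phi> \<in> S" for \<phi>
    proof (rule norm_bound)
      fix t
      have ap: "ap (apply_bcontfun \<phi>)" using \<phi> by (auto simp: AP_iff)
      have "norm (F t (G.K \<sigma> (apply_bcontfun \<phi>) t)) \<le> cF * norm (G.K \<sigma> (apply_bcontfun \<phi>) t)"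
        by (rule F_bound[OF G.K_in[OF rG(1) \<sigma> ap]])
      also have "\<dots> \<le> cF * (b * norm \<phi>)" using cF0 by (intro mult_left_mono b(2) ap norm_bounded)
      finally show "norm (apply_bcontfun (LL \<sigma> \<phi>) t) \<le> cF * b * norm \<phi>" by (simp add: LL_apply[OF \<phi>] mult.assoc)
    qed
    show "0 \<le> cF * b" using cF0 b(1) by simp
    show "Q \<subseteq> S" by (auto simp: Q_def)
    show "closed Q" unfolding Q_def by (rule closed_AP_cone[OF P_closed])
    show "0 \<in> Q" using P0 subspace_0[OF subspace_AP] by (simp add: Q_def)
    show "\<phi> + \<psi> \<in> Q" if "\<phi> \<in> Q" "\<psi> \<in> Q" for \<phi> \<psi>
      using that subspace_add[OF subspace_AP, of \<phi> \<psi>] P_add by (simp add: Q_def)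
    show "a *\<^sub>R \<phi> \<in> Q" if "0 \<le> a" "\<phi> \<in> Q" for a \<phi>
      using that subspace_scale[OF subspace_AP, of \<phi> a] P_scale by (simp add: Q_def)
    show "LL \<sigma> \<phi> \<in> Q" if "\<phi> \<in> Q" for \<phi>
    proof -
      have \<phi>: "\<phi> \<in> S" "ap (apply_bcontfun \<phi>)" "\<And>t. apply_bcontfun \<phi> t \<in> P" using that by (auto simp: Q_def AP_iff)
      then show ?thesis using LL_in[OF \<phi>(1)] by (simp add: Q_def LL_apply F_pos G.K_in[OF rG(1) \<sigma>] G.K_pos[OF rG(1) \<sigma>])
    qed
    show "norm \<phi> \<le> cn * norm \<psi>" if "\<phi> \<in> Q" "\<psi> - \<phi> \<in> Q" for \<phi> \<psi>
    proof (rule norm_bound)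
      fix t
      have "apply_bcontfun \<phi> t \<in> P" "apply_bcontfun \<psi> t - apply_bcontfun \<phi> t \<in> P" using that by (auto simp: Q_def)
      then have "norm (apply_bcontfun \<phi> t) \<le> cn * norm (apply_bcontfun \<psi> t)" by (rule normal_P)
      also have "\<dots> \<le> cn * norm \<psi>" using cn0 by (intro mult_left_mono norm_bounded)
      finally show "norm (apply_bcontfun \<phi> t) \<le> cn * norm \<psi>" .
    qed
    show "0 \<le> cn" "0 \<le> cd" by (rule cn0 cd0)+
    show "\<exists>y\<in>Q. \<exists>z\<in>Q. norm y \<le> cd * norm \<phi> \<and> norm z \<le> cd * norm \<phi> \<and> norm (\<phi> - (y - z)) \<le> \<epsilon>"
      if \<phi>: "\<phi> \<in> S" and \<epsilon>: "\<epsilon> > 0" for \<phi> \<epsilon>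
    proof -
      have P: "convex P" "cone P" using cone by (auto simp: order_cone_def)
      have ap: "ap (apply_bcontfun \<phi>)" using \<phi> by (simp add: AP_iff)
      obtain y z where yz: "ap y" "ap z" "\<And>t. y t \<in> P" "\<And>t. z t \<in> P" "\<And>t. norm (y t) \<le> cd * norm \<phi>"
          "\<And>t. norm (z t) \<le> cd * norm \<phi>" "\<And>t. norm (apply_bcontfun \<phi> t - (y t - z t)) \<le> \<epsilon>"
        using ap_cone_approx[OF P P0 decomp_P cd0 ap norm_bounded \<epsilon>] by auto
      have "Bcontfun y \<in> Q" "Bcontfun z \<in> Q"
        using yz by (auto simp: Q_def AP_iff apply_Bcontfun_ap)
      moreover have "norm (Bcontfun y) \<le> cd * norm \<phi>" "norm (Bcontfun z) \<le> cd * norm \<phi>"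
        "norm (\<phi> - (Bcontfun y - Bcontfun z)) \<le> \<epsilon>"
        using yz by (auto intro!: norm_bound simp: apply_Bcontfun_ap)
      ultimately show ?thesis by blast
    qed
  qed
  then show ?thesis by (rule that)
qed

text \<open>The algebraic link between the two families: \<open>F u\<close> is moved from the
  coefficient to the inhomogeneity, and back in the companion lemma.\<close>

lemma solves_transfer: "E.solves \<sigma> u f \<Longrightarrow> G.solves \<sigma> u (\<lambda>t. F t (u t) + f t)"
  unfolding E.solves_def G.solves_def
proof (intro allI)
  fix s t assume "\<forall>s t. mild u (\<lambda>r. CE r (u r) - \<sigma> *\<^sub>R u r + f r) s t"
  then have m: "mild u (\<lambda>r. CE r (u r) - \<sigma> *\<^sub>R u r + f r) s t" by blast
  show "mild u (\<lambda>r. CG r (u r) - \<sigma> *\<^sub>R u r + (F r (u r) + f r)) s t"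
    by (rule mild_cong[OF m]) (simp_all add: CE_eq mildD(3)[OF m])
qed

lemma solves_transfer': "G.solves \<sigma> u g \<Longrightarrow> E.solves \<sigma> u (\<lambda>t. g t - F t (u t))"
  unfolding E.solves_def G.solves_def
proof (intro allI)
  fix s t assume "\<forall>s t. mild u (\<lambda>r. CG r (u r) - \<sigma> *\<^sub>R u r + g r) s t"
  then have m: "mild u (\<lambda>r. CG r (u r) - \<sigma> *\<^sub>R u r + g r) s t" by blast
  show "mild u (\<lambda>r. CE r (u r) - \<sigma> *\<^sub>R u r + (g r - F r (u r))) s t"
    by (rule mild_cong[OF m]) (simp_all add: CE_eq mildD(3)[OF m])
qed

text \<open>Uniqueness, the norm bound and positivity of the inverse of
  \<open>1 - LL \<sigma>\<close> all follow from one formula that recovers \<open>g\<close> from its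
  defect \<open>g - LL \<sigma> g\<close>.\<close>

lemma rate_power_bounded:
  assumes r: "E.rate r" "r < \<sigma>"
  shows "\<exists>a. 0 < a \<and> a < 1 \<and> power_bounded_by S (LL \<sigma>) a"
proof -
  obtain B where "positive_op S (LL \<sigma>) B Q cn cd" by (rule LL_positive_op)
  then interpret L: positive_op S "LL \<sigma>" B Q cn cd .
  obtain b where b: "b \<ge> 0" "\<And>f B t. ap f \<Longrightarrow> (\<And>t. norm (f t) \<le> B) \<Longrightarrow> norm (E.K \<sigma> f t) \<le> b * B"
    using E.K_bound[OF r] by metis
  \<comment> \<open>With \<open>u = K \<sigma> g\<close> the defect equals \<open>g - F u\<close>,
    which is the inhomogeneity of \<open>u\<close> in the equation that includes \<open>F\<close>.
    Uniqueness there expresses \<open>u\<close>, and hence \<open>g\<close>, through the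
    defect.\<close>
  have repr: "apply_bcontfun g t = apply_bcontfun (g - LL \<sigma> g) t + F t (E.K \<sigma> (apply_bcontfun (g - LL \<sigma> g)) t)"
    if g: "g \<in> S" for g t
  proof -
    have ap: "ap (apply_bcontfun g)" using g by (simp add: AP_iff)
    have "g - LL \<sigma> g \<in> S" by (rule subspace_diff[OF subspace_AP g LL_in[OF g]])
    then have ap': "ap (apply_bcontfun (g - LL \<sigma> g))" by (simp add: AP_iff)
    define u where "u = G.K \<sigma> (apply_bcontfun g)"
    obtain B' where B': "\<And>t. norm (u t) \<le> B'" using ap_bounded[OF G.K_ap[OF rG(1) \<sigma> ap]] unfolding u_def by metis
    have "E.solves \<sigma> u (\<lambda>t. apply_bcontfun g t - F t (u t))"
      unfolding u_def by (rule solves_transfer'[OF G.K_solves[OF rG(1) \<sigma> ap]])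
    moreover have "(\<lambda>t. apply_bcontfun g t - F t (u t)) = apply_bcontfun (g - LL \<sigma> g)"
      by (simp add: fun_eq_iff LL_apply[OF g] u_def)
    ultimately have "E.solves \<sigma> u (apply_bcontfun (g - LL \<sigma> g))" by simp
    from E.K_unique[OF r ap' this B'] have "u t = E.K \<sigma> (apply_bcontfun (g - LL \<sigma> g)) t" .
    then show ?thesis using LL_apply[OF g] by (simp add: u_def)
  qed
  \<comment> \<open>The same computation backwards: \<open>F u + f\<close> is the inhomogeneity of
    \<open>u\<close> for \<open>\<Gamma>\<close>, so its image under \<open>LL \<sigma>\<close> is
    \<open>F u\<close>.\<close>
  have ex: "\<exists>g. g \<in> S \<and> g - LL \<sigma> g = f" if f: "f \<in> S" for f
  proof -
    have ap: "ap (apply_bcontfun f)" using f by (simp add: AP_iff)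
    define u where "u = E.K \<sigma> (apply_bcontfun f)"
    have uX: "u t \<in> X0" for t unfolding u_def by (rule E.K_in[OF r ap])
    have uap: "ap u" unfolding u_def by (rule E.K_ap[OF r ap])
    obtain B' where B': "\<And>t. norm (u t) \<le> B'" using ap_bounded[OF uap] by metis
    define h where "h t = F t (u t) + apply_bcontfun f t" for t
    have hap: "ap h" unfolding h_def by (intro ap_add F_ap uX uap ap)
    define g where "g = Bcontfun h"
    have g: "g \<in> S" "apply_bcontfun g = h" using hap by (auto simp: g_def AP_iff apply_Bcontfun_ap)
    have "G.solves \<sigma> u h" unfolding h_def u_def by (rule solves_transfer[OF E.K_solves[OF r ap]])
    from G.K_unique[OF rG(1) \<sigma> hap this B'] have "u t = G.K \<sigma> h t" for t .
    then have "g - LL \<sigma> g = f"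
      by (intro bcontfun_eqI) (simp add: LL_apply[OF g(1)] g(2) h_def)
    then show ?thesis using g(1) by blast
  qed
  have bound: "norm g \<le> (1 + cF * b) * norm (1 *\<^sub>R g - LL \<sigma> g)" if g: "g \<in> S" for g
  proof (rule norm_bound)
    fix t
    define f where "f = g - LL \<sigma> g"
    have f: "f \<in> S" unfolding f_def by (rule subspace_diff[OF subspace_AP g LL_in[OF g]])
    have ap: "ap (apply_bcontfun f)" using f by (simp add: AP_iff)
    have "norm (F t (E.K \<sigma> (apply_bcontfun f) t)) \<le> cF * norm (E.K \<sigma> (apply_bcontfun f) t)" by (rule F_bound[OF E.K_in[OF r ap]])
    also have "\<dots> \<le> cF * (b * norm f)" using cF0 by (intro mult_left_mono b(2) ap norm_bounded)
    finally have "norm (F t (E.K \<sigma> (apply_bcontfun f) t)) \<le> cF * (b * norm f)" .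
    moreover have "apply_bcontfun g t = apply_bcontfun f t + F t (E.K \<sigma> (apply_bcontfun f) t)"
      using repr[OF g, of t] unfolding f_def[symmetric] .
    ultimately show "norm (apply_bcontfun g t) \<le> (1 + cF * b) * norm (1 *\<^sub>R g - LL \<sigma> g)"
      using norm_bounded[of f t] norm_triangle_ineq[of "apply_bcontfun f t" "F t (E.K \<sigma> (apply_bcontfun f) t)"]
      unfolding scaleR_one f_def[symmetric] by (simp add: algebra_simps)
  qed
  have res: "L.resolvable 1 (1 + cF * b)"
    unfolding L.resolvable_def
  proof (intro conjI ballI bound)
    fix f assume f: "f \<in> S"
    obtain g where g: "g \<in> S" "g - LL \<sigma> g = f" using ex[OF f] by blast
    show "\<exists>!g. g \<in> S \<and> 1 *\<^sub>R g - LL \<sigma> g = f"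
    proof (rule ex1I[of _ g])
      show "g \<in> S \<and> 1 *\<^sub>R g - LL \<sigma> g = f" using g by simp
      fix g' assume g': "g' \<in> S \<and> 1 *\<^sub>R g' - LL \<sigma> g' = f"
      then have "g' \<in> S" "g' - LL \<sigma> g' = f" by auto
      then show "g' = g" using repr[of g'] repr[OF g(1)] g(2) by (intro bcontfun_eqI) metis
    qed
  qed
  have pos: "L.pos_at 1"
    unfolding L.pos_at_def
  proof (intro ballI impI)
    fix g assume g: "g \<in> S" and q: "1 *\<^sub>R g - LL \<sigma> g \<in> Q"
    define f where "f = g - LL \<sigma> g"
    have fQ: "f \<in> Q" using q by (simp add: f_def)
    then have f: "ap (apply_bcontfun f)" "\<And>t. apply_bcontfun f t \<in> P" by (auto simp: Q_def AP_iff)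
    have "apply_bcontfun g t \<in> P" for t
    proof -
      have "F t (E.K \<sigma> (apply_bcontfun f) t) \<in> P"
        by (rule F_pos[OF E.K_in[OF r f(1)] E.K_pos[OF r f]])
      then show ?thesis using repr[OF g, of t] P_add[OF f(2)[of t]] unfolding f_def[symmetric] by metis
    qed
    then show "g \<in> Q" using g by (simp add: Q_def)
  qed
  have "1 + cF * b \<ge> 0" using cF0 b(1) by simp
  then show ?thesis using L.resolvable_one_power_bounded[OF pos res] by metis
qed

text \<open>The almost periodic inhomogeneity \<open>f\<close> below dominates \<open>r \<mapsto> U(r,s)x\<close> on \<open>[s,s+1]\<close>, so that the
  bounded solution with inhomogeneity \<open>f\<close> dominates \<open>U(t,s)x\<close> for \<open>t \<ge> s + 1\<close>.\<close>

lemma positive_orbit_bound: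
  assumes a: "0 < a" "a < 1" "power_bounded_by S (LL \<sigma>) a"
  obtains c where "c \<ge> 0" "\<And>s t x. s \<le> t \<Longrightarrow> x \<in> X0 \<Longrightarrow> x \<in> P \<Longrightarrow> norm (E.sh \<sigma> t s x) \<le> c * norm x"
proof -
  obtain B where "positive_op S (LL \<sigma>) B Q cn cd" by (rule LL_positive_op)
  then interpret L: positive_op S "LL \<sigma>" B Q cn cd .
  interpret p: perturbed D A P w M w' "\<lambda>t x. CE t x - \<sigma> *\<^sub>R x" "cE + \<bar>\<sigma>\<bar>" "kE + \<sigma>" by (rule E.perturbed_shift)
  obtain N where N: "L.resolvable 1 N" "N \<ge> 0" "L.pos_at 1" using L.power_bounded_resolvable[OF a(3,1,2)] by metis
  obtain b where b: "b \<ge> 0" "\<And>f B t. ap f \<Longrightarrow> (\<And>t. norm (f t) \<le> B) \<Longrightarrow> norm (G.K \<sigma> f t) \<le> b * B"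
    using G.K_bound[OF rG(1) \<sigma>] by metis
  obtain NE where NE: "NE \<ge> 1" "\<And>s t x. x \<in> X0 \<Longrightarrow> s \<le> t \<Longrightarrow> norm (U t s x) \<le> NE * exp (rE * (t - s)) * norm x"
    using rE by (auto simp: E.rate_def)
  \<comment> \<open>Bounds the rescaled orbit over one unit of time; the sign of
    \<open>rE - \<sigma>\<close> is unknown.\<close>
  define m where "m = NE * exp \<bar>rE - \<sigma>\<bar>"
  have m: "m \<ge> 1" using NE(1) mult_mono[of 1 NE 1 "exp \<bar>rE - \<sigma>\<bar>"] by (simp add: m_def)
  have short: "norm (E.sh \<sigma> t s x) \<le> m * norm x" if "s \<le> t" "t \<le> s + 1" "x \<in> X0" for s t x
  proof -
    have "norm (E.sh \<sigma> t s x) \<le> exp (- \<sigma> * (t - s)) * (NE * exp (rE * (t - s)) * norm x)"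
      using NE(2)[OF that(3,1)] by (simp add: E.sh_def mult_left_mono)
    also have "\<dots> = NE * exp ((rE - \<sigma>) * (t - s)) * norm x" by (simp add: algebra_simps flip: exp_add)
    also have "(rE - \<sigma>) * (t - s) \<le> \<bar>rE - \<sigma>\<bar> * 1" using that by (intro mult_mono) auto
    finally show ?thesis using NE(1) by (simp add: m_def mult_left_mono mult_right_mono)
  qed
  have shX: "E.sh \<sigma> t s x \<in> X0" if "s \<le> t" "x \<in> X0" for s t x
    using mildD(3)[OF E.sh_mild[OF that, of \<sigma>], of t] that by simp
  have shP: "E.sh \<sigma> t s x \<in> P" if "s \<le> t" "x \<in> X0" "x \<in> P" for s t x
  proof -
    have "mild (\<lambda>r. E.sh \<sigma> r s x) (\<lambda>r. CE r (E.sh \<sigma> r s x) - \<sigma> *\<^sub>R E.sh \<sigma> r s x + 0) s t"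
      using E.sh_mild[OF that(1,2), of \<sigma>] by simp
    then show ?thesis
      by (rule p.mild_pos[OF _ that(1)]) (use that P0 in \<open>auto simp: E.sh_def E.W_id\<close>)
  qed
  define c where "c = max m (cn * (b * (N * m)))"
  have "norm (E.sh \<sigma> t s x) \<le> c * norm x" if st: "s \<le> t" and x: "x \<in> X0" "x \<in> P" for s t x
  proof (cases "t \<le> s + 1")
    case True
    have "m * norm x \<le> c * norm x" by (intro mult_right_mono) (auto simp: c_def)
    then show ?thesis using short[OF st True x(1)] by linarith
  next
    case False
    \<comment> \<open>A continuous triangular wave of period two with values in
      \<open>{0..1}\<close>, equal to \<open>r - s\<close> on \<open>{s..s + 1}\<close>. It prolongs
      the orbit segment over one unit of time to a periodic function.\<close>
    define q where "q r = arccos (cos (pi * (r - s))) / pi" for r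
    have q01: "0 \<le> q r" "q r \<le> 1" for r
      using arccos_lbound[of "cos (pi * (r - s))"] arccos_ubound[of "cos (pi * (r - s))"] by (auto simp: q_def)
    have q_id: "q r = r - s" if "r \<in> {s..s + 1}" for r
    proof -
      have "0 \<le> pi * (r - s)" "pi * (r - s) \<le> pi" using that by (auto intro: mult_left_le)
      then show ?thesis by (simp add: q_def arccos_cos)
    qed
    define f where "f r = E.sh \<sigma> (s + q r) s x" for r
    have cf: "continuous_on UNIV f"
    proof -
      have ce: "continuous_on {(t, s). s \<le> t} (\<lambda>(t, s). E.sh \<sigma> t s x)"
        using E.sh_evolution[of \<sigma>] x(1) by (simp add: evolution_family_def)
      have cq: "continuous_on UNIV q" unfolding q_def by (intro continuous_intros) auto
      have "continuous_on UNIV (\<lambda>r. (\<lambda>(t, s). E.sh \<sigma> t s x) (s + q r, s))"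
        by (rule continuous_on_compose2[OF ce]) (use q01 in \<open>auto intro!: continuous_intros cq\<close>)
      then show ?thesis by (simp add: f_def)
    qed
    have fap: "ap f"
    proof (rule ap_periodic[OF cf])
      fix r
      have "pi * (r + 2 - s) = pi * (r - s) + 2 * pi" by (simp add: algebra_simps)
      then show "f (r + 2) = f r" by (simp only: f_def q_def cos_periodic)
    qed simp
    have fP: "f r \<in> P" for r unfolding f_def by (rule shP) (use q01 x in auto)
    have fb: "norm (f r) \<le> m * norm x" for r unfolding f_def by (rule short) (use q01 x in auto)
    define \<phi> where "\<phi> = Bcontfun f"
    have \<phi>: "\<phi> \<in> Q" "apply_bcontfun \<phi> = f" using fap fP by (auto simp: \<phi>_def Q_def AP_iff apply_Bcontfun_ap)
    have \<phi>n: "norm \<phi> \<le> m * norm x" by (rule norm_bound) (simp add: \<phi>(2) fb)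
    obtain g where g: "g \<in> S" "1 *\<^sub>R g - LL \<sigma> g = \<phi>" using N(1) L.Q_in[OF \<phi>(1)] unfolding L.resolvable_def by blast
    have gQ: "g \<in> Q" using N(3) g \<phi>(1) unfolding L.pos_at_def by metis
    have gn: "norm g \<le> N * norm \<phi>" using N(1) g unfolding L.resolvable_def by metis
    have gap: "ap (apply_bcontfun g)" "\<And>t. apply_bcontfun g t \<in> P" using gQ by (auto simp: Q_def AP_iff)
    define u where "u = G.K \<sigma> (apply_bcontfun g)"
    have uP: "u r \<in> P" for r unfolding u_def by (rule G.K_pos[OF rG(1) \<sigma> gap])
    have "norm (u t) \<le> b * norm g" unfolding u_def by (rule b(2)[OF gap(1) norm_bounded])
    also have "\<dots> \<le> b * (N * (m * norm x))"
      using gn mult_left_mono[OF \<phi>n N(2)] b(1) by (intro mult_left_mono) auto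
    finally have un: "norm (u t) \<le> b * (N * (m * norm x))" .
    have "E.solves \<sigma> u (\<lambda>t. apply_bcontfun g t - F t (u t))"
      unfolding u_def by (rule solves_transfer'[OF G.K_solves[OF rG(1) \<sigma> gap(1)]])
    moreover have "(\<lambda>t. apply_bcontfun g t - F t (u t)) = f"
      using g(2) \<phi>(2) by (auto simp: fun_eq_iff LL_apply[OF g(1)] u_def)
    ultimately have um: "mild u (\<lambda>r. CE r (u r) - \<sigma> *\<^sub>R u r + f r) s' t'" for s' t' by (simp add: E.solves_def)
    have uX: "u r \<in> X0" for r using mildD(3)[OF um, of r r r] by simp
    have one: "u (s + 1) - E.sh \<sigma> (s + 1) s x \<in> P"
    proof -
      \<comment> \<open>This solves the equation with the orbit as inhomogeneity, starts at zero and
        meets the orbit at \<open>s + 1\<close>. On \<open>{s..s + 1}\<close> the orbit is also the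
        inhomogeneity of \<open>u\<close>, so \<open>u - y\<close> is a homogeneous solution with
        positive initial value.\<close>
      define y where "y r = (r - s) *\<^sub>R E.sh \<sigma> r s x" for r
      have yX: "y r \<in> X0" if "r \<in> {s..s + 1}" for r unfolding y_def using that x(1) by (intro subspace_scale[OF subX0] shX) auto
      have my: "mild y (\<lambda>r. (r - s) *\<^sub>R (CE r (E.sh \<sigma> r s x) - \<sigma> *\<^sub>R E.sh \<sigma> r s x) + 1 *\<^sub>R E.sh \<sigma> r s x) s (s + 1)"
        unfolding y_def
        by (rule mild_multiply[OF E.sh_mild]) (use x in \<open>auto intro!: derivative_eq_intros\<close>)
      have "mild (\<lambda>r. u r - y r) (\<lambda>r. CE r (u r - y r) - \<sigma> *\<^sub>R (u r - y r) + 0) s (s + 1)"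
        using mild_diff[OF um my]
      proof (rule mild_cong)
        fix r assume r: "r \<in> {s..s + 1}"
        have e1: "CE r (u r - y r) = CE r (u r) - (r - s) *\<^sub>R CE r (E.sh \<sigma> r s x)"
        proof -
          define Z where "Z = CE r (u r - y r)"
          define Y where "Y = CE r (y r)"
          have 1: "Z - \<sigma> *\<^sub>R (u r - y r) = (CE r (u r) - \<sigma> *\<^sub>R u r) - (Y - \<sigma> *\<^sub>R y r)"
            unfolding Z_def Y_def by (rule p.C_diff[OF uX yX[OF r]])
          have 2: "Y - \<sigma> *\<^sub>R y r = (r - s) *\<^sub>R (CE r (E.sh \<sigma> r s x) - \<sigma> *\<^sub>R E.sh \<sigma> r s x)"
            unfolding Y_def y_def by (rule p.C_scale[OF shX]) (use r x in auto)
          show ?thesis unfolding Z_def[symmetric] using 1 unfolding 2 by (simp add: y_def algebra_simps)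
        qed
        have e2: "f r = E.sh \<sigma> r s x" using q_id[OF r] by (simp add: f_def)
        show "CE r (u r) - \<sigma> *\<^sub>R u r + f r - ((r - s) *\<^sub>R (CE r (E.sh \<sigma> r s x) - \<sigma> *\<^sub>R E.sh \<sigma> r s x) + 1 *\<^sub>R E.sh \<sigma> r s x)
            = CE r (u r - y r) - \<sigma> *\<^sub>R (u r - y r) + 0"
          unfolding e1 e2 by (simp add: y_def algebra_simps)
      qed simp
      then have "u (s + 1) - y (s + 1) \<in> P"
        by (rule p.mild_pos) (use uP P0 in \<open>auto simp: y_def\<close>)
      then show ?thesis by (simp add: y_def)
    qed
    \<comment> \<open>From \<open>s + 1\<close> on, the difference has a positive initial value and
      the positive inhomogeneity \<open>f\<close>.\<close>
    have "u t - E.sh \<sigma> t s x \<in> P"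
    proof -
      have "mild (\<lambda>r. u r - E.sh \<sigma> r s x) (\<lambda>r. CE r (u r - E.sh \<sigma> r s x) - \<sigma> *\<^sub>R (u r - E.sh \<sigma> r s x) + f r) (s + 1) t"
        using mild_diff[OF um mild_subset[OF E.sh_mild[OF st x(1)]]]
      proof (rule mild_cong)
        fix r assume r: "r \<in> {s + 1..t}"
        have "(\<lambda>x. CE r x - \<sigma> *\<^sub>R x) (u r - E.sh \<sigma> r s x) = (CE r (u r) - \<sigma> *\<^sub>R u r) - (CE r (E.sh \<sigma> r s x) - \<sigma> *\<^sub>R E.sh \<sigma> r s x)"
          by (rule p.C_diff[OF uX shX]) (use r x in auto)
        then show "CE r (u r) - \<sigma> *\<^sub>R u r + f r - (CE r (E.sh \<sigma> r s x) - \<sigma> *\<^sub>R E.sh \<sigma> r s x) =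
          CE r (u r - E.sh \<sigma> r s x) - \<sigma> *\<^sub>R (u r - E.sh \<sigma> r s x) + f r" by simp
      qed simp_all
      then show ?thesis by (rule p.mild_pos) (use False one fP in auto)
    qed
    then have "norm (E.sh \<sigma> t s x) \<le> cn * norm (u t)" by (rule normal_P[OF shP[OF st x]])
    also have "\<dots> \<le> cn * (b * (N * (m * norm x)))" using un cn0 by (rule mult_left_mono)
    also have "\<dots> = (cn * (b * (N * m))) * norm x" by simp
    also have "\<dots> \<le> c * norm x" by (intro mult_right_mono) (auto simp: c_def)
    finally show ?thesis .
  qed
  moreover have "c \<ge> 0" using m by (simp add: c_def)
  ultimately show ?thesis using that by blast
qed

text \<open>Orbits are so far bounded for initial values in \<open>X0\<close> that are positive. A
  general \<open>x\<close> is split in \<open>X\<close>, and \<open>J \<mu>\<close> moves the parts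
  into \<open>X0\<close> while keeping them positive.\<close>

lemma power_bounded_rate:
  assumes a: "0 < a" "a < 1" "power_bounded_by S (LL \<sigma>) a"
  shows "E.rate \<sigma>"
proof -
  obtain c where c: "c \<ge> 0" "\<And>s t x. s \<le> t \<Longrightarrow> x \<in> X0 \<Longrightarrow> x \<in> P \<Longrightarrow> norm (E.sh \<sigma> t s x) \<le> c * norm x"
    using positive_orbit_bound[OF a] by metis
  define c' where "c' = 2 * (c * (2 * M * cd))"
  have all: "norm (E.sh \<sigma> t s x) \<le> c' * norm x" if st: "s \<le> t" and x: "x \<in> X0" for s t x
  proof -
    have op: "bounded_op_on X0 (E.sh \<sigma> t s)" using E.sh_evolution[of \<sigma>] st by (auto simp: evolution_family_def)
    obtain K where K: "K \<ge> 0" "\<And>x. x \<in> X0 \<Longrightarrow> norm (E.sh \<sigma> t s x) \<le> K * norm x" using bounded_op_onD[OF op] by metis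
    have add: "E.sh \<sigma> t s (x + y) = E.sh \<sigma> t s x + E.sh \<sigma> t s y" if "x \<in> X0" "y \<in> X0" for x y
      using op that by (simp add: bounded_op_on_def linear_op_on_def)
    have neg: "E.sh \<sigma> t s (- y) = - E.sh \<sigma> t s y" if "y \<in> X0" for y
    proof -
      have "E.sh \<sigma> t s ((-1) *\<^sub>R y) = (-1) *\<^sub>R E.sh \<sigma> t s y" using op that unfolding bounded_op_on_def linear_op_on_def by blast
      then show ?thesis by simp
    qed
    \<comment> \<open>\<open>K\<close> depends on \<open>s\<close> and \<open>t\<close>, but it
      multiplies only \<open>\<epsilon>\<close>, so the uniform constant \<open>c'\<close> survives
      in the limit.\<close>
    have "norm (E.sh \<sigma> t s x) \<le> c' * norm x + \<epsilon> * (K * (2 * M + 1))" if \<epsilon>: "\<epsilon> > 0" for \<epsilon>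
    proof -
      obtain \<mu>1 where \<mu>1: "\<mu>1 \<ge> \<mu>0" "\<And>\<mu>. \<mu> \<ge> \<mu>1 \<Longrightarrow> norm (J \<mu> x - x) \<le> \<epsilon>" using J_X0_small[OF x \<epsilon>] by blast
      define \<mu> where "\<mu> = max \<mu>1 (w' + 1)"
      have \<mu>: "\<mu> \<ge> \<mu>0" "\<mu> > w'" "norm (J \<mu> x - x) \<le> \<epsilon>" using \<mu>1 by (auto simp: \<mu>_def)
      interpret J: bounded_linear "J \<mu>" using \<mu>0(1)[OF \<mu>(1)] by (rule bounded_linear_J)
      have JX: "J \<mu> y \<in> X0" for y using J_in[OF \<mu>0(1)[OF \<mu>(1)]] D_X0 by blast
      have JP: "J \<mu> y \<in> P" if "y \<in> P" for y unfolding J_def using that \<mu> \<mu>0(2)[OF \<mu>(1)] by (intro P_scale res_pos) auto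
      obtain y z where yz: "y \<in> P" "z \<in> P" "norm y \<le> cd * norm x" "norm z \<le> cd * norm x" "norm (x - (y - z)) \<le> \<epsilon>"
        using decomp_P[OF \<epsilon>, of x] by blast
      define v where "v = x - (J \<mu> y - J \<mu> z)"
      have vX: "v \<in> X0" unfolding v_def by (intro subspace_diff[OF subX0] x JX)
      have "v = J \<mu> (x - (y - z)) - (J \<mu> x - x)" by (simp add: v_def J.diff)
      then have "norm v \<le> norm (J \<mu> (x - (y - z))) + norm (J \<mu> x - x)" by (simp add: norm_triangle_ineq4)
      also have "\<dots> \<le> 2 * M * \<epsilon> + \<epsilon>"
        using J_bound[OF \<mu>(1), of "x - (y - z)"] mult_left_mono[OF yz(5), of "2 * M"] M1 \<mu>(3) by linarith
      finally have "K * norm v \<le> K * (2 * M * \<epsilon> + \<epsilon>)" using K(1) by (rule mult_left_mono)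
      then have nv: "norm (E.sh \<sigma> t s v) \<le> K * (2 * M * \<epsilon> + \<epsilon>)" using K(2)[OF vX] by linarith
      have nJ: "norm (E.sh \<sigma> t s (J \<mu> y)) \<le> c * (2 * M * (cd * norm x))" if "y \<in> P" "norm y \<le> cd * norm x" for y
      proof -
        have "norm (J \<mu> y) \<le> 2 * M * (cd * norm x)"
          using J_bound[OF \<mu>(1), of y] mult_left_mono[OF that(2), of "2 * M"] M1 by linarith
        then have "c * norm (J \<mu> y) \<le> c * (2 * M * (cd * norm x))" using c(1) by (rule mult_left_mono)
        then show ?thesis using c(2)[OF st JX JP[OF that(1)]] by linarith
      qed
      have "x = v + (J \<mu> y + - J \<mu> z)" by (simp add: v_def)
      then have "E.sh \<sigma> t s x = E.sh \<sigma> t s v + (E.sh \<sigma> t s (J \<mu> y) - E.sh \<sigma> t s (J \<mu> z))"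
        using add[OF vX subspace_add[OF subX0 JX subspace_neg[OF subX0 JX]]] add[OF JX subspace_neg[OF subX0 JX]] neg[OF JX] by simp
      also have "norm \<dots> \<le> K * (2 * M * \<epsilon> + \<epsilon>) + (c * (2 * M * (cd * norm x)) + c * (2 * M * (cd * norm x)))"
        by (intro order_trans[OF norm_triangle_ineq] add_mono nv order_trans[OF norm_triangle_ineq4] nJ yz)
      finally show ?thesis by (simp add: c'_def algebra_simps)
    qed
    then show ?thesis by (rule le_all_eps)
  qed
  have c'0: "c' \<ge> 0" using c(1) M1 cd0 by (simp add: c'_def)
  show ?thesis
    unfolding E.rate_def
  proof (intro exI[of _ "c' + 1"] conjI allI ballI impI)
    show "1 \<le> c' + 1" using c'0 by simp
    fix s t :: real and x assume x: "x \<in> X0" and st: "s \<le> t"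
    have "U t s x = exp (\<sigma> * (t - s)) *\<^sub>R E.sh \<sigma> t s x" by (simp add: E.sh_def flip: exp_add)
    then have "norm (U t s x) = exp (\<sigma> * (t - s)) * norm (E.sh \<sigma> t s x)" by simp
    also have "\<dots> \<le> exp (\<sigma> * (t - s)) * ((c' + 1) * norm x)"
      using all[OF st x] by (intro mult_left_mono order_trans[OF all[OF st x] mult_right_mono]) auto
    finally show "norm (U t s x) \<le> (c' + 1) * exp (\<sigma> * (t - s)) * norm x" by (simp add: mult_ac)
  qed
qed

end

end

section \<open>Interpolation between rescalings\<close>

context reproduction_model
begin

lemma CG_add: "x \<in> X0 \<Longrightarrow> y \<in> X0 \<Longrightarrow> CG t (x + y) = CG t x + CG t y"
  and CG_scale: "x \<in> X0 \<Longrightarrow> CG t (a *\<^sub>R x) = a *\<^sub>R CG t x"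
  using G.C_lin'[of t] by (auto simp: linear_op_on_def)

lemma CG_diff: "x \<in> X0 \<Longrightarrow> y \<in> X0 \<Longrightarrow> CG t (x - y) = CG t x - CG t y"
  using CG_add[of x "-y" t] CG_scale[of y t "-1"] subspace_neg[OF subX0, of y] by simp

lemma weighted_mild:
  assumes "G.solves \<sigma> u f"
  shows "mild (\<lambda>r. (p * exp (\<sigma> * r)) *\<^sub>R u r) (\<lambda>r. CG r ((p * exp (\<sigma> * r)) *\<^sub>R u r) + (p * exp (\<sigma> * r)) *\<^sub>R f r) s t"
proof -
  have m: "mild u (\<lambda>r. CG r (u r) - \<sigma> *\<^sub>R u r + f r) s t" using assms by (simp add: G.solves_def)
  show ?thesis
    using mild_exp[OF m, of p \<sigma>]
    by (rule mild_cong) (simp_all add: CG_scale mildD(3)[OF m] scaleR_add_right)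
qed

text \<open>
  The rescaled operator \<open>LL \<sigma>\<close> is \<open>LL 0\<close> conjugated with the weight \<open>exp (\<sigma> t)\<close>. Hence a pointwise
  inequality between the weights, which is propagated by positivity on half lines, passes to the
  iterates; this replaces the logarithmic convexity of the spectral radius.
\<close>

lemma iterate_domination:
  assumes \<sigma>: "rG < \<sigma>" "rG < \<sigma>1" "rG < \<sigma>2" and p: "p1 \<ge> 0" "p2 \<ge> 0"
    and ineq: "\<And>a. a \<ge> 0 \<Longrightarrow> exp (- \<sigma> * a) \<le> p1 * exp (- \<sigma>1 * a) + p2 * exp (- \<sigma>2 * a)" and \<phi>: "\<phi> \<in> Q"
  shows "p1 *\<^sub>R apply_bcontfun ((LL \<sigma>1 ^^ n) \<phi>) t0 + p2 *\<^sub>R apply_bcontfun ((LL \<sigma>2 ^^ n) \<phi>) t0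
    - apply_bcontfun ((LL \<sigma> ^^ n) \<phi>) t0 \<in> P"
proof -
  define f0 where "f0 n = apply_bcontfun ((LL \<sigma> ^^ n) \<phi>)" for n
  define f1 where "f1 n = apply_bcontfun ((LL \<sigma>1 ^^ n) \<phi>)" for n
  define f2 where "f2 n = apply_bcontfun ((LL \<sigma>2 ^^ n) \<phi>)" for n
  have \<phi>S: "\<phi> \<in> S" using \<phi> by (simp add: Q_def)
  have it: "(LL s ^^ n) \<phi> \<in> S" if "rG < s" for s n
    by (induction n) (auto intro: LL_in[OF that] \<phi>S)
  have ap: "ap (f0 n)" "ap (f1 n)" "ap (f2 n)" for n
    using it \<sigma> by (auto simp: f0_def f1_def f2_def AP_iff)
  have Suc: "f0 (Suc n) t = F t (G.K \<sigma> (f0 n) t)" "f1 (Suc n) t = F t (G.K \<sigma>1 (f1 n) t)"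
    "f2 (Suc n) t = F t (G.K \<sigma>2 (f2 n) t)" for n t
    using LL_apply[OF \<sigma>(1) it[OF \<sigma>(1)]] LL_apply[OF \<sigma>(2) it[OF \<sigma>(2)]] LL_apply[OF \<sigma>(3) it[OF \<sigma>(3)]]
    by (simp_all add: f0_def f1_def f2_def)
  define e0 where "e0 r = exp (- \<sigma> * t0) * exp (\<sigma> * r)" for r
  define e1 where "e1 r = (p1 * exp (- \<sigma>1 * t0)) * exp (\<sigma>1 * r)" for r
  define e2 where "e2 r = (p2 * exp (- \<sigma>2 * t0)) * exp (\<sigma>2 * r)" for r
  \<comment> \<open>The weights take the values \<open>1\<close>, \<open>p1\<close>,
    \<open>p2\<close> at \<open>t0\<close>. The induction needs the inequality at all earlier times,
    since \<open>K\<close> looks at the whole past.\<close>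
  define \<psi> where "\<psi> n r = e1 r *\<^sub>R f1 n r + e2 r *\<^sub>R f2 n r - e0 r *\<^sub>R f0 n r" for n r
  have "\<forall>T\<le>t0. \<psi> n T \<in> P" for n
  proof (induction n)
    case 0
    show ?case
    proof (intro allI impI)
      fix T assume T: "T \<le> t0"
      have e: "exp (- s * t0) * exp (s * T) = exp (- s * (t0 - T))" for s :: real by (simp add: algebra_simps flip: exp_add)
      have "e0 T \<le> e1 T + e2 T" unfolding e0_def e1_def e2_def mult.assoc e using T by (intro ineq) simp
      moreover have "\<psi> 0 T = (e1 T + e2 T - e0 T) *\<^sub>R apply_bcontfun \<phi> T"
        by (simp add: \<psi>_def f0_def f1_def f2_def algebra_simps)
      ultimately show "\<psi> 0 T \<in> P" using \<phi> by (auto simp: Q_def intro: P_scale)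
    qed
  next
    case (Suc n)
    define u0 where "u0 = G.K \<sigma> (f0 n)"
    define u1 where "u1 = G.K \<sigma>1 (f1 n)"
    define u2 where "u2 = G.K \<sigma>2 (f2 n)"
    have uX: "u0 r \<in> X0" "u1 r \<in> X0" "u2 r \<in> X0" for r
      unfolding u0_def u1_def u2_def using G.K_in[OF rG(1)] \<sigma> ap by blast+
    obtain B0 where B0: "\<And>r. norm (u0 r) \<le> B0" "B0 \<ge> 0" using ap_bounded[OF G.K_ap[OF rG(1) \<sigma>(1) ap(1)]] unfolding u0_def by metis
    obtain B1 where B1: "\<And>r. norm (u1 r) \<le> B1" "B1 \<ge> 0" using ap_bounded[OF G.K_ap[OF rG(1) \<sigma>(2) ap(2)]] unfolding u1_def by metis
    obtain B2 where B2: "\<And>r. norm (u2 r) \<le> B2" "B2 \<ge> 0" using ap_bounded[OF G.K_ap[OF rG(1) \<sigma>(3) ap(3)]] unfolding u2_def by metis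
    \<comment> \<open>The weights undo the three rescalings, so this combination solves the unscaled
      equation with inhomogeneity \<open>\<psi> n\<close>.\<close>
    define z where "z r = e1 r *\<^sub>R u1 r + e2 r *\<^sub>R u2 r - e0 r *\<^sub>R u0 r" for r
    have zX: "z r \<in> X0" for r
      unfolding z_def by (intro subspace_diff[OF subX0] subspace_add[OF subX0] subspace_scale[OF subX0] uX)
    have mz: "mild z (\<lambda>r. CG r (z r) + \<psi> n r) s t" for s t
    proof -
      have "mild z (\<lambda>r. (CG r (e1 r *\<^sub>R u1 r) + e1 r *\<^sub>R f1 n r) + (CG r (e2 r *\<^sub>R u2 r) + e2 r *\<^sub>R f2 n r)
          - (CG r (e0 r *\<^sub>R u0 r) + e0 r *\<^sub>R f0 n r)) s t"
        unfolding z_def e0_def e1_def e2_def u0_def u1_def u2_def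
        by (intro mild_diff mild_add weighted_mild G.K_solves[OF rG(1)] \<sigma> ap)
      then show ?thesis
      proof (rule mild_cong)
        fix r
        have "CG r (z r) = CG r (e1 r *\<^sub>R u1 r) + CG r (e2 r *\<^sub>R u2 r) - CG r (e0 r *\<^sub>R u0 r)"
          unfolding z_def by (simp add: CG_diff CG_add subspace_add[OF subX0] subspace_scale[OF subX0] uX)
        then show "(CG r (e1 r *\<^sub>R u1 r) + e1 r *\<^sub>R f1 n r) + (CG r (e2 r *\<^sub>R u2 r) + e2 r *\<^sub>R f2 n r)
          - (CG r (e0 r *\<^sub>R u0 r) + e0 r *\<^sub>R f0 n r) = CG r (z r) + \<psi> n r" by (simp add: \<psi>_def)
      qed simp
    qed
    \<comment> \<open>The weighted solutions may grow at minus infinity, at most at this rate. It is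
      below \<open>- rG\<close> because \<open>rG\<close> is negative and below all three
      parameters.\<close>
    define \<epsilon> where "\<epsilon> = max 0 (max (- \<sigma>) (max (- \<sigma>1) (- \<sigma>2)))"
    have \<epsilon>: "\<epsilon> < - rG" "- \<sigma> \<le> \<epsilon>" "- \<sigma>1 \<le> \<epsilon>" "- \<sigma>2 \<le> \<epsilon>" using \<sigma> rG(2) by (auto simp: \<epsilon>_def)
    have zP: "z T \<in> P" if T: "T \<le> t0" for T
    proof (rule G.backward_positivity[OF rG, of T z "\<psi> n" _ \<epsilon>])
      show "mild z (\<lambda>q. CG q (z q) + \<psi> n q) s T" for s by (rule mz)
      show "\<psi> n q \<in> P" if "q \<le> T" for q using Suc that T by auto
      have w: "p * exp (s * r) \<le> p * exp (s * T) * exp (\<epsilon> * (T - r))" if "r \<le> T" "- s \<le> \<epsilon>" "p \<ge> 0" for p s r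
      proof -
        have "(- s) * (T - r) \<le> \<epsilon> * (T - r)" using that by (intro mult_right_mono) auto
        then have "s * r \<le> s * T + \<epsilon> * (T - r)" by (simp add: algebra_simps)
        then have "exp (s * r) \<le> exp (s * T) * exp (\<epsilon> * (T - r))" by (simp flip: exp_add)
        then show ?thesis using that(3) by (simp add: mult_left_mono mult.assoc)
      qed
      show "norm (z r) \<le> (e1 T * B1 + e2 T * B2 + e0 T * B0) * exp (\<epsilon> * (T - r))" if r: "r \<le> T" for r
      proof -
        have part: "norm (e *\<^sub>R x) \<le> e' * X * B" if "0 \<le> e" "e \<le> e' * X" "norm x \<le> B" "B \<ge> 0" for e e' X B :: real and x :: 'a
        proof -
          have "norm (e *\<^sub>R x) = e * norm x" using that(1) by simp
          also have "\<dots> \<le> (e' * X) * B" using that by (intro mult_mono) auto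
          finally show ?thesis .
        qed
        have "norm (z r) \<le> norm (e1 r *\<^sub>R u1 r) + norm (e2 r *\<^sub>R u2 r) + norm (e0 r *\<^sub>R u0 r)"
          unfolding z_def by (rule order_trans[OF norm_triangle_ineq4 add_mono[OF norm_triangle_ineq order_refl]])
        also have "\<dots> \<le> e1 T * exp (\<epsilon> * (T - r)) * B1 + e2 T * exp (\<epsilon> * (T - r)) * B2 + e0 T * exp (\<epsilon> * (T - r)) * B0"
        proof (intro add_mono part B0 B1 B2)
          show "e1 r \<le> e1 T * exp (\<epsilon> * (T - r))" "e2 r \<le> e2 T * exp (\<epsilon> * (T - r))" "e0 r \<le> e0 T * exp (\<epsilon> * (T - r))"
            unfolding e0_def e1_def e2_def by (intro w r \<epsilon> mult_nonneg_nonneg p exp_ge_zero)+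
        qed (use p in \<open>auto simp: e0_def e1_def e2_def\<close>)
        finally show ?thesis by (simp add: algebra_simps)
      qed
      show "\<epsilon> < - rG" by (rule \<epsilon>(1))
    qed
    show ?case
    proof (intro allI impI)
      fix T assume T: "T \<le> t0"
      have "F T (z T) \<in> P" by (rule F_pos[OF zX zP[OF T]])
      moreover have "F T (z T) = \<psi> (Suc n) T"
        unfolding z_def \<psi>_def \<open>\<And>n t. f0 (Suc n) t = F t (G.K \<sigma> (f0 n) t)\<close>
          \<open>\<And>n t. f1 (Suc n) t = F t (G.K \<sigma>1 (f1 n) t)\<close> \<open>\<And>n t. f2 (Suc n) t = F t (G.K \<sigma>2 (f2 n) t)\<close>
          u0_def[symmetric] u1_def[symmetric] u2_def[symmetric]
        by (simp add: F_diff F_add F_scale subspace_add[OF subX0] subspace_scale[OF subX0] uX)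
      ultimately show "\<psi> (Suc n) T \<in> P" by simp
    qed
  qed
  then have "\<psi> n t0 \<in> P" by blast
  moreover have "e0 t0 = 1" "e1 t0 = p1" "e2 t0 = p2"
    by (simp_all add: e0_def e1_def e2_def mult.assoc flip: exp_add)
  ultimately show ?thesis by (simp add: \<psi>_def f0_def f1_def f2_def)
qed

text \<open>\<open>\<alpha>\<close> is a free length of time per generation. For elapsed times
  beyond \<open>\<alpha> * n\<close> the weight of \<open>\<sigma>1\<close> dominates, for shorter
  ones that of \<open>\<sigma>2\<close>; the prices \<open>p1\<close> and \<open>p2\<close> are
  \<open>n\<close>-th powers and combine with the bases \<open>b1\<close> and
  \<open>b2\<close>.\<close>

lemma power_bounded_interpolation:
  assumes \<sigma>: "rG < \<sigma>1" "\<sigma>1 \<le> \<sigma>" "\<sigma> \<le> \<sigma>2" and \<alpha>: "\<alpha> > 0"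
    and pb: "power_bounded_by S (LL \<sigma>1) b1" "power_bounded_by S (LL \<sigma>2) b2" and b: "b1 \<ge> 0" "b2 \<ge> 0"
    and x: "exp (- (\<sigma> - \<sigma>1) * \<alpha>) * b1 \<le> x" "exp ((\<sigma>2 - \<sigma>) * \<alpha>) * b2 \<le> x"
  shows "power_bounded_by S (LL \<sigma>) x"
proof -
  have r: "rG < \<sigma>" "rG < \<sigma>2" using \<sigma> by auto
  obtain B where "positive_op S (LL \<sigma>) B Q cn cd" by (rule LL_positive_op[OF r(1)])
  then interpret L: positive_op S "LL \<sigma>" B Q cn cd .
  obtain K1 where K1: "\<And>n \<phi>. \<phi> \<in> S \<Longrightarrow> norm ((LL \<sigma>1 ^^ n) \<phi>) \<le> K1 * b1 ^ n * norm \<phi>" using pb(1) by (auto simp: power_bounded_by_def)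
  obtain K2 where K2: "\<And>n \<phi>. \<phi> \<in> S \<Longrightarrow> norm ((LL \<sigma>2 ^^ n) \<phi>) \<le> K2 * b2 ^ n * norm \<phi>" using pb(2) by (auto simp: power_bounded_by_def)
  have x0: "x \<ge> 0" using x(1) b(1) by (meson exp_ge_zero mult_nonneg_nonneg order_trans)
  show ?thesis
  proof (rule L.power_bounded_from_positive[of "cn * (\<bar>K1\<bar> + \<bar>K2\<bar>)"])
    show "0 \<le> cn * (\<bar>K1\<bar> + \<bar>K2\<bar>)" using cn0 by simp
    show "0 \<le> x" by (rule x0)
    fix n \<phi> assume \<phi>: "\<phi> \<in> Q"
    have \<phi>S: "\<phi> \<in> S" by (rule L.Q_in[OF \<phi>])
    define p1 where "p1 = exp (- (\<sigma> - \<sigma>1) * (\<alpha> * real n))"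
    define p2 where "p2 = exp ((\<sigma>2 - \<sigma>) * (\<alpha> * real n))"
    have pe: "p1 = exp (- (\<sigma> - \<sigma>1) * \<alpha>) ^ n" "p2 = exp ((\<sigma>2 - \<sigma>) * \<alpha>) ^ n"
      by (simp_all add: p1_def p2_def exp_of_nat_mult[symmetric] mult_ac)
    have ineq: "exp (- \<sigma> * a) \<le> p1 * exp (- \<sigma>1 * a) + p2 * exp (- \<sigma>2 * a)" if "a \<ge> 0" for a
    proof (cases "a \<ge> \<alpha> * real n")
      case True
      have "(\<sigma> - \<sigma>1) * (\<alpha> * real n) \<le> (\<sigma> - \<sigma>1) * a" using True \<sigma> by (intro mult_left_mono) auto
      then have "exp (- \<sigma> * a) \<le> exp (- (\<sigma> - \<sigma>1) * (\<alpha> * real n) + - \<sigma>1 * a)" by (simp add: algebra_simps)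
      then have "exp (- \<sigma> * a) \<le> p1 * exp (- \<sigma>1 * a)" by (simp only: p1_def exp_add)
      moreover have "0 \<le> p2 * exp (- \<sigma>2 * a)" by (simp add: p2_def)
      ultimately show ?thesis by linarith
    next
      case False
      have "(\<sigma>2 - \<sigma>) * a \<le> (\<sigma>2 - \<sigma>) * (\<alpha> * real n)" using False \<sigma> by (intro mult_left_mono) auto
      then have "exp (- \<sigma> * a) \<le> exp ((\<sigma>2 - \<sigma>) * (\<alpha> * real n) + - \<sigma>2 * a)" by (simp add: algebra_simps)
      then have "exp (- \<sigma> * a) \<le> p2 * exp (- \<sigma>2 * a)" by (simp only: p2_def exp_add)
      moreover have "0 \<le> p1 * exp (- \<sigma>1 * a)" by (simp add: p1_def)
      ultimately show ?thesis by linarith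
    qed
    define v where "v = p1 *\<^sub>R (LL \<sigma>1 ^^ n) \<phi> + p2 *\<^sub>R (LL \<sigma>2 ^^ n) \<phi>"
    have it: "(LL s ^^ n) \<phi> \<in> S" if "rG < s" for s
      by (induction n) (auto intro: LL_in[OF that] \<phi>S)
    have "v \<in> S" unfolding v_def by (intro subspace_add[OF subspace_AP] subspace_scale[OF subspace_AP] it \<sigma> r)
    then have "v - (LL \<sigma> ^^ n) \<phi> \<in> S" by (intro subspace_diff[OF subspace_AP] it r)
    moreover have "apply_bcontfun (v - (LL \<sigma> ^^ n) \<phi>) t \<in> P" for t
      using iterate_domination[OF r(1) \<sigma>(1) r(2) _ _ ineq \<phi>, of n t] by (simp add: v_def p1_def p2_def)
    ultimately have "v - (LL \<sigma> ^^ n) \<phi> \<in> Q" by (simp add: Q_def)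
    then have nv: "norm ((LL \<sigma> ^^ n) \<phi>) \<le> cn * norm v" by (rule L.normal[OF L.Tn_pos[OF \<phi>]])
    have "norm v \<le> \<bar>K1\<bar> * x ^ n * norm \<phi> + \<bar>K2\<bar> * x ^ n * norm \<phi>"
      unfolding v_def
    proof (rule order_trans[OF norm_triangle_ineq], rule add_mono)
      have *: "norm (p *\<^sub>R \<psi>) \<le> \<bar>K\<bar> * x ^ n * norm \<phi>"
        if "norm \<psi> \<le> K * b ^ n * norm \<phi>" "p = q ^ n" "q * b \<le> x" "q \<ge> 0" "b \<ge> 0" for p q b K \<psi>
      proof -
        have "norm (p *\<^sub>R \<psi>) \<le> p * (K * b ^ n * norm \<phi>)" using that by (simp add: mult_left_mono)
        also have "\<dots> = (q * b) ^ n * K * norm \<phi>" by (simp add: that(2) power_mult_distrib)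
        also have "\<dots> \<le> (q * b) ^ n * \<bar>K\<bar> * norm \<phi>" using that by (intro mult_right_mono mult_left_mono) auto
        also have "\<dots> \<le> x ^ n * \<bar>K\<bar> * norm \<phi>" using that by (intro mult_right_mono power_mono) auto
        finally show ?thesis by (simp add: mult_ac)
      qed
      show "norm (p1 *\<^sub>R (LL \<sigma>1 ^^ n) \<phi>) \<le> \<bar>K1\<bar> * x ^ n * norm \<phi>" by (rule *[OF K1[OF \<phi>S] pe(1) x(1)]) (use b in auto)
      show "norm (p2 *\<^sub>R (LL \<sigma>2 ^^ n) \<phi>) \<le> \<bar>K2\<bar> * x ^ n * norm \<phi>" by (rule *[OF K2[OF \<phi>S] pe(2) x(2)]) (use b in auto)
    qed
    then have "cn * norm v \<le> cn * (\<bar>K1\<bar> * x ^ n * norm \<phi> + \<bar>K2\<bar> * x ^ n * norm \<phi>)" using cn0 by (intro mult_left_mono) auto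
    with nv show "norm ((LL \<sigma> ^^ n) \<phi>) \<le> cn * (\<bar>K1\<bar> + \<bar>K2\<bar>) * x ^ n * norm \<phi>"
      by (simp add: algebra_simps)
  qed
qed

lemma some_power_bound: assumes "rG < \<sigma>" obtains B where "B \<ge> 0" "power_bounded_by S (LL \<sigma>) B"
proof -
  obtain B where "positive_op S (LL \<sigma>) B Q cn cd" by (rule LL_positive_op[OF assms])
  then interpret L: positive_op S "LL \<sigma>" B Q cn cd .
  have "power_bounded_by S (LL \<sigma>) B"
    unfolding power_bounded_by_def using L.Tn_bound by (intro exI[of _ 1]) simp
  then show ?thesis using that L.B0 by blast
qed

text \<open>Only a crude bound \<open>B\<close> is known at \<open>\<sigma>1\<close>. It is
  suppressed by a long generation time \<open>\<alpha>\<close>, after which the displacement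
  \<open>d\<close> is taken so small that the base \<open>a\<close> at \<open>\<sigma>\<close> grows
  only to \<open>(1 + a) / 2\<close>.\<close>

lemma power_bounded_openness:
  assumes \<sigma>: "rG < \<sigma>" and a: "0 < a" "a < 1" "power_bounded_by S (LL \<sigma>) a"
  shows "\<exists>\<tau><\<sigma>. rG < \<tau> \<and> (\<exists>a. 0 < a \<and> a < 1 \<and> power_bounded_by S (LL \<tau>) a)"
proof -
  define \<sigma>1 where "\<sigma>1 = (rG + \<sigma>) / 2"
  define h where "h = (\<sigma> - \<sigma>1) / 2"
  have h: "h > 0" "rG < \<sigma>1" "\<sigma> = \<sigma>1 + 2 * h" using \<sigma> by (auto simp: \<sigma>1_def h_def field_simps)
  obtain B where B: "B \<ge> 0" "power_bounded_by S (LL \<sigma>1) B" using some_power_bound[OF h(2)] by metis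
  \<comment> \<open>Gives \<open>exp (- h * \<alpha>) = 1 / (2 * B + 2)\<close>, which brings the
    crude base below one half.\<close>
  define \<alpha> where "\<alpha> = ln (2 * B + 2) / h"
  have \<alpha>: "\<alpha> > 0" "h * \<alpha> = ln (2 * B + 2)" using h B by (auto simp: \<alpha>_def)
  \<comment> \<open>\<open>d \<le> h\<close> keeps the distance to \<open>\<sigma>1\<close> at least
    \<open>h\<close>; the second bound gives
    \<open>exp (d * \<alpha>) * a \<le> (1 + a) / 2\<close>.\<close>
  define d where "d = min h (ln ((1 + a) / (2 * a)) / \<alpha>)"
  have l: "ln ((1 + a) / (2 * a)) > 0" using a by (simp add: ln_gt_zero)
  have d: "d > 0" "d \<le> h" using h l \<alpha> by (auto simp: d_def)
  have "d * \<alpha> \<le> ln ((1 + a) / (2 * a)) / \<alpha> * \<alpha>" using \<alpha> by (intro mult_right_mono) (auto simp: d_def)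
  then have d\<alpha>: "d * \<alpha> \<le> ln ((1 + a) / (2 * a))" using \<alpha> by simp
  have "power_bounded_by S (LL (\<sigma> - d)) ((1 + a) / 2)"
  proof (rule power_bounded_interpolation[OF h(2) _ _ \<alpha>(1) B(2) a(3) B(1)])
    show "\<sigma>1 \<le> \<sigma> - d" "\<sigma> - d \<le> \<sigma>" "0 \<le> a" using h d a by auto
    have "h * \<alpha> \<le> (\<sigma> - d - \<sigma>1) * \<alpha>" using h d \<alpha> by (intro mult_right_mono) auto
    then have "exp (- (\<sigma> - d - \<sigma>1) * \<alpha>) \<le> exp (- ln (2 * B + 2))" unfolding \<alpha>(2)[symmetric] exp_le_cancel_iff by (simp only: mult_minus_left neg_le_iff_le)
    also have "\<dots> = 1 / (2 * B + 2)" using B by (simp add: exp_minus inverse_eq_divide)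
    finally have "exp (- (\<sigma> - d - \<sigma>1) * \<alpha>) * B \<le> 1 / (2 * B + 2) * B" using B by (intro mult_right_mono)
    also have "\<dots> \<le> 1 / 2" using B by (simp add: field_simps)
    finally show "exp (- (\<sigma> - d - \<sigma>1) * \<alpha>) * B \<le> (1 + a) / 2" using a by simp
    have "exp ((\<sigma> - (\<sigma> - d)) * \<alpha>) \<le> exp (ln ((1 + a) / (2 * a)))" using d\<alpha> by simp
    also have "\<dots> = (1 + a) / (2 * a)" using a by (intro exp_ln) auto
    finally have "exp ((\<sigma> - (\<sigma> - d)) * \<alpha>) * a \<le> (1 + a) / (2 * a) * a" using a by (intro mult_right_mono) auto
    then show "exp ((\<sigma> - (\<sigma> - d)) * \<alpha>) * a \<le> (1 + a) / 2" using a by simp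
  qed
  then show ?thesis using a d h by (intro exI[of _ "\<sigma> - d"] conjI exI[of _ "(1 + a) / 2"]) auto
qed

theorem power_bounded_iff_rate:
  assumes \<sigma>: "rG < \<sigma>"
  shows "(\<exists>a. 0 < a \<and> a < 1 \<and> power_bounded_by S (LL \<sigma>) a) \<longleftrightarrow> (\<exists>r<\<sigma>. E.rate r)"
proof
  assume "\<exists>a. 0 < a \<and> a < 1 \<and> power_bounded_by S (LL \<sigma>) a"
  then obtain \<tau> where "\<tau> < \<sigma>" "rG < \<tau>" "\<exists>a. 0 < a \<and> a < 1 \<and> power_bounded_by S (LL \<tau>) a"
    using power_bounded_openness[OF \<sigma>] by blast
  then show "\<exists>r<\<sigma>. E.rate r" using power_bounded_rate by blast
qed (use rate_power_bounded[OF \<sigma>] in blast)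

theorem power_bounded_all_iff_rate:
  "(\<forall>a>1. power_bounded_by S (LL 0) a) \<longleftrightarrow> (\<forall>\<sigma>>0. \<exists>r<\<sigma>. E.rate r)"
proof (intro iffI allI impI)
  fix \<sigma> :: real assume pb: "\<forall>a>1. power_bounded_by S (LL 0) a" and \<sigma>: "\<sigma> > 0"
  \<comment> \<open>Above the known rate \<open>rE\<close>, where the base \<open>b\<close> is below
    one, and above \<open>\<sigma>\<close>, which then lies between \<open>0\<close> and
    \<open>\<Lambda>\<close>.\<close>
  define \<Lambda> where "\<Lambda> = max \<sigma> rE + 1"
  have \<Lambda>: "rG < \<Lambda>" "rE < \<Lambda>" "\<sigma> < \<Lambda>" using rG(2) \<sigma> by (auto simp: \<Lambda>_def)
  obtain b where b: "0 < b" "b < 1" "power_bounded_by S (LL \<Lambda>) b" using rate_power_bounded[OF \<Lambda>(1) rE \<Lambda>(2)] by blast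
  \<comment> \<open>Chosen so that the base \<open>b\<close> at \<open>\<Lambda>\<close>, carried
    back to \<open>\<sigma>\<close>, becomes \<open>(1 + b) / 2 < 1\<close>.\<close>
  define \<alpha> where "\<alpha> = ln ((1 + b) / (2 * b)) / (\<Lambda> - \<sigma>)"
  have l: "ln ((1 + b) / (2 * b)) > 0" using b by (simp add: ln_gt_zero)
  have \<alpha>: "\<alpha> > 0" "(\<Lambda> - \<sigma>) * \<alpha> = ln ((1 + b) / (2 * b))" using l \<Lambda> by (auto simp: \<alpha>_def)
  \<comment> \<open>An admissible base above one at parameter \<open>0\<close>; the gain
    \<open>exp (- \<sigma> * \<alpha>)\<close> more than compensates for it.\<close>
  define \<xi> where "\<xi> = exp (\<sigma> * \<alpha> / 2)"
  define x where "x = max ((1 + b) / 2) (exp (- (\<sigma> * \<alpha> / 2)))"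
  have \<xi>: "\<xi> > 1" using \<sigma> \<alpha> by (simp add: \<xi>_def)
  have x: "0 < x" "x < 1" using b \<sigma> \<alpha> by (auto simp: x_def less_max_iff_disj)
  have "power_bounded_by S (LL \<sigma>) x"
  proof (rule power_bounded_interpolation[OF rG(2) _ _ \<alpha>(1) _ b(3)])
    show "power_bounded_by S (LL 0) \<xi>" using pb \<xi> by blast
    show "0 \<le> \<sigma>" "\<sigma> \<le> \<Lambda>" "0 \<le> \<xi>" "0 \<le> b" using \<sigma> \<Lambda> \<xi> b by auto
    have "exp (- (\<sigma> - 0) * \<alpha>) * \<xi> = exp (- (\<sigma> * \<alpha> / 2))" unfolding \<xi>_def by (simp flip: exp_add)
    then show "exp (- (\<sigma> - 0) * \<alpha>) * \<xi> \<le> x" by (simp add: x_def)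
    have "exp ((\<Lambda> - \<sigma>) * \<alpha>) * b = (1 + b) / 2" unfolding \<alpha>(2) using b by simp
    then show "exp ((\<Lambda> - \<sigma>) * \<alpha>) * b \<le> x" unfolding x_def by linarith
  qed
  then show "\<exists>r<\<sigma>. E.rate r" using power_bounded_iff_rate[of \<sigma>] x rG(2) \<sigma> by auto
next
  fix a :: real assume rates: "\<forall>\<sigma>>0. \<exists>r<\<sigma>. E.rate r" and a: "a > 1"
  \<comment> \<open>The point \<open>- h\<close> lies halfway between \<open>rG\<close> and
    \<open>0\<close>, where at least a crude bound is available.\<close>
  define h where "h = - (rG / 2)"
  have h: "h > 0" "rG < - h" using rG(2) by (auto simp: h_def)
  obtain B where B: "B \<ge> 0" "power_bounded_by S (LL (- h)) B" using some_power_bound[OF h(2)] by metis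
  \<comment> \<open>Reduces the crude base \<open>B\<close> at \<open>- h\<close> to
    \<open>B / (B + 2) \<le> 1\<close>.\<close>
  define \<alpha> where "\<alpha> = ln (B + 2) / h"
  have \<alpha>: "\<alpha> > 0" "h * \<alpha> = ln (B + 2)" using h B by (auto simp: \<alpha>_def)
  \<comment> \<open>Carrying a base from \<open>\<sigma>2\<close> to \<open>0\<close> then costs
    exactly the factor \<open>a\<close>, and the base at \<open>\<sigma>2\<close> is below
    one.\<close>
  define \<sigma>2 where "\<sigma>2 = ln a / \<alpha>"
  have \<sigma>2: "\<sigma>2 > 0" "\<sigma>2 * \<alpha> = ln a" using \<alpha> a by (auto simp: \<sigma>2_def)
  obtain b where b: "0 < b" "b < 1" "power_bounded_by S (LL \<sigma>2) b"
    using power_bounded_iff_rate[of \<sigma>2] rates \<sigma>2(1) rG(2) by auto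
  show "power_bounded_by S (LL 0) a"
  proof (rule power_bounded_interpolation[OF h(2) _ _ \<alpha>(1) B(2) b(3) B(1)])
    show "- h \<le> 0" "0 \<le> \<sigma>2" "0 \<le> b" using h \<sigma>2 b by auto
    have "exp (- (0 - (- h)) * \<alpha>) = 1 / (B + 2)" using \<alpha>(2) B by (simp add: exp_minus inverse_eq_divide)
    then have "exp (- (0 - (- h)) * \<alpha>) * B = B / (B + 2)" by simp
    also have "\<dots> \<le> 1" using B by simp
    finally show "exp (- (0 - (- h)) * \<alpha>) * B \<le> a" using a by linarith
    have "exp ((\<sigma>2 - 0) * \<alpha>) = a" using \<sigma>2(2) a by simp
    then show "exp ((\<sigma>2 - 0) * \<alpha>) * b \<le> a" using a b by simp
  qed
qed

section \<open>The growth bound of the evolution semigroup\<close>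

text \<open>\<open>Bcontfun\<close> is meaningful only for bounded continuous functions. Continuity
  comes from the joint continuity of a rescaled, decaying family, for which
  \<open>\<sigma> = rE + 1\<close> is one choice.\<close>

lemma evolution_semigroup_apply:
  assumes \<phi>: "\<phi> \<in> AP X0" and t: "t \<ge> 0"
  shows "apply_bcontfun (evolution_semigroup U t \<phi>) = (\<lambda>s. U s (s - t) (apply_bcontfun \<phi> (s - t)))"
proof -
  define \<sigma> where "\<sigma> = rE + 1"
  have r: "E.rate rE" "rE < \<sigma>" using rE by (auto simp: \<sigma>_def)
  obtain N where "evolution D A P w M w' (\<lambda>t x. CE t x - \<sigma> *\<^sub>R x) (cE + \<bar>\<sigma>\<bar>) (kE + \<sigma>) (E.sh \<sigma>) N (\<sigma> - rE)"
    by (rule E.evolution_shift[OF r])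
  then interpret e: evolution D A P w M w' "\<lambda>t x. CE t x - \<sigma> *\<^sub>R x" "cE + \<bar>\<sigma>\<bar>" "kE + \<sigma>" "E.sh \<sigma>" N "\<sigma> - rE" .
  let ?g = "apply_bcontfun \<phi>"
  have g: "continuous_on UNIV ?g" "\<And>s. ?g s \<in> X0" "\<And>s. norm (?g s) \<le> norm \<phi>"
    using \<phi> norm_bounded by (auto simp: AP_iff)
  have c: "continuous_on UNIV (\<lambda>s. (\<lambda>(t, s). E.sh \<sigma> t s (?g s)) (s, s - t))"
    by (rule continuous_on_compose2[OF e.W_g_cont[OF g]]) (use t in \<open>auto intro!: continuous_intros\<close>)
  have eq: "U s (s - t) (?g (s - t)) = exp (\<sigma> * t) *\<^sub>R E.sh \<sigma> s (s - t) (?g (s - t))" for s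
    by (simp add: E.sh_def flip: exp_add)
  have cU: "continuous_on UNIV (\<lambda>s. U s (s - t) (?g (s - t)))"
    unfolding eq using c by (intro continuous_intros) simp
  obtain NE where NE: "NE \<ge> 1" "\<And>s t x. x \<in> X0 \<Longrightarrow> s \<le> t \<Longrightarrow> norm (U t s x) \<le> NE * exp (rE * (t - s)) * norm x"
    using rE by (auto simp: E.rate_def)
  have "norm (U s (s - t) (?g (s - t))) \<le> NE * exp (rE * t) * norm \<phi>" for s
  proof -
    have "norm (U s (s - t) (?g (s - t))) \<le> NE * exp (rE * t) * norm (?g (s - t))"
      using NE(2)[OF g(2), of "s - t" s "s - t"] t by simp
    also have "\<dots> \<le> NE * exp (rE * t) * norm \<phi>" using NE(1) g(3) by (intro mult_left_mono) auto
    finally show ?thesis .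
  qed
  then have "(\<lambda>s. U s (s - t) (?g (s - t))) \<in> bcontfun" by (rule bcontfun_normI[OF cU])
  then show ?thesis unfolding evolution_semigroup_def by (rule Bcontfun_inverse)
qed

lemma semigroup_rate_iff:
  "(\<exists>M\<ge>1. \<forall>t\<ge>0. onorm_on (AP X0) (evolution_semigroup U t) \<le> M * exp (r * t)) \<longleftrightarrow> E.rate r"
proof
  assume "E.rate r"
  then obtain N where N: "N \<ge> 1" "\<And>s t x. x \<in> X0 \<Longrightarrow> s \<le> t \<Longrightarrow> norm (U t s x) \<le> N * exp (r * (t - s)) * norm x"
    by (auto simp: E.rate_def)
  have "onorm_on (AP X0) (evolution_semigroup U t) \<le> N * exp (r * t)" if t: "t \<ge> 0" for t
  proof (rule onorm_on_le)
    show "0 \<le> N * exp (r * t)" using N(1) by simp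
    have "0 \<in> AP X0" using ap_const[of "0::'a"] subspace_0[OF subX0] by (simp add: AP_iff)
    then show "AP X0 \<noteq> {}" by blast
    fix \<phi> assume \<phi>: "\<phi> \<in> AP X0"
    show "norm (evolution_semigroup U t \<phi>) \<le> N * exp (r * t) * norm \<phi>"
    proof (rule norm_bound)
      fix s
      have "norm (U s (s - t) (apply_bcontfun \<phi> (s - t))) \<le> N * exp (r * t) * norm (apply_bcontfun \<phi> (s - t))"
        using N(2)[of "apply_bcontfun \<phi> (s - t)" "s - t" s] \<phi> t by (simp add: AP_iff)
      also have "\<dots> \<le> N * exp (r * t) * norm \<phi>" using N(1) by (intro mult_left_mono norm_bounded) auto
      finally show "norm (apply_bcontfun (evolution_semigroup U t \<phi>) s) \<le> N * exp (r * t) * norm \<phi>"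
        by (simp add: evolution_semigroup_apply[OF \<phi> t])
    qed
  qed
  then show "\<exists>M\<ge>1. \<forall>t\<ge>0. onorm_on (AP X0) (evolution_semigroup U t) \<le> M * exp (r * t)" using N(1) by blast
next
  assume "\<exists>M\<ge>1. \<forall>t\<ge>0. onorm_on (AP X0) (evolution_semigroup U t) \<le> M * exp (r * t)"
  then obtain M' where M': "M' \<ge> 1" "\<And>t. t \<ge> 0 \<Longrightarrow> onorm_on (AP X0) (evolution_semigroup U t) \<le> M' * exp (r * t)" by blast
  obtain N where N: "N \<ge> 1" "\<And>s t x. x \<in> X0 \<Longrightarrow> s \<le> t \<Longrightarrow> norm (U t s x) \<le> N * exp (rE * (t - s)) * norm x"
    using rE by (auto simp: E.rate_def)
  show "E.rate r"
    unfolding E.rate_def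
  proof (intro exI[of _ M'] conjI allI ballI impI M'(1))
    fix s t :: real and x assume x: "x \<in> X0" and st: "s \<le> t"
    define \<phi> where "\<phi> = (const_bcontfun x :: real \<Rightarrow>\<^sub>C 'a)"
    have \<phi>: "\<phi> \<in> AP X0" "norm \<phi> \<le> norm x" using x ap_const[of x] by (auto simp: \<phi>_def AP_iff intro: norm_bound)
    have t: "t - s \<ge> 0" using st by simp
    \<comment> \<open>This bound from the known rate \<open>rE\<close> makes the real supremum in
      the operator norm genuine, so that the assumed estimate can be applied.\<close>
    have bd: "norm (evolution_semigroup U (t - s) \<psi>) \<le> N * exp (rE * (t - s)) * norm \<psi>" if \<psi>: "\<psi> \<in> AP X0" for \<psi>
    proof (rule norm_bound)
      fix q
      have "norm (U q (q - (t - s)) (apply_bcontfun \<psi> (q - (t - s)))) \<le> N * exp (rE * (t - s)) * norm (apply_bcontfun \<psi> (q - (t - s)))"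
        using N(2)[of "apply_bcontfun \<psi> (q - (t - s))" "q - (t - s)" q] \<psi> t by (simp add: AP_iff)
      also have "\<dots> \<le> N * exp (rE * (t - s)) * norm \<psi>" using N(1) by (intro mult_left_mono norm_bounded) auto
      finally show "norm (apply_bcontfun (evolution_semigroup U (t - s) \<psi>) q) \<le> N * exp (rE * (t - s)) * norm \<psi>"
        by (simp add: evolution_semigroup_apply[OF \<psi> t])
    qed
    have "U t s x = apply_bcontfun (evolution_semigroup U (t - s) \<phi>) t"
      unfolding evolution_semigroup_apply[OF \<phi>(1) t] by (simp add: \<phi>_def)
    then have "norm (U t s x) \<le> norm (evolution_semigroup U (t - s) \<phi>)" by (simp add: norm_bounded)
    also have "\<dots> \<le> onorm_on (AP X0) (evolution_semigroup U (t - s)) * norm \<phi>" by (rule onorm_on_bound[OF bd \<phi>(1)])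
    also have "\<dots> \<le> M' * exp (r * (t - s)) * norm x"
      using M'(2)[OF t] \<phi>(2) M'(1) by (intro mult_mono) auto
    finally show "norm (U t s x) \<le> M' * exp (r * (t - s)) * norm x" .
  qed
qed

lemma semigroup_growth_bound_eq:
  "semigroup_growth_bound (AP X0) (evolution_semigroup U) = (INF r\<in>{r. E.rate r}. ereal r)"
  unfolding semigroup_growth_bound_def semigroup_rate_iff ..

text \<open>The equivalences for \<open><\<close> and \<open>\<le>\<close> determine all three cases
  by linearity of the order. The second passes through the strict inequalities for every positive
  \<open>\<sigma>\<close>, since an infimum equal to \<open>0\<close> need not be attained as a
  rate.\<close>

theorem sign_relation:
  "(spectral_radius_on S (LL 0) < 1 \<longleftrightarrow> semigroup_growth_bound (AP X0) (evolution_semigroup U) < 0) \<and>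
   (spectral_radius_on S (LL 0) \<le> 1 \<longleftrightarrow> semigroup_growth_bound (AP X0) (evolution_semigroup U) \<le> 0)"
proof -
  obtain B where "positive_op S (LL 0) B Q cn cd" by (rule LL_positive_op[OF rG(2)])
  then interpret L: positive_op S "LL 0" B Q cn cd .
  let ?g = "INF r\<in>{r. E.rate r}. ereal r"
  have lt: "?g < ereal \<sigma> \<longleftrightarrow> (\<exists>r<\<sigma>. E.rate r)" for \<sigma> by (auto simp: INF_less_iff)
  have le: "?g \<le> 0 \<longleftrightarrow> (\<forall>\<sigma>>0. ?g < ereal \<sigma>)"
  proof (intro iffI allI impI)
    fix \<sigma> :: real assume "?g \<le> 0" "\<sigma> > 0"
    then show "?g < ereal \<sigma>" by (simp add: le_less_trans zero_ereal_def)
  next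
    assume *: "\<forall>\<sigma>>0. ?g < ereal \<sigma>"
    show "?g \<le> 0"
    proof (rule ccontr)
      assume "\<not> ?thesis"
      then have "0 < ?g" by (rule not_le_imp_less)
      then obtain \<sigma> where "0 < ereal \<sigma>" "ereal \<sigma> < ?g" using ereal_dense2 by blast
      then show False using * by (metis ereal_less(2) less_asym)
    qed
  qed
  have "spectral_radius_on S (LL 0) < 1 \<longleftrightarrow> ?g < 0"
    using L.spectral_radius_less_one power_bounded_iff_rate[OF rG(2)] lt[of 0] by (simp add: zero_ereal_def)
  moreover have "spectral_radius_on S (LL 0) \<le> 1 \<longleftrightarrow> ?g \<le> 0"
    unfolding L.spectral_radius_le_one power_bounded_all_iff_rate le lt ..
  ultimately show ?thesis unfolding semigroup_growth_bound_eq by blast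
qed

end

section \<open>Deduction of the statement from the abstract model\<close>

lemma exp_rates_bound:
  assumes W: "evolution_family S W" and r: "r \<in> exp_rates S W"
  obtains N where "N \<ge> 1" "\<And>s t x. x \<in> S \<Longrightarrow> s \<le> t \<Longrightarrow> norm (W t s x) \<le> N * exp (r * (t - s)) * norm x"
proof -
  obtain N where N: "N \<ge> 1" "\<And>s t. s \<le> t \<Longrightarrow> onorm_on S (W t s) \<le> N * exp (r * (t - s))"
    using r by (auto simp: exp_rates_def)
  have "norm (W t s x) \<le> N * exp (r * (t - s)) * norm x" if x: "x \<in> S" and st: "s \<le> t" for s t x
  proof -
    have "bounded_op_on S (W t s)" using W st by (simp add: evolution_family_def)
    then obtain K where "\<And>x. x \<in> S \<Longrightarrow> norm (W t s x) \<le> K * norm x" using bounded_op_onD by metis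
    from onorm_on_bound[OF this x] have "norm (W t s x) \<le> onorm_on S (W t s) * norm x" .
    also have "\<dots> \<le> N * exp (r * (t - s)) * norm x" by (intro mult_right_mono N st) simp
    finally show ?thesis .
  qed
  with N(1) show ?thesis by (rule that)
qed

theorem theorem3p17:
  fixes D :: "'a::banach set" and A :: "'a \<Rightarrow> 'a" and X\<^sub>0 P :: "'a set"
    and F V :: "real \<Rightarrow> 'a \<Rightarrow> 'a" and U \<Gamma> :: "real \<Rightarrow> real \<Rightarrow> 'a \<Rightarrow> 'a"
    and \<omega>\<^sub>A M\<^sub>A :: real and R\<^sub>0 \<omega>\<^sub>U :: ereal
  assumes HY: "hille_yosida D A \<omega>\<^sub>A M\<^sub>A"
    and X0: "X\<^sub>0 = closure D"
    and cone: "order_cone P" "normal_cone_of P" "generating_cone UNIV P"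
    and cone0: "normal_cone_of (X\<^sub>0 \<inter> P)" "generating_cone X\<^sub>0 (X\<^sub>0 \<inter> P)"
    and F: "\<And>t. bounded_op_on X\<^sub>0 (F t)" "almost_periodic (op_dist_on X\<^sub>0) F"
    and V: "\<And>t. bounded_op_on X\<^sub>0 (V t)" "almost_periodic (op_dist_on X\<^sub>0) V"
    and U: "solution_family D A (\<lambda>t x. F t x - V t x) U"
    and \<Gamma>: "solution_family D A (\<lambda>t x. - V t x) \<Gamma>"
    and resolvent_pos: "\<exists>\<omega>. {\<omega><..} \<subseteq> resolvent_set D A \<and>
      (\<forall>\<mu>>\<omega>. resolvent D A \<mu> ` P \<subseteq> P)"
    and V_pos: "\<exists>\<mu>\<^sub>1>\<omega>\<^sub>A. \<forall>t. \<forall>x\<in>X\<^sub>0 \<inter> P. \<mu>\<^sub>1 *\<^sub>R x - V t x \<in> P"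
    and F_pos: "\<forall>t. \<forall>x\<in>X\<^sub>0 \<inter> P. F t x \<in> P"
    and \<Gamma>_stable: "growth_bound X\<^sub>0 \<Gamma> < 0"
    and \<Gamma>_almost_periods: "\<And>\<epsilon> \<nu>. \<epsilon> > 0 \<Longrightarrow> \<nu> > 0 \<Longrightarrow>
      \<exists>\<eta>>0. \<exists>\<delta><0. \<forall>t s. t - s \<ge> \<nu> \<longrightarrow> (\<forall>\<tau>\<in>almost_periods (op_dist_on X\<^sub>0) V \<eta>.
        op_dist_on X\<^sub>0 (\<Gamma> (t + \<tau>) (s + \<tau>)) (\<Gamma> t s) \<le> \<epsilon> * exp (\<delta> * (t - s)))"
    and R0: "R\<^sub>0 = spectral_radius_on (AP UNIV) (next_generation D A F \<Gamma>)"
    and \<omega>U: "\<omega>\<^sub>U = semigroup_growth_bound (AP X\<^sub>0) (evolution_semigroup U)"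
  shows "(R\<^sub>0 < 1 \<longleftrightarrow> \<omega>\<^sub>U < 0) \<and> (R\<^sub>0 = 1 \<longleftrightarrow> \<omega>\<^sub>U = 0) \<and> (R\<^sub>0 > 1 \<longleftrightarrow> \<omega>\<^sub>U > 0)"
proof -
  obtain w' where w': "\<And>\<mu> x. \<mu> > w' \<Longrightarrow> x \<in> P \<Longrightarrow> resolvent D A \<mu> x \<in> P" using resolvent_pos by blast
  obtain k where k: "\<And>t x. x \<in> X\<^sub>0 \<Longrightarrow> x \<in> P \<Longrightarrow> k *\<^sub>R x - V t x \<in> P" using V_pos by blast
  interpret hy: hille_yosida_cone D A P \<omega>\<^sub>A M\<^sub>A w'
    by unfold_locales (use HY cone w' in auto)
  obtain \<rho>F cF where \<rho>F: "ap_dist \<rho>F" "\<And>s t x. x \<in> X\<^sub>0 \<Longrightarrow> norm (F s x - F t x) \<le> \<rho>F s t * norm x"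
    and cF: "cF \<ge> 0" "\<And>t x. x \<in> X\<^sub>0 \<Longrightarrow> norm (F t x) \<le> cF * norm x"
    by (rule ap_operator[OF F]) blast
  obtain \<rho>V cV where \<rho>V: "ap_dist \<rho>V" "\<And>s t x. x \<in> X\<^sub>0 \<Longrightarrow> norm (V s x - V t x) \<le> \<rho>V s t * norm x"
    and cV: "cV \<ge> 0" "\<And>t x. x \<in> X\<^sub>0 \<Longrightarrow> norm (V t x) \<le> cV * norm x"
    by (rule ap_operator[OF V]) blast
  have lin: "linear_op_on X\<^sub>0 (F t)" "linear_op_on X\<^sub>0 (V t)" for t
    using F(1) V(1) by (auto simp: bounded_op_on_def)
  interpret G0: ap_coefficient D A P \<omega>\<^sub>A M\<^sub>A w' "\<lambda>t x. - V t x" cV k \<rho>V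
  proof unfold_locales
    fix s t x
    show "linear_op_on (closure D) (\<lambda>x. - V t x)" using lin(2)[of t] unfolding X0 linear_op_on_def by auto
    show "norm (- V t x) \<le> cV * norm x" if "x \<in> closure D" using cV(2) that by (simp add: X0)
    show "- V t x + k *\<^sub>R x \<in> P" if "x \<in> closure D" "x \<in> P" using k[of x t] that by (simp add: X0)
    show "0 \<le> cV" "ap_dist \<rho>V" by fact+
    show "norm (- V s x - - V t x) \<le> \<rho>V s t * norm x" if "x \<in> closure D"
      using \<rho>V(2)[of x s t] that by (simp add: X0 norm_minus_commute)
  qed
  interpret E0: ap_coefficient D A P \<omega>\<^sub>A M\<^sub>A w' "\<lambda>t x. F t x - V t x" "cF + cV" k "\<lambda>s t. \<rho>F s t + \<rho>V s t"
  proof unfold_locales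
    fix s t x
    show "linear_op_on (closure D) (\<lambda>x. F t x - V t x)"
      using lin[of t] unfolding X0 linear_op_on_def by (auto simp: algebra_simps)
    show "norm (F t x - V t x) \<le> (cF + cV) * norm x" if "x \<in> closure D"
      using cF(2)[of x t] cV(2)[of x t] that norm_triangle_ineq4[of "F t x" "V t x"] by (simp add: X0 algebra_simps)
    show "F t x - V t x + k *\<^sub>R x \<in> P" if "x \<in> closure D" "x \<in> P"
      using hy.P_add[of "F t x" "k *\<^sub>R x - V t x"] F_pos k[of x t] that by (simp add: X0 algebra_simps)
    show "0 \<le> cF + cV" using cF cV by simp
    show "ap_dist (\<lambda>s t. \<rho>F s t + \<rho>V s t)" by (rule ap_dist_add[OF \<rho>F(1) \<rho>V(1)])
    show "norm (F s x - V s x - (F t x - V t x)) \<le> (\<rho>F s t + \<rho>V s t) * norm x" if "x \<in> closure D"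
    proof -
      have *: "F s x - V s x - (F t x - V t x) = (F s x - F t x) - (V s x - V t x)" by simp
      have "x \<in> X\<^sub>0" using that by (simp add: X0)
      then show ?thesis
        unfolding * distrib_right by (intro order_trans[OF norm_triangle_ineq4] add_mono \<rho>F(2) \<rho>V(2))
    qed
  qed
  have evG: "evolution_family (closure D) \<Gamma>" and solG: "\<And>s x. x \<in> closure D \<Longrightarrow> mild_solution D A (\<lambda>t x. - V t x) s x (\<lambda>t. \<Gamma> t s x)"
    using \<Gamma> by (auto simp: solution_family_def)
  have evE: "evolution_family (closure D) U" and solE: "\<And>s x. x \<in> closure D \<Longrightarrow> mild_solution D A (\<lambda>t x. F t x - V t x) s x (\<lambda>t. U t s x)"
    using U by (auto simp: solution_family_def)
  \<comment> \<open>The case of shift \<open>0\<close> supplies the continuity of the perturbation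
    along the orbits, which is needed to recognise them as solutions in the sense of
    \<open>mild\<close>.\<close>
  interpret Gp: perturbed D A P \<omega>\<^sub>A M\<^sub>A w' "\<lambda>t x. - V t x - 0 *\<^sub>R x" "cV + \<bar>0\<bar>" "k + 0" by (rule G0.perturbed_shift)
  interpret Ep: perturbed D A P \<omega>\<^sub>A M\<^sub>A w' "\<lambda>t x. F t x - V t x - 0 *\<^sub>R x" "cF + cV + \<bar>0\<bar>" "k + 0" by (rule E0.perturbed_shift)
  interpret G: ap_family D A P \<omega>\<^sub>A M\<^sub>A w' "\<lambda>t x. - V t x" cV k \<rho>V \<Gamma>
  proof unfold_locales
    show "evolution_family (closure D) \<Gamma>" by (rule evG)
    fix s t :: real and x assume st: "s \<le> t" and x: "x \<in> closure D"
    show "hy.mild (\<lambda>r. \<Gamma> r s x) (\<lambda>r. - V r (\<Gamma> r s x)) s t"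
    proof (rule hy.mild_from_solution[OF solG[OF x]])
      have *: "continuous_on {s..} (\<lambda>r. \<Gamma> r s x)" "(\<lambda>r. \<Gamma> r s x) ` {s..} \<subseteq> closure D"
        using solG[OF x, of s] by (auto simp: mild_solution_def)
      have "continuous_on {s..t} (\<lambda>r. - V r (\<Gamma> r s x) - 0 *\<^sub>R \<Gamma> r s x)"
        by (rule Gp.C_continuous_on) (use * in \<open>auto intro: continuous_on_subset\<close>)
      then show "continuous_on {s..t} (\<lambda>r. - V r (\<Gamma> r s x))" by simp
    qed
  qed
  interpret E: ap_family D A P \<omega>\<^sub>A M\<^sub>A w' "\<lambda>t x. F t x - V t x" "cF + cV" k "\<lambda>s t. \<rho>F s t + \<rho>V s t" U
  proof unfold_locales
    show "evolution_family (closure D) U" by (rule evE)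
    fix s t :: real and x assume st: "s \<le> t" and x: "x \<in> closure D"
    show "hy.mild (\<lambda>r. U r s x) (\<lambda>r. F r (U r s x) - V r (U r s x)) s t"
    proof (rule hy.mild_from_solution[OF solE[OF x]])
      have *: "continuous_on {s..} (\<lambda>r. U r s x)" "(\<lambda>r. U r s x) ` {s..} \<subseteq> closure D"
        using solE[OF x, of s] by (auto simp: mild_solution_def)
      have "continuous_on {s..t} (\<lambda>r. F r (U r s x) - V r (U r s x) - 0 *\<^sub>R U r s x)"
        by (rule Ep.C_continuous_on) (use * in \<open>auto intro: continuous_on_subset\<close>)
      then show "continuous_on {s..t} (\<lambda>r. F r (U r s x) - V r (U r s x))" by simp
    qed
  qed
  obtain cn where cn: "cn > 0" "\<And>x y. x \<in> P \<Longrightarrow> y - x \<in> P \<Longrightarrow> norm x \<le> cn * norm y"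
    using cone(2) by (auto simp: normal_cone_of_def)
  have PP: "convex P" "cone P" using cone(1) by (auto simp: order_cone_def)
  obtain cd where cd: "cd \<ge> 0" "\<And>x \<epsilon>. \<epsilon> > 0 \<Longrightarrow> \<exists>y\<in>P. \<exists>z\<in>P. norm y \<le> cd * norm x \<and> norm z \<le> cd * norm x \<and> norm (x - (y - z)) \<le> \<epsilon>"
    by (rule generating_cone_approx[OF PP cone(3)]) blast
  obtain rG where rG: "rG < 0" "G.rate rG"
  proof -
    obtain r where r: "r \<in> exp_rates X\<^sub>0 \<Gamma>" "ereal r < 0"
      using \<Gamma>_stable by (auto simp: growth_bound_def INF_less_iff)
    obtain N where "N \<ge> 1" "\<And>s t x. x \<in> X\<^sub>0 \<Longrightarrow> s \<le> t \<Longrightarrow> norm (\<Gamma> t s x) \<le> N * exp (r * (t - s)) * norm x"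
      by (rule exp_rates_bound[OF evG[folded X0] r(1)]) blast
    then have "G.rate r" unfolding G.rate_def X0 by blast
    then show ?thesis using that r(2) by simp
  qed
  obtain rE where rE: "E.rate rE"
  proof -
    obtain r where r: "r \<in> exp_rates X\<^sub>0 U" using U by (auto simp: solution_family_def exponentially_bounded_def X0)
    obtain N where "N \<ge> 1" "\<And>s t x. x \<in> X\<^sub>0 \<Longrightarrow> s \<le> t \<Longrightarrow> norm (U t s x) \<le> N * exp (r * (t - s)) * norm x"
      by (rule exp_rates_bound[OF evE[folded X0] r(1)]) blast
    then have "E.rate r" unfolding E.rate_def X0 by blast
    then show ?thesis using that by simp
  qed
  interpret m: reproduction_model D A P \<omega>\<^sub>A M\<^sub>A w' "\<lambda>t x. - V t x" cV k \<rho>V \<Gamma>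
    "\<lambda>t x. F t x - V t x" "cF + cV" k "\<lambda>s t. \<rho>F s t + \<rho>V s t" U F cF cn cd rG rE \<rho>F
  proof unfold_locales
    fix s t x
    show "linear_op_on (closure D) (F t)" using lin(1) by (simp add: X0)
    show "norm (F t x) \<le> cF * norm x" if "x \<in> closure D" using cF(2) that by (simp add: X0)
    show "F t x \<in> P" if "x \<in> closure D" "x \<in> P" using F_pos that by (simp add: X0)
    show "norm (F s x - F t x) \<le> \<rho>F s t * norm x" if "x \<in> closure D" using \<rho>F(2) that by (simp add: X0)
    show "F t x - V t x = - V t x + F t x" by simp
  qed (use cF \<rho>F cn cd rG rE in auto)
  \<comment> \<open>For \<open>\<sigma> = 0\<close> the rescaling factor is one, so both sides are
    built from the same limit.\<close>
  have "next_generation D A F \<Gamma> = m.LL 0"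
    by (simp add: fun_eq_iff next_generation_def m.LL_def G.K_def G.sh_def)
  then have "(R\<^sub>0 < 1 \<longleftrightarrow> \<omega>\<^sub>U < 0) \<and> (R\<^sub>0 \<le> 1 \<longleftrightarrow> \<omega>\<^sub>U \<le> 0)"
    using m.sign_relation by (simp add: R0 \<omega>U X0)
  then show ?thesis by (metis less_le not_le)
qed

end
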